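(* Let $G$ be a locally compact second countable group with Kazhdan's property $(T)$, let $1<p<\infty$, and let $\mu$ be a $\sigma$-finite measure on a standard Borel space $\Omega$. If $X$ is either a closed subspace or a quotient (by a closed subspace) of $L_p(\mu)$, then $G$ has property $(T_X)$.
   Context: All Banach spaces (including $L_p(\mu)$) are real. For a Banach space $X$, $O(X)$ denotes the group of all surjective linear isometries of $X$ with the strong operator topology, and $S(X)=\{x\in X:\|x\|=1\}$. A representation $\rho:G\to O(X)$ is a group homomorphism; it is strongly continuous if for every $x\in X$ the orbit map $g\mapsto\rho(g)x$ is norm-continuous. Put $X^{\rho(G)}=\{x\in X:\rho(g)x=x\text{ for every }g\in G\}$. Let $q_\rho:X\to X/X^{\rho(G)}$ be the quotient map (the quotient carries the quotient norm); $\rho$ induces a strongly continuous linear isometric representation $\bar\rho$ on $X/X^{\rho(G)}$ by $\bar\rho(g)q_\rho(x)=q_\rho(\rho(g)x)$. A strongly continuous representation $\rho:G\to O(X)$ almost has invariant vectors if $$\inf_{x\in S(X)}\operatorname{diam}\bigl(\rho(K)x\bigr)=0\quad\text{for every compact set }K\subseteq G,$$ where $\operatorname{diam}(A)=\sup\{\|x-y\|:x,y\in A\}$, with conventions $\operatorname{diam}(\varnothing)=0$ and $\inf\varnothing=+\infty$ (so a representation on the zero space does not almost have invariant vectors). $G$ has property $(T_X)$ if, for every strongly continuous representation $\rho:G\to O(X)$, the induced representation $\bar\rho$ on $X/X^{\rho(G)}$ does not almost have invariant vectors. Kazhdan's property $(T)$ is equivalent to the existence of a compact set $Q\subseteq G$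 with $e\in Q$ and a $\kappa_2>0$ such that every strongly continuous orthogonal representation $\pi:G\to O(H)$ on a real Hilbert space satisfies $\max_{q\in Q}\|\pi(q)\xi-\xi\|_H\ge\kappa_2\inf_{\eta\in H^{\pi(G)}}\|\xi-\eta\|_H$ for all $\xi\in H$. *)

theory Defs
  imports "HOL-Analysis.Analysis" "HOL-Algebra.Algebra" "HOL-Algebra.Algebraic_Closure_Type"
begin

section \<open>Real normed spaces with explicit carrier\<close>

text \<open>
  The spaces \<open>L\<^sub>p(\<mu>)\<close>, their closed subspaces, their quotients, and the Hilbert spaces quantified over in
  property (T) depend on term variables, so they cannot be types. They are modules over the
  ring of real numbers in the sense of \<open>HOL-Algebra\<close>, with an added norm; the fields
  \<open>mult\<close> and \<open>one\<close> inherited from \<open>ring\<close> are irrelevant, as usual for modules.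
\<close>

record 'v normed_module = "(real, 'v) module" +
  nrm :: "'v \<Rightarrow> real"

abbreviation real_ring :: "real ring" where
  "real_ring \<equiv> ring_of_type_algebra"

definition normed_space :: "'v normed_module \<Rightarrow> bool" where
  "normed_space V \<longleftrightarrow>
     Module.module real_ring V \<and>
     (\<forall>x\<in>carrier V. nrm V x = 0 \<longleftrightarrow> x = \<zero>\<^bsub>V\<^esub>) \<and>
     (\<forall>c. \<forall>x\<in>carrier V. nrm V (c \<odot>\<^bsub>V\<^esub> x) = \<bar>c\<bar> * nrm V x) \<and>
     (\<forall>x\<in>carrier V. \<forall>y\<in>carrier V. nrm V (x \<oplus>\<^bsub>V\<^esub> y) \<le> nrm V x + nrm V y)"

text \<open>The value off the carrier is fixed because the locale \<open>Metric_space\<close> requires symmetry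
  and nonnegativity on the whole type.\<close>

definition ndist :: "'v normed_module \<Rightarrow> 'v \<Rightarrow> 'v \<Rightarrow> real" where
  "ndist V x y = (if x \<in> carrier V \<and> y \<in> carrier V then nrm V (x \<ominus>\<^bsub>V\<^esub> y) else 0)"

definition norm_topology :: "'v normed_module \<Rightarrow> 'v topology" where
  "norm_topology V = Metric_space.mtopology (carrier V) (ndist V)"

definition banach_space :: "'v normed_module \<Rightarrow> bool" where
  "banach_space V \<longleftrightarrow> normed_space V \<and> Metric_space.mcomplete (carrier V) (ndist V)"

definition real_hilbert_space :: "'v normed_module \<Rightarrow> bool" where
  "real_hilbert_space H \<longleftrightarrow> banach_space H \<and>
     (\<exists>ip :: 'v \<Rightarrow> 'v \<Rightarrow> real.
        (\<forall>x\<in>carrier H. \<forall>y\<in>carrier H. ip x y = ip y x) \<and>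
        (\<forall>x\<in>carrier H. \<forall>y\<in>carrier H. \<forall>z\<in>carrier H. ip (x \<oplus>\<^bsub>H\<^esub> y) z = ip x z + ip y z) \<and>
        (\<forall>c. \<forall>x\<in>carrier H. \<forall>y\<in>carrier H. ip (c \<odot>\<^bsub>H\<^esub> x) y = c * ip x y) \<and>
        (\<forall>x\<in>carrier H. ip x x = (nrm H x)\<^sup>2))"

definition closed_subspace :: "'v normed_module \<Rightarrow> 'v set \<Rightarrow> bool" where
  "closed_subspace V Y \<longleftrightarrow> submodule Y real_ring V \<and> closedin (norm_topology V) Y"

definition restrict_space_to :: "'v normed_module \<Rightarrow> 'v set \<Rightarrow> 'v normed_module" where
  "restrict_space_to V Y = V\<lparr>carrier := Y\<rparr>"

text \<open>The quotient consists of the cosets \<open>Y +> x\<close>. In the scalar multiplication \<open>Y\<close> is added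
  again so that \<open>0\<close> times a coset is \<open>Y\<close> and not \<open>{0}\<close>.\<close>

definition quotient_space :: "'v normed_module \<Rightarrow> 'v set \<Rightarrow> 'v set normed_module" where
  "quotient_space V Y =
     \<lparr>carrier = a_rcosets\<^bsub>V\<^esub> Y,
      monoid.mult = undefined, monoid.one = undefined,
      ring.zero = Y,
      ring.add = (\<lambda>A B. A <+>\<^bsub>V\<^esub> B),
      Module.module.smult = (\<lambda>c A. \<Union>x\<in>A. Y +>\<^bsub>V\<^esub> (c \<odot>\<^bsub>V\<^esub> x)),
      nrm = (\<lambda>A. INF x\<in>A. nrm V x)\<rparr>"

section \<open>The spaces \<open>L\<^sub>p(\<mu>)\<close>\<close>

definition Lp_functions :: "real \<Rightarrow> 'w measure \<Rightarrow> ('w \<Rightarrow> real) normed_module" where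
  "Lp_functions p M =
     \<lparr>carrier = {f \<in> borel_measurable M. integrable M (\<lambda>w. \<bar>f w\<bar> powr p)},
      monoid.mult = undefined, monoid.one = undefined,
      ring.zero = (\<lambda>w. 0),
      ring.add = (\<lambda>f g w. f w + g w),
      Module.module.smult = (\<lambda>c f w. c * f w),
      nrm = (\<lambda>f. (LINT w|M. \<bar>f w\<bar> powr p) powr (1 / p))\<rparr>"

text \<open>The cosets of the almost everywhere vanishing functions are the classes of almost everywhere
  equal functions; \<open>nrm (Lp_functions p M)\<close> is only a seminorm, constant on each class, so
  the infimum in \<open>quotient_space\<close> is its value at any representative.\<close>

definition Lp :: "real \<Rightarrow> 'w measure \<Rightarrow> ('w \<Rightarrow> real) set normed_module" where
  "Lp p M = quotient_space (Lp_functions p M)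
     {f \<in> carrier (Lp_functions p M). AE w in M. f w = 0}"

definition standard_borel :: "'w measure \<Rightarrow> bool" where
  "standard_borel M \<longleftrightarrow>
     (\<exists>S. topspace S = space M \<and> completely_metrizable_space S \<and> separable_space S \<and>
          sets M = sigma_sets (space M) {U. openin S U})"

section \<open>Topological groups and isometric representations\<close>

definition topological_group :: "('g, 'm) monoid_scheme \<Rightarrow> 'g topology \<Rightarrow> bool" where
  "topological_group G \<tau> \<longleftrightarrow> group G \<and> topspace \<tau> = carrier G \<and>
     continuous_map (prod_topology \<tau> \<tau>) \<tau> (\<lambda>(g, h). g \<otimes>\<^bsub>G\<^esub> h) \<and>
     continuous_map \<tau> \<tau> (\<lambda>g. inv\<^bsub>G\<^esub> g)"

text \<open>\<open>O(V)\<close>; its elements are extensional, being members of \<open>Bij\<close>, and surjectivity comes from there.\<close>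

definition isometry_group :: "'v normed_module \<Rightarrow> ('v \<Rightarrow> 'v) monoid" where
  "isometry_group V = (BijGroup (carrier V))
     \<lparr>carrier := {T \<in> Bij (carrier V).
        (\<forall>x\<in>carrier V. \<forall>y\<in>carrier V. T (x \<oplus>\<^bsub>V\<^esub> y) = T x \<oplus>\<^bsub>V\<^esub> T y) \<and>
        (\<forall>c. \<forall>x\<in>carrier V. T (c \<odot>\<^bsub>V\<^esub> x) = c \<odot>\<^bsub>V\<^esub> T x) \<and>
        (\<forall>x\<in>carrier V. nrm V (T x) = nrm V x)}\<rparr>"

definition strongly_continuous_rep ::
    "('g, 'm) monoid_scheme \<Rightarrow> 'g topology \<Rightarrow> 'v normed_module \<Rightarrow> ('g \<Rightarrow> 'v \<Rightarrow> 'v) \<Rightarrow> bool" where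
  "strongly_continuous_rep G \<tau> V \<rho> \<longleftrightarrow>
     \<rho> \<in> hom G (isometry_group V) \<and>
     (\<forall>x\<in>carrier V. continuous_map \<tau> (norm_topology V) (\<lambda>g. \<rho> g x))"

definition fixed_vectors ::
    "('g, 'm) monoid_scheme \<Rightarrow> 'v normed_module \<Rightarrow> ('g \<Rightarrow> 'v \<Rightarrow> 'v) \<Rightarrow> 'v set" where
  "fixed_vectors G V \<rho> = {x \<in> carrier V. \<forall>g\<in>carrier G. \<rho> g x = x}"

text \<open>On a coset \<open>A\<close> of the fixed vectors the sets in the union below all coincide, because \<open>\<rho> g\<close> is
  additive and leaves the fixed vectors in place.\<close>

definition induced_rep ::
    "('g, 'm) monoid_scheme \<Rightarrow> 'v normed_module \<Rightarrow> ('g \<Rightarrow> 'v \<Rightarrow> 'v) \<Rightarrow> 'g \<Rightarrow> 'v set \<Rightarrow> 'v set" where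
  "induced_rep G V \<rho> g A = (\<Union>x\<in>A. fixed_vectors G V \<rho> +>\<^bsub>V\<^esub> \<rho> g x)"

text \<open>Values in \<open>ennreal\<close>: there the supremum over the empty set is \<open>0\<close> and the infimum over
  the empty set is \<open>\<infinity>\<close>, which are the conventions \<open>diam \<emptyset> = 0\<close> and \<open>inf \<emptyset> = \<infinity>\<close>.\<close>

definition ndiam :: "'v normed_module \<Rightarrow> 'v set \<Rightarrow> ennreal" where
  "ndiam V A = (SUP x\<in>A. SUP y\<in>A. ennreal (nrm V (x \<ominus>\<^bsub>V\<^esub> y)))"

definition unit_sphere :: "'v normed_module \<Rightarrow> 'v set" where
  "unit_sphere V = {x \<in> carrier V. nrm V x = 1}"

definition almost_has_invariant_vectors ::
    "'g topology \<Rightarrow> 'v normed_module \<Rightarrow> ('g \<Rightarrow> 'v \<Rightarrow> 'v) \<Rightarrow> bool" where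
  "almost_has_invariant_vectors \<tau> V \<rho> \<longleftrightarrow>
     (\<forall>K. compactin \<tau> K \<longrightarrow> (INF x\<in>unit_sphere V. ndiam V ((\<lambda>g. \<rho> g x) ` K)) = 0)"

definition property_TX ::
    "('g, 'm) monoid_scheme \<Rightarrow> 'g topology \<Rightarrow> 'v normed_module \<Rightarrow> bool" where
  "property_TX G \<tau> V \<longleftrightarrow>
     (\<forall>\<rho>. strongly_continuous_rep G \<tau> V \<rho> \<longrightarrow>
        \<not> almost_has_invariant_vectors \<tau>
            (quotient_space V (fixed_vectors G V \<rho>)) (induced_rep G V \<rho>))"

text \<open>
  A formula cannot quantify over types, so the Hilbert spaces range over all Hilbert space structures
  on subsets of the type \<^typ>\<open>'g \<Rightarrow> real\<close>. This loses nothing. If \<open>\<pi>\<close> acts on an arbitrary \<open>H\<close> and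
  \<open>\<xi> \<in> H\<close>, let \<open>H\<^sub>0\<close> be the closed span of the orbit of \<open>\<xi>\<close>; mapping \<open>\<eta> \<in> H\<^sub>0\<close> to the function
  \<open>g \<mapsto> \<langle>\<eta>, \<pi>(g)\<xi>\<rangle>\<close> is injective, so \<open>H\<^sub>0\<close> has a copy on such a subset. The projection of \<open>\<xi>\<close> to the
  invariant vectors of \<open>H\<close> is the element of least norm of the closed convex hull of the orbit, hence
  lies in \<open>H\<^sub>0\<close>, so both sides of the inequality at \<open>\<xi>\<close> are the same for \<open>H\<close> and for \<open>H\<^sub>0\<close>.
\<close>

definition kazhdan_property_T :: "('g, 'm) monoid_scheme \<Rightarrow> 'g topology \<Rightarrow> bool" where
  "kazhdan_property_T G \<tau> \<longleftrightarrow>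
     (\<exists>Q \<kappa>. compactin \<tau> Q \<and> \<one>\<^bsub>G\<^esub> \<in> Q \<and> \<kappa> > 0 \<and>
        (\<forall>(H :: ('g \<Rightarrow> real) normed_module) \<pi>.
           real_hilbert_space H \<longrightarrow> strongly_continuous_rep G \<tau> H \<pi> \<longrightarrow>
           (\<forall>\<xi>\<in>carrier H.
              (SUP q\<in>Q. nrm H (\<pi> q \<xi> \<ominus>\<^bsub>H\<^esub> \<xi>))
                \<ge> \<kappa> * (INF \<eta>\<in>fixed_vectors G H \<pi>. nrm H (\<xi> \<ominus>\<^bsub>H\<^esub> \<eta>)))))"

end

theory Submission
  imports Defs
begin

text \<open>
  A family \<open>f : G \<rightarrow> L\<^sub>r\<close> is called isometric if the \<open>r\<close>-norm of \<open>\<Sum>i. c i * f (h g\<^sub>i)\<close> does not depend on \<open>h\<close>.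
  Property (T), applied to the Hilbert space of an invariant positive definite kernel \<open>k\<close> on \<open>G\<close>, shows
  that \<open>k g g - 2 k g 1 + k 1 1\<close> is small for all \<open>g\<close> once it is small on a Kazhdan set \<open>Q\<close>. Such kernels come from
  isometric families: if \<open>r\<close> is not an even integer, \<open>\<integral> K (f g) (f h)\<close>, where \<open>K s t\<close> is a linear combination of
  terms \<open>\<bar>i s + j t\<bar>\<^sup>r\<close>; if \<open>r = 2 n\<close>, polarisation makes the integrals of \<open>2 n\<close>-fold products invariant, and one takes
  \<open>\<integral> f(g)\<^sup>n f(h)\<^sup>n\<close> for odd \<open>n\<close>. For even \<open>n\<close> the latter controls only \<open>\<bar>f\<bar>\<close>, and a second kernel
  \<open>\<integral> f(g)\<^sup>n\<^sup>-\<^sup>1 f(h)\<^sup>n\<^sup>-\<^sup>1 c\<close> with an invariant weight \<open>c\<close>, close to \<open>f(1)\<^sup>2\<close>, recovers the sign. In all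
  cases an orbit in \<open>L\<^sub>r\<close> that moves little under \<open>Q\<close> moves little under \<open>G\<close>.

  Suppose now that \<open>V\<close> is uniformly convex and admits a map \<open>\<Phi> : V \<rightarrow> L\<^sub>r\<close> that turns orbits into isometric families
  and is a uniform homeomorphism onto its image on bounded sets. If \<open>V\<close> modulo the invariant vectors almost had invariant
  vectors, take \<open>x\<close> of norm one modulo the invariant vectors, moved little by \<open>Q\<close> modulo them, and let \<open>c\<close> be the
  (invariant) element of least norm of the closed convex hull of the orbit. An invariant norming functional shows that
  \<open>e = x - c\<close> itself is moved little by \<open>Q\<close>, so its orbit stays close to \<open>e\<close>, so \<open>c\<close> is close to \<open>x\<close>, a contradiction.
  For a subspace of \<open>L\<^sub>p\<close> one takes the inclusion for \<open>\<Phi>\<close>. For a quotient one takes the duality map into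
  \<open>L\<^sub>r\<close>, \<open>r = p / (p - 1)\<close>, composed with the lift of least norm; it is equivariant because a supporting functional of the
  norm is unique.
\<close>

section \<open>Homogeneous functions of two variables\<close>

text \<open>The obstacle is that an isometry between subspaces of L_r need not extend to L_r when r
  is an even integer, and that for quotients the map into L_r is not linear. Hence no action of G on
  L_r is available: only norms of linear combinations of one orbit are known, and every kernel must
  be built from them. For r not even a combination of the functions |i s + j t|^r separates all
  values. For r = 2 n they are polynomials, so only integrals of homogeneous polynomials of degree 2
  n in the orbit can be used; the weight c, of degree 2, completes a product of degree 2 (n - 1) to
  that degree, and n - 1 is odd.

  All passages between L_r-distances and kernel distances are uniform because integrands a(f, g),
  with a continuous and positively homogeneous of degree r, can be compared on the unit circle: that
  a \<le> 0 on the zeros of b \<ge> 0 suffices. The moduli depend on r and on a bound for the norms,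
  but not on the orbit, so the tolerance on Q can be fixed before the vector x is chosen.\<close>

definition homogeneous2 :: "real \<Rightarrow> (real \<Rightarrow> real \<Rightarrow> real) \<Rightarrow> bool" where
  "homogeneous2 r a \<longleftrightarrow> continuous_on UNIV (\<lambda>x. a (fst x) (snd x)) \<and>
     (\<forall>c s t. c > 0 \<longrightarrow> a (c * s) (c * t) = c powr r * a s t)"

text \<open>The signed power, or Mazur map: it carries L_r to L_(r/q). For q = p - 1 it leads from
  L_p to the dual exponent, and p times it is the derivative of |x|^p.\<close>

definition spow :: "real \<Rightarrow> real \<Rightarrow> real" where
  "spow q x = sgn x * \<bar>x\<bar> powr q"

lemma homogeneous2_lin: "homogeneous2 1 (\<lambda>s t. x * s + y * t)"
  unfolding homogeneous2_def by (auto intro!: continuous_intros simp: algebra_simps)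

lemma homogeneous2_fst: "homogeneous2 1 (\<lambda>s t. s)"
  and homogeneous2_snd: "homogeneous2 1 (\<lambda>s t. t)"
  unfolding homogeneous2_def by (auto intro!: continuous_intros)

lemma homogeneous2_add: "homogeneous2 r a \<Longrightarrow> homogeneous2 r b \<Longrightarrow> homogeneous2 r (\<lambda>s t. a s t + b s t)"
  and homogeneous2_diff: "homogeneous2 r a \<Longrightarrow> homogeneous2 r b \<Longrightarrow> homogeneous2 r (\<lambda>s t. a s t - b s t)"
  and homogeneous2_cmult: "homogeneous2 r a \<Longrightarrow> homogeneous2 r (\<lambda>s t. c * a s t)"
  and homogeneous2_cdiv: "homogeneous2 r a \<Longrightarrow> homogeneous2 r (\<lambda>s t. a s t / c)"
  and homogeneous2_abs: "homogeneous2 r a \<Longrightarrow> homogeneous2 r (\<lambda>s t. \<bar>a s t\<bar>)"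
  unfolding homogeneous2_def divide_inverse
  by (auto intro!: continuous_intros simp: algebra_simps abs_mult)

lemma homogeneous2_mult:
  assumes "homogeneous2 r a" "homogeneous2 q b" "r + q = rq"
  shows "homogeneous2 rq (\<lambda>s t. a s t * b s t)"
  using assms unfolding homogeneous2_def
  by (auto intro!: continuous_intros simp: powr_add)

lemma homogeneous2_powr:
  assumes "homogeneous2 r a" "q > 0" "r * q = rq"
  shows "homogeneous2 rq (\<lambda>s t. \<bar>a s t\<bar> powr q)"
  using assms unfolding homogeneous2_def
  by (auto intro!: continuous_intros continuous_on_powr' simp: abs_mult powr_mult powr_powr)

lemma homogeneous2_power:
  assumes "homogeneous2 r a" "r * real n = rq"
  shows "homogeneous2 rq (\<lambda>s t. a s t ^ n)"
  using assms unfolding homogeneous2_def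
  by (auto intro!: continuous_intros simp: power_mult_distrib powr_power mult.commute)

lemma spow_if: "spow q x = (if x < 0 then - ((-x) powr q) else x powr q)"
  by (cases "x = 0") (auto simp: spow_def)

text \<open>In this form continuity at 0 is visible: both terms are powers of nonnegative continuous
  functions.\<close>

lemma spow_alt: "spow q x = max x 0 powr q - max (-x) 0 powr q"
  by (auto simp: spow_def max_def sgn_if)

lemma abs_spow [simp]: "\<bar>spow q x\<bar> = \<bar>x\<bar> powr q"
  by (auto simp: spow_def abs_mult sgn_if)

lemma spow_mult: "c > 0 \<Longrightarrow> spow q (c * x) = c powr q * spow q x"
  by (auto simp: spow_def abs_mult powr_mult sgn_mult)

lemma spow_times: "spow q x * x = \<bar>x\<bar> powr (q + 1)"
  by (cases "x = 0") (auto simp: spow_def powr_add sgn_if)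

lemma spow_spow: "q > 0 \<Longrightarrow> spow q (spow (1 / q) x) = x"
  by (auto simp: spow_if powr_powr)

lemma spow_eq_iff: "q > 0 \<Longrightarrow> spow q x = spow q y \<longleftrightarrow> x = y"
proof
  assume q: "q > 0" and e: "spow q x = spow q y"
  have "spow (1 / q) (spow q z) = z" for z using spow_spow[of "1 / q" z] q by simp
  from this[of x] this[of y] e show "x = y" by metis
qed auto

lemma continuous_on_spow:
  fixes f :: "'a::topological_space \<Rightarrow> real"
  assumes "q > 0" "continuous_on A f"
  shows "continuous_on A (\<lambda>x. spow q (f x))"
proof -
  have c: "continuous_on A (\<lambda>x. max (g x) 0 powr q)" if "continuous_on A g" for g :: "'a \<Rightarrow> real"
    by (rule continuous_on_powr'[OF continuous_on_max[OF that continuous_on_const] continuous_on_const])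
      (use assms in auto)
  show ?thesis unfolding spow_alt
    by (rule continuous_on_diff[OF c c, OF assms(2) continuous_on_minus[OF assms(2)]])
qed

lemma borel_measurable_spow [measurable]: "spow q \<in> borel_measurable borel"
  unfolding spow_def[abs_def] by measurable

lemma homogeneous2_spow:
  assumes "homogeneous2 r a" "q > 0" "r * q = rq"
  shows "homogeneous2 rq (\<lambda>s t. spow q (a s t))"
  using assms continuous_on_spow[of q UNIV "\<lambda>x. a (fst x) (snd x)"] unfolding homogeneous2_def
  by (simp add: spow_mult powr_powr)

lemma homogeneous2D: "homogeneous2 r a \<Longrightarrow> c > 0 \<Longrightarrow> a (c * s) (c * t) = c powr r * a s t"
  by (simp add: homogeneous2_def)

text \<open>Scaling the origin by 2 leaves it in place but multiplies the value by 2^r > 1.\<close>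

lemma homogeneous2_zero: "homogeneous2 r a \<Longrightarrow> r > 0 \<Longrightarrow> a 0 0 = 0"
proof -
  assume a: "homogeneous2 r a" "r > 0"
  have "a (2 * 0) (2 * 0) = 2 powr r * a 0 0" by (rule homogeneous2D[OF a(1)]) simp
  then have h: "a 0 0 = 2 powr r * a 0 0" unfolding mult_zero_right .
  have "(2::real) powr r > 1" using a(2) by (simp add: gr_one_powr)
  with h[unfolded mult_cancel_right1] show ?thesis by linarith
qed

text \<open>Both sides are homogeneous of the same degree, so that compactness of the unit circle suffices.\<close>

lemma homogeneous2_dominate:
  assumes a: "homogeneous2 r a" and b: "homogeneous2 r b" and r: "r > 0"
    and b0: "\<And>s t. b s t \<ge> 0" and ba: "\<And>s t. b s t = 0 \<Longrightarrow> a s t \<le> 0" and d: "\<delta> > 0"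
  obtains C where "C \<ge> 0" "\<And>s t. a s t \<le> C * b s t + \<delta> * (\<bar>s\<bar> powr r + \<bar>t\<bar> powr r)"
proof -
  define n where "n = (\<lambda>s t::real. \<bar>s\<bar> powr r + \<bar>t\<bar> powr r)"
  have hn: "homogeneous2 r n" unfolding n_def by (intro homogeneous2_add homogeneous2_powr[where r = 1] homogeneous2_fst homogeneous2_snd) (use r in auto)
  have npos: "n s t > 0" if "(s, t) \<noteq> (0, 0)" for s t using that unfolding n_def
    by (auto simp: add_pos_nonneg add_nonneg_pos)
  let ?u = "\<lambda>f x. f (fst x) (snd x :: real) :: real"
  have ca: "continuous_on A (?u a)" and cb: "continuous_on A (?u b)" and cn: "continuous_on A (?u n)" for A
    using a b hn unfolding homogeneous2_def by (auto intro: continuous_on_subset)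
  define S where "S = sphere (0::real \<times> real) 1"
  \<comment> \<open>Off \<open>K\<close> the error term alone dominates \<open>a\<close>. On
    \<open>K\<close> the function \<open>b\<close> has no zero, since \<open>b = 0\<close> would
    give \<open>a \<le> 0\<close>; so its minimum on the compact set \<open>K\<close> is positive,
    and C = |max a| / min b works.\<close>
  define K where "K = {x \<in> S. ?u a x \<ge> \<delta> * ?u n x}"
  have S: "compact S" unfolding S_def by simp
  have S0: "fst x \<noteq> 0 \<or> snd x \<noteq> 0" if "x \<in> S" for x using that unfolding S_def
    by (auto simp: norm_prod_def)
  have cdiff: "continuous_on UNIV (\<lambda>x. ?u a x - \<delta> * ?u n x)"
    by (intro continuous_intros ca cn)
  have "closed {x. 0 \<le> ?u a x - \<delta> * ?u n x}"
    by (intro closed_Collect_le cdiff continuous_intros)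
  moreover have "K = S \<inter> {x. 0 \<le> ?u a x - \<delta> * ?u n x}" unfolding K_def by auto
  ultimately have K: "compact K" using S by (simp add: compact_Int_closed)
  have ex: "\<exists>C\<ge>0. \<forall>x\<in>S. ?u a x \<le> C * ?u b x + \<delta> * ?u n x"
  proof (cases "K = {}")
    case True
    then show ?thesis using b0 unfolding K_def by (intro exI[of _ 0]) force
  next
    case False
    obtain x0 where x0: "x0 \<in> K" "\<And>y. y \<in> K \<Longrightarrow> ?u b x0 \<le> ?u b y"
      using continuous_attains_inf[OF K False cb] by blast
    have Sne: "S \<noteq> {}" using False K_def by auto
    obtain x1 where x1: "x1 \<in> S" "\<And>y. y \<in> S \<Longrightarrow> ?u a y \<le> ?u a x1"
      using continuous_attains_sup[OF S Sne ca] by blast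
    have pos: "?u b x0 > 0"
    proof (rule ccontr)
      assume "\<not> ?u b x0 > 0"
      then have "?u b x0 = 0" using b0[of "fst x0" "snd x0"] by simp
      then have "?u a x0 \<le> 0" using ba by blast
      moreover have "\<delta> * ?u n x0 > 0" using d npos S0[of x0] x0(1) K_def by auto
      ultimately show False using x0(1) unfolding K_def by auto
    qed
    show ?thesis
    proof (intro exI[of _ "\<bar>?u a x1\<bar> / ?u b x0"] conjI ballI)
      fix x assume x: "x \<in> S"
      have nn: "\<delta> * ?u n x \<ge> 0" using d npos S0[OF x] by (simp add: less_imp_le)
      show "?u a x \<le> \<bar>?u a x1\<bar> / ?u b x0 * ?u b x + \<delta> * ?u n x"
      proof (cases "x \<in> K")
        case True
        have "?u a x \<le> \<bar>?u a x1\<bar> * 1" using x1(2)[OF x] by auto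
        also have "\<dots> \<le> \<bar>?u a x1\<bar> * (?u b x / ?u b x0)"
          by (intro mult_left_mono) (use x0(2)[OF True] pos in auto)
        finally show ?thesis using nn by simp
      next
        case False
        then have "?u a x < \<delta> * ?u n x" using x unfolding K_def by auto
        moreover have "\<bar>?u a x1\<bar> / ?u b x0 * ?u b x \<ge> 0" using pos b0 by auto
        ultimately show ?thesis by linarith
      qed
    qed (use pos in auto)
  qed
  then obtain C where C: "C \<ge> 0" "\<And>x. x \<in> S \<Longrightarrow> ?u a x \<le> C * ?u b x + \<delta> * ?u n x" by blast
  have "a s t \<le> C * b s t + \<delta> * n s t" for s t
  proof (cases "(s, t) = (0, 0)")
    case True
    then show ?thesis using homogeneous2_zero[OF a r] homogeneous2_zero[OF b r] homogeneous2_zero[OF hn r] by simp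
  next
    case False
    define c where "c = norm (s, t)"
    have c: "c > 0" using False unfolding c_def by (simp add: zero_prod_def)
    have "norm ((1 / c) *\<^sub>R (s, t)) = 1" using c unfolding c_def norm_scaleR by simp
    then have "(s / c, t / c) \<in> S" unfolding S_def by simp
    from C(2)[OF this] have h: "a (s / c) (t / c) \<le> C * b (s / c) (t / c) + \<delta> * n (s / c) (t / c)" by simp
    have sc: "f s t = c powr r * f (s / c) (t / c)" if "homogeneous2 r f" for f
    proof -
      have "f (c * (s / c)) (c * (t / c)) = c powr r * f (s / c) (t / c)"
        using homogeneous2D[OF that c] .
      then show ?thesis using c by simp
    qed
    have "c powr r * a (s / c) (t / c) \<le> c powr r * (C * b (s / c) (t / c) + \<delta> * n (s / c) (t / c))"
      using h by (intro mult_left_mono) auto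
    then show ?thesis unfolding sc[OF a] sc[OF b] sc[OF hn] by (simp add: algebra_simps)
  qed
  with C(1) that show ?thesis unfolding n_def by blast
qed

text \<open>Domination by |s|^r + |t|^r itself, whose only zero is the origin, where
  \<open>a\<close> vanishes. The error term with \<delta> = 1 has the same shape, hence the constant
  C + 1.\<close>

lemma homogeneous2_bound:
  assumes "homogeneous2 r a" "r > 0"
  obtains K where "K \<ge> 0" "\<And>s t. \<bar>a s t\<bar> \<le> K * (\<bar>s\<bar> powr r + \<bar>t\<bar> powr r)"
proof -
  have hn: "homogeneous2 r (\<lambda>s t. \<bar>s\<bar> powr r + \<bar>t\<bar> powr r)"
    by (intro homogeneous2_add homogeneous2_powr[where r = 1] homogeneous2_fst homogeneous2_snd) (use assms in auto)
  have z: "\<bar>a s t\<bar> \<le> 0" if "\<bar>s\<bar> powr r + \<bar>t\<bar> powr r = 0" for s t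
  proof -
    have "s = 0" "t = 0" using that by (auto simp: add_nonneg_eq_0_iff)
    then show ?thesis using homogeneous2_zero[OF assms] by simp
  qed
  obtain C where "C \<ge> 0" "\<And>s t. \<bar>a s t\<bar> \<le> C * (\<bar>s\<bar> powr r + \<bar>t\<bar> powr r) + 1 * (\<bar>s\<bar> powr r + \<bar>t\<bar> powr r)"
    by (rule homogeneous2_dominate[OF homogeneous2_abs[OF assms(1)] hn assms(2) _ z, of 1]) auto
  then show ?thesis by (intro that[of "C + 1"]) (auto simp: algebra_simps)
qed

section \<open>Tangents and midpoint convexity of |x|^p\<close>

lemma powr_tangent_strict:
  fixes u p :: real
  assumes "p > 1" "u \<ge> 0" "u \<noteq> 1"
  shows "u powr p > 1 + p * (u - 1)"
proof (cases "u = 0")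
  case True then show ?thesis using assms by simp
next
  case False
  then have u: "u > 0" using assms by simp
  have D: "DERIV (\<lambda>x. x powr p) x :> p * x powr (p - 1)" if "x > 0" for x :: real
    using that by (auto intro!: derivative_eq_intros)
  show ?thesis
  proof (cases "u > 1")
    case True
    obtain z where z: "1 < z" "z < u" "u powr p - 1 powr p = (u - 1) * (p * z powr (p - 1))"
      using MVT2[OF True, of "\<lambda>x. x powr p" "\<lambda>x. p * x powr (p - 1)"] D by force
    have "z powr (p - 1) > 1" using z(1) assms(1) by (simp add: gr_one_powr)
    then have "(u - 1) * (p * z powr (p - 1)) > (u - 1) * (p * 1)" using True assms(1)
      by (intro mult_strict_left_mono) auto
    then show ?thesis using z(3) by (simp add: algebra_simps)
  next
    case False
    then have l: "u < 1" using assms by simp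
    obtain z where z: "u < z" "z < 1" "1 powr p - u powr p = (1 - u) * (p * z powr (p - 1))"
      using MVT2[OF l, of "\<lambda>x. x powr p" "\<lambda>x. p * x powr (p - 1)"] D u by force
    have "z powr (p - 1) < 1" using z(1,2) u assms(1) powr_less_mono2[of "p - 1" z 1] by simp
    then have "(1 - u) * (p * z powr (p - 1)) < (1 - u) * (p * 1)" using l assms(1)
      by (intro mult_strict_left_mono) auto
    then show ?thesis using z(3) by (simp add: algebra_simps)
  qed
qed

text \<open>Dividing by |x|^p reduces to the tangent at 1 with u = y / x. For u < 0 that tangent is
  already negative.\<close>

lemma abs_powr_tangent_strict:
  fixes x y p :: real
  assumes "p > 1" "x \<noteq> y"
  shows "\<bar>y\<bar> powr p > \<bar>x\<bar> powr p + p * spow (p - 1) x * (y - x)"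
proof (cases "x = 0")
  case True then show ?thesis using assms by (simp add: spow_def)
next
  case False
  define u where "u = y / x"
  have y: "y = u * x" using False by (simp add: u_def)
  have u1: "u \<noteq> 1" using assms(2) y by auto
  have "\<bar>u\<bar> powr p > 1 + p * (u - 1)"
  proof (cases "u \<ge> 0")
    case True then show ?thesis using powr_tangent_strict[OF assms(1) True u1] by simp
  next
    case False
    then have "p * u < 0" using assms(1) by (simp add: mult_pos_neg)
    then have "1 + p * (u - 1) < 0" using assms(1) by (simp add: algebra_simps)
    then show ?thesis using powr_ge_zero[of "\<bar>u\<bar>" p] by linarith
  qed
  then have "\<bar>x\<bar> powr p * \<bar>u\<bar> powr p > \<bar>x\<bar> powr p * (1 + p * (u - 1))"
    using False by (intro mult_strict_left_mono) auto
  moreover have "spow (p - 1) x * (y - x) = \<bar>x\<bar> powr p * (u - 1)"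
  proof -
    have "spow (p - 1) x * (y - x) = (spow (p - 1) x * x) * (u - 1)" unfolding y by (simp add: algebra_simps)
    then show ?thesis by (simp add: spow_times)
  qed
  then have "p * spow (p - 1) x * (y - x) = p * (\<bar>x\<bar> powr p * (u - 1))" by simp
  ultimately show ?thesis by (simp add: y abs_mult powr_mult algebra_simps)
qed

lemma abs_powr_tangent:
  fixes x y p :: real
  assumes "p > 1"
  shows "\<bar>y\<bar> powr p \<ge> \<bar>x\<bar> powr p + p * spow (p - 1) x * (y - x)"
  using abs_powr_tangent_strict[OF assms, of x y] by (cases "x = y") auto

text \<open>Add the tangent inequalities at the midpoint m for the points s and t: the linear terms
  cancel, and both inequalities are strict unless s = m = t.\<close>

lemma abs_powr_midpoint:
  fixes s t p :: real
  assumes "p > 1"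
  shows "\<bar>(s + t) / 2\<bar> powr p \<le> (\<bar>s\<bar> powr p + \<bar>t\<bar> powr p) / 2"
    and "\<bar>(s + t) / 2\<bar> powr p = (\<bar>s\<bar> powr p + \<bar>t\<bar> powr p) / 2 \<Longrightarrow> s = t"
proof -
  define m where "m = (s + t) / 2"
  have le: "x \<le> (y + z) / 2" if "x + A \<le> y" "x + B \<le> z" "A + B = 0" for x y z A B :: real
    using that by (simp add: field_simps)
  have lt: "x < (y + z) / 2" if "x + A < y" "x + B < z" "A + B = 0" for x y z A B :: real
    using that by (simp add: field_simps)
  have "(s - m) + (t - m) = 0" by (simp add: m_def field_simps)
  define A B where "A = p * spow (p - 1) m * (s - m)" and "B = p * spow (p - 1) m * (t - m)"
  have e: "A + B = 0"
    unfolding A_def B_def using \<open>(s - m) + (t - m) = 0\<close> by (simp flip: distrib_left)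
  have "\<bar>m\<bar> powr p \<le> (\<bar>s\<bar> powr p + \<bar>t\<bar> powr p) / 2"
    using abs_powr_tangent[OF assms, of m s] abs_powr_tangent[OF assms, of m t] e
    unfolding A_def[symmetric] B_def[symmetric] by (rule le)
  then show "\<bar>(s + t) / 2\<bar> powr p \<le> (\<bar>s\<bar> powr p + \<bar>t\<bar> powr p) / 2" unfolding m_def .
  have "s = t" if q: "\<bar>m\<bar> powr p = (\<bar>s\<bar> powr p + \<bar>t\<bar> powr p) / 2"
  proof (rule ccontr)
    assume "s \<noteq> t"
    then have "m \<noteq> s" "m \<noteq> t" by (auto simp: m_def)
    with abs_powr_tangent_strict[OF assms, of m s] abs_powr_tangent_strict[OF assms, of m t] e
    have "\<bar>m\<bar> powr p < (\<bar>s\<bar> powr p + \<bar>t\<bar> powr p) / 2"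
      unfolding A_def[symmetric] B_def[symmetric] by (intro lt) auto
    with q show False by simp
  qed
  then show "\<bar>(s + t) / 2\<bar> powr p = (\<bar>s\<bar> powr p + \<bar>t\<bar> powr p) / 2 \<Longrightarrow> s = t"
    unfolding m_def .
qed

section \<open>Functions in \<open>L\<^sub>p\<close>\<close>

abbreviation Lp_set :: "real \<Rightarrow> 'w measure \<Rightarrow> ('w \<Rightarrow> real) set" where
  "Lp_set p M \<equiv> carrier (Lp_functions p M)"

definition pint :: "real \<Rightarrow> 'w measure \<Rightarrow> ('w \<Rightarrow> real) \<Rightarrow> real" where
  "pint p M f = (LINT w|M. \<bar>f w\<bar> powr p)"

lemma Lp_set_iff: "f \<in> Lp_set p M \<longleftrightarrow> f \<in> borel_measurable M \<and> integrable M (\<lambda>w. \<bar>f w\<bar> powr p)"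
  by (simp add: Lp_functions_def)

lemma Lp_set_measurable [measurable_dest]: "f \<in> Lp_set p M \<Longrightarrow> f \<in> borel_measurable M"
  and Lp_set_integrable: "f \<in> Lp_set p M \<Longrightarrow> integrable M (\<lambda>w. \<bar>f w\<bar> powr p)"
  by (auto simp: Lp_set_iff)

lemma pint_nonneg [simp]: "0 \<le> pint p M f"
  unfolding pint_def by simp

lemma homogeneous2_measurable:
  assumes "homogeneous2 q a" "f \<in> borel_measurable M" "g \<in> borel_measurable M"
  shows "(\<lambda>w. a (f w) (g w)) \<in> borel_measurable M"
  by (rule borel_measurable_continuous_Pair[OF assms(2,3)
      conjunct1[OF assms(1)[unfolded homogeneous2_def]]])

lemma homogeneous2_integrable:
  assumes a: "homogeneous2 r a" and r: "r > 0" and f: "f \<in> Lp_set r M" and g: "g \<in> Lp_set r M"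
  shows "integrable M (\<lambda>w. a (f w) (g w))"
proof -
  obtain K where K: "K \<ge> 0" "\<And>s t. \<bar>a s t\<bar> \<le> K * (\<bar>s\<bar> powr r + \<bar>t\<bar> powr r)"
    using homogeneous2_bound[OF a r] by blast
  have "integrable M (\<lambda>w. K * (\<bar>f w\<bar> powr r + \<bar>g w\<bar> powr r))"
    using f g by (intro integrable_mult_right Bochner_Integration.integrable_add Lp_set_integrable)
  then show ?thesis
  proof (rule Bochner_Integration.integrable_bound)
    show "AE w in M. norm (a (f w) (g w)) \<le> norm (K * (\<bar>f w\<bar> powr r + \<bar>g w\<bar> powr r))"
      using K by (intro AE_I2) (metis abs_ge_self order_trans real_norm_def)
  qed (use homogeneous2_measurable[OF a] f g in \<open>auto simp: Lp_set_iff\<close>)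
qed

text \<open>A function of degree q divides the exponent by q. The cases below are q = 1, for linear
  combinations, and q = 2, which leads from L_(2n) to L_n.\<close>

lemma homogeneous2_Lp_set:
  assumes a: "homogeneous2 q a" and r: "r > 0" "q > 0" and f: "f \<in> Lp_set r M" and g: "g \<in> Lp_set r M"
    and s: "q * s = r"
  shows "(\<lambda>w. a (f w) (g w)) \<in> Lp_set s M"
proof -
  have s0: "s > 0" using r s by (metis zero_less_mult_pos)
  have h: "homogeneous2 r (\<lambda>x y. \<bar>a x y\<bar> powr s)"
    using homogeneous2_powr[OF a s0 s] .
  show ?thesis unfolding Lp_set_iff
    using homogeneous2_integrable[OF h r(1) f g] homogeneous2_measurable[OF a] f g
    by (auto simp: Lp_set_iff)
qed

lemma Lp_set_add: "p > 0 \<Longrightarrow> f \<in> Lp_set p M \<Longrightarrow> g \<in> Lp_set p M \<Longrightarrow> (\<lambda>w. f w + g w) \<in> Lp_set p M"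
  using homogeneous2_Lp_set[OF homogeneous2_add[OF homogeneous2_fst homogeneous2_snd], of p f M g p] by simp

lemma Lp_set_diff: "p > 0 \<Longrightarrow> f \<in> Lp_set p M \<Longrightarrow> g \<in> Lp_set p M \<Longrightarrow> (\<lambda>w. f w - g w) \<in> Lp_set p M"
  using homogeneous2_Lp_set[OF homogeneous2_diff[OF homogeneous2_fst homogeneous2_snd], of p f M g p] by simp

lemma Lp_set_mid: "p > 0 \<Longrightarrow> f \<in> Lp_set p M \<Longrightarrow> g \<in> Lp_set p M \<Longrightarrow> (\<lambda>w. (f w + g w) / 2) \<in> Lp_set p M"
  using homogeneous2_Lp_set[OF homogeneous2_cdiv[OF homogeneous2_add[OF homogeneous2_fst homogeneous2_snd], of 2], of p f M g p] by simp

lemma Lp_set_cmult: "p > 0 \<Longrightarrow> f \<in> Lp_set p M \<Longrightarrow> (\<lambda>w. c * f w) \<in> Lp_set p M"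
  using homogeneous2_Lp_set[OF homogeneous2_cmult[OF homogeneous2_fst, of c], of p f M f p] by simp

lemma Lp_set_zero: "p > 0 \<Longrightarrow> (\<lambda>w. 0) \<in> Lp_set p M"
  by (simp add: Lp_set_iff)

lemma pint_cmult: "pint p M (\<lambda>w. c * f w) = \<bar>c\<bar> powr p * pint p M f"
  unfolding pint_def by (simp add: abs_mult powr_mult)

lemma pint_diff_commute: "pint p M (\<lambda>w. f w - g w) = pint p M (\<lambda>w. g w - f w)"
  unfolding pint_def by (simp add: abs_minus_commute)

section \<open>The p-th power of the norm: triangle inequality up to a constant, and uniform
  estimates\<close>

lemma abs_add_powr_le: "p > 0 \<Longrightarrow> \<bar>a + b\<bar> powr p \<le> 2 powr p * (\<bar>a\<bar> powr p + \<bar>b :: real\<bar> powr p)"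
proof -
  assume p: "p > 0"
  have "\<bar>a + b\<bar> powr p \<le> (2 * max \<bar>a\<bar> \<bar>b\<bar>) powr p" by (rule powr_mono2) (use p in auto)
  also have "\<dots> = 2 powr p * max \<bar>a\<bar> \<bar>b\<bar> powr p" by (simp add: powr_mult)
  also have "\<dots> \<le> 2 powr p * (\<bar>a\<bar> powr p + \<bar>b\<bar> powr p)" by (intro mult_left_mono) (auto simp: max_def)
  finally show ?thesis .
qed

lemma pint_add_le:
  assumes p: "p > 0" and f: "f \<in> Lp_set p M" and g: "g \<in> Lp_set p M"
  shows "pint p M (\<lambda>w. f w + g w) \<le> 2 powr p * (pint p M f + pint p M g)"
proof -
  have "pint p M (\<lambda>w. f w + g w) \<le> (LINT w|M. 2 powr p * (\<bar>f w\<bar> powr p + \<bar>g w\<bar> powr p))"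
    unfolding pint_def using Lp_set_integrable[OF Lp_set_add[OF p f g]] Lp_set_integrable[OF f] Lp_set_integrable[OF g] p
    by (intro integral_mono) (auto simp: abs_add_powr_le)
  also have "\<dots> = 2 powr p * (pint p M f + pint p M g)"
    unfolding pint_def using Lp_set_integrable[OF f] Lp_set_integrable[OF g] by simp
  finally show ?thesis .
qed

lemma pint_triangle:
  assumes p: "p > 0" and f: "f \<in> Lp_set p M" and g: "g \<in> Lp_set p M" and h: "h \<in> Lp_set p M"
  shows "pint p M (\<lambda>w. f w - h w) \<le> 2 powr p * (pint p M (\<lambda>w. f w - g w) + pint p M (\<lambda>w. g w - h w))"
  using pint_add_le[OF p Lp_set_diff[OF p f g] Lp_set_diff[OF p g h]] by simp

text \<open>This is \<open>homogeneous2_dominate\<close> integrated. An application has to check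
  only the pointwise implication from b = 0 to a \<le> 0; since \<delta> is fixed before the measure
  and the functions, it serves all members of an orbit at once.\<close>

lemma homogeneous2_integral_small:
  assumes a: "homogeneous2 r a" and b: "homogeneous2 r b" and r: "r > 0"
    and b0: "\<And>s t. b s t \<ge> 0" and ba: "\<And>s t. b s t = 0 \<Longrightarrow> a s t \<le> 0" and e: "\<epsilon> > 0"
  obtains \<delta> where "\<delta> > 0"
    "\<And>(M :: 'w measure) f g. \<lbrakk>f \<in> Lp_set r M; g \<in> Lp_set r M; pint r M f \<le> B; pint r M g \<le> B;
       (LINT w|M. b (f w) (g w)) \<le> \<delta>\<rbrakk> \<Longrightarrow> (LINT w|M. a (f w) (g w)) \<le> \<epsilon>"
proof -
  \<comment> \<open>The error term d (|s|^r + |t|^r) then integrates to at most \<epsilon> /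
    2.\<close>
  define d where "d = \<epsilon> / (4 * (\<bar>B\<bar> + 1))"
  have d: "d > 0" unfolding d_def using e by simp
  obtain C where C: "C \<ge> 0" "\<And>s t. a s t \<le> C * b s t + d * (\<bar>s\<bar> powr r + \<bar>t\<bar> powr r)"
    using homogeneous2_dominate[OF a b r b0 ba d] by blast
  show ?thesis
  \<comment> \<open>C times this bound is at most \<epsilon> / 2; the summand 1 covers C =
    0.\<close>
  proof (rule that[of "\<epsilon> / (2 * (C + 1))"])
    show "\<epsilon> / (2 * (C + 1)) > 0" using e C(1) by simp
    fix M :: "'w measure" and f g
    assume f: "f \<in> Lp_set r M" and g: "g \<in> Lp_set r M" and fB: "pint r M f \<le> B" and gB: "pint r M g \<le> B"
      and s: "(LINT w|M. b (f w) (g w)) \<le> \<epsilon> / (2 * (C + 1))"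
    note ints = homogeneous2_integrable[OF a r f g] homogeneous2_integrable[OF b r f g]
      Lp_set_integrable[OF f] Lp_set_integrable[OF g]
    have "(LINT w|M. a (f w) (g w)) \<le> (LINT w|M. C * b (f w) (g w) + d * (\<bar>f w\<bar> powr r + \<bar>g w\<bar> powr r))"
      using ints C(2) by (intro integral_mono) auto
    also have "\<dots> = C * (LINT w|M. b (f w) (g w)) + d * (pint r M f + pint r M g)"
      unfolding pint_def using ints by simp
    also have "\<dots> \<le> C * (\<epsilon> / (2 * (C + 1))) + d * (B + B)"
      using s fB gB C(1) d by (intro add_mono mult_left_mono) auto
    also have "\<dots> \<le> \<epsilon> / 2 + \<epsilon> / 2"
    proof (rule add_mono)
      have "C * \<epsilon> \<le> (C + 1) * \<epsilon>" using e by simp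
      then show "C * (\<epsilon> / (2 * (C + 1))) \<le> \<epsilon> / 2" using C(1) by (simp add: field_simps)
      have "\<epsilon> * B \<le> \<epsilon> * (\<bar>B\<bar> + 1)" using e by (intro mult_left_mono) auto
      moreover have "\<bar>B\<bar> + 1 > 0" by simp
      ultimately show "d * (B + B) \<le> \<epsilon> / 2" unfolding d_def by (simp add: field_simps)
    qed
    finally show "(LINT w|M. a (f w) (g w)) \<le> \<epsilon>" by simp
  qed
qed

text \<open>The convexity defect (|s|^p + |t|^p) / 2 - |(s + t) / 2|^p is nonnegative and vanishes
  on the diagonal only, so after integration it controls |s - t|^p.\<close>

lemma uniform_convexity_pint:
  assumes p: "p > 1" and e: "\<epsilon> > 0"
  obtains \<delta> where "\<delta> > 0"
    "\<And>(M :: 'w measure) f g. \<lbrakk>f \<in> Lp_set p M; g \<in> Lp_set p M; pint p M f \<le> B; pint p M g \<le> B;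
       (pint p M f + pint p M g) / 2 - pint p M (\<lambda>w. (f w + g w) / 2) \<le> \<delta>\<rbrakk>
       \<Longrightarrow> pint p M (\<lambda>w. f w - g w) \<le> \<epsilon>"
proof -
  define b :: "real \<Rightarrow> real \<Rightarrow> real" where "b = (\<lambda>s t. (\<bar>s\<bar> powr p + \<bar>t\<bar> powr p) / 2 - \<bar>(s + t) / 2\<bar> powr p)"
  note hi = homogeneous2_add homogeneous2_diff homogeneous2_cdiv homogeneous2_powr[where r = 1]
    homogeneous2_fst homogeneous2_snd
  have b: "homogeneous2 p b" unfolding b_def by (intro hi) (use p in auto)
  have a: "homogeneous2 p (\<lambda>s t. \<bar>s - t\<bar> powr p)" by (intro hi) (use p in auto)
  have p0: "p > 0" using p by simp
  have b0: "b s t \<ge> 0" for s t using abs_powr_midpoint(1)[OF p, of s t] by (simp add: b_def)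
  have ba: "\<bar>s - t\<bar> powr p \<le> 0" if "b s t = 0" for s t
    using abs_powr_midpoint(2)[OF p, of s t] that by (simp add: b_def)
  obtain \<delta> where \<delta>: "\<delta> > 0" "\<And>(M :: 'w measure) f g. \<lbrakk>f \<in> Lp_set p M; g \<in> Lp_set p M; pint p M f \<le> B; pint p M g \<le> B;
       (LINT w|M. b (f w) (g w)) \<le> \<delta>\<rbrakk> \<Longrightarrow> (LINT w|M. \<bar>f w - g w\<bar> powr p) \<le> \<epsilon>"
    by (rule homogeneous2_integral_small[OF a b p0 b0 ba e]) auto
  show ?thesis
  proof (rule that[OF \<delta>(1)])
    fix M :: "'w measure" and f g
    assume f: "f \<in> Lp_set p M" and g: "g \<in> Lp_set p M" and B: "pint p M f \<le> B" "pint p M g \<le> B"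
      and d: "(pint p M f + pint p M g) / 2 - pint p M (\<lambda>w. (f w + g w) / 2) \<le> \<delta>"
    have "(LINT w|M. b (f w) (g w)) = (pint p M f + pint p M g) / 2 - pint p M (\<lambda>w. (f w + g w) / 2)"
      unfolding b_def pint_def
      using Lp_set_integrable[OF f] Lp_set_integrable[OF g] Lp_set_integrable[OF Lp_set_mid[OF p0 f g]] by simp
    then show "pint p M (\<lambda>w. f w - g w) \<le> \<epsilon>"
      unfolding pint_def[of p M "\<lambda>w. f w - g w"] using \<delta>(2)[OF f g B] d by simp
  qed
qed

section \<open>Completeness of L_p and elements of least norm\<close>

lemma Fatou_bound:
  fixes h :: "nat \<Rightarrow> 'w \<Rightarrow> real"
  assumes m: "\<And>i. integrable M (h i)" and h0: "\<And>i w. h i w \<ge> 0" and g [measurable]: "g \<in> borel_measurable M"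
    and lim: "AE w in M. (\<lambda>i. h i w) \<longlonglongrightarrow> g w" and bd: "\<And>i. (LINT w|M. h i w) \<le> c"
  shows "integrable M g" "(LINT w|M. g w) \<le> c"
proof -
  have [measurable]: "h i \<in> borel_measurable M" for i using m by auto
  have g0: "AE w in M. g w \<ge> 0"
    using lim by eventually_elim (use h0 in \<open>auto intro: LIMSEQ_le_const\<close>)
  have c0: "c \<ge> 0" using order_trans[OF _ bd[of 0], of 0] h0 by (simp add: integral_nonneg_AE)
  have "(\<integral>\<^sup>+w. ennreal (g w) \<partial>M) = (\<integral>\<^sup>+w. liminf (\<lambda>i. ennreal (h i w)) \<partial>M)"
  proof (rule nn_integral_cong_AE)
    show "AE w in M. ennreal (g w) = liminf (\<lambda>i. ennreal (h i w))"
      using lim by eventually_elim (auto intro!: lim_imp_Liminf[symmetric] tendsto_ennrealI)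
  qed
  also have "\<dots> \<le> liminf (\<lambda>i. \<integral>\<^sup>+w. ennreal (h i w) \<partial>M)"
    by (intro nn_integral_liminf) auto
  also have "\<dots> \<le> liminf (\<lambda>i. ennreal c)"
  proof (intro Liminf_mono always_eventually allI)
    fix i show "(\<integral>\<^sup>+w. ennreal (h i w) \<partial>M) \<le> ennreal c"
      by (subst nn_integral_eq_integral) (use m h0 bd in \<open>auto intro: ennreal_leI\<close>)
  qed
  also have "\<dots> = ennreal c" by (simp add: Liminf_const)
  finally have le: "(\<integral>\<^sup>+w. ennreal (g w) \<partial>M) \<le> ennreal c" .
  \<comment> \<open>\<open>g\<close> is not known to be integrable in advance; the bound on its
    nonnegative integral supplies this.\<close>
  show i: "integrable M g"
    using le g0 by (intro integrableI_nonneg) (auto simp: le_less_trans)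
  show "(LINT w|M. g w) \<le> c"
    using le c0 unfolding nn_integral_eq_integral[OF i g0] by (simp add: ennreal_le_iff)
qed

text \<open>Completeness is transferred from \<open>L\<^sub>1\<close> along the Mazur map \<open>spow p\<close>.\<close>

lemma Lp_set_complete:
  fixes f :: "nat \<Rightarrow> 'w \<Rightarrow> real"
  assumes p: "p > 1" and f: "\<And>n. f n \<in> Lp_set p M"
    and cau: "\<And>\<epsilon>. \<epsilon> > 0 \<Longrightarrow> \<exists>N. \<forall>m\<ge>N. \<forall>n\<ge>N. pint p M (\<lambda>w. f m w - f n w) \<le> \<epsilon>"
  obtains g where "g \<in> Lp_set p M" "\<And>\<epsilon>. \<epsilon> > 0 \<Longrightarrow> \<exists>N. \<forall>n\<ge>N. pint p M (\<lambda>w. f n w - g w) \<le> \<epsilon>"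
proof -
  have p0: "p > 0" using p by simp
  note hi = homogeneous2_abs homogeneous2_diff homogeneous2_powr[where r = 1] homogeneous2_spow[where r = 1]
    homogeneous2_fst homogeneous2_snd
  obtain N0 where N0: "\<And>m n. m \<ge> N0 \<Longrightarrow> n \<ge> N0 \<Longrightarrow> pint p M (\<lambda>w. f m w - f n w) \<le> 1"
    using cau[of 1] by auto
  define B where "B = 2 powr p * (1 + pint p M (f N0))"
  have B: "pint p M (f n) \<le> B" if "n \<ge> N0" for n
  proof -
    have "pint p M (f n) \<le> 2 powr p * (pint p M (\<lambda>w. f n w - f N0 w) + pint p M (f N0))"
      using pint_add_le[OF p0 Lp_set_diff[OF p0 f f] f, of n N0 N0] by simp
    also have "\<dots> \<le> B" unfolding B_def using N0[OF that order_refl] by (intro mult_left_mono add_right_mono) auto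
    finally show ?thesis .
  qed
  \<comment> \<open>Dropping the first \<open>N0\<close> terms makes all norms at most
    \<open>B\<close>, as the uniform estimate requires.\<close>
  define F where "F = (\<lambda>n. f (n + N0))"
  have F: "F n \<in> Lp_set p M" for n unfolding F_def by (rule f)
  have FB: "pint p M (F n) \<le> B" for n unfolding F_def by (intro B) simp
  have [measurable]: "f n \<in> borel_measurable M" "F n \<in> borel_measurable M" for n
    using f F by (auto intro: Lp_set_measurable)
  have isp: "integrable M (\<lambda>w. spow p (F n w))" for n
    by (rule homogeneous2_integrable[OF homogeneous2_spow[OF homogeneous2_fst p0] p0 F F]) simp
  have cs: "\<exists>N. \<forall>i\<ge>N. \<forall>j\<ge>N. (LINT w|M. norm (spow p (F i w) - spow p (F j w))) < e" if e: "e > 0" for e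
  proof -
    have a: "homogeneous2 p (\<lambda>s t. \<bar>spow p s - spow p t\<bar>)" by (intro hi) (use p in auto)
    have b: "homogeneous2 p (\<lambda>s t. \<bar>s - t\<bar> powr p)" by (intro hi) (use p in auto)
    obtain \<delta> where \<delta>: "\<delta> > 0" "\<And>(M :: 'w measure) f g. \<lbrakk>f \<in> Lp_set p M; g \<in> Lp_set p M; pint p M f \<le> B; pint p M g \<le> B;
       (LINT w|M. \<bar>f w - g w\<bar> powr p) \<le> \<delta>\<rbrakk> \<Longrightarrow> (LINT w|M. \<bar>spow p (f w) - spow p (g w)\<bar>) \<le> e / 2"
      by (rule homogeneous2_integral_small[OF a b p0, of "e / 2"]) (use e in auto)
    obtain N where "\<And>m n. m \<ge> N \<Longrightarrow> n \<ge> N \<Longrightarrow> pint p M (\<lambda>w. f m w - f n w) \<le> \<delta>"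
      using cau[OF \<delta>(1)] by blast
    then have N: "i \<ge> N \<Longrightarrow> j \<ge> N \<Longrightarrow> (LINT w|M. \<bar>F i w - F j w\<bar> powr p) \<le> \<delta>" for i j
      unfolding F_def pint_def by simp
    show ?thesis
    proof (intro exI[of _ N] allI impI)
      fix i j assume ij: "i \<ge> N" "j \<ge> N"
      have "(LINT w|M. \<bar>spow p (F i w) - spow p (F j w)\<bar>) \<le> e / 2"
        by (rule \<delta>(2)[OF F F FB FB N[OF ij]])
      then show "(LINT w|M. norm (spow p (F i w) - spow p (F j w))) < e" using e by simp
    qed
  qed
  \<comment> \<open>The transformed sequence is Cauchy in L_1, so a subsequence is Cauchy almost
    everywhere; the continuous inverse \<open>spow (1 / p)\<close> brings the limit back.\<close>
  obtain r where r: "strict_mono r" "AE w in M. Cauchy (\<lambda>i. spow p (F (r i) w))"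
    using cauchy_L1_AE_cauchy_subseq[OF isp cs] by blast
  define g where "g = (\<lambda>w. lim (\<lambda>i. F (r i) w))"
  have [measurable]: "g \<in> borel_measurable M" unfolding g_def by measurable
  have conv: "AE w in M. (\<lambda>i. F (r i) w) \<longlonglongrightarrow> g w"
    using r(2)
  proof eventually_elim
    fix w assume "Cauchy (\<lambda>i. spow p (F (r i) w))"
    then obtain l where l: "(\<lambda>i. spow p (F (r i) w)) \<longlonglongrightarrow> l"
      using Cauchy_convergent_iff convergent_def by blast
    have "continuous_on UNIV (spow (1 / p))" using continuous_on_spow[of "1 / p" UNIV "\<lambda>x. x"] p by simp
    then have "isCont (spow (1 / p)) l" by (simp add: continuous_on_eq_continuous_at)
    from isCont_tendsto_compose[OF this l]
    have "(\<lambda>i. F (r i) w) \<longlonglongrightarrow> spow (1 / p) l"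
      using spow_spow[of "1 / p"] p by simp
    then show "(\<lambda>i. F (r i) w) \<longlonglongrightarrow> g w" unfolding g_def by (simp add: limI)
  qed
  \<comment> \<open>Fatou's lemma along the subsequence turns the Cauchy estimate at n into an
    estimate for f n - g. The case n = \<open>N0\<close> shows that g lies in L_p, the general case
    is the convergence.\<close>
  have main: "integrable M (\<lambda>w. \<bar>f n w - g w\<bar> powr p) \<and> pint p M (\<lambda>w. f n w - g w) \<le> \<epsilon>"
    if N: "\<And>m. m \<ge> N \<Longrightarrow> pint p M (\<lambda>w. f n w - f m w) \<le> \<epsilon>" for n N \<epsilon>
  proof -
    define h where "h = (\<lambda>i w. \<bar>f n w - F (r (i + N)) w\<bar> powr p)"
    have hi: "integrable M (h i)" for i
      unfolding h_def using Lp_set_integrable[OF Lp_set_diff[OF p0 f F]] .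
    have hb: "(LINT w|M. h i w) \<le> \<epsilon>" for i
    proof -
      have "r (i + N) + N0 \<ge> N" using seq_suble[OF r(1), of "i + N"] by simp
      from N[OF this] show ?thesis unfolding h_def pint_def F_def by simp
    qed
    have hl: "AE w in M. (\<lambda>i. h i w) \<longlonglongrightarrow> \<bar>f n w - g w\<bar> powr p"
      using conv
    proof eventually_elim
      fix w assume "(\<lambda>i. F (r i) w) \<longlonglongrightarrow> g w"
      then have "(\<lambda>i. F (r (i + N)) w) \<longlonglongrightarrow> g w" by (rule LIMSEQ_ignore_initial_segment)
      then have l: "(\<lambda>i. f n w - F (r (i + N)) w) \<longlonglongrightarrow> f n w - g w" by (intro tendsto_intros)
      have "continuous_on UNIV (\<lambda>x::real. \<bar>x\<bar> powr p)" using p by (intro continuous_on_powr' continuous_intros) auto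
      then have "isCont (\<lambda>x::real. \<bar>x\<bar> powr p) (f n w - g w)" by (simp add: continuous_on_eq_continuous_at)
      from isCont_tendsto_compose[OF this l] show "(\<lambda>i. h i w) \<longlonglongrightarrow> \<bar>f n w - g w\<bar> powr p"
        unfolding h_def .
    qed
    have "(\<lambda>w. \<bar>f n w - g w\<bar> powr p) \<in> borel_measurable M" by measurable
    from Fatou_bound[OF hi _ this hl hb] show ?thesis unfolding pint_def h_def by auto
  qed
  have "integrable M (\<lambda>w. \<bar>f N0 w - g w\<bar> powr p)" using main[of N0 N0 1] N0 by auto
  then have fg: "(\<lambda>w. f N0 w - g w) \<in> Lp_set p M" by (simp add: Lp_set_iff)
  have "g \<in> Lp_set p M" using Lp_set_diff[OF p0 f fg, of N0] by simp
  then show ?thesis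
  proof (rule that)
    fix \<epsilon> :: real assume "\<epsilon> > 0"
    then obtain N where "\<forall>m\<ge>N. \<forall>n\<ge>N. pint p M (\<lambda>w. f m w - f n w) \<le> \<epsilon>" using cau by blast
    then show "\<exists>N. \<forall>n\<ge>N. pint p M (\<lambda>w. f n w - g w) \<le> \<epsilon>" using main by blast
  qed
qed

text \<open>The midpoint of two near-minimisers lies in C, hence is not below the infimum, so
  uniform convexity forces the two together. C is not assumed closed and c may lie outside it; what
  is recorded is that all near-minimisers are close to c.\<close>

lemma pint_minimizer:
  fixes C :: "('w \<Rightarrow> real) set"
  assumes p: "p > 1" and C: "C \<subseteq> Lp_set p M" "C \<noteq> {}"
    and mid: "\<And>u v. u \<in> C \<Longrightarrow> v \<in> C \<Longrightarrow> (\<lambda>w. (u w + v w) / 2) \<in> C"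
  obtains c where "c \<in> Lp_set p M"
    "\<And>\<epsilon>. \<epsilon> > 0 \<Longrightarrow> \<exists>\<delta>>0. \<forall>u\<in>C. pint p M u \<le> (INF u\<in>C. pint p M u) + \<delta> \<longrightarrow> pint p M (\<lambda>w. u w - c w) \<le> \<epsilon>"
proof -
  have p0: "p > 0" using p by simp
  define m where "m = (INF u\<in>C. pint p M u)"
  have bdd: "bdd_below (pint p M ` C)" by (intro bdd_belowI[of _ 0]) auto
  have m: "m \<le> pint p M u" if "u \<in> C" for u unfolding m_def using bdd that by (rule cINF_lower)
  have ex: "\<exists>u\<in>C. pint p M u \<le> m + d" if "d > 0" for d
  proof -
    have "(INF u\<in>C. pint p M u) < m + d" using that unfolding m_def by simp
    then show ?thesis unfolding cINF_less_iff[OF C(2) bdd] by (blast intro: less_imp_le)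
  qed
  have uc: "\<exists>\<delta>>0. \<forall>u\<in>C. \<forall>v\<in>C. pint p M u \<le> m + \<delta> \<longrightarrow> pint p M v \<le> m + \<delta> \<longrightarrow> pint p M (\<lambda>w. u w - v w) \<le> \<epsilon>"
    if e: "\<epsilon> > 0" for \<epsilon>
  proof -
    obtain \<delta> where \<delta>: "\<delta> > 0"
      "\<And>(M :: 'w measure) f g. \<lbrakk>f \<in> Lp_set p M; g \<in> Lp_set p M; pint p M f \<le> m + 1; pint p M g \<le> m + 1;
       (pint p M f + pint p M g) / 2 - pint p M (\<lambda>w. (f w + g w) / 2) \<le> \<delta>\<rbrakk>
       \<Longrightarrow> pint p M (\<lambda>w. f w - g w) \<le> \<epsilon>"
      by (rule uniform_convexity_pint[OF p e, of "m + 1"], rule that)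
    show ?thesis
    proof (intro exI[of _ "min 1 \<delta>"] conjI ballI impI)
      fix u v assume u: "u \<in> C" and v: "v \<in> C" and b: "pint p M u \<le> m + min 1 \<delta>" "pint p M v \<le> m + min 1 \<delta>"
      show "pint p M (\<lambda>w. u w - v w) \<le> \<epsilon>"
      proof (rule \<delta>(2))
        have "m \<le> pint p M (\<lambda>w. (u w + v w) / 2)" by (rule m[OF mid[OF u v]])
        then show "(pint p M u + pint p M v) / 2 - pint p M (\<lambda>w. (u w + v w) / 2) \<le> \<delta>"
          using b by (simp add: field_simps)
      qed (use u v b C(1) in auto)
    qed (use \<delta>(1) in auto)
  qed
  have "\<exists>u. u \<in> C \<and> pint p M u \<le> m + 1 / real (Suc n)" for n using ex[of "1 / real (Suc n)"] by auto
  then obtain u where u: "\<And>n. u n \<in> C" "\<And>n. pint p M (u n) \<le> m + 1 / real (Suc n)" by metis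
  have small: "\<exists>N. \<forall>n\<ge>N. pint p M (u n) \<le> m + d" if d: "d > 0" for d
  proof -
    obtain N where N: "1 / real (Suc N) < d" using d by (metis nat_approx_posE)
    have "pint p M (u n) \<le> m + d" if "n \<ge> N" for n
    proof -
      have "1 / real (Suc n) \<le> 1 / real (Suc N)" using that by (simp add: frac_le)
      with u(2)[of n] N show ?thesis by linarith
    qed
    then show ?thesis by blast
  qed
  have cau: "\<exists>N. \<forall>k\<ge>N. \<forall>n\<ge>N. pint p M (\<lambda>w. u k w - u n w) \<le> \<epsilon>" if eps: "\<epsilon> > 0" for \<epsilon>
  proof -
    obtain \<delta> where \<delta>: "\<delta> > 0" "\<And>u v. u \<in> C \<Longrightarrow> v \<in> C \<Longrightarrow> pint p M u \<le> m + \<delta> \<Longrightarrow> pint p M v \<le> m + \<delta> \<Longrightarrow> pint p M (\<lambda>w. u w - v w) \<le> \<epsilon>"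
      using uc[OF eps] by blast
    obtain N where "\<And>n. n \<ge> N \<Longrightarrow> pint p M (u n) \<le> m + \<delta>" using small[OF \<delta>(1)] by blast
    then show ?thesis using \<delta>(2)[OF u(1) u(1)] by blast
  qed
  have uL: "u n \<in> Lp_set p M" for n using u(1) C(1) by auto
  obtain c where c: "c \<in> Lp_set p M" "\<And>\<epsilon>. \<epsilon> > 0 \<Longrightarrow> \<exists>N. \<forall>n\<ge>N. pint p M (\<lambda>w. u n w - c w) \<le> \<epsilon>"
    by (rule Lp_set_complete[OF p uL cau], assumption, rule that)
  show ?thesis
  proof (rule that[OF c(1)])
    fix \<epsilon> :: real assume e: "\<epsilon> > 0"
    \<comment> \<open>The factor 2^p is the constant of the triangle inequality for p-th powers, the
      factor 2 splits the error between two summands.\<close>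
    define \<eta> where "\<eta> = \<epsilon> / (2 powr p * 2)"
    have eta: "\<eta> > 0" unfolding \<eta>_def using e by simp
    obtain \<delta> where \<delta>: "\<delta> > 0" "\<And>u v. u \<in> C \<Longrightarrow> v \<in> C \<Longrightarrow> pint p M u \<le> m + \<delta> \<Longrightarrow> pint p M v \<le> m + \<delta> \<Longrightarrow> pint p M (\<lambda>w. u w - v w) \<le> \<eta>"
      using uc[OF eta] by blast
    obtain N1 where N1: "\<And>n. n \<ge> N1 \<Longrightarrow> pint p M (\<lambda>w. u n w - c w) \<le> \<eta>" using c(2)[OF eta] by blast
    obtain N2 where N2: "\<And>n. n \<ge> N2 \<Longrightarrow> pint p M (u n) \<le> m + \<delta>" using small[OF \<delta>(1)] by blast
    define n where "n = max N1 N2"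
    have "pint p M (\<lambda>w. v w - c w) \<le> \<epsilon>" if v: "v \<in> C" "pint p M v \<le> m + \<delta>" for v
    proof -
      have "v \<in> Lp_set p M" using v C by auto
      from pint_triangle[OF p0 this uL c(1), of n]
      have "pint p M (\<lambda>w. v w - c w) \<le> 2 powr p * (pint p M (\<lambda>w. v w - u n w) + pint p M (\<lambda>w. u n w - c w))" .
      also have "\<dots> \<le> 2 powr p * (\<eta> + \<eta>)"
        using \<delta>(2)[OF v(1) u(1) v(2) N2, of n] N1[of n] by (intro mult_left_mono add_mono) (auto simp: n_def)
      also have "\<dots> = \<epsilon>" unfolding \<eta>_def by simp
      finally show ?thesis .
    qed
    then show "\<exists>\<delta>>0. \<forall>u\<in>C. pint p M u \<le> (INF u\<in>C. pint p M u) + \<delta> \<longrightarrow> pint p M (\<lambda>w. u w - c w) \<le> \<epsilon>"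
      unfolding m_def[symmetric] using \<delta>(1) by blast
  qed
qed

text \<open>(f + g) / (A + B) is a convex combination of f / A and g / B, to which convexity of
  |x|^p applies. Taking A and B slightly larger than the norms keeps the divisions legitimate when a
  norm is 0.\<close>

lemma Minkowski_pint:
  assumes p: "p > 1" and f: "f \<in> Lp_set p M" and g: "g \<in> Lp_set p M"
  shows "pint p M (\<lambda>w. f w + g w) powr (1 / p) \<le> pint p M f powr (1 / p) + pint p M g powr (1 / p)"
proof -
  have p0: "p > 0" using p by simp
  have conv: "\<bar>l * x + k * y\<bar> powr p \<le> l * \<bar>x\<bar> powr p + k * \<bar>y\<bar> powr p" if "l \<ge> 0" "k \<ge> 0" "l + k = 1" for l k x y
  proof -
    define z where "z = l * x + k * y"
    define A where "A = p * spow (p - 1) z"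
    have k: "k = 1 - l" using that by simp
    have "l * (\<bar>z\<bar> powr p + A * (x - z)) + k * (\<bar>z\<bar> powr p + A * (y - z)) \<le> l * \<bar>x\<bar> powr p + k * \<bar>y\<bar> powr p"
      using abs_powr_tangent[OF p, of z x] abs_powr_tangent[OF p, of z y] that
      unfolding A_def by (intro add_mono mult_left_mono) auto
    moreover have "l * (\<bar>z\<bar> powr p + A * (x - z)) + k * (\<bar>z\<bar> powr p + A * (y - z))
        = \<bar>z\<bar> powr p + A * (l * x + k * y - z)" unfolding k by (simp add: algebra_simps)
    ultimately show ?thesis unfolding z_def by simp
  qed
  have step: "pint p M (\<lambda>w. f w + g w) \<le> (A + B) powr p"
    if A: "A > 0" "pint p M f \<le> A powr p" and B: "B > 0" "pint p M g \<le> B powr p" for A B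
  proof -
    have pt: "\<bar>f w + g w\<bar> powr p \<le> (A + B) powr p * (A / (A + B) * (\<bar>f w\<bar> powr p / A powr p) + B / (A + B) * (\<bar>g w\<bar> powr p / B powr p))" for w
    proof -
      have e: "f w + g w = (A + B) * (A / (A + B) * (f w / A) + B / (A + B) * (g w / B))"
      proof -
        have "A / (A + B) * (f w / A) = f w / (A + B)" "B / (A + B) * (g w / B) = g w / (A + B)"
          using A B by auto
        then show ?thesis using A B by (simp add: add_divide_distrib[symmetric])
      qed
      have "\<bar>f w + g w\<bar> powr p = (A + B) powr p * \<bar>A / (A + B) * (f w / A) + B / (A + B) * (g w / B)\<bar> powr p"
        unfolding e using A B by (simp add: abs_mult powr_mult)
      also have "\<dots> \<le> (A + B) powr p * (A / (A + B) * \<bar>f w / A\<bar> powr p + B / (A + B) * \<bar>g w / B\<bar> powr p)"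
        using A B by (intro mult_left_mono conv) (auto simp: add_divide_distrib[symmetric])
      finally show ?thesis using A B by (simp add: powr_divide)
    qed
    note ints = Lp_set_integrable[OF f] Lp_set_integrable[OF g] Lp_set_integrable[OF Lp_set_add[OF p0 f g]]
    have "pint p M (\<lambda>w. f w + g w) \<le> (LINT w|M. (A + B) powr p * (A / (A + B) * (\<bar>f w\<bar> powr p / A powr p) + B / (A + B) * (\<bar>g w\<bar> powr p / B powr p)))"
      unfolding pint_def using ints pt by (intro integral_mono) auto
    also have "\<dots> = (A + B) powr p * (A / (A + B) * (pint p M f / A powr p) + B / (A + B) * (pint p M g / B powr p))"
      unfolding pint_def using ints by simp
    also have "\<dots> \<le> (A + B) powr p * (A / (A + B) * 1 + B / (A + B) * 1)"
      using A B by (intro mult_left_mono add_mono) (auto simp: divide_le_eq_1)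
    also have "\<dots> = (A + B) powr p" using A B by (simp add: add_divide_distrib[symmetric])
    finally show ?thesis .
  qed
  show ?thesis
  proof (rule field_le_epsilon)
    fix e :: real assume e: "e > 0"
    define A where "A = pint p M f powr (1 / p) + e / 2"
    define B where "B = pint p M g powr (1 / p) + e / 2"
    have le: "pint p M h \<le> (pint p M h powr (1 / p) + e / 2) powr p" for h :: "'a \<Rightarrow> real"
    proof -
      have "pint p M h = (pint p M h powr (1 / p)) powr p" using p by (simp add: powr_powr)
      also have "\<dots> \<le> (pint p M h powr (1 / p) + e / 2) powr p" using e p by (intro powr_mono2) auto
      finally show ?thesis .
    qed
    have pos: "A > 0" "B > 0" unfolding A_def B_def using e by (auto simp: add_nonneg_pos)
    have "pint p M (\<lambda>w. f w + g w) \<le> (A + B) powr p"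
      by (rule step) (use pos le[of f] le[of g] in \<open>auto simp: A_def B_def\<close>)
    then have "pint p M (\<lambda>w. f w + g w) powr (1 / p) \<le> ((A + B) powr p) powr (1 / p)"
      using p by (intro powr_mono2) auto
    also have "\<dots> = A + B" using pos p by (simp add: powr_powr)
    finally show "pint p M (\<lambda>w. f w + g w) powr (1 / p) \<le> pint p M f powr (1 / p) + pint p M g powr (1 / p) + e"
      unfolding A_def B_def by simp
  qed
qed

section \<open>Normed spaces and their quotients\<close>

lemma real_ring_simps [simp]:
  "carrier real_ring = UNIV" "x \<oplus>\<^bsub>real_ring\<^esub> y = x + y" "x \<otimes>\<^bsub>real_ring\<^esub> y = x * y"
  "\<one>\<^bsub>real_ring\<^esub> = 1" "\<zero>\<^bsub>real_ring\<^esub> = 0"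
  by (simp_all add: ring_of_type_algebra_def)

lemma real_ring_cring: "cring real_ring"
  by (rule cring_from_type_algebra)

lemma real_ring_uminus [simp]: "\<ominus>\<^bsub>real_ring\<^esub> x = - x"
proof -
  interpret cring real_ring by (rule real_ring_cring)
  show ?thesis by (rule minus_equality) auto
qed

locale real_module = Module.module "real_ring" V for V :: "'v normed_module" (structure)
begin

lemma smult_1 [simp]: "x \<in> carrier V \<Longrightarrow> 1 \<odot> x = x"
  using smult_one by simp

lemma smult_add: "x \<in> carrier V \<Longrightarrow> (a + b) \<odot> x = a \<odot> x \<oplus> b \<odot> x"
  using smult_l_distr[of a b x] by simp

lemma smult_mult: "x \<in> carrier V \<Longrightarrow> (a * b) \<odot> x = a \<odot> (b \<odot> x)"
  using smult_assoc1[of a b x] by simp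

lemma smult_minus_one: "x \<in> carrier V \<Longrightarrow> (- 1) \<odot> x = \<ominus> x"
  using smult_l_minus[of 1 x] by simp

lemma minus_minus_cancel:
  assumes "x \<in> carrier V" "y \<in> carrier V" "z \<in> carrier V"
  shows "(x \<ominus> y) \<oplus> (y \<ominus> z) = x \<ominus> z" "\<ominus> (x \<ominus> y) = y \<ominus> x" "(x \<ominus> z) \<ominus> (y \<ominus> z) = x \<ominus> y"
    "(x \<ominus> y) \<oplus> y = x" "x \<oplus> (y \<ominus> x) = y" "(x \<oplus> y) \<ominus> (x \<oplus> z) = y \<ominus> z" "(x \<oplus> y) \<ominus> y = x" "x \<ominus> x = \<zero>"
proof -
  have aux: "a \<oplus> (b \<oplus> \<ominus> a) = b" "a \<oplus> (b \<oplus> (\<ominus> a \<oplus> c)) = b \<oplus> c"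
    if "a \<in> carrier V" "b \<in> carrier V" "c \<in> carrier V" for a b c
    using that by (simp_all add: M.a_lcomm[of a b] M.r_neg M.r_neg2)
  show "(x \<ominus> y) \<oplus> (y \<ominus> z) = x \<ominus> z" "\<ominus> (x \<ominus> y) = y \<ominus> x" "(x \<ominus> z) \<ominus> (y \<ominus> z) = x \<ominus> y"
    "(x \<ominus> y) \<oplus> y = x" "x \<oplus> (y \<ominus> x) = y" "(x \<oplus> y) \<ominus> (x \<oplus> z) = y \<ominus> z" "(x \<oplus> y) \<ominus> y = x" "x \<ominus> x = \<zero>"
    using assms by (simp_all add: a_minus_def M.a_ac M.minus_add M.r_neg M.r_neg2 M.r_neg1 M.l_neg aux)
qed

lemma smult_diff: "x \<in> carrier V \<Longrightarrow> y \<in> carrier V \<Longrightarrow> c \<odot> (x \<ominus> y) = c \<odot> x \<ominus> c \<odot> y"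
  by (simp add: a_minus_def smult_r_distr smult_r_minus)

section \<open>Cosets of a submodule\<close>

context
  fixes F assumes F: "submodule F real_ring V"
begin

lemma submodule_abelian: "abelian_subgroup F V"
proof (rule abelian_subgroupI3)
  show "additive_subgroup F V"
    using F by (simp add: submodule_def additive_subgroup_def)
qed (rule M.abelian_group_axioms)

interpretation F: abelian_subgroup F V by (rule submodule_abelian)

lemma quotient_carrier: "carrier (quotient_space V F) = (\<lambda>x. F +> x) ` carrier V"
  unfolding quotient_space_def A_RCOSETS_def' by auto

lemma quotient_add:
  "x \<in> carrier V \<Longrightarrow> y \<in> carrier V \<Longrightarrow> (F +> x) \<oplus>\<^bsub>quotient_space V F\<^esub> (F +> y) = F +> (x \<oplus> y)"
  by (simp add: quotient_space_def F.a_rcos_sum)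

lemma coset_eq_iff:
  assumes x: "x \<in> carrier V" and y: "y \<in> carrier V"
  shows "F +> x = F +> y \<longleftrightarrow> x \<ominus> y \<in> F"
proof -
  have 1: "x \<in> F +> y \<longleftrightarrow> x \<ominus> y \<in> F"
  proof
    assume "x \<in> F +> y"
    then obtain h where h: "h \<in> F" "x = h \<oplus> y" unfolding a_r_coset_def' by auto
    then show "x \<ominus> y \<in> F" using y F.a_subset by (auto simp: minus_minus_cancel)
  next
    assume "x \<ominus> y \<in> F"
    moreover have "x = (x \<ominus> y) \<oplus> y" using x y by (simp add: minus_minus_cancel)
    ultimately show "x \<in> F +> y" unfolding a_r_coset_def' by auto
  qed
  have 2: "x \<in> F +> x" by (rule F.a_rcos_self[OF x])
  have "F +> x = F +> y" if "x \<in> F +> y" using M.a_repr_independence[OF that y F.a_subgroup] by simp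
  with 1 2 show ?thesis by auto
qed

text \<open>Representatives of a coset differ by some h in F, and c h stays in F; so the sets in the
  union that defines the scalar product all coincide.\<close>

lemma quotient_smult:
  assumes x: "x \<in> carrier V"
  shows "c \<odot>\<^bsub>quotient_space V F\<^esub> (F +> x) = F +> (c \<odot> x)"
proof -
  have "F +> (c \<odot> z) = F +> (c \<odot> x)" if z: "z \<in> F +> x" for z
  proof -
    obtain h where h: "h \<in> F" "z = h \<oplus> x" using z unfolding a_r_coset_def' by auto
    have hV: "h \<in> carrier V" using h F.a_subset by auto
    have "c \<odot> z \<ominus> c \<odot> x = c \<odot> h"
      using h hV x by (simp add: smult_r_distr minus_minus_cancel)
    also have "\<dots> \<in> F" using F h(1) by (simp add: submodule.smult_closed)
    finally show ?thesis using h hV x by (subst coset_eq_iff) auto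
  qed
  then have "(\<Union>z\<in>F +> x. F +> (c \<odot> z)) = F +> (c \<odot> x)"
    using F.a_rcos_self[OF x] by blast
  then show ?thesis by (simp add: quotient_space_def)
qed

lemma quotient_zero: "\<zero>\<^bsub>quotient_space V F\<^esub> = F +> \<zero>"
proof -
  have "F +> \<zero> = F" unfolding a_r_coset_def' using F.a_subset by (auto intro!: bexI simp: subset_iff)
  then show ?thesis by (simp add: quotient_space_def)
qed

lemma quotient_module: "real_module (quotient_space V F)"
  unfolding real_module_def
proof (rule moduleI)
  let ?Q = "quotient_space V F"
  have m: "F +> x \<in> carrier ?Q" if "x \<in> carrier V" for x using that by (auto simp: quotient_carrier)
  show "abelian_group ?Q"
  proof (rule abelian_groupI)
    fix a b c assume "a \<in> carrier ?Q" "b \<in> carrier ?Q" "c \<in> carrier ?Q"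
    then show "a \<oplus>\<^bsub>?Q\<^esub> b \<oplus>\<^bsub>?Q\<^esub> c = a \<oplus>\<^bsub>?Q\<^esub> (b \<oplus>\<^bsub>?Q\<^esub> c)"
      by (auto simp: quotient_carrier quotient_add M.a_assoc)
  next
    fix a assume "a \<in> carrier ?Q"
    then obtain x where x: "x \<in> carrier V" "a = F +> x" by (auto simp: quotient_carrier)
    then show "\<exists>y\<in>carrier ?Q. y \<oplus>\<^bsub>?Q\<^esub> a = \<zero>\<^bsub>?Q\<^esub>"
      by (intro bexI[of _ "F +> (\<ominus> x)"]) (auto simp: quotient_add quotient_zero m M.l_neg)
  qed (auto simp: quotient_carrier quotient_add quotient_zero M.a_comm intro!: image_eqI)
qed (auto simp: real_ring_cring quotient_carrier quotient_add quotient_smult smult_add smult_r_distr smult_mult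
    intro!: image_eqI)

lemma quotient_diff:
  assumes x: "x \<in> carrier V" and y: "y \<in> carrier V"
  shows "(F +> x) \<ominus>\<^bsub>quotient_space V F\<^esub> (F +> y) = F +> (x \<ominus> y)"
proof -
  interpret Q: real_module "quotient_space V F" by (rule quotient_module)
  have m: "F +> z \<in> carrier (quotient_space V F)" if "z \<in> carrier V" for z using that by (auto simp: quotient_carrier)
  have "\<ominus>\<^bsub>quotient_space V F\<^esub> (F +> y) = F +> (\<ominus> y)"
    by (rule Q.minus_equality) (use y in \<open>auto simp: m quotient_add quotient_zero M.l_neg\<close>)
  then show ?thesis using x y by (simp add: a_minus_def quotient_add)
qed

lemma quotient_nrm: "nrm (quotient_space V F) (F +> x) = (INF f\<in>F. nrm V (f \<oplus> x))"
proof -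
  have "nrm V ` (F +> x) = (\<lambda>f. nrm V (f \<oplus> x)) ` F" unfolding a_r_coset_def' by auto
  then show ?thesis by (simp add: quotient_space_def)
qed

lemma restrict_module: "real_module (restrict_space_to V F)"
  unfolding real_module_def
proof (rule moduleI)
  show "abelian_group (restrict_space_to V F)"
  proof (rule abelian_groupI)
    fix x assume x: "x \<in> carrier (restrict_space_to V F)"
    then have "\<ominus> x \<in> F" by (simp add: restrict_space_to_def)
    then show "\<exists>y\<in>carrier (restrict_space_to V F). y \<oplus>\<^bsub>restrict_space_to V F\<^esub> x = \<zero>\<^bsub>restrict_space_to V F\<^esub>"
      using x F.a_subset by (intro bexI[of _ "\<ominus> x"]) (auto simp: restrict_space_to_def M.l_neg)
  qed (use F.a_subset in \<open>auto simp: restrict_space_to_def subset_iff intro: M.a_assoc M.a_comm\<close>)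
qed (use F.a_subset in \<open>auto simp: restrict_space_to_def real_ring_cring subset_iff smult_add smult_r_distr smult_mult
      submodule.smult_closed[OF F]\<close>)

end

end

section \<open>Norm estimates, continuity and isometries\<close>

locale nspace =
  fixes V :: "'v normed_module" (structure)
  assumes normed_space: "normed_space V"

sublocale nspace \<subseteq> real_module
  using normed_space by (simp add: real_module_def normed_space_def)

context nspace
begin

lemma nrm_eq_0: "x \<in> carrier V \<Longrightarrow> nrm V x = 0 \<longleftrightarrow> x = \<zero>"
  and nrm_smult: "x \<in> carrier V \<Longrightarrow> nrm V (c \<odot> x) = \<bar>c\<bar> * nrm V x"
  and nrm_triangle: "x \<in> carrier V \<Longrightarrow> y \<in> carrier V \<Longrightarrow> nrm V (x \<oplus> y) \<le> nrm V x + nrm V y"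
  using normed_space by (auto simp: normed_space_def)

lemma nrm_zero [simp]: "nrm V \<zero> = 0"
  using nrm_eq_0[of \<zero>] by simp

lemma nrm_neg: "x \<in> carrier V \<Longrightarrow> nrm V (\<ominus> x) = nrm V x"
  using nrm_smult[of x "- 1"] by (simp add: smult_minus_one)

lemma nrm_nonneg: "x \<in> carrier V \<Longrightarrow> 0 \<le> nrm V x"
  using nrm_triangle[of x "\<ominus> x"] by (simp add: M.r_neg nrm_neg)

lemma nrm_minus_commute: "x \<in> carrier V \<Longrightarrow> y \<in> carrier V \<Longrightarrow> nrm V (x \<ominus> y) = nrm V (y \<ominus> x)"
  using nrm_neg[of "x \<ominus> y"] by (simp add: minus_minus_cancel)

lemma nrm_triangle_minus:
  "x \<in> carrier V \<Longrightarrow> y \<in> carrier V \<Longrightarrow> z \<in> carrier V \<Longrightarrow> nrm V (x \<ominus> z) \<le> nrm V (x \<ominus> y) + nrm V (y \<ominus> z)"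
  using nrm_triangle[of "x \<ominus> y" "y \<ominus> z"] by (simp add: minus_minus_cancel)

lemma nrm_diff_le: "x \<in> carrier V \<Longrightarrow> y \<in> carrier V \<Longrightarrow> nrm V (x \<ominus> y) \<le> nrm V x + nrm V y"
  using nrm_triangle[of x "\<ominus> y"] by (simp add: a_minus_def nrm_neg)

lemma nrm_le_diff: "x \<in> carrier V \<Longrightarrow> y \<in> carrier V \<Longrightarrow> nrm V x \<le> nrm V (x \<ominus> y) + nrm V y"
  using nrm_triangle[of "x \<ominus> y" y] by (simp add: minus_minus_cancel)

lemma metric: "Metric_space (carrier V) (ndist V)"
proof
  fix x y z assume "x \<in> carrier V" "y \<in> carrier V" "z \<in> carrier V"
  then show "ndist V x z \<le> ndist V x y + ndist V y z" by (simp add: ndist_def nrm_triangle_minus)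
next
  fix x y assume xy: "x \<in> carrier V" "y \<in> carrier V"
  have "x \<ominus> y = \<zero> \<longleftrightarrow> x = y"
  proof
    assume "x \<ominus> y = \<zero>"
    then have "(x \<ominus> y) \<oplus> y = \<zero> \<oplus> y" by simp
    then show "x = y" using xy by (simp add: minus_minus_cancel)
  qed (use xy in \<open>auto simp: minus_minus_cancel\<close>)
  then show "ndist V x y = 0 \<longleftrightarrow> x = y" using xy by (simp add: ndist_def nrm_eq_0)
qed (auto simp: ndist_def nrm_nonneg nrm_minus_commute)

lemma continuous_map_norm_topology:
  "continuous_map \<tau> (norm_topology V) f \<longleftrightarrow> (\<forall>g\<in>topspace \<tau>. f g \<in> carrier V) \<and>
     (\<forall>g\<in>topspace \<tau>. \<forall>\<epsilon>>0. \<exists>U. openin \<tau> U \<and> g \<in> U \<and> (\<forall>h\<in>U. nrm V (f h \<ominus> f g) < \<epsilon>))"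
  (is "?L \<longleftrightarrow> ?R")
proof -
  interpret D: Metric_space "carrier V" "ndist V" by (rule metric)
  have b: "(\<forall>h\<in>U. f h \<in> D.mball (f g) \<epsilon>) \<longleftrightarrow> (\<forall>h\<in>U. nrm V (f h \<ominus> f g) < \<epsilon>)"
    if "openin \<tau> U" "\<forall>g\<in>topspace \<tau>. f g \<in> carrier V" "g \<in> topspace \<tau>" for U g \<epsilon>
    using that openin_subset[OF that(1)] by (auto simp: D.in_mball ndist_def nrm_minus_commute subset_iff)
  have sub: "\<forall>g\<in>topspace \<tau>. f g \<in> carrier V" if ?L
    using that continuous_map_image_subset_topspace[of \<tau> "norm_topology V" f] by (auto simp: norm_topology_def)
  show ?thesis
  proof (cases "\<forall>g\<in>topspace \<tau>. f g \<in> carrier V")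
    case True
    then show ?thesis unfolding norm_topology_def D.continuous_map_to_metric using b[OF _ True] by (simp cong: conj_cong)
  next
    case False then show ?thesis using sub by blast
  qed
qed

lemma closedin_norm_topologyD:
  assumes Y: "closedin (norm_topology V) Y" and x: "x \<in> carrier V"
    and ap: "\<And>\<epsilon>. \<epsilon> > 0 \<Longrightarrow> \<exists>y\<in>Y. nrm V (x \<ominus> y) < \<epsilon>"
  shows "x \<in> Y"
proof (rule ccontr)
  interpret D: Metric_space "carrier V" "ndist V" by (rule metric)
  assume "x \<notin> Y"
  with Y x obtain r where r: "r > 0" "disjnt Y (D.mball x r)" and YV: "Y \<subseteq> carrier V"
    unfolding norm_topology_def D.closedin_metric by blast
  obtain y where "y \<in> Y" "nrm V (x \<ominus> y) < r" using ap[OF r(1)] by blast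
  then have "y \<in> D.mball x r" using x YV by (auto simp: D.in_mball ndist_def)
  with r(2) \<open>y \<in> Y\<close> show False by (auto simp: disjnt_def)
qed

end

lemma isometryD:
  assumes "T \<in> carrier (isometry_group V)"
  shows "x \<in> carrier V \<Longrightarrow> T x \<in> carrier V" "bij_betw T (carrier V) (carrier V)"
    "x \<in> carrier V \<Longrightarrow> y \<in> carrier V \<Longrightarrow> T (x \<oplus>\<^bsub>V\<^esub> y) = T x \<oplus>\<^bsub>V\<^esub> T y"
    "x \<in> carrier V \<Longrightarrow> T (c \<odot>\<^bsub>V\<^esub> x) = c \<odot>\<^bsub>V\<^esub> T x"
    "x \<in> carrier V \<Longrightarrow> nrm V (T x) = nrm V x"
  using assms by (auto simp: isometry_group_def Bij_def bij_betw_def)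

lemma (in nspace) isometry_diff:
  assumes T: "T \<in> carrier (isometry_group V)" and x: "x \<in> carrier V" and y: "y \<in> carrier V"
  shows "T (x \<ominus> y) = T x \<ominus> T y"
proof -
  have "\<ominus> y = (- 1) \<odot> y" "\<ominus> (T y) = (- 1) \<odot> T y" using y isometryD(1)[OF T y] by (simp_all add: smult_minus_one)
  then show ?thesis using isometryD(3,4)[OF T] x y by (simp add: a_minus_def)
qed

section \<open>The Hilbert space of an invariant kernel\<close>

text \<open>The Hilbert space of an invariant positive definite kernel is realised as the dual of the space of
  formal combinations of group elements (lists of coefficient--element pairs), with
  \<open>\<parallel>f\<parallel>\<^sup>2 = sup\<^sub>c (2 \<langle>f, c\<rangle> - q c)\<close>, where \<open>q\<close> is the quadratic form of the kernel. Completeness is then that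
  of a dual space, and completing the square shows that the combinations of kernel functions are dense.\<close>

locale invariant_kernel = group G for G :: "('g, 'm) monoid_scheme" (structure) +
  fixes k :: "'g \<Rightarrow> 'g \<Rightarrow> real"
  assumes kernel_sym: "a \<in> carrier G \<Longrightarrow> b \<in> carrier G \<Longrightarrow> k a b = k b a"
    and kernel_psd: "snd ` set c \<subseteq> carrier G \<Longrightarrow> (\<Sum>(x, a)\<leftarrow>c. \<Sum>(y, b)\<leftarrow>c. x * y * k a b) \<ge> 0"
    and kernel_inv: "h \<in> carrier G \<Longrightarrow> a \<in> carrier G \<Longrightarrow> b \<in> carrier G \<Longrightarrow> k (h \<otimes> a) (h \<otimes> b) = k a b"
begin

definition combs :: "(real \<times> 'g) list set" where
  "combs = {c. snd ` set c \<subseteq> carrier G}"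

definition pairing :: "('g \<Rightarrow> real) \<Rightarrow> (real \<times> 'g) list \<Rightarrow> real" where
  "pairing f c = (\<Sum>(x, a)\<leftarrow>c. x * f a)"

definition scale :: "real \<Rightarrow> (real \<times> 'g) list \<Rightarrow> (real \<times> 'g) list" where
  "scale t c = map (\<lambda>(x, a). (t * x, a)) c"

text \<open>The image of a combination in the Hilbert space. Its values off the group are fixed as
  0, since the norm sees only values on the group and must be definite.\<close>

definition kvec :: "(real \<times> 'g) list \<Rightarrow> 'g \<Rightarrow> real" where
  "kvec c = (\<lambda>a. if a \<in> carrier G then (\<Sum>(y, b)\<leftarrow>c. y * k b a) else 0)"

definition form :: "(real \<times> 'g) list \<Rightarrow> (real \<times> 'g) list \<Rightarrow> real" where
  "form c d = pairing (kvec c) d"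

definition translate :: "'g \<Rightarrow> (real \<times> 'g) list \<Rightarrow> (real \<times> 'g) list" where
  "translate g c = map (\<lambda>(x, a). (x, g \<otimes> a)) c"

text \<open>The squared distance of the kernel functions at a and b in the Hilbert space, see
  \<open>hnorm_vec_diff\<close>.\<close>

definition kdist :: "'g \<Rightarrow> 'g \<Rightarrow> real" where
  "kdist a b = k a a - 2 * k a b + k b b"

lemma combs_simps [simp]: "[] \<in> combs" "(x, a) # c \<in> combs \<longleftrightarrow> a \<in> carrier G \<and> c \<in> combs"
  "c @ d \<in> combs \<longleftrightarrow> c \<in> combs \<and> d \<in> combs"
  by (auto simp: combs_def)

lemma scale_combs [simp]: "scale t c \<in> combs \<longleftrightarrow> c \<in> combs"
  by (auto simp: combs_def scale_def image_image case_prod_beta)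

lemma translate_combs [simp]: "g \<in> carrier G \<Longrightarrow> c \<in> combs \<Longrightarrow> translate g c \<in> combs"
  by (auto simp: combs_def translate_def image_image case_prod_beta subset_iff)

lemma pairing_simps [simp]: "pairing f [] = 0" "pairing f ((x, a) # c) = x * f a + pairing f c"
  "pairing f (c @ d) = pairing f c + pairing f d"
  by (simp_all add: pairing_def)

lemma pairing_scale [simp]: "pairing f (scale t c) = t * pairing f c"
  by (induction c) (auto simp: scale_def algebra_simps)

lemma pairing_lin: "pairing (\<lambda>a. f a + g a) c = pairing f c + pairing g c"
  "pairing (\<lambda>a. f a - g a) c = pairing f c - pairing g c" "pairing (\<lambda>a. t * f a) c = t * pairing f c"
  "pairing (\<lambda>a. 0) c = 0"
  by (induction c) (auto simp: algebra_simps)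

lemma pairing_cong: "c \<in> combs \<Longrightarrow> (\<And>a. a \<in> carrier G \<Longrightarrow> f a = g a) \<Longrightarrow> pairing f c = pairing g c"
  by (induction c) auto

lemma kvec_simps: "kvec [] = (\<lambda>a. 0)" "kvec (c @ d) = (\<lambda>a. kvec c a + kvec d a)"
  "kvec (scale t c) = (\<lambda>a. t * kvec c a)"
  "a \<in> carrier G \<Longrightarrow> kvec ((x, b) # c) a = x * k b a + kvec c a"
proof -
  have "(\<Sum>(y, b)\<leftarrow>scale t c. y * k b a) = t * (\<Sum>(y, b)\<leftarrow>c. y * k b a)" for a
    by (induction c) (auto simp: scale_def algebra_simps)
  then show "kvec (scale t c) = (\<lambda>a. t * kvec c a)" unfolding kvec_def by auto
qed (auto simp: kvec_def)

lemma kvec_outside: "a \<notin> carrier G \<Longrightarrow> kvec c a = 0"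
  by (simp add: kvec_def)

lemma form_simps: "form (c @ c') d = form c d + form c' d" "form c (d @ d') = form c d + form c d'"
  "form (scale t c) d = t * form c d" "form c (scale t d) = t * form c d"
  by (simp_all add: form_def kvec_simps pairing_lin)

lemma pairing_kernel: "a \<in> carrier G \<Longrightarrow> c \<in> combs \<Longrightarrow> pairing (k a) c = kvec c a"
  by (induction c) (auto simp: kvec_simps kernel_sym)

lemma form_sym: "c \<in> combs \<Longrightarrow> d \<in> combs \<Longrightarrow> form c d = form d c"
proof (induction c)
  case Nil then show ?case by (simp add: form_def kvec_simps pairing_lin)
next
  case (Cons z c)
  obtain x a where z: "z = (x, a)" by (cases z)
  have "form (z # c) d = pairing (\<lambda>b. x * k a b + kvec c b) d"
    unfolding form_def z using Cons.prems by (intro pairing_cong) (auto simp: kvec_simps)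
  also have "\<dots> = x * kvec d a + form c d"
    using Cons.prems by (simp add: pairing_lin z pairing_kernel form_def)
  finally show ?case using Cons by (simp add: z form_def)
qed

lemma form_nonneg: "c \<in> combs \<Longrightarrow> form c c \<ge> 0"
proof -
  assume c: "c \<in> combs"
  have "(\<Sum>(x, a)\<leftarrow>d. \<Sum>(y, b)\<leftarrow>c. x * y * k a b) = (\<Sum>(x, a)\<leftarrow>d. x * kvec c a)" if "d \<in> combs" for d
    using that
  proof (induction d)
    case (Cons z d)
    obtain x a where z: "z = (x, a)" by (cases z)
    have "(\<Sum>(y, b)\<leftarrow>c. x * y * k a b) = x * pairing (k a) c"
      unfolding pairing_def by (induction c) (auto simp: algebra_simps)
    then show ?case using Cons c by (simp add: z pairing_kernel)
  qed simp
  from this[OF c] show ?thesis using kernel_psd[of c] c by (simp add: form_def pairing_def combs_def)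
qed

lemma form_translate:
  assumes "g \<in> carrier G" "c \<in> combs" "d \<in> combs"
  shows "form (translate g c) (translate g d) = form c d"
proof -
  have v: "kvec (translate g c) (g \<otimes> a) = kvec c a" if "a \<in> carrier G" for a
    using assms(2) by (induction c) (use assms(1) that in \<open>auto simp: kvec_def translate_def kernel_inv\<close>)
  have "pairing f (translate g d) = pairing (\<lambda>a. f (g \<otimes> a)) d" for f
    by (induction d) (auto simp: translate_def)
  then show ?thesis unfolding form_def using pairing_cong[OF assms(3), OF v] by simp
qed

text \<open>B bounds the squared dual norm. The quadratic form of the condition stays meaningful
  where the form of the kernel degenerates, and makes subtraction of a kernel function a mere shift
  of c.\<close>

definition bounds :: "('g \<Rightarrow> real) \<Rightarrow> real \<Rightarrow> bool" where
  "bounds f B \<longleftrightarrow> (\<forall>c\<in>combs. 2 * pairing f c - form c c \<le> B)"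

definition sqn :: "('g \<Rightarrow> real) \<Rightarrow> real" where
  "sqn f = (SUP c\<in>combs. 2 * pairing f c - form c c)"

text \<open>The reproducing kernel Hilbert space of \<open>k\<close>: functions that are bounded as
  functionals on combinations.\<close>

definition hset :: "('g \<Rightarrow> real) set" where
  "hset = {f. (\<forall>a. a \<notin> carrier G \<longrightarrow> f a = 0) \<and> (\<exists>B. bounds f B)}"

lemma hset_iff: "f \<in> hset \<longleftrightarrow> (\<forall>a. a \<notin> carrier G \<longrightarrow> f a = 0) \<and> (\<exists>B. bounds f B)"
  by (simp add: hset_def)

lemma bounds_sqn: "f \<in> hset \<Longrightarrow> bounds f (sqn f)"
  unfolding bounds_def sqn_def by (auto simp: hset_iff bounds_def intro!: cSUP_upper bdd_aboveI2)

lemma sqn_le: "bounds f B \<Longrightarrow> sqn f \<le> B"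
proof -
  assume b: "bounds f B"
  have "combs \<noteq> {}" using combs_simps(1) by blast
  then show "sqn f \<le> B" unfolding sqn_def using b by (intro cSUP_least) (auto simp: bounds_def)
qed

lemma bounds_nonneg: "bounds f B \<Longrightarrow> B \<ge> 0"
  unfolding bounds_def by (drule bspec[of _ _ "[]"]) (auto simp: form_def)

lemma sqn_nonneg: "f \<in> hset \<Longrightarrow> sqn f \<ge> 0"
  using bounds_sqn bounds_nonneg by blast

text \<open>Replacing c by t c and optimising over t turns the quadratic bound into the
  Cauchy-Schwarz inequality. The converse rests on 4 B q \<le> (B + q)^2.\<close>

lemma bounds_iff: "bounds f B \<longleftrightarrow> B \<ge> 0 \<and> (\<forall>c\<in>combs. (pairing f c)\<^sup>2 \<le> B * form c c)"
proof
  assume b: "bounds f B"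
  have B: "B \<ge> 0" using bounds_nonneg[OF b] .
  have "(pairing f c)\<^sup>2 \<le> B * form c c" if c: "c \<in> combs" for c
  proof -
    have t: "2 * t * pairing f c - t\<^sup>2 * form c c \<le> B" for t
      using bspec[OF b[unfolded bounds_def], of "scale t c"] c by (simp add: form_simps power2_eq_square mult.assoc)
    show ?thesis
    proof (cases "form c c = 0")
      case True
      have "pairing f c = 0"
      proof (rule ccontr)
        assume n: "pairing f c \<noteq> 0"
        \<comment> \<open>For this t the left side is 2 (B + 1), which exceeds B.\<close>
        show False using t[of "(B + 1) / pairing f c"] n B True by simp
      qed
      then show ?thesis using True by simp
    next
      case False
      then have q: "form c c > 0" using form_nonneg[OF c] by simp
      have "2 * (x / y) * x - (x / y)\<^sup>2 * y = x\<^sup>2 / y" if "y > 0" for x y :: real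
        using that by (simp add: power2_eq_square divide_simps)
      from this[OF q] have "(pairing f c)\<^sup>2 / form c c \<le> B" using t[of "pairing f c / form c c"] by simp
      then show ?thesis using q by (simp add: pos_divide_le_eq)
    qed
  qed
  then show "B \<ge> 0 \<and> (\<forall>c\<in>combs. (pairing f c)\<^sup>2 \<le> B * form c c)" using B by blast
next
  assume h: "B \<ge> 0 \<and> (\<forall>c\<in>combs. (pairing f c)\<^sup>2 \<le> B * form c c)"
  show "bounds f B" unfolding bounds_def
  proof
    fix c assume c: "c \<in> combs"
    have q: "form c c \<ge> 0" by (rule form_nonneg[OF c])
    have "(2 * pairing f c)\<^sup>2 \<le> 4 * (B * form c c)" using h c by (simp add: power_mult_distrib)
    also have "\<dots> \<le> (B + form c c)\<^sup>2"
      using zero_le_power2[of "B - form c c"] by (simp add: power2_eq_square algebra_simps)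
    finally have "2 * pairing f c \<le> B + form c c" by (rule power2_le_imp_le) (use h q in auto)
    then show "2 * pairing f c - form c c \<le> B" by simp
  qed
qed

definition hnorm :: "('g \<Rightarrow> real) \<Rightarrow> real" where
  "hnorm f = sqrt (sqn f)"

lemma hnorm_power2: "f \<in> hset \<Longrightarrow> (hnorm f)\<^sup>2 = sqn f"
  by (simp add: hnorm_def sqn_nonneg)

lemma hnorm_nonneg: "f \<in> hset \<Longrightarrow> hnorm f \<ge> 0"
  by (simp add: hnorm_def sqn_nonneg)

lemma hnorm_le: "bounds f (B\<^sup>2) \<Longrightarrow> B \<ge> 0 \<Longrightarrow> hnorm f \<le> B"
  unfolding hnorm_def using sqn_le by (simp add: real_le_lsqrt)

lemma abs_pair_le: "f \<in> hset \<Longrightarrow> c \<in> combs \<Longrightarrow> \<bar>pairing f c\<bar> \<le> hnorm f * sqrt (form c c)"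
proof -
  assume f: "f \<in> hset" and c: "c \<in> combs"
  have "(pairing f c)\<^sup>2 \<le> sqn f * form c c" using bounds_sqn[OF f] c by (simp add: bounds_iff)
  then have "sqrt ((pairing f c)\<^sup>2) \<le> sqrt (sqn f * form c c)" by (rule real_sqrt_le_mono)
  then show ?thesis by (simp add: hnorm_def real_sqrt_mult)
qed

lemma bounds_squareI:
  assumes "\<And>c. c \<in> combs \<Longrightarrow> \<bar>pairing f c\<bar> \<le> B * sqrt (form c c)"
  shows "bounds f (B\<^sup>2)"
  unfolding bounds_iff
proof (intro conjI ballI)
  fix c assume c: "c \<in> combs"
  have "\<bar>pairing f c\<bar>\<^sup>2 \<le> (B * sqrt (form c c))\<^sup>2" using assms[OF c] by (rule power_mono) simp
  then show "(pairing f c)\<^sup>2 \<le> B\<^sup>2 * form c c" using form_nonneg[OF c] by (simp add: power_mult_distrib)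
qed simp

lemma hset_add:
  assumes f: "f \<in> hset" and g: "g \<in> hset"
  shows "(\<lambda>a. f a + g a) \<in> hset" "hnorm (\<lambda>a. f a + g a) \<le> hnorm f + hnorm g"
proof -
  have b: "bounds (\<lambda>a. f a + g a) ((hnorm f + hnorm g)\<^sup>2)"
  proof (rule bounds_squareI)
    fix c assume c: "c \<in> combs"
    show "\<bar>pairing (\<lambda>a. f a + g a) c\<bar> \<le> (hnorm f + hnorm g) * sqrt (form c c)"
      using abs_pair_le[OF f c] abs_pair_le[OF g c] by (simp add: pairing_lin algebra_simps)
  qed
  then show "(\<lambda>a. f a + g a) \<in> hset" using f g by (auto simp: hset_iff)
  show "hnorm (\<lambda>a. f a + g a) \<le> hnorm f + hnorm g"
    by (rule hnorm_le[OF b]) (simp add: hnorm_nonneg f g)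
qed

lemma bounds_cmult: "bounds f B \<Longrightarrow> bounds (\<lambda>a. t * f a) (t\<^sup>2 * B)"
  unfolding bounds_iff by (auto simp: pairing_lin power_mult_distrib mult.assoc intro!: mult_left_mono)

lemma hset_cmult: "f \<in> hset \<Longrightarrow> (\<lambda>a. t * f a) \<in> hset"
  using bounds_cmult by (auto simp: hset_iff)

lemma sqn_cmult: assumes f: "f \<in> hset" shows "sqn (\<lambda>a. t * f a) = t\<^sup>2 * sqn f"
proof (rule antisym)
  show 1: "sqn (\<lambda>a. t * f a) \<le> t\<^sup>2 * sqn f" by (intro sqn_le bounds_cmult bounds_sqn f)
  show "t\<^sup>2 * sqn f \<le> sqn (\<lambda>a. t * f a)"
  proof (cases "t = 0")
    case True then show ?thesis using sqn_nonneg[OF hset_cmult[OF f, of t]] by simp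
  next
    case False
    have "sqn (\<lambda>a. (1 / t) * (t * f a)) \<le> (1 / t)\<^sup>2 * sqn (\<lambda>a. t * f a)"
      by (intro sqn_le bounds_cmult bounds_sqn hset_cmult f)
    then show ?thesis using False by (simp add: power_divide field_simps)
  qed
qed

lemma hnorm_cmult: "f \<in> hset \<Longrightarrow> hnorm (\<lambda>a. t * f a) = \<bar>t\<bar> * hnorm f"
  by (simp add: hnorm_def sqn_cmult real_sqrt_mult)

lemma hset_zero: "(\<lambda>a. 0) \<in> hset" and hnorm_zero: "hnorm (\<lambda>a. 0) = 0"
proof -
  have b: "bounds (\<lambda>a. 0) 0" unfolding bounds_iff by (simp add: pairing_lin)
  then show "(\<lambda>a. 0) \<in> hset" by (auto simp: hset_iff)
  then have "sqn (\<lambda>a. 0) = 0" using sqn_le[OF b] sqn_nonneg by fastforce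
  then show "hnorm (\<lambda>a. 0) = 0" by (simp add: hnorm_def)
qed

lemma hset_diff: "f \<in> hset \<Longrightarrow> g \<in> hset \<Longrightarrow> (\<lambda>a. f a - g a) \<in> hset"
  using hset_add[OF _ hset_cmult[of g "- 1"], of f] by simp

lemma hnorm_diff_commute: "f \<in> hset \<Longrightarrow> g \<in> hset \<Longrightarrow> hnorm (\<lambda>a. f a - g a) = hnorm (\<lambda>a. g a - f a)"
  using hnorm_cmult[OF hset_diff, of g f "- 1"] by simp

text \<open>Substitute d + c for d in the supremum: 2 <f - k_c, d> - q(d) equals 2 <f, d + c> - q(d
  + c) plus the constant q(c) - 2 <f, c>.\<close>

lemma complete_square:
  assumes f: "f \<in> hset" and c: "c \<in> combs"
  shows "(\<lambda>a. f a - kvec c a) \<in> hset" "sqn (\<lambda>a. f a - kvec c a) = sqn f - 2 * pairing f c + form c c"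
proof -
  have id1: "2 * pairing (\<lambda>a. f a - kvec c a) d - form d d
      = (2 * pairing f (d @ c) - form (d @ c) (d @ c)) - 2 * pairing f c + form c c" if "d \<in> combs" for d
    using form_sym[OF c that] unfolding form_simps pairing_lin form_def[symmetric] pairing_simps by simp
  have "bounds (\<lambda>a. f a - kvec c a) (sqn f - 2 * pairing f c + form c c)"
    unfolding bounds_def
  proof
    fix d assume d: "d \<in> combs"
    have "2 * pairing f (d @ c) - form (d @ c) (d @ c) \<le> sqn f"
      using bounds_sqn[OF f] c d unfolding bounds_def by (drule_tac bspec[of _ _ "d @ c"]) auto
    then show "2 * pairing (\<lambda>a. f a - kvec c a) d - form d d \<le> sqn f - 2 * pairing f c + form c c"
      unfolding id1[OF d] by simp
  qed
  note b = this
  show h: "(\<lambda>a. f a - kvec c a) \<in> hset" using b f by (auto simp: hset_iff kvec_def)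
  show "sqn (\<lambda>a. f a - kvec c a) = sqn f - 2 * pairing f c + form c c"
  proof (rule antisym)
    show "sqn (\<lambda>a. f a - kvec c a) \<le> sqn f - 2 * pairing f c + form c c" by (rule sqn_le[OF b])
    have "bounds f (sqn (\<lambda>a. f a - kvec c a) + 2 * pairing f c - form c c)"
      unfolding bounds_def
    proof
      fix d assume d: "d \<in> combs"
      \<comment> \<open>This combination represents d - c: concatenation is addition.\<close>
      let ?e = "d @ scale (- 1) c"
      have e: "?e \<in> combs" using c d by simp
      have "2 * pairing (\<lambda>a. f a - kvec c a) ?e - form ?e ?e \<le> sqn (\<lambda>a. f a - kvec c a)"
        using bounds_sqn[OF h] e unfolding bounds_def by blast
      moreover have "2 * pairing (\<lambda>a. f a - kvec c a) ?e - form ?e ?e = 2 * pairing f d - form d d - 2 * pairing f c + form c c"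
        using form_sym[OF c d] unfolding form_simps pairing_lin form_def[symmetric] pairing_simps pairing_scale by simp
      ultimately show "2 * pairing f d - form d d \<le> sqn (\<lambda>a. f a - kvec c a) + 2 * pairing f c - form c c" by simp
    qed
    from sqn_le[OF this] show "sqn f - 2 * pairing f c + form c c \<le> sqn (\<lambda>a. f a - kvec c a)" by simp
  qed
qed

lemma kvec_hset: assumes c: "c \<in> combs" shows "kvec c \<in> hset"
  using hset_cmult[OF complete_square(1)[OF hset_zero c], of "- 1"] by simp

lemma sqn_kvec: assumes c: "c \<in> combs" shows "sqn (kvec c) = form c c"
proof -
  have "sqn (\<lambda>a. (- 1) * (0 - kvec c a)) = (- 1)\<^sup>2 * sqn (\<lambda>a. 0 - kvec c a)"
    by (rule sqn_cmult[OF complete_square(1)[OF hset_zero c]])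
  moreover have "sqn (\<lambda>a. 0) = 0" using hnorm_zero by (simp add: hnorm_def)
  ultimately show ?thesis using complete_square(2)[OF hset_zero c] by (simp add: pairing_lin)
qed

text \<open>By \<open>complete_square\<close> the squared distance of f from \<open>kvec c\<close>
  is the amount by which c fails to attain the supremum \<open>sqn f\<close>.\<close>

lemma kvec_dense:
  assumes f: "f \<in> hset" and e: "\<epsilon> > 0"
  obtains c where "c \<in> combs" "hnorm (\<lambda>a. f a - kvec c a) < \<epsilon>"
proof -
  have ne: "combs \<noteq> {}" using combs_simps(1) by blast
  have bdd: "bdd_above ((\<lambda>c. 2 * pairing f c - form c c) ` combs)"
    using bounds_sqn[OF f] unfolding bounds_def by (auto intro: bdd_aboveI2)
  have "sqn f - \<epsilon>\<^sup>2 < (SUP c\<in>combs. 2 * pairing f c - form c c)" unfolding sqn_def using e by simp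
  then obtain c where c: "c \<in> combs" "sqn f - \<epsilon>\<^sup>2 < 2 * pairing f c - form c c"
    unfolding less_cSUP_iff[OF ne bdd] by blast
  have "sqn (\<lambda>a. f a - kvec c a) < \<epsilon>\<^sup>2" using c(2) complete_square(2)[OF f c(1)] by simp
  then have "hnorm (\<lambda>a. f a - kvec c a) < \<epsilon>"
    unfolding hnorm_def using e real_sqrt_less_mono by fastforce
  then show ?thesis using that c by blast
qed

lemma hnorm_eq_0: assumes f: "f \<in> hset" shows "hnorm f = 0 \<longleftrightarrow> f = (\<lambda>a. 0)"
proof
  assume z: "hnorm f = 0"
  show "f = (\<lambda>a. 0)"
  proof
    fix a show "f a = 0"
      using f abs_pair_le[OF f, of "[(1, a)]"] z by (cases "a \<in> carrier G") (auto simp: hset_iff)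
  qed
qed (simp add: hnorm_zero)

section \<open>The inner product by polarisation, and completeness\<close>

definition hip :: "('g \<Rightarrow> real) \<Rightarrow> ('g \<Rightarrow> real) \<Rightarrow> real" where
  "hip f g = (sqn (\<lambda>a. f a + g a) - sqn (\<lambda>a. f a - g a)) / 4"

lemma hip_vec: assumes f: "f \<in> hset" and c: "c \<in> combs" shows "hip f (kvec c) = pairing f c"
  using complete_square(2)[OF f c] complete_square(2)[OF f, of "scale (- 1) c"] c
  unfolding hip_def by (simp add: kvec_simps form_simps)

text \<open>Against kernel functions \<open>hip\<close> is the pairing, which is linear in f. Their
  density transfers linearity to all arguments, in place of a proof of the parallelogram
  law.\<close>

lemma hip_approx:
  assumes f: "f \<in> hset" and g: "g \<in> hset" and c: "c \<in> combs" and le: "hnorm (\<lambda>a. g a - kvec c a) \<le> \<eta>" and e: "\<eta> \<le> 1"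
  shows "\<bar>hip f g - pairing f c\<bar> \<le> \<eta> * (hnorm f + hnorm g + 1)"
proof -
  note v = kvec_hset[OF c]
  have e0: "\<eta> \<ge> 0" using le hnorm_nonneg[OF hset_diff[OF g v]] by simp
  have vg: "hnorm (kvec c) \<le> hnorm g + \<eta>"
    using hset_add(2)[OF g hset_diff[OF v g]] hnorm_diff_commute[OF g v] le by simp
  \<comment> \<open>A difference of squares of norms; \<eta> \<le> 1 is what bounds the sum of the
    two norms by 2 ||f|| + 2 ||g|| + 1.\<close>
  have sq: "\<bar>sqn u - sqn w\<bar> \<le> \<eta> * (2 * hnorm f + 2 * hnorm g + 1)"
    if u: "u \<in> hset" and w: "w \<in> hset" and d: "hnorm (\<lambda>a. u a - w a) \<le> \<eta>"
      and bu: "hnorm u \<le> hnorm f + hnorm g" and bw: "hnorm w \<le> hnorm f + hnorm (kvec c)" for u w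
  proof -
    have "hnorm u \<le> hnorm (\<lambda>a. u a - w a) + hnorm w" using hset_add(2)[OF hset_diff[OF u w] w] by simp
    moreover have "hnorm w \<le> hnorm (\<lambda>a. u a - w a) + hnorm u"
      using hset_add(2)[OF hset_diff[OF w u] u] hnorm_diff_commute[OF u w] by simp
    ultimately have 1: "\<bar>hnorm u - hnorm w\<bar> \<le> \<eta>" using d by linarith
    have "sqn u - sqn w = (hnorm u - hnorm w) * (hnorm u + hnorm w)"
      using hnorm_power2[OF u] hnorm_power2[OF w] by (simp add: power2_eq_square algebra_simps)
    then have "\<bar>sqn u - sqn w\<bar> = \<bar>hnorm u - hnorm w\<bar> * (hnorm u + hnorm w)"
      using hnorm_nonneg[OF u] hnorm_nonneg[OF w] by (simp add: abs_mult)
    also have "\<dots> \<le> \<eta> * (2 * hnorm f + 2 * hnorm g + 1)"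
      using 1 bu bw vg e e0 hnorm_nonneg[OF u] hnorm_nonneg[OF w] by (intro mult_mono) auto
    finally show ?thesis .
  qed
  have 1: "\<bar>sqn (\<lambda>a. f a + g a) - sqn (\<lambda>a. f a + kvec c a)\<bar> \<le> \<eta> * (2 * hnorm f + 2 * hnorm g + 1)"
    using le by (intro sq hset_add f g v) simp_all
  have 2: "\<bar>sqn (\<lambda>a. f a - g a) - sqn (\<lambda>a. f a - kvec c a)\<bar> \<le> \<eta> * (2 * hnorm f + 2 * hnorm g + 1)"
  proof (intro sq hset_diff f g v)
    have m: "hnorm (\<lambda>a. f a - u a) \<le> hnorm f + hnorm u" if "u \<in> hset" for u
      using hset_add(2)[OF f hset_cmult[OF that, of "- 1"]] hnorm_cmult[OF that, of "- 1"] by simp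
    show "hnorm (\<lambda>a. f a - g a) \<le> hnorm f + hnorm g" "hnorm (\<lambda>a. f a - kvec c a) \<le> hnorm f + hnorm (kvec c)"
      using m g v by auto
    show "hnorm (\<lambda>a. f a - g a - (f a - kvec c a)) \<le> \<eta>"
      using le hnorm_diff_commute[OF g v] by simp
  qed
  have id: "hip f g - pairing f c = ((sqn (\<lambda>a. f a + g a) - sqn (\<lambda>a. f a + kvec c a)) - (sqn (\<lambda>a. f a - g a) - sqn (\<lambda>a. f a - kvec c a))) / 4"
    unfolding hip_vec[OF f c, symmetric] unfolding hip_def by (simp add: field_simps)
  have "\<bar>hip f g - pairing f c\<bar> \<le> (\<eta> * (2 * hnorm f + 2 * hnorm g + 1) + \<eta> * (2 * hnorm f + 2 * hnorm g + 1)) / 4"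
    using 1 2 unfolding id by (simp add: abs_le_iff)
  also have "\<dots> \<le> \<eta> * (hnorm f + hnorm g + 1)"
    using e0 by (simp add: field_simps)
  finally show ?thesis .
qed

lemma hip_add:
  assumes f: "f \<in> hset" and f': "f' \<in> hset" and g: "g \<in> hset"
  shows "hip (\<lambda>a. f a + f' a) g = hip f g + hip f' g"
proof -
  \<comment> \<open>The sum of the three constants of \<open>hip_approx\<close>, so that the total
    error is \<eta> C.\<close>
  define C where "C = (hnorm (\<lambda>a. f a + f' a) + hnorm g + 1) + (hnorm f + hnorm g + 1) + (hnorm f' + hnorm g + 1)"
  have C: "C > 0" unfolding C_def using hnorm_nonneg f f' g hset_add(1)[OF f f']
    by (smt (verit) hnorm_nonneg)
  have "\<bar>hip (\<lambda>a. f a + f' a) g - (hip f g + hip f' g)\<bar> \<le> 0 + e" if e: "e > 0" for e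
  proof -
    define \<eta> where "\<eta> = min 1 (e / C)"
    have eta: "\<eta> > 0" "\<eta> \<le> 1" "\<eta> * C \<le> e" unfolding \<eta>_def using e C by (auto simp: min_def field_simps)
    obtain c where c: "c \<in> combs" "hnorm (\<lambda>a. g a - kvec c a) < \<eta>" using kvec_dense[OF g eta(1)] by blast
    note ap = hip_approx[OF _ g c(1) less_imp_le[OF c(2)] eta(2)]
    have "\<bar>hip (\<lambda>a. f a + f' a) g - (hip f g + hip f' g)\<bar> \<le> \<eta> * C"
      using ap[OF f] ap[OF f'] ap[OF hset_add(1)[OF f f']] unfolding C_def by (simp add: pairing_lin algebra_simps abs_le_iff)
    then show ?thesis using eta(3) by simp
  qed
  then have "\<bar>hip (\<lambda>a. f a + f' a) g - (hip f g + hip f' g)\<bar> \<le> 0" by (rule field_le_epsilon)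
  then show ?thesis by simp
qed

lemma hip_cmult:
  assumes f: "f \<in> hset" and g: "g \<in> hset"
  shows "hip (\<lambda>a. t * f a) g = t * hip f g"
proof -
  define C where "C = (hnorm (\<lambda>a. t * f a) + hnorm g + 1) + \<bar>t\<bar> * (hnorm f + hnorm g + 1)"
  have C: "C > 0" unfolding C_def using hnorm_nonneg[OF f] hnorm_nonneg[OF g] hnorm_nonneg[OF hset_cmult[OF f, of t]]
    by (simp add: add_pos_nonneg)
  have "\<bar>hip (\<lambda>a. t * f a) g - t * hip f g\<bar> \<le> 0 + e" if e: "e > 0" for e
  proof -
    define \<eta> where "\<eta> = min 1 (e / C)"
    have eta: "\<eta> > 0" "\<eta> \<le> 1" "\<eta> * C \<le> e" unfolding \<eta>_def using e C by (auto simp: min_def field_simps)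
    obtain c where c: "c \<in> combs" "hnorm (\<lambda>a. g a - kvec c a) < \<eta>" using kvec_dense[OF g eta(1)] by blast
    note ap = hip_approx[OF _ g c(1) less_imp_le[OF c(2)] eta(2)]
    have "\<bar>t * hip f g - t * pairing f c\<bar> \<le> \<bar>t\<bar> * (\<eta> * (hnorm f + hnorm g + 1))"
      unfolding right_diff_distrib[symmetric] abs_mult by (intro mult_left_mono ap f) simp
    moreover have "\<bar>hip (\<lambda>a. t * f a) g - t * pairing f c\<bar> \<le> \<eta> * (hnorm (\<lambda>a. t * f a) + hnorm g + 1)"
      using ap[OF hset_cmult[OF f, of t]] by (simp add: pairing_lin)
    ultimately have "\<bar>hip (\<lambda>a. t * f a) g - t * hip f g\<bar> \<le> \<eta> * (hnorm (\<lambda>a. t * f a) + hnorm g + 1) + \<bar>t\<bar> * (\<eta> * (hnorm f + hnorm g + 1))"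
      by linarith
    also have "\<dots> = \<eta> * C" unfolding C_def by (simp add: algebra_simps)
    finally show ?thesis using eta(3) by simp
  qed
  then have "\<bar>hip (\<lambda>a. t * f a) g - t * hip f g\<bar> \<le> 0" by (rule field_le_epsilon)
  then show ?thesis by simp
qed

definition gns :: "('g \<Rightarrow> real) normed_module" where
  "gns = \<lparr>carrier = hset, monoid.mult = undefined, monoid.one = undefined, ring.zero = (\<lambda>a. 0),
     ring.add = (\<lambda>f g a. f a + g a), Module.module.smult = (\<lambda>t f a. t * f a), nrm = hnorm\<rparr>"

lemma gns_simps [simp]: "carrier gns = hset" "\<zero>\<^bsub>gns\<^esub> = (\<lambda>a. 0)" "f \<oplus>\<^bsub>gns\<^esub> g = (\<lambda>a. f a + g a)"
  "t \<odot>\<^bsub>gns\<^esub> f = (\<lambda>a. t * f a)" "nrm gns = hnorm"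
  by (simp_all add: gns_def)

lemma nspace_gns: "nspace gns"
proof
  have "Module.module real_ring gns"
  proof (rule moduleI)
    show "abelian_group gns"
    proof (rule abelian_groupI)
      fix f assume f: "f \<in> carrier gns"
      then show "\<exists>y\<in>carrier gns. y \<oplus>\<^bsub>gns\<^esub> f = \<zero>\<^bsub>gns\<^esub>"
        using hset_cmult[of f "- 1"] by (intro bexI[of _ "\<lambda>a. - f a"]) auto
    qed (auto simp: hset_add hset_zero add_ac)
  qed (auto simp: real_ring_cring hset_cmult algebra_simps)
  then show "normed_space gns"
    unfolding normed_space_def by (auto simp: hnorm_eq_0 hnorm_cmult hset_add)
qed

lemma gns_diff: assumes "f \<in> hset" "g \<in> hset" shows "f \<ominus>\<^bsub>gns\<^esub> g = (\<lambda>a. f a - g a)"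
proof -
  interpret H: nspace gns by (rule nspace_gns)
  have "\<ominus>\<^bsub>gns\<^esub> g = (- 1) \<odot>\<^bsub>gns\<^esub> g" using assms by (simp add: H.smult_minus_one del: gns_simps(4))
  then show ?thesis by (simp add: a_minus_def)
qed

text \<open>Evaluation at a group element is bounded, so a Cauchy sequence converges pointwise and
  hence under every pairing. The Cauchy estimates are bounds on pairings and pass to the
  limit.\<close>

lemma gns_hilbert: "real_hilbert_space gns"
proof -
  interpret H: nspace gns by (rule nspace_gns)
  interpret D: Metric_space "carrier gns" "ndist gns" by (rule H.metric)
  have nd: "ndist gns f g = hnorm (\<lambda>a. f a - g a)" if "f \<in> hset" "g \<in> hset" for f g
    using that by (simp add: ndist_def gns_diff)
  have "D.mcomplete" unfolding D.mcomplete_def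
  proof (intro allI impI)
    fix \<sigma> assume "D.MCauchy \<sigma>"
    then have s: "\<sigma> n \<in> hset" and cau: "\<And>\<epsilon>. \<epsilon> > 0 \<Longrightarrow> \<exists>N. \<forall>n n'. N \<le> n \<longrightarrow> N \<le> n' \<longrightarrow> hnorm (\<lambda>a. \<sigma> n a - \<sigma> n' a) < \<epsilon>" for n
      unfolding D.MCauchy_def by (auto simp: image_subset_iff nd)
    have conv: "convergent (\<lambda>n. \<sigma> n a)" for a
    proof (cases "a \<in> carrier G")
      case False then show ?thesis using s by (simp add: hset_iff convergent_const)
    next
      case True
      define K where "K = sqrt (form [(1, a)] [(1, a)])"
      have K: "K \<ge> 0" unfolding K_def by (intro real_sqrt_ge_zero form_nonneg) (simp add: True)
      have "Cauchy (\<lambda>n. \<sigma> n a)"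
      proof (rule metric_CauchyI)
        fix e :: real assume e: "e > 0"
        obtain N where N: "\<And>n n'. N \<le> n \<Longrightarrow> N \<le> n' \<Longrightarrow> hnorm (\<lambda>a. \<sigma> n a - \<sigma> n' a) < e / (K + 1)"
          using cau[of "e / (K + 1)"] e K by auto
        have "dist (\<sigma> n a) (\<sigma> n' a) < e" if nn: "n \<ge> N" "n' \<ge> N" for n n'
        proof -
          have "\<bar>\<sigma> n a - \<sigma> n' a\<bar> \<le> hnorm (\<lambda>a. \<sigma> n a - \<sigma> n' a) * K"
            using abs_pair_le[OF hset_diff[OF s[of n] s[of n']], of "[(1, a)]"] True unfolding K_def by simp
          also have "\<dots> \<le> e / (K + 1) * K" using N[OF nn] K by (intro mult_right_mono) auto
          also have "\<dots> < e" using e K by (simp add: field_simps)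
          finally show ?thesis by (simp add: dist_real_def)
        qed
        then show "\<exists>M. \<forall>m\<ge>M. \<forall>n\<ge>M. dist (\<sigma> m a) (\<sigma> n a) < e" by blast
      qed
      then show ?thesis by (simp add: Cauchy_convergent_iff)
    qed
    define f where "f = (\<lambda>a. lim (\<lambda>n. \<sigma> n a))"
    have lim: "(\<lambda>n. \<sigma> n a) \<longlonglongrightarrow> f a" for a using conv unfolding f_def by (simp add: convergent_LIMSEQ_iff)
    have pl: "(\<lambda>n. pairing (\<sigma> n) c) \<longlonglongrightarrow> pairing f c" for c
      by (induction c) (auto intro!: tendsto_intros lim)
    have f0: "f a = 0" if "a \<notin> carrier G" for a unfolding f_def using s that by (simp add: hset_iff)
    have bd: "bounds (\<lambda>a. \<sigma> n a - f a) (\<epsilon>\<^sup>2)" if N: "\<And>n'. n' \<ge> N \<Longrightarrow> hnorm (\<lambda>a. \<sigma> n a - \<sigma> n' a) < \<epsilon>" for n N \<epsilon>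
    proof (rule bounds_squareI)
      fix c assume c: "c \<in> combs"
      have "(\<lambda>m. \<bar>pairing (\<sigma> n) c - pairing (\<sigma> m) c\<bar>) \<longlonglongrightarrow> \<bar>pairing (\<sigma> n) c - pairing f c\<bar>"
        by (intro tendsto_intros pl)
      moreover have "\<bar>pairing (\<sigma> n) c - pairing (\<sigma> m) c\<bar> \<le> \<epsilon> * sqrt (form c c)" if "m \<ge> N" for m
      proof -
        have "\<bar>pairing (\<sigma> n) c - pairing (\<sigma> m) c\<bar> \<le> hnorm (\<lambda>a. \<sigma> n a - \<sigma> m a) * sqrt (form c c)"
          using abs_pair_le[OF hset_diff[OF s[of n] s[of m]] c] by (simp add: pairing_lin)
        also have "\<dots> \<le> \<epsilon> * sqrt (form c c)" using N[OF that] form_nonneg[OF c] by (intro mult_right_mono) auto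
        finally show ?thesis .
      qed
      ultimately have "\<bar>pairing (\<sigma> n) c - pairing f c\<bar> \<le> \<epsilon> * sqrt (form c c)"
        by (intro LIMSEQ_le_const2) auto
      then show "\<bar>pairing (\<lambda>a. \<sigma> n a - f a) c\<bar> \<le> \<epsilon> * sqrt (form c c)" by (simp add: pairing_lin)
    qed
    have mem: "(\<lambda>a. \<sigma> n a - f a) \<in> hset" if "bounds (\<lambda>a. \<sigma> n a - f a) B" for n B
      using that s[of n] f0 by (auto simp: hset_iff)
    obtain N1 where N1: "\<And>n n'. N1 \<le> n \<Longrightarrow> N1 \<le> n' \<Longrightarrow> hnorm (\<lambda>a. \<sigma> n a - \<sigma> n' a) < 1" using cau[of 1] by auto
    have "(\<lambda>a. \<sigma> N1 a - f a) \<in> hset" by (rule mem[OF bd[of N1]]) (rule N1, auto)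
    from hset_diff[OF s[of N1] this] have fH: "f \<in> hset" by simp
    have "limitin D.mtopology \<sigma> f sequentially"
      unfolding D.limit_metric_sequentially
    proof (intro conjI allI impI)
      fix \<epsilon> :: real assume e: "\<epsilon> > 0"
      obtain N where N: "\<And>n n'. N \<le> n \<Longrightarrow> N \<le> n' \<Longrightarrow> hnorm (\<lambda>a. \<sigma> n a - \<sigma> n' a) < \<epsilon> / 2" using cau[of "\<epsilon> / 2"] e by auto
      have "hnorm (\<lambda>a. \<sigma> n a - f a) \<le> \<epsilon> / 2" if n: "n \<ge> N" for n
        by (rule hnorm_le[OF bd[of N]]) (use N[OF n] e in auto)
      then show "\<exists>N. \<forall>n\<ge>N. \<sigma> n \<in> carrier gns \<and> ndist gns (\<sigma> n) f < \<epsilon>"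
        using s fH nd e by (intro exI[of _ N]) fastforce
    qed (simp add: fH)
    then show "\<exists>f. limitin D.mtopology \<sigma> f sequentially" by blast
  qed
  then have ban: "banach_space gns" using H.normed_space by (simp add: banach_space_def)
  have sym: "hip f g = hip g f" if "f \<in> hset" "g \<in> hset" for f g
  proof -
    have "sqn (\<lambda>a. f a - g a) = sqn (\<lambda>a. g a - f a)"
      using sqn_cmult[OF hset_diff, of g f "- 1"] that by simp
    then show ?thesis unfolding hip_def by (simp add: add.commute)
  qed
  have self: "hip f f = (hnorm f)\<^sup>2" if "f \<in> hset" for f
  proof -
    have "sqn (\<lambda>a. f a + f a) = 4 * sqn f" using sqn_cmult[OF that, of 2] by simp
    moreover have "sqn (\<lambda>a. 0) = 0" using hnorm_zero by (simp add: hnorm_def)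
    ultimately show ?thesis using hnorm_power2[OF that] unfolding hip_def by simp
  qed
  show ?thesis unfolding real_hilbert_space_def
    using ban sym self hip_add hip_cmult by (intro conjI exI[of _ hip]) auto
qed

end

section \<open>The translation representation\<close>

context invariant_kernel
begin

text \<open>Left translation, restricted to \<open>hset\<close> because members of the isometry
  group are extensional, and cut off outside the group in order to stay in
  \<open>hset\<close>.\<close>

definition hrep :: "'g \<Rightarrow> ('g \<Rightarrow> real) \<Rightarrow> 'g \<Rightarrow> real" where
  "hrep g = (\<lambda>f\<in>hset. \<lambda>a. if a \<in> carrier G then f (inv g \<otimes> a) else 0)"

lemma hrep_apply: "f \<in> hset \<Longrightarrow> a \<in> carrier G \<Longrightarrow> hrep g f a = f (inv g \<otimes> a)"
  "f \<in> hset \<Longrightarrow> a \<notin> carrier G \<Longrightarrow> hrep g f a = 0"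
  by (simp_all add: hrep_def)

lemma bounds_hrep:
  assumes g: "g \<in> carrier G" and f: "f \<in> hset" and b: "bounds f B"
  shows "bounds (hrep g f) B"
  unfolding bounds_def
proof
  fix c assume c: "c \<in> combs"
  have "pairing (hrep g f) c = pairing (\<lambda>a. f (inv g \<otimes> a)) c"
    using c f by (intro pairing_cong) (auto simp: hrep_apply)
  also have "\<dots> = pairing f (translate (inv g) c)"
    by (induction c) (auto simp: translate_def)
  finally have p: "pairing (hrep g f) c = pairing f (translate (inv g) c)" .
  have "form (translate (inv g) c) (translate (inv g) c) = form c c"
    using form_translate[of "inv g" c c] g c by simp
  then show "2 * pairing (hrep g f) c - form c c \<le> B"
    using bspec[OF b[unfolded bounds_def], of "translate (inv g) c"] g c p by simp
qed

lemma hrep_hset: "g \<in> carrier G \<Longrightarrow> f \<in> hset \<Longrightarrow> hrep g f \<in> hset"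
  using bounds_hrep[of g f] by (auto simp: hset_iff[of "hrep g f"] hset_iff[of f] hrep_apply)

lemma hrep_mult:
  assumes "g \<in> carrier G" "h \<in> carrier G" "f \<in> hset"
  shows "hrep (g \<otimes> h) f = hrep g (hrep h f)"
proof
  fix a show "hrep (g \<otimes> h) f a = hrep g (hrep h f) a"
    using assms by (cases "a \<in> carrier G") (simp_all add: hrep_apply hrep_hset inv_mult_group m_assoc)
qed

lemma hrep_one: "f \<in> hset \<Longrightarrow> hrep \<one> f = f"
proof
  fix a assume "f \<in> hset" then show "hrep \<one> f a = f a"
    by (cases "a \<in> carrier G") (auto simp: hrep_apply hset_iff[of f])
qed

lemma hrep_inv: "g \<in> carrier G \<Longrightarrow> f \<in> hset \<Longrightarrow> hrep g (hrep (inv g) f) = f"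
  "g \<in> carrier G \<Longrightarrow> f \<in> hset \<Longrightarrow> hrep (inv g) (hrep g f) = f"
  using hrep_mult[of g "inv g" f] hrep_mult[of "inv g" g f] by (simp_all add: hrep_one)

text \<open>Neither g nor its inverse increases the supremum, and the two translations undo each
  other.\<close>

lemma hnorm_hrep: assumes g: "g \<in> carrier G" and f: "f \<in> hset" shows "hnorm (hrep g f) = hnorm f"
proof -
  have le: "sqn (hrep h u) \<le> sqn u" if "h \<in> carrier G" "u \<in> hset" for h u
    using that by (intro sqn_le bounds_hrep bounds_sqn)
  have "sqn (hrep (inv g) (hrep g f)) \<le> sqn (hrep g f)" using g f by (intro le hrep_hset) auto
  then have "sqn (hrep g f) = sqn f" using le[OF g f] hrep_inv[OF g f] by simp
  then show ?thesis by (simp add: hnorm_def)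
qed

lemma hrep_vec:
  assumes g: "g \<in> carrier G" and c: "c \<in> combs"
  shows "hrep g (kvec c) = kvec (translate g c)"
proof
  fix a show "hrep g (kvec c) a = kvec (translate g c) a"
  proof (cases "a \<in> carrier G")
    case True
    have "kvec c (inv g \<otimes> a) = kvec (translate g c) a"
      using c
    proof (induction c)
      case Nil then show ?case by (simp add: kvec_simps translate_def)
    next
      case (Cons z c)
      obtain x b where z: "z = (x, b)" by (cases z)
      have b: "b \<in> carrier G" using Cons.prems z by simp
      have "k b (inv g \<otimes> a) = k (g \<otimes> b) (g \<otimes> (inv g \<otimes> a))"
        using kernel_inv[OF g b] g True by simp
      also have "g \<otimes> (inv g \<otimes> a) = a" using g True by (simp flip: m_assoc)
      finally show ?case using Cons g True b by (simp add: z kvec_simps translate_def)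
    qed
    then show ?thesis using True c by (simp add: hrep_apply kvec_hset)
  qed (simp add: hrep_apply kvec_hset[OF c] kvec_outside)
qed

lemma hrep_hom: "hrep \<in> hom G (isometry_group gns)"
proof -
  have bij: "hrep g \<in> Bij hset" if g: "g \<in> carrier G" for g
    unfolding Bij_def
  proof (intro IntI CollectI)
    show "bij_betw (hrep g) hset hset"
      by (rule bij_betwI[where g = "hrep (inv g)"]) (use g in \<open>auto simp: hrep_hset hrep_inv\<close>)
  qed (simp add: hrep_def)
  have add: "hrep g (\<lambda>a. f a + h a) = (\<lambda>a. hrep g f a + hrep g h a)" if "f \<in> hset" "h \<in> hset" for g f h
    using that hset_add(1)[of f h] by (auto simp: hrep_def fun_eq_iff)
  have cm: "hrep g (\<lambda>a. t * f a) = (\<lambda>a. t * hrep g f a)" if "f \<in> hset" for g f t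
    using that hset_cmult[of f t] by (auto simp: hrep_def fun_eq_iff)
  show ?thesis
    unfolding hom_def
  proof (intro CollectI conjI ballI funcsetI)
    fix g assume g: "g \<in> carrier G"
    show "hrep g \<in> carrier (isometry_group gns)"
      using bij[OF g] add cm hnorm_hrep[OF g] by (simp add: isometry_group_def)
    fix h assume h: "h \<in> carrier G"
    have "hrep (g \<otimes> h) = compose hset (hrep g) (hrep h)"
    proof (rule extensionalityI[of _ hset])
      show "hrep (g \<otimes> h) f = compose hset (hrep g) (hrep h) f" if "f \<in> hset" for f
        using that g h by (simp add: hrep_mult compose_eq)
    qed (auto simp: hrep_def compose_def)
    then show "hrep (g \<otimes> h) = hrep g \<otimes>\<^bsub>isometry_group gns\<^esub> hrep h"
      using bij[OF g] bij[OF h] by (simp add: isometry_group_def BijGroup_def)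
  qed
qed

lemma hnorm_vec_diff:
  assumes a: "a \<in> carrier G" and b: "b \<in> carrier G"
  shows "hnorm (\<lambda>c. kvec [(1, a)] c - kvec [(1, b)] c) = sqrt (kdist a b)"
proof -
  have "sqn (\<lambda>c. kvec [(1, a)] c - kvec [(1, b)] c) = kdist a b"
    using complete_square(2)[OF kvec_hset, of "[(1, a)]" "[(1, b)]"] sqn_kvec[of "[(1, a)]"] a b
    by (simp add: form_def kvec_simps kdist_def)
  then show ?thesis by (simp add: hnorm_def)
qed

text \<open>Continuity of the kernel distance gives continuity on single kernel functions, induction
  over the list extends it to combinations, and density together with isometry extends it to all
  vectors.\<close>

lemma hrep_continuous:
  assumes G: "topological_group G \<tau>"
    and cont: "\<And>b \<epsilon>. b \<in> carrier G \<Longrightarrow> \<epsilon> > 0 \<Longrightarrow> \<exists>U. openin \<tau> U \<and> b \<in> U \<and> (\<forall>g\<in>U. kdist g b < \<epsilon>)"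
  shows "strongly_continuous_rep G \<tau> gns hrep"
  unfolding strongly_continuous_rep_def
proof (intro conjI hrep_hom ballI)
  interpret H: nspace gns by (rule nspace_gns)
  have top: "topspace \<tau> = carrier G" using G by (simp add: topological_group_def)
  \<comment> \<open>The hypothesis gives a neighbourhood of \<open>g0 \<otimes> b\<close>; right
    translation by b pulls it back to one of \<open>g0\<close>.\<close>
  have right: "continuous_map \<tau> \<tau> (\<lambda>g. g \<otimes> b)" if "b \<in> carrier G" for b
  proof -
    have "continuous_map \<tau> (prod_topology \<tau> \<tau>) (\<lambda>g. (g, b))"
      using that top by (intro continuous_map_pairedI) (auto simp: continuous_map_const)
    moreover have "continuous_map (prod_topology \<tau> \<tau>) \<tau> (\<lambda>(g, h). g \<otimes> h)"
      using G by (simp add: topological_group_def)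
    ultimately have "continuous_map \<tau> \<tau> ((\<lambda>(g, h). g \<otimes> h) \<circ> (\<lambda>g. (g, b)))" by (rule continuous_map_compose)
    then show ?thesis by (simp add: o_def)
  qed
  have vc: "\<exists>U. openin \<tau> U \<and> g0 \<in> U \<and> (\<forall>g\<in>U. hnorm (\<lambda>a. kvec (translate g c) a - kvec (translate g0 c) a) < \<epsilon>)"
    if "c \<in> combs" "g0 \<in> carrier G" "\<epsilon> > 0" for c g0 \<epsilon>
    using that
  proof (induction c arbitrary: \<epsilon>)
    case Nil
    then show ?case using top openin_topspace[of \<tau>]
      by (intro exI[of _ "carrier G"]) (auto simp: translate_def hnorm_zero)
  next
    case (Cons z c)
    obtain x b where z: "z = (x, b)" by (cases z)
    have b: "b \<in> carrier G" "c \<in> combs" using Cons.prems z by auto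
    obtain U where U: "openin \<tau> U" "g0 \<in> U" "\<And>g. g \<in> U \<Longrightarrow> hnorm (\<lambda>a. kvec (translate g c) a - kvec (translate g0 c) a) < \<epsilon> / 2"
      using Cons.IH[OF b(2) Cons.prems(2), of "\<epsilon> / 2"] Cons.prems(3) by auto
    define e where "e = \<epsilon> / (2 * (\<bar>x\<bar> + 1))"
    have e: "e > 0" unfolding e_def using Cons.prems(3) by simp
    have g0b: "g0 \<otimes> b \<in> carrier G" using b Cons.prems by simp
    obtain W where W: "openin \<tau> W" "g0 \<otimes> b \<in> W" "\<And>g. g \<in> W \<Longrightarrow> kdist g (g0 \<otimes> b) < e\<^sup>2"
      using cont[OF g0b, of "e\<^sup>2"] e by auto
    define U' where "U' = U \<inter> {g \<in> topspace \<tau>. g \<otimes> b \<in> W}"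
    have "openin \<tau> {g \<in> topspace \<tau>. g \<otimes> b \<in> W}" by (rule openin_continuous_map_preimage[OF right[OF b(1)] W(1)])
    then have oU: "openin \<tau> U'" "g0 \<in> U'" unfolding U'_def using U(1,2) W(2) top Cons.prems by auto
    have "hnorm (\<lambda>a. kvec (translate g (z # c)) a - kvec (translate g0 (z # c)) a) < \<epsilon>" if g: "g \<in> U'" for g
    proof -
      have gG: "g \<in> carrier G" "g \<otimes> b \<in> W" "g \<in> U" using g top unfolding U'_def by auto
      let ?p = "\<lambda>a. kvec [(1, g \<otimes> b)] a - kvec [(1, g0 \<otimes> b)] a"
      let ?r = "\<lambda>a. kvec (translate g c) a - kvec (translate g0 c) a"
      have gb: "g \<otimes> b \<in> carrier G" using gG b by simp
      have ph: "?p \<in> hset" by (intro hset_diff kvec_hset) (use gb g0b in auto)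
      have rh: "?r \<in> hset" by (intro hset_diff kvec_hset translate_combs) (use gG b Cons.prems in auto)
      have eq: "(\<lambda>a. kvec (translate g (z # c)) a - kvec (translate g0 (z # c)) a) = (\<lambda>a. x * ?p a + ?r a)"
        by (auto simp: fun_eq_iff z translate_def kvec_def algebra_simps)
      have "hnorm ?p < e"
        unfolding hnorm_vec_diff[OF gb g0b] using W(3)[OF gG(2)] e real_sqrt_less_mono by fastforce
      then have "\<bar>x\<bar> * hnorm ?p \<le> \<bar>x\<bar> * e" by (intro mult_left_mono) auto
      also have "\<dots> \<le> \<epsilon> / 2" unfolding e_def using Cons.prems(3) by (simp add: field_simps)
      finally have "\<bar>x\<bar> * hnorm ?p \<le> \<epsilon> / 2" .
      moreover have "hnorm (\<lambda>a. x * ?p a + ?r a) \<le> \<bar>x\<bar> * hnorm ?p + hnorm ?r"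
        using hset_add(2)[OF hset_cmult[OF ph, of x] rh] hnorm_cmult[OF ph, of x] by simp
      ultimately show ?thesis using U(3)[OF gG(3)] unfolding eq by linarith
    qed
    then show ?case using oU by blast
  qed
  fix f assume f: "f \<in> carrier gns"
  show "continuous_map \<tau> (norm_topology gns) (\<lambda>g. hrep g f)"
    unfolding H.continuous_map_norm_topology
  proof (intro conjI ballI allI impI)
    fix g0 and \<epsilon> :: real assume g0: "g0 \<in> topspace \<tau>" and e: "\<epsilon> > 0"
    obtain c where c: "c \<in> combs" "hnorm (\<lambda>a. f a - kvec c a) < \<epsilon> / 3" using kvec_dense[of f "\<epsilon> / 3"] f e by auto
    obtain U where U: "openin \<tau> U" "g0 \<in> U" "\<And>g. g \<in> U \<Longrightarrow> hnorm (\<lambda>a. kvec (translate g c) a - kvec (translate g0 c) a) < \<epsilon> / 3"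
      using vc[OF c(1), of g0 "\<epsilon> / 3"] g0 top e by auto
    have "nrm gns (hrep g f \<ominus>\<^bsub>gns\<^esub> hrep g0 f) < \<epsilon>" if g: "g \<in> U" for g
    proof -
      have gG: "g \<in> carrier G" "g0 \<in> carrier G" using openin_subset[OF U(1)] g g0 top by auto
      have fv: "(\<lambda>a. f a - kvec c a) \<in> hset" using f kvec_hset[OF c(1)] by (simp add: hset_diff)
      have d: "hnorm (\<lambda>a. hrep h f a - kvec (translate h c) a) < \<epsilon> / 3" if h: "h \<in> carrier G" for h
      proof -
        have "(\<lambda>a. hrep h f a - kvec (translate h c) a) = hrep h (\<lambda>a. f a - kvec c a)"
          unfolding hrep_vec[OF h c(1), symmetric] using f kvec_hset[OF c(1)] fv by (auto simp: hrep_def fun_eq_iff)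
        then show ?thesis using hnorm_hrep[OF h fv] c(2) by simp
      qed
      have mem: "hrep h f \<in> carrier gns" "kvec (translate h c) \<in> carrier gns" if "h \<in> carrier G" for h
        using that f c(1) by (auto intro: hrep_hset kvec_hset)
      note mem' = mem[unfolded gns_simps]
      have "nrm gns (hrep g f \<ominus>\<^bsub>gns\<^esub> hrep g0 f) \<le> nrm gns (hrep g f \<ominus>\<^bsub>gns\<^esub> kvec (translate g c)) +
          (nrm gns (kvec (translate g c) \<ominus>\<^bsub>gns\<^esub> kvec (translate g0 c)) + nrm gns (kvec (translate g0 c) \<ominus>\<^bsub>gns\<^esub> hrep g0 f))"
        using H.nrm_triangle_minus[OF mem(1)[OF gG(1)] mem(2)[OF gG(1)] mem(1)[OF gG(2)]]
          H.nrm_triangle_minus[OF mem(2)[OF gG(1)] mem(2)[OF gG(2)] mem(1)[OF gG(2)]] by linarith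
      also have "nrm gns (kvec (translate g0 c) \<ominus>\<^bsub>gns\<^esub> hrep g0 f) = nrm gns (hrep g0 f \<ominus>\<^bsub>gns\<^esub> kvec (translate g0 c))"
        by (rule H.nrm_minus_commute[OF mem(2)[OF gG(2)] mem(1)[OF gG(2)]])
      finally show ?thesis using d[OF gG(1)] d[OF gG(2)] U(3)[OF g] mem'[OF gG(1)] mem'[OF gG(2)]
        by (simp add: gns_diff)
    qed
    then show "\<exists>U. openin \<tau> U \<and> g0 \<in> U \<and> (\<forall>h\<in>U. nrm gns (hrep h f \<ominus>\<^bsub>gns\<^esub> hrep g0 f) < \<epsilon>)"
      using U(1,2) by blast
  qed (use f top in \<open>auto simp: hrep_hset\<close>)
qed

end

text \<open>Apply (T) to the kernel function \<xi> at the identity. A fixed vector \<eta> moves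
  \<xi> by at most twice the distance of \<xi> from \<eta>, whence the factor 2. \<open>Q\<close>
  and \<kappa> precede the kernel, because the spaces \<open>gns\<close> all live on the one type
  over which (T) quantifies.\<close>

lemma kazhdan_kernel:
  assumes G: "topological_group G \<tau>" and T: "kazhdan_property_T G \<tau>"
  obtains Q \<kappa> where "compactin \<tau> Q" "\<one>\<^bsub>G\<^esub> \<in> Q" "\<kappa> > 0"
    "\<And>k \<delta> g. \<lbrakk>invariant_kernel G k;
       \<forall>b\<in>carrier G. \<forall>e>0. \<exists>U. openin \<tau> U \<and> b \<in> U \<and> (\<forall>g\<in>U. invariant_kernel.kdist k g b < e);
       \<forall>q\<in>Q. invariant_kernel.kdist k q \<one>\<^bsub>G\<^esub> \<le> \<delta>\<^sup>2; \<delta> \<ge> 0; g \<in> carrier G\<rbrakk>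
       \<Longrightarrow> invariant_kernel.kdist k g \<one>\<^bsub>G\<^esub> \<le> (2 * \<delta> / \<kappa>)\<^sup>2"
proof -
  obtain Q \<kappa> where Q: "compactin \<tau> Q" "\<one>\<^bsub>G\<^esub> \<in> Q" "\<kappa> > 0"
    and K: "\<And>(H :: ('a \<Rightarrow> real) normed_module) \<pi> \<xi>. real_hilbert_space H \<Longrightarrow> strongly_continuous_rep G \<tau> H \<pi> \<Longrightarrow>
           \<xi>\<in>carrier H \<Longrightarrow> (SUP q\<in>Q. nrm H (\<pi> q \<xi> \<ominus>\<^bsub>H\<^esub> \<xi>)) \<ge> \<kappa> * (INF \<eta>\<in>fixed_vectors G H \<pi>. nrm H (\<xi> \<ominus>\<^bsub>H\<^esub> \<eta>))"
    using T unfolding kazhdan_property_T_def by blast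
  show ?thesis
  proof (rule that[OF Q])
    fix k :: "'a \<Rightarrow> 'a \<Rightarrow> real" and \<delta> :: real and g
    assume inv: "invariant_kernel G k"
      and cont: "\<forall>b\<in>carrier G. \<forall>e>0. \<exists>U. openin \<tau> U \<and> b \<in> U \<and> (\<forall>g\<in>U. invariant_kernel.kdist k g b < e)"
      and small: "\<forall>q\<in>Q. invariant_kernel.kdist k q \<one>\<^bsub>G\<^esub> \<le> \<delta>\<^sup>2" and d: "\<delta> \<ge> 0" and g: "g \<in> carrier G"
    interpret invariant_kernel G k by (rule inv)
    interpret H: nspace gns by (rule nspace_gns)
    have rep: "strongly_continuous_rep G \<tau> gns hrep" by (rule hrep_continuous[OF G]) (use cont in blast)
    define \<xi> where "\<xi> = kvec [(1, \<one>\<^bsub>G\<^esub>)]"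
    have xi: "\<xi> \<in> hset" unfolding \<xi>_def by (rule kvec_hset) simp
    have QG: "Q \<subseteq> carrier G" using compactin_subset_topspace[OF Q(1)] G by (simp add: topological_group_def)
    have nd: "nrm gns (hrep q \<xi> \<ominus>\<^bsub>gns\<^esub> \<xi>) = sqrt (kdist q \<one>\<^bsub>G\<^esub>)" if q: "q \<in> carrier G" for q
    proof -
      have "hrep q \<xi> = kvec [(1, q)]" unfolding \<xi>_def using hrep_vec[OF q, of "[(1, \<one>\<^bsub>G\<^esub>)]"] q by (simp add: translate_def)
      then show ?thesis using hnorm_vec_diff[OF q one_closed] hrep_hset[OF q xi] xi by (simp add: gns_diff \<xi>_def)
    qed
    have sup: "(SUP q\<in>Q. nrm gns (hrep q \<xi> \<ominus>\<^bsub>gns\<^esub> \<xi>)) \<le> \<delta>"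
    proof (rule cSUP_least)
      fix q assume q: "q \<in> Q"
      then have "sqrt (kdist q \<one>\<^bsub>G\<^esub>) \<le> sqrt (\<delta>\<^sup>2)" by (intro real_sqrt_le_mono) (use small in blast)
      then show "nrm gns (hrep q \<xi> \<ominus>\<^bsub>gns\<^esub> \<xi>) \<le> \<delta>" using nd[of q] q QG d by (auto simp: subset_iff)
    qed (use Q(2) in auto)
    let ?F = "fixed_vectors G gns hrep"
    have F0: "?F \<noteq> {}"
    proof -
      have "(\<lambda>a. 0) \<in> ?F" unfolding fixed_vectors_def using hset_zero by (auto simp: hrep_def)
      then show ?thesis by blast
    qed
    have "\<kappa> * (INF \<eta>\<in>?F. nrm gns (\<xi> \<ominus>\<^bsub>gns\<^esub> \<eta>)) \<le> \<delta>"
      using K[OF gns_hilbert rep, of \<xi>] xi sup by simp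
    then have inf: "(INF \<eta>\<in>?F. nrm gns (\<xi> \<ominus>\<^bsub>gns\<^esub> \<eta>)) \<le> \<delta> / \<kappa>" using Q(3) by (simp add: field_simps)
    have bdd: "bdd_below ((\<lambda>\<eta>. nrm gns (\<xi> \<ominus>\<^bsub>gns\<^esub> \<eta>)) ` ?F)"
      using xi by (intro bdd_belowI2[of _ 0] H.nrm_nonneg H.minus_closed) (auto simp: fixed_vectors_def)
    have "sqrt (kdist g \<one>\<^bsub>G\<^esub>) \<le> 2 * \<delta> / \<kappa> + \<epsilon>" if e: "\<epsilon> > 0" for \<epsilon>
    proof -
      \<comment> \<open>A nearly closest fixed vector is enough; the slack \<epsilon> is removed at
        the end.\<close>
      have "(INF \<eta>\<in>?F. nrm gns (\<xi> \<ominus>\<^bsub>gns\<^esub> \<eta>)) < \<delta> / \<kappa> + \<epsilon> / 2" using inf e by simp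
      then obtain \<eta> where eta: "\<eta> \<in> ?F" "nrm gns (\<xi> \<ominus>\<^bsub>gns\<^esub> \<eta>) < \<delta> / \<kappa> + \<epsilon> / 2"
        unfolding cINF_less_iff[OF F0 bdd] by blast
      have etaH: "\<eta> \<in> carrier gns" "hrep g \<eta> = \<eta>" using eta(1) g by (auto simp: fixed_vectors_def)
      have xiH: "\<xi> \<in> carrier gns" "hrep g \<xi> \<in> carrier gns" using xi hrep_hset[OF g xi] by auto
      have iso: "hrep g \<in> carrier (isometry_group gns)" using hrep_hom g by (auto simp: hom_def)
      have "nrm gns (hrep g \<xi> \<ominus>\<^bsub>gns\<^esub> \<xi>) \<le> nrm gns (hrep g \<xi> \<ominus>\<^bsub>gns\<^esub> \<eta>) + nrm gns (\<eta> \<ominus>\<^bsub>gns\<^esub> \<xi>)"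
        by (rule H.nrm_triangle_minus[OF xiH(2) etaH(1) xiH(1)])
      also have "hrep g \<xi> \<ominus>\<^bsub>gns\<^esub> \<eta> = hrep g (\<xi> \<ominus>\<^bsub>gns\<^esub> \<eta>)"
        using H.isometry_diff[OF iso xiH(1) etaH(1)] etaH(2) by simp
      also have "nrm gns (hrep g (\<xi> \<ominus>\<^bsub>gns\<^esub> \<eta>)) = nrm gns (\<xi> \<ominus>\<^bsub>gns\<^esub> \<eta>)"
        by (rule isometryD(5)[OF iso H.minus_closed[OF xiH(1) etaH(1)]])
      also have "nrm gns (\<eta> \<ominus>\<^bsub>gns\<^esub> \<xi>) = nrm gns (\<xi> \<ominus>\<^bsub>gns\<^esub> \<eta>)"
        by (rule H.nrm_minus_commute[OF etaH(1) xiH(1)])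
      finally show ?thesis using nd[OF g] eta(2) by simp
    qed
    then have "sqrt (kdist g \<one>\<^bsub>G\<^esub>) \<le> 2 * \<delta> / \<kappa>" by (rule field_le_epsilon)
    then have "kdist g \<one>\<^bsub>G\<^esub> \<le> (2 * \<delta> / \<kappa>)\<^sup>2"
      by (rule sqrt_le_D)
    then show "kdist g \<one>\<^bsub>G\<^esub> \<le> (2 * \<delta> / \<kappa>)\<^sup>2" .
  qed
qed

section \<open>Kernels for exponents that are not even\<close>

text \<open>For \<open>r\<close> not an even integer, an invariant positive definite kernel on every subspace of \<open>L\<^sub>r\<close> is obtained from
  \<open>\<integral>\<^sub>0\<^sup>\<infinity> sin(us)\<^sup>N sin(ut)\<^sup>N u\<^sup>-\<^sup>1\<^sup>-\<^sup>r du\<close>, which is a linear combination of terms \<open>\<bar>i s + j t\<bar>\<^sup>r\<close>: the mixed differences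
  below turn \<open>cos(uz)\<close> into products of sines and kill the Taylor polynomial that makes
  \<open>\<integral>\<^sub>0\<^sup>\<infinity> (cos(uz) - \<dots>) u\<^sup>-\<^sup>1\<^sup>-\<^sup>r du = C \<bar>z\<bar>\<^sup>r\<close> converge.\<close>

primrec mdiff :: "(real \<Rightarrow> real) \<Rightarrow> nat \<Rightarrow> real \<Rightarrow> real \<Rightarrow> real \<Rightarrow> real" where
  "mdiff F 0 s t z = F z"
| "mdiff F (Suc m) s t z = mdiff F m s t (z + s + t) - mdiff F m s t (z + s - t)
     - mdiff F m s t (z - s + t) + mdiff F m s t (z - s - t)"

lemma mdiff_diff: "mdiff (\<lambda>x. F x - H x) m s t z = mdiff F m s t z - mdiff H m s t z"
  by (induction m arbitrary: z) auto

lemma mdiff_cmult: "mdiff (\<lambda>x. c * F x) m s t z = c * mdiff F m s t z"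
  by (induction m arbitrary: z) (auto simp: algebra_simps)

lemma mdiff_sym: "mdiff F m s t z = mdiff F m t s z"
  by (induction m arbitrary: z) (auto simp: algebra_simps)

text \<open>Differences commute with each other, so a step may be applied to F first.\<close>

lemma mdiff_step: "mdiff F (Suc m) s t z = mdiff (\<lambda>x. F (x + s + t) - F (x + s - t) - F (x - s + t) + F (x - s - t)) m s t z"
proof (induction m arbitrary: z)
  case (Suc m)
  have "mdiff F (Suc (Suc m)) s t z = mdiff F (Suc m) s t (z + s + t) - mdiff F (Suc m) s t (z + s - t)
     - mdiff F (Suc m) s t (z - s + t) + mdiff F (Suc m) s t (z - s - t)" by (rule mdiff.simps)
  also have "\<dots> = mdiff (\<lambda>x. F (x + s + t) - F (x + s - t) - F (x - s + t) + F (x - s - t)) (Suc m) s t z"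
    unfolding Suc.IH by simp
  finally show ?case .
qed simp

text \<open>By the addition theorems cos(u z) is an eigenfunction of a step, with eigenvalue -4
  sin(u s) sin(u t).\<close>

lemma mdiff_cos: "mdiff (\<lambda>x. cos (u * x)) m s t z = (- 4) ^ m * (sin (u * s) * sin (u * t)) ^ m * cos (u * z)"
proof (induction m arbitrary: z)
  case (Suc m)
  have "cos (a + b + c) - cos (a + b - c) - cos (a - b + c) + cos (a - b - c) = - 4 * (sin b * sin c) * cos a" for a b c :: real
    by (simp add: cos_add cos_diff sin_add sin_diff algebra_simps)
  from this[of "u * z" "u * s" "u * t"]
  have e: "cos (u * (z + s + t)) - cos (u * (z + s - t)) - cos (u * (z - s + t)) + cos (u * (z - s - t))
      = - 4 * (sin (u * s) * sin (u * t)) * cos (u * z)" by (simp only: distrib_left right_diff_distrib)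
  define A where "A = (- 4) ^ m * (sin (u * s) * sin (u * t)) ^ m"
  have "mdiff (\<lambda>x. cos (u * x)) (Suc m) s t z = A * (cos (u * (z + s + t)) - cos (u * (z + s - t)) - cos (u * (z - s + t)) + cos (u * (z - s - t)))"
    unfolding mdiff.simps Suc.IH A_def[symmetric] by (simp only: distrib_left right_diff_distrib)
  also have "\<dots> = (- 4) ^ Suc m * (sin (u * s) * sin (u * t)) ^ Suc m * cos (u * z)"
    unfolding e A_def by (simp add: mult_ac)
  finally show ?case .
qed simp

lemma degree_shift_diff:
  fixes p :: "real Polynomial.poly"
  shows "Polynomial.degree (pcompose p [:h, 1:] - p) \<le> Polynomial.degree p - 1"
    "Polynomial.degree p = 0 \<Longrightarrow> pcompose p [:h, 1:] - p = 0"
proof -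
  show 0: "pcompose p [:h, 1:] - p = 0" if "Polynomial.degree p = 0" for p :: "real Polynomial.poly"
    using that by (metis degree_eq_zeroE pcompose_const right_minus_eq)
  show "Polynomial.degree (pcompose p [:h, 1:] - p) \<le> Polynomial.degree p - 1"
  proof (induction p)
    case (pCons a p)
    let ?P = "pcompose p [:h, 1:]"
    have e: "pcompose (pCons a p) [:h, 1:] - pCons a p = pCons 0 (?P - p) + Polynomial.smult h ?P"
      by (simp add: pcompose_pCons)
    have d: "Polynomial.degree ?P = Polynomial.degree p" by (simp add: degree_pcompose)
    show ?case
    proof (cases "p = 0")
      case False
      have "Polynomial.degree (pCons 0 (?P - p)) \<le> Polynomial.degree p"
      proof (cases "Polynomial.degree p = 0")
        case True then show ?thesis using 0[OF True] by simp
      next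
        case False then show ?thesis using pCons.IH by (auto simp: degree_pCons_eq_if)
      qed
      moreover have "Polynomial.degree (Polynomial.smult h ?P) \<le> Polynomial.degree p"
        using degree_smult_le[of h ?P] d by simp
      ultimately show ?thesis unfolding e using False by (simp add: degree_add_le)
    qed simp
  qed simp
qed

lemma degree_sym_diff:
  fixes p :: "real Polynomial.poly"
  obtains q where "\<And>x. Polynomial.poly q x = Polynomial.poly p (x + h) - Polynomial.poly p (x - h)"
    "Polynomial.degree q \<le> Polynomial.degree p - 1" "Polynomial.degree p = 0 \<Longrightarrow> q = 0"
proof -
  define p1 where "p1 = pcompose p [:- h, 1:]"
  have d: "Polynomial.degree p1 = Polynomial.degree p" unfolding p1_def by (simp add: degree_pcompose)
  show ?thesis
    using degree_shift_diff[of p1 "2 * h"] d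
    by (intro that[of "pcompose p1 [:2 * h, 1:] - p1"]) (auto simp: poly_pcompose p1_def add.commute)
qed

text \<open>Each step contains two differences, and each difference lowers the degree.\<close>

lemma mdiff_poly: "Polynomial.degree (p :: real Polynomial.poly) < 2 * m \<Longrightarrow> mdiff (Polynomial.poly p) m s t z = 0"
proof (induction m arbitrary: p)
  case (Suc m)
  obtain q where q: "\<And>x. Polynomial.poly q x = Polynomial.poly p (x + s) - Polynomial.poly p (x - s)"
    "Polynomial.degree q \<le> Polynomial.degree p - 1" "Polynomial.degree p = 0 \<Longrightarrow> q = 0"
    using degree_sym_diff[of p s] by blast
  obtain q' where q': "\<And>x. Polynomial.poly q' x = Polynomial.poly q (x + t) - Polynomial.poly q (x - t)"
    "Polynomial.degree q' \<le> Polynomial.degree q - 1" "Polynomial.degree q = 0 \<Longrightarrow> q' = 0"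
    using degree_sym_diff[of q t] by blast
  have "(\<lambda>x. Polynomial.poly p (x + s + t) - Polynomial.poly p (x + s - t) - Polynomial.poly p (x - s + t) + Polynomial.poly p (x - s - t))
      = Polynomial.poly q'" by (auto simp: fun_eq_iff q q' algebra_simps)
  then have e: "mdiff (Polynomial.poly p) (Suc m) s t z = mdiff (Polynomial.poly q') m s t z"
    unfolding mdiff_step by simp
  show ?case
  proof (cases "Polynomial.degree q' < 2 * m")
    case True then show ?thesis using Suc.IH e by simp
  next
    case False
    \<comment> \<open>Only m = 0 leads here: subtraction in the degree bounds truncates at 0, so a
      constant \<open>q\<close> needs separate treatment; its difference is 0.\<close>
    then have "Polynomial.degree q = 0" using q(2) q'(2) Suc.prems by arith
    then have "Polynomial.poly q' = (\<lambda>x. 0)" using q'(3) by auto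
    then show ?thesis unfolding e using mdiff_cmult[of 0 "\<lambda>x. 0"] by simp
  qed
qed simp

section \<open>Taylor remainders of the cosine and their integrals\<close>

definition cosrem :: "nat \<Rightarrow> real \<Rightarrow> real" where
  "cosrem n v = cos v - (\<Sum>m<2 * n. cos_coeff m * v ^ m)"

lemma cosrem_minus: "cosrem n (- v) = cosrem n v"
proof -
  have "cos_coeff m * (- v) ^ m = cos_coeff m * v ^ m" for m
    by (cases "even m") (auto simp: cos_coeff_def)
  note e = this
  show ?thesis unfolding cosrem_def e cos_minus ..
qed

text \<open>The first bound is the Taylor remainder of order 2 n. The coefficient of order 2 n - 1
  vanishes, so a single term separates it from the remainder of order 2 n - 2, which gives the
  second. They serve near 0 and near infinity.\<close>

lemma cosrem_bounds:
  shows "\<bar>cosrem n v\<bar> \<le> \<bar>v\<bar> ^ (2 * n)" "n \<ge> 1 \<Longrightarrow> \<bar>cosrem n v\<bar> \<le> 2 * \<bar>v\<bar> ^ (2 * n - 2)"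
proof -
  have b: "\<bar>cos v - (\<Sum>m<k. cos_coeff m * v ^ m)\<bar> \<le> \<bar>v\<bar> ^ k" for k
  proof -
    obtain t where "cos v = (\<Sum>m<k. cos_coeff m * v ^ m) + (cos (t + 1/2 * real k * pi) / fact k) * v ^ k"
      using Maclaurin_cos_expansion by blast
    then have "cos v - (\<Sum>m<k. cos_coeff m * v ^ m) = (cos (t + 1/2 * real k * pi) / fact k) * v ^ k" by simp
    then have "\<bar>cos v - (\<Sum>m<k. cos_coeff m * v ^ m)\<bar> = \<bar>cos (t + 1/2 * real k * pi)\<bar> / fact k * \<bar>v\<bar> ^ k"
      by (simp add: abs_mult power_abs)
    also have "\<dots> \<le> 1 * \<bar>v\<bar> ^ k"
    proof (rule mult_right_mono)
      have "\<bar>cos (t + 1/2 * real k * pi)\<bar> \<le> 1" by (rule abs_cos_le_one)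
      also have "1 \<le> (fact k :: real)" by (rule fact_ge_1)
      finally show "\<bar>cos (t + 1/2 * real k * pi)\<bar> / fact k \<le> 1" by simp
    qed simp
    finally show ?thesis by simp
  qed
  show "\<bar>cosrem n v\<bar> \<le> \<bar>v\<bar> ^ (2 * n)" unfolding cosrem_def by (rule b)
  show "\<bar>cosrem n v\<bar> \<le> 2 * \<bar>v\<bar> ^ (2 * n - 2)" if n: "n \<ge> 1"
  proof -
    define k where "k = 2 * n - 2"
    have k: "2 * n = Suc (Suc k)" "even k" unfolding k_def using n by auto
    have odd: "cos_coeff (Suc k) = 0" using k(2) by (simp add: cos_coeff_def)
    have "\<bar>cos_coeff k\<bar> \<le> 1" unfolding cos_coeff_def using fact_ge_1[of k, where ?'a = real] by (auto simp: power_abs)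
    then have "\<bar>cos_coeff k * v ^ k\<bar> \<le> \<bar>v\<bar> ^ k" by (simp add: abs_mult power_abs mult_left_le_one_le)
    moreover have "cosrem n v = (cos v - (\<Sum>m<k. cos_coeff m * v ^ m)) - cos_coeff k * v ^ k"
      unfolding cosrem_def k(1) by (simp add: odd)
    ultimately show ?thesis using b[of k] unfolding k_def by linarith
  qed
qed

lemma integrable_powr_near_0:
  assumes "a > - 1"
  shows "integrable lborel (\<lambda>v::real. indicator {0<..1} v * v powr a)"
proof -
  have "(\<lambda>v. v powr a) integrable_on {0..1}" using has_integral_powr_from_0[OF assms, of 1] by (auto simp: integrable_on_def)
  then have "(\<lambda>v. v powr a) absolutely_integrable_on {0..1}" by (rule nonnegative_absolutely_integrable_1) simp
  then have "integrable lebesgue (\<lambda>v. indicator {0..1} v *\<^sub>R v powr a)" by (simp add: set_integrable_def)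
  then have "integrable lborel (\<lambda>v. indicator {0..1} v *\<^sub>R v powr a)"
    by (subst (asm) integrable_completion) auto
  then show ?thesis
    by (rule Bochner_Integration.integrable_bound) (auto simp: indicator_def)
qed

lemma integrable_powr_to_inf:
  assumes "a < - 1"
  shows "integrable lborel (\<lambda>v::real. indicator {1<..} v * v powr a)"
proof -
  have "(\<lambda>v. v powr a) integrable_on {1..}" using has_integral_powr_to_inf[OF assms, of 1] by (auto simp: integrable_on_def)
  then have "(\<lambda>v. v powr a) absolutely_integrable_on {1..}" by (rule nonnegative_absolutely_integrable_1) simp
  then have "integrable lebesgue (\<lambda>v. indicator {1..} v *\<^sub>R v powr a)" by (simp add: set_integrable_def)
  then have "integrable lborel (\<lambda>v. indicator {1..} v *\<^sub>R v powr a)"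
    by (subst (asm) integrable_completion) auto
  then show ?thesis
    by (rule Bochner_Integration.integrable_bound) (auto simp: indicator_def)
qed

definition wt :: "real \<Rightarrow> real \<Rightarrow> real" where
  "wt r v = indicator {0<..} v * v powr (- 1 - r)"

lemma wt_nonneg: "wt r v \<ge> 0" by (simp add: wt_def)

lemma wt_measurable [measurable]: "wt r \<in> borel_measurable borel"
  unfolding wt_def[abs_def] by measurable

lemma cosrem_measurable [measurable]: "cosrem n \<in> borel_measurable borel"
  unfolding cosrem_def[abs_def] by (intro borel_measurable_continuous_onI continuous_intros)

text \<open>Near 0 the integrand is at most v^(2n-1-r), whose exponent is above -1, and beyond 1 at
  most 2 v^(2n-3-r), whose exponent is below -1; these are the two inequalities on r.\<close>

lemma integrable_cosrem:
  assumes n: "n \<ge> 1" and r: "2 * real n - 2 < r" "r < 2 * real n"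
  shows "integrable lborel (\<lambda>v. cosrem n v * wt r v)"
proof -
  have i: "integrable lborel (\<lambda>v::real. indicator {0<..1} v * v powr (2 * real n - 1 - r) + 2 * (indicator {1<..} v * v powr (2 * real n - 3 - r)))"
    using r by (intro Bochner_Integration.integrable_add integrable_mult_right integrable_powr_near_0 integrable_powr_to_inf) auto
  have bd: "\<bar>cosrem n v * wt r v\<bar> \<le> indicator {0<..1} v * v powr (2 * real n - 1 - r) + 2 * (indicator {1<..} v * v powr (2 * real n - 3 - r))" for v
  proof (cases "v > 0")
    case v: True
    have p: "v ^ k * v powr (- 1 - r) = v powr (real k - 1 - r)" for k
      using v by (simp add: powr_realpow[symmetric] powr_add[symmetric] algebra_simps)
    show ?thesis
    proof (cases "v \<le> 1")
      case True
      have "\<bar>cosrem n v * wt r v\<bar> = \<bar>cosrem n v\<bar> * v powr (- 1 - r)" using v by (simp add: wt_def abs_mult)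
      also have "\<dots> \<le> v ^ (2 * n) * v powr (- 1 - r)" using cosrem_bounds(1)[of n v] v by (intro mult_right_mono) auto
      also have "\<dots> = v powr (2 * real n - 1 - r)" using p[of "2 * n"] by simp
      finally show ?thesis using v True by simp
    next
      case False
      have "\<bar>cosrem n v * wt r v\<bar> = \<bar>cosrem n v\<bar> * v powr (- 1 - r)" using v by (simp add: wt_def abs_mult)
      also have "\<dots> \<le> (2 * v ^ (2 * n - 2)) * v powr (- 1 - r)" using cosrem_bounds(2)[OF n, of v] v by (intro mult_right_mono) auto
      also have "\<dots> = 2 * v powr (real (2 * n - 2) - 1 - r)" using p[of "2 * n - 2"] by simp
      also have "real (2 * n - 2) - 1 - r = 2 * real n - 3 - r" using n by (simp add: of_nat_diff)
      finally show ?thesis using v False by simp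
    qed
  qed (simp add: wt_def)
  show ?thesis
    by (rule Bochner_Integration.integrable_bound[OF i]) (use bd in \<open>auto intro: order_trans[OF _ abs_ge_self]\<close>)
qed

text \<open>The substitution v = b u extracts |b|^r from the weight, and evenness of
  \<open>cosrem\<close> settles b < 0.\<close>

lemma cosrem_scaling:
  assumes n: "n \<ge> 1" and r: "2 * real n - 2 < r" "r < 2 * real n" "r > 0"
  shows "integrable lborel (\<lambda>u. cosrem n (b * u) * wt r u)"
    "(LINT u|lborel. cosrem n (b * u) * wt r u) = (LINT u|lborel. cosrem n u * wt r u) * \<bar>b\<bar> powr r"
proof -
  have pos: "integrable lborel (\<lambda>u. cosrem n (b * u) * wt r u) \<and>
     (LINT u|lborel. cosrem n (b * u) * wt r u) = (LINT u|lborel. cosrem n u * wt r u) * \<bar>b\<bar> powr r" if b: "b > 0" for b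
  proof -
    let ?h = "\<lambda>v. cosrem n v * wt r v"
    have e: "?h (0 + b * u) = b powr (- 1 - r) * (cosrem n (b * u) * wt r u)" for u
    proof (cases "u > 0")
      case True then show ?thesis using b by (simp add: wt_def powr_mult)
    next
      case False then show ?thesis using b by (simp add: wt_def zero_less_mult_iff)
    qed
    have "integrable lborel (\<lambda>u. ?h (0 + b * u))" using lborel_integrable_real_affine[OF integrable_cosrem[OF n r(1,2)], of b 0] b by simp
    then have i: "integrable lborel (\<lambda>u. cosrem n (b * u) * wt r u)" unfolding e using b by simp
    have "(LINT v|lborel. ?h v) = \<bar>b\<bar> *\<^sub>R (LINT u|lborel. ?h (0 + b * u))"
      by (rule lborel_integral_real_affine) (use b in simp)
    also have "\<dots> = b * (b powr (- 1 - r) * (LINT u|lborel. cosrem n (b * u) * wt r u))" unfolding e using b by simp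
    also have "\<dots> = b powr (- r) * (LINT u|lborel. cosrem n (b * u) * wt r u)"
    proof -
      have "b * b powr (- 1 - r) = b powr (- r)" using b powr_add[of b 1 "- 1 - r"] by simp
      then show ?thesis by (simp flip: mult.assoc)
    qed
    finally show ?thesis using i b by (simp add: powr_minus field_simps)
  qed
  have "integrable lborel (\<lambda>u. cosrem n (b * u) * wt r u) \<and>
     (LINT u|lborel. cosrem n (b * u) * wt r u) = (LINT u|lborel. cosrem n u * wt r u) * \<bar>b\<bar> powr r"
  proof (cases b "0 :: real" rule: linorder_cases)
    case greater then show ?thesis by (rule pos)
  next
    case less
    then show ?thesis using pos[of "- b"] by (simp add: cosrem_minus)
  next
    case equal
    have "cosrem n 0 = 0" using cosrem_bounds(1)[of n 0] n by (simp add: power_0_left)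
    then show ?thesis using equal by simp
  qed
  then show "integrable lborel (\<lambda>u. cosrem n (b * u) * wt r u)"
    "(LINT u|lborel. cosrem n (b * u) * wt r u) = (LINT u|lborel. cosrem n u * wt r u) * \<bar>b\<bar> powr r" by auto
qed

text \<open>Apply N mixed differences to the scaling identity. In the integrand the Taylor
  polynomial, of degree below 2 n \<le> 2 N, disappears, and the cosine becomes a product of
  sines.\<close>

lemma sine_kernel:
  assumes n: "n \<ge> 1" and r: "2 * real n - 2 < r" "r < 2 * real n" "r > 0" and N: "N \<ge> n"
  defines "C \<equiv> LINT u|lborel. cosrem n u * wt r u"
  shows "integrable lborel (\<lambda>u. (sin (u * s) * sin (u * t)) ^ N * wt r u)"
    "(LINT u|lborel. (sin (u * s) * sin (u * t)) ^ N * wt r u) = C / (- 4) ^ N * mdiff (\<lambda>z. \<bar>z\<bar> powr r) N s t 0"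
proof -
  have ind: "integrable lborel (\<lambda>u. mdiff (\<lambda>z. cosrem n (z * u)) m s t z * wt r u) \<and>
     (LINT u|lborel. mdiff (\<lambda>z. cosrem n (z * u)) m s t z * wt r u) = C * mdiff (\<lambda>z. \<bar>z\<bar> powr r) m s t z" for m z
  proof (induction m arbitrary: z)
    case 0 then show ?case using cosrem_scaling[OF n r, of z] by (simp add: C_def)
  next
    case (Suc m)
    show ?case by (simp add: left_diff_distrib distrib_right Suc.IH right_diff_distrib distrib_left)
  qed
  have e: "mdiff (\<lambda>z. cosrem n (z * u)) N s t 0 = (- 4) ^ N * (sin (u * s) * sin (u * t)) ^ N" for u
  proof -
    define p where "p = (\<Sum>m<2 * n. Polynomial.monom (cos_coeff m * u ^ m) m)"
    have "Polynomial.degree p \<le> 2 * n - 1" unfolding p_def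
      by (intro Polynomial.degree_sum_le) (auto intro: order_trans[OF Polynomial.degree_monom_le])
    then have "mdiff (Polynomial.poly p) N s t 0 = 0" using n N by (intro mdiff_poly) linarith
    moreover have "(\<lambda>z. cosrem n (z * u)) = (\<lambda>z. cos (u * z) - Polynomial.poly p z)"
      unfolding cosrem_def p_def by (auto simp: fun_eq_iff Polynomial.poly_sum Polynomial.poly_monom power_mult_distrib mult_ac)
    ultimately show ?thesis by (simp add: mdiff_diff mdiff_cos)
  qed
  have i: "integrable lborel (\<lambda>u. (- 4) ^ N * ((sin (u * s) * sin (u * t)) ^ N * wt r u))"
    using ind[of N 0] unfolding e by (simp add: mult.assoc)
  then show "integrable lborel (\<lambda>u. (sin (u * s) * sin (u * t)) ^ N * wt r u)" by simp
  have "(- 4) ^ N * (LINT u|lborel. (sin (u * s) * sin (u * t)) ^ N * wt r u) = C * mdiff (\<lambda>z. \<bar>z\<bar> powr r) N s t 0"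
    using ind[of N 0] unfolding e by (simp add: mult.assoc)
  then show "(LINT u|lborel. (sin (u * s) * sin (u * t)) ^ N * wt r u) = C / (- 4) ^ N * mdiff (\<lambda>z. \<bar>z\<bar> powr r) N s t 0"
    by (simp add: field_simps)
qed

section \<open>The positive definite kernel on the real line\<close>

lemma double_sum_integral:
  assumes "\<And>a b. a \<in> A \<Longrightarrow> b \<in> A \<Longrightarrow> integrable M (\<phi> a b)" "snd ` set c \<subseteq> A"
  shows "(\<Sum>(x, a)\<leftarrow>c. \<Sum>(y, b)\<leftarrow>c. x * y * (LINT w|M. \<phi> a b w :: real)) =
    (LINT w|M. (\<Sum>(x, a)\<leftarrow>c. \<Sum>(y, b)\<leftarrow>c. x * y * \<phi> a b w))"
proof -
  have i1: "integrable M (\<lambda>w. \<Sum>(y, b)\<leftarrow>d. x * y * \<phi> a b w) \<and>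
      (LINT w|M. (\<Sum>(y, b)\<leftarrow>d. x * y * \<phi> a b w)) = (\<Sum>(y, b)\<leftarrow>d. x * y * (LINT w|M. \<phi> a b w))"
    if "snd ` set d \<subseteq> A" "a \<in> A" for x a d
    using that by (induction d) (auto simp: assms(1))
  have "integrable M (\<lambda>w. \<Sum>(x, a)\<leftarrow>d. \<Sum>(y, b)\<leftarrow>c. x * y * \<phi> a b w) \<and>
      (LINT w|M. (\<Sum>(x, a)\<leftarrow>d. \<Sum>(y, b)\<leftarrow>c. x * y * \<phi> a b w)) = (\<Sum>(x, a)\<leftarrow>d. \<Sum>(y, b)\<leftarrow>c. x * y * (LINT w|M. \<phi> a b w))"
    if "snd ` set d \<subseteq> A" for d
    using that by (induction d) (auto simp: i1[OF assms(2)])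
  then show ?thesis using assms(2) by simp
qed

lemma double_sum_product:
  "(\<Sum>(x, a)\<leftarrow>c. \<Sum>(y, b)\<leftarrow>c. x * y * (f a * f b)) = (\<Sum>(x, a)\<leftarrow>c. x * f a :: real)\<^sup>2"
proof -
  have 1: "(\<Sum>(y, b)\<leftarrow>d. x * y * (f a * f b)) = x * f a * (\<Sum>(y, b)\<leftarrow>d. y * f b)" for x a d
    by (induction d) (auto simp: algebra_simps)
  have "(\<Sum>(x, a)\<leftarrow>d. \<Sum>(y, b)\<leftarrow>c. x * y * (f a * f b)) = (\<Sum>(x, a)\<leftarrow>d. x * f a) * (\<Sum>(y, b)\<leftarrow>c. y * f b)" for d
    unfolding 1 by (induction d) (auto simp: algebra_simps)
  then show ?thesis by (simp add: power2_eq_square)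
qed

lemma double_sum_cmult:
  "(\<Sum>(x, a)\<leftarrow>c. \<Sum>(y, b)\<leftarrow>c. x * y * (f a b * t)) = (\<Sum>(x, a)\<leftarrow>c. \<Sum>(y, b)\<leftarrow>c. x * y * f a b :: real) * t"
proof -
  have 1: "(\<Sum>(y, b)\<leftarrow>d. x * y * (f a b * t)) = (\<Sum>(y, b)\<leftarrow>d. x * y * f a b) * t" for x a d
    by (induction d) (auto simp: algebra_simps)
  have "(\<Sum>(x, a)\<leftarrow>d. \<Sum>(y, b)\<leftarrow>c. x * y * (f a b * t)) = (\<Sum>(x, a)\<leftarrow>d. \<Sum>(y, b)\<leftarrow>c. x * y * f a b) * t" for d
    unfolding 1 by (induction d) (auto simp: algebra_simps)
  then show ?thesis .
qed

text \<open>The kernel is the Gram kernel of the functions sin(u s)^N in L_2 of the weight, hence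
  positive definite. If two of them agree almost everywhere, then sin(u s) = sin(u t) for
  arbitrarily small u > 0, and the derivatives at 0 give s = t.\<close>

lemma scalar_kernel:
  fixes r :: real
  assumes r: "r > 0" and ne: "\<And>n :: nat. r \<noteq> 2 * real n"
  obtains \<sigma> N where
    "\<And>c. 0 \<le> (\<Sum>(x, s)\<leftarrow>c. \<Sum>(y, t)\<leftarrow>c. x * y * (\<sigma> * mdiff (\<lambda>z. \<bar>z\<bar> powr r) N s t 0))"
    "\<And>s t. \<sigma> * mdiff (\<lambda>z. \<bar>z\<bar> powr r) N s s 0 - 2 * (\<sigma> * mdiff (\<lambda>z. \<bar>z\<bar> powr r) N s t 0)
       + \<sigma> * mdiff (\<lambda>z. \<bar>z\<bar> powr r) N t t 0 = 0 \<Longrightarrow> s = t"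
proof -
  \<comment> \<open>2 n is the first even integer above r; that r itself is not even makes 2 n - 2 <
    r strict.\<close>
  define n where "n = nat \<lfloor>r / 2\<rfloor> + 1"
  have n: "n \<ge> 1" "2 * real n - 2 < r" "r < 2 * real n"
  proof -
    have f: "real (nat \<lfloor>r / 2\<rfloor>) = of_int \<lfloor>r / 2\<rfloor>" using r by simp
    have fl: "of_int \<lfloor>r / 2\<rfloor> \<le> r / 2" "r / 2 < of_int \<lfloor>r / 2\<rfloor> + 1" by linarith+
    have "r < 2 * (of_int \<lfloor>r / 2\<rfloor> + 1)"
    proof -
      have "r < 2 * y" if "r / 2 < y" for y using that by simp
      from this[OF fl(2)] show ?thesis .
    qed
    then show "r < 2 * real n" unfolding n_def using f by simp
    have "2 * real (nat \<lfloor>r / 2\<rfloor>) \<le> r" using f fl(1) by simp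
    then have "2 * real (nat \<lfloor>r / 2\<rfloor>) < r" using ne[of "nat \<lfloor>r / 2\<rfloor>"] by linarith
    then show "2 * real n - 2 < r" unfolding n_def by simp
  qed (simp add: n_def)
  \<comment> \<open>Odd, so that the power of the sine determines the sine with its sign, and at
    least n, so that the Taylor polynomial is annihilated.\<close>
  define N where "N = 2 * n + 1"
  have N: "N \<ge> n" "odd N" unfolding N_def by auto
  define \<sigma> where "\<sigma> = (LINT u|lborel. cosrem n u * wt r u) / (- 4) ^ N"
  define k where "k = (\<lambda>s t. \<sigma> * mdiff (\<lambda>z. \<bar>z\<bar> powr r) N s t 0)"
  have i: "integrable lborel (\<lambda>u. (sin (u * s) * sin (u * t)) ^ N * wt r u)"
    and k: "(LINT u|lborel. (sin (u * s) * sin (u * t)) ^ N * wt r u) = k s t" for s t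
    using sine_kernel[OF n r N(1), of s t] unfolding k_def \<sigma>_def by auto
  have "0 \<le> (\<Sum>(x, s)\<leftarrow>c. \<Sum>(y, t)\<leftarrow>c. x * y * k s t)" for c
  proof -
    have "(\<Sum>(x, s)\<leftarrow>c. \<Sum>(y, t)\<leftarrow>c. x * y * k s t) =
       (LINT u|lborel. (\<Sum>(x, s)\<leftarrow>c. \<Sum>(y, t)\<leftarrow>c. x * y * ((sin (u * s) * sin (u * t)) ^ N * wt r u)))"
      unfolding k[symmetric] by (rule double_sum_integral[of UNIV]) (auto intro: i)
    also have "\<dots> = (LINT u|lborel. (\<Sum>(x, s)\<leftarrow>c. x * sin (u * s) ^ N)\<^sup>2 * wt r u)"
      unfolding double_sum_cmult power_mult_distrib double_sum_product ..
    also have "\<dots> \<ge> 0" by (simp add: wt_nonneg)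
    finally show ?thesis .
  qed
  moreover have "s = t" if z: "k s s - 2 * k s t + k t t = 0" for s t
  proof -
    let ?f = "\<lambda>u. (sin (u * s) ^ N - sin (u * t) ^ N)\<^sup>2 * wt r u"
    have e: "?f = (\<lambda>u. (sin (u * s) * sin (u * s)) ^ N * wt r u - 2 * ((sin (u * s) * sin (u * t)) ^ N * wt r u)
        + (sin (u * t) * sin (u * t)) ^ N * wt r u)"
      by (auto simp: fun_eq_iff power2_eq_square power_mult_distrib algebra_simps)
    have fi: "integrable lborel ?f" unfolding e by (intro Bochner_Integration.integrable_add Bochner_Integration.integrable_diff integrable_mult_right i)
    have "(LINT u|lborel. ?f u) = 0" unfolding e using z by (simp add: i k)
    then have ae: "AE u in lborel. ?f u = 0"
      using integral_nonneg_eq_0_iff_AE[OF fi] by (simp add: wt_nonneg)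
    \<comment> \<open>Otherwise the interval (0, e) would be a null set.\<close>
    have ex: "\<exists>u. 0 < u \<and> u < e \<and> sin (u * s) = sin (u * t)" if e: "e > 0" for e
    proof (rule ccontr)
      assume no: "\<not> ?thesis"
      have "AE u in lborel. u \<notin> {0<..<e}"
        using ae
      proof eventually_elim
        fix u assume u: "?f u = 0"
        show "u \<notin> {0<..<e}"
        proof
          assume ue: "u \<in> {0<..<e}"
          then have "sin (u * s) ^ N = sin (u * t) ^ N" using u by (simp add: wt_def)
          then have "root N (sin (u * s) ^ N) = root N (sin (u * t) ^ N)" by simp
          then have "sin (u * s) = sin (u * t)" using N(2) by (simp add: odd_real_root_power_cancel)
          then show False using no ue by auto
        qed
      qed
      then have "{0<..<e} \<in> null_sets lborel" by (subst AE_iff_null_sets) auto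
      then show False using e by (auto simp: null_sets_def)
    qed
    have "\<forall>m. \<exists>u. 0 < u \<and> u < 1 / real (Suc m) \<and> sin (u * s) = sin (u * t)" using ex by simp
    then obtain u where u: "\<And>m. 0 < u m" "\<And>m. u m < 1 / real (Suc m)" "\<And>m. sin (u m * s) = sin (u m * t)" by metis
    have u0: "u \<longlonglongrightarrow> 0"
      by (rule tendsto_sandwich[OF _ _ tendsto_const LIMSEQ_inverse_real_of_nat])
        (use u in \<open>auto intro!: always_eventually less_imp_le simp: inverse_eq_divide\<close>)
    have "((\<lambda>x. sin (x * s) - sin (x * t)) has_field_derivative (s - t)) (at 0)"
      by (auto intro!: derivative_eq_intros)
    then have "(\<lambda>h. (sin (h * s) - sin (h * t)) / h) \<midarrow>0\<rightarrow> s - t" by (auto simp: DERIV_def)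
    moreover have "filterlim u (at 0) sequentially"
      using u0 u(1) by (auto simp: filterlim_at less_imp_neq[symmetric] intro!: always_eventually)
    ultimately have "(\<lambda>m. (sin (u m * s) - sin (u m * t)) / u m) \<longlonglongrightarrow> s - t" by (rule filterlim_compose)
    then have "(\<lambda>m. 0) \<longlonglongrightarrow> s - t" by (simp add: u(3))
    then show ?thesis using LIMSEQ_unique[OF tendsto_const] by fastforce
  qed
  ultimately show ?thesis using that[of \<sigma> N] unfolding k_def by blast
qed

section \<open>Rigidity of orbits in \<open>L\<^sub>r\<close>\<close>

text \<open>Property (T) as a modulus: \<delta> depends on \<epsilon> alone and serves all invariant
  kernels. This is the form in which (T) is used from here on.\<close>

definition kernel_rigid :: "('g, 'm) monoid_scheme \<Rightarrow> 'g topology \<Rightarrow> 'g set \<Rightarrow> bool" where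
  "kernel_rigid G \<tau> Q \<longleftrightarrow> (\<forall>\<epsilon>>0. \<exists>\<delta>>0. \<forall>k. invariant_kernel G k \<longrightarrow>
     (\<forall>b\<in>carrier G. \<forall>e>0. \<exists>U. openin \<tau> U \<and> b \<in> U \<and> (\<forall>g\<in>U. k g g - 2 * k g b + k b b < e)) \<longrightarrow>
     (\<forall>q\<in>Q. k q q - 2 * k q \<one>\<^bsub>G\<^esub> + k \<one>\<^bsub>G\<^esub> \<one>\<^bsub>G\<^esub> \<le> \<delta>) \<longrightarrow>
     (\<forall>g\<in>carrier G. k g g - 2 * k g \<one>\<^bsub>G\<^esub> + k \<one>\<^bsub>G\<^esub> \<one>\<^bsub>G\<^esub> \<le> \<epsilon>))"

lemma kazhdan_kernel_rigid:
  assumes G: "topological_group G \<tau>" and T: "kazhdan_property_T G \<tau>"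
  obtains Q where "compactin \<tau> Q" "\<one>\<^bsub>G\<^esub> \<in> Q" "kernel_rigid G \<tau> Q"
proof -
  obtain Q \<kappa> where Q: "compactin \<tau> Q" "\<one>\<^bsub>G\<^esub> \<in> Q" "\<kappa> > 0"
    and K: "\<And>k \<delta> g. \<lbrakk>invariant_kernel G k;
       \<forall>b\<in>carrier G. \<forall>e>0. \<exists>U. openin \<tau> U \<and> b \<in> U \<and> (\<forall>g\<in>U. invariant_kernel.kdist k g b < e);
       \<forall>q\<in>Q. invariant_kernel.kdist k q \<one>\<^bsub>G\<^esub> \<le> \<delta>\<^sup>2; \<delta> \<ge> 0; g \<in> carrier G\<rbrakk>
       \<Longrightarrow> invariant_kernel.kdist k g \<one>\<^bsub>G\<^esub> \<le> (2 * \<delta> / \<kappa>)\<^sup>2"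
    by (rule kazhdan_kernel[OF G T], rule that)
  have "kernel_rigid G \<tau> Q" unfolding kernel_rigid_def
  proof (intro allI impI)
    fix \<epsilon> :: real assume e: "\<epsilon> > 0"
    \<comment> \<open>The solution of (2 d / \<kappa>)^2 = \<epsilon>; the tolerance on Q is the
      square of d.\<close>
    define d where "d = \<kappa> * sqrt \<epsilon> / 2"
    have d: "d > 0" unfolding d_def using e Q(3) by simp
    have de: "(2 * d / \<kappa>)\<^sup>2 = \<epsilon>" unfolding d_def using e Q(3) by simp
    show "\<exists>\<delta>>0. \<forall>k. invariant_kernel G k \<longrightarrow>
     (\<forall>b\<in>carrier G. \<forall>e>0. \<exists>U. openin \<tau> U \<and> b \<in> U \<and> (\<forall>g\<in>U. k g g - 2 * k g b + k b b < e)) \<longrightarrow>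
     (\<forall>q\<in>Q. k q q - 2 * k q \<one>\<^bsub>G\<^esub> + k \<one>\<^bsub>G\<^esub> \<one>\<^bsub>G\<^esub> \<le> \<delta>) \<longrightarrow>
     (\<forall>g\<in>carrier G. k g g - 2 * k g \<one>\<^bsub>G\<^esub> + k \<one>\<^bsub>G\<^esub> \<one>\<^bsub>G\<^esub> \<le> \<epsilon>)"
    proof (intro exI[of _ "d\<^sup>2"] conjI allI impI ballI)
      fix k :: "'a \<Rightarrow> 'a \<Rightarrow> real" and g
      assume inv: "invariant_kernel G k"
        and c: "\<forall>b\<in>carrier G. \<forall>e>0. \<exists>U. openin \<tau> U \<and> b \<in> U \<and> (\<forall>g\<in>U. k g g - 2 * k g b + k b b < e)"
        and s: "\<forall>q\<in>Q. k q q - 2 * k q \<one>\<^bsub>G\<^esub> + k \<one>\<^bsub>G\<^esub> \<one>\<^bsub>G\<^esub> \<le> d\<^sup>2" and g: "g \<in> carrier G"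
      have kd: "invariant_kernel.kdist k a b = k a a - 2 * k a b + k b b" for a b
        by (rule invariant_kernel.kdist_def[OF inv])
      show "k g g - 2 * k g \<one>\<^bsub>G\<^esub> + k \<one>\<^bsub>G\<^esub> \<one>\<^bsub>G\<^esub> \<le> \<epsilon>"
        using K[OF inv, unfolded kd, of d g, OF c s] d g unfolding de by simp
    qed (use d in simp)
  qed
  then show ?thesis using that Q by blast
qed

text \<open>An orbit seen only through the norms of its linear combinations. Neither an action on
  L_r nor linearity is assumed, so the images of orbits under nonlinear maps are covered.\<close>

locale isometric_family = group G for G :: "('g, 'm) monoid_scheme" (structure) +
  fixes \<tau> :: "'g topology" and r :: real and M :: "'w measure" and f :: "'g \<Rightarrow> 'w \<Rightarrow> real"
  assumes exponent: "r > 1" and top: "topspace \<tau> = carrier G"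
    and fam: "g \<in> carrier G \<Longrightarrow> f g \<in> Lp_set r M"
    and combination: "h \<in> carrier G \<Longrightarrow> (\<And>i. i < (n::nat) \<Longrightarrow> a i \<in> carrier G) \<Longrightarrow>
      pint r M (\<lambda>w. \<Sum>i<n. c i * f (h \<otimes> a i) w) = pint r M (\<lambda>w. \<Sum>i<n. c i * f (a i) w)"
    and fam_continuous: "b \<in> carrier G \<Longrightarrow> e > 0 \<Longrightarrow> \<exists>U. openin \<tau> U \<and> b \<in> U \<and> (\<forall>g\<in>U. pint r M (\<lambda>w. f g w - f b w) < e)"
begin

lemma r0: "r > 0" using exponent by simp

lemma pint_fam: assumes g: "g \<in> carrier G" shows "pint r M (f g) = pint r M (f \<one>)"
  using combination[of g 1 "\<lambda>_. \<one>" "\<lambda>_. 1"] g by simp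

lemma pint_two:
  assumes "h \<in> carrier G" "g \<in> carrier G" "g' \<in> carrier G"
  shows "pint r M (\<lambda>w. x * f (h \<otimes> g) w + y * f (h \<otimes> g') w) = pint r M (\<lambda>w. x * f g w + y * f g' w)"
  using combination[of h 2 "\<lambda>i. if i = 0 then g else g'" "\<lambda>i. if i = 0 then x else y"] assms
  by (simp add: numeral_2_eq_2)

text \<open>At each point w the values of the family form a combination for \<open>k0\<close>, so
  positivity holds pointwise and survives integration.\<close>

lemma invariant_kernelI:
  assumes k0: "homogeneous2 r k0" and psd: "\<And>c. 0 \<le> (\<Sum>(x, s)\<leftarrow>c. \<Sum>(y, t)\<leftarrow>c. x * y * k0 s t)"
    and sym: "\<And>s t. k0 s t = k0 t s"
    and inv: "\<And>h g g'. h \<in> carrier G \<Longrightarrow> g \<in> carrier G \<Longrightarrow> g' \<in> carrier G \<Longrightarrow>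
      (LINT w|M. k0 (f (h \<otimes> g) w) (f (h \<otimes> g') w)) = (LINT w|M. k0 (f g w) (f g' w))"
  shows "invariant_kernel G (\<lambda>g g'. LINT w|M. k0 (f g w) (f g' w))"
proof unfold_locales
  fix c :: "(real \<times> 'g) list" assume c: "snd ` set c \<subseteq> carrier G"
  have "(\<Sum>(x, a)\<leftarrow>c. \<Sum>(y, b)\<leftarrow>c. x * y * (LINT w|M. k0 (f a w) (f b w))) =
      (LINT w|M. (\<Sum>(x, a)\<leftarrow>c. \<Sum>(y, b)\<leftarrow>c. x * y * k0 (f a w) (f b w)))"
    by (rule double_sum_integral[OF _ c]) (intro homogeneous2_integrable[OF k0 r0] fam)
  also have "\<dots> \<ge> 0"
  proof (rule integral_nonneg_AE, rule AE_I2)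
    fix w
    have "(\<Sum>(x, s)\<leftarrow>map (\<lambda>(x, a). (x, f a w)) c. \<Sum>(y, t)\<leftarrow>map (\<lambda>(x, a). (x, f a w)) c. x * y * k0 s t)
        = (\<Sum>(x, a)\<leftarrow>c. \<Sum>(y, b)\<leftarrow>c. x * y * k0 (f a w) (f b w))"
      by (simp add: o_def case_prod_unfold)
    then show "0 \<le> (\<Sum>(x, a)\<leftarrow>c. \<Sum>(y, b)\<leftarrow>c. x * y * k0 (f a w) (f b w))" using psd by metis
  qed
  finally show "(\<Sum>(x, a)\<leftarrow>c. \<Sum>(y, b)\<leftarrow>c. x * y * (LINT w|M. k0 (f a w) (f b w))) \<ge> 0" .
qed (auto simp: sym inv)

end

lemma homogeneous2_powr_diff: "r > 0 \<Longrightarrow> homogeneous2 r (\<lambda>s t. \<bar>s - t\<bar> powr r)"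
  using homogeneous2_powr[OF homogeneous2_diff[OF homogeneous2_fst homogeneous2_snd], of r r] by simp

text \<open>The comparison with b = |s - t|^r, whose zeros are the diagonal.\<close>

lemma small_of_pint:
  assumes a: "homogeneous2 r a" and r: "r > 0" and z: "\<And>s. a s s \<le> 0" and e: "\<epsilon> > 0"
  obtains \<delta> where "\<delta> > 0"
    "\<And>(M :: 'w measure) f g. \<lbrakk>f \<in> Lp_set r M; g \<in> Lp_set r M; pint r M f \<le> B; pint r M g \<le> B;
       pint r M (\<lambda>w. f w - g w) \<le> \<delta>\<rbrakk> \<Longrightarrow> (LINT w|M. a (f w) (g w)) \<le> \<epsilon>"
proof -
  have b0: "0 \<le> \<bar>s - t\<bar> powr r" for s t :: real by simp
  have ba: "a s t \<le> 0" if "\<bar>s - t\<bar> powr r = 0" for s t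
  proof -
    have "s = t" using that by simp
    then show ?thesis using z[of t] by simp
  qed
  obtain \<delta> where \<delta>: "\<delta> > 0"
    "\<And>(M :: 'w measure) f g. \<lbrakk>f \<in> Lp_set r M; g \<in> Lp_set r M; pint r M f \<le> B; pint r M g \<le> B;
       (LINT w|M. \<bar>f w - g w\<bar> powr r) \<le> \<delta>\<rbrakk> \<Longrightarrow> (LINT w|M. a (f w) (g w)) \<le> \<epsilon>"
    by (rule homogeneous2_integral_small[OF a homogeneous2_powr_diff[OF r] r b0 ba e, of B], assumption, rule that)
  show ?thesis
    by (rule that[OF \<delta>(1)], rule \<delta>(2)) (simp_all add: pint_def)
qed

text \<open>The opposite comparison, with |s - t|^r in the role of the dominated function.\<close>

lemma pint_small_of:
  assumes b: "homogeneous2 r b" and r: "r > 0" and b0: "\<And>s t. 0 \<le> b s t" and z: "\<And>s t. b s t = 0 \<Longrightarrow> s = t" and e: "\<epsilon> > 0"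
  obtains \<delta> where "\<delta> > 0"
    "\<And>(M :: 'w measure) f g. \<lbrakk>f \<in> Lp_set r M; g \<in> Lp_set r M; pint r M f \<le> B; pint r M g \<le> B;
       (LINT w|M. b (f w) (g w)) \<le> \<delta>\<rbrakk> \<Longrightarrow> pint r M (\<lambda>w. f w - g w) \<le> \<epsilon>"
proof -
  have ba: "\<bar>s - t\<bar> powr r \<le> 0" if "b s t = 0" for s t using z[OF that] by simp
  obtain \<delta> where \<delta>: "\<delta> > 0"
    "\<And>(M :: 'w measure) f g. \<lbrakk>f \<in> Lp_set r M; g \<in> Lp_set r M; pint r M f \<le> B; pint r M g \<le> B;
       (LINT w|M. b (f w) (g w)) \<le> \<delta>\<rbrakk> \<Longrightarrow> (LINT w|M. \<bar>f w - g w\<bar> powr r) \<le> \<epsilon>"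
    by (rule homogeneous2_integral_small[OF homogeneous2_powr_diff[OF r] b r b0 ba e, of B], assumption, rule that)
  show ?thesis
    by (rule that[OF \<delta>(1)]) (simp add: pint_def[of r _ "\<lambda>w. _ w - _ w"] \<delta>(2))
qed

text \<open>The kernel distance is the integral of d(f g, f 1), where \<open>d\<close> vanishes on
  the diagonal. So a small L_r-displacement on Q makes it small on Q, and rigidity spreads this over
  G; the same estimate supplies the continuity that rigidity demands.\<close>

lemma kernel_step:
  assumes rig: "kernel_rigid G \<tau> Q" and Q: "Q \<subseteq> carrier G" and r: "r > 1"
    and k0: "homogeneous2 r k0" and psd: "\<And>c. 0 \<le> (\<Sum>(x, s)\<leftarrow>c. \<Sum>(y, t)\<leftarrow>c. x * y * k0 s t)"
    and sym: "\<And>s t. k0 s t = k0 t s" and e: "\<epsilon> > 0"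
  obtains \<delta> where "\<delta> > 0"
    "\<And>(M :: 'w measure) f g. \<lbrakk>isometric_family G \<tau> r M f;
      \<forall>h\<in>carrier G. \<forall>g\<in>carrier G. \<forall>g'\<in>carrier G.
        (LINT w|M. k0 (f (h \<otimes>\<^bsub>G\<^esub> g) w) (f (h \<otimes>\<^bsub>G\<^esub> g') w)) = (LINT w|M. k0 (f g w) (f g' w));
      pint r M (f \<one>\<^bsub>G\<^esub>) \<le> B; \<forall>q\<in>Q. pint r M (\<lambda>w. f q w - f \<one>\<^bsub>G\<^esub> w) \<le> \<delta>; g \<in> carrier G\<rbrakk>
      \<Longrightarrow> (LINT w|M. k0 (f g w) (f g w) - 2 * k0 (f g w) (f \<one>\<^bsub>G\<^esub> w) + k0 (f \<one>\<^bsub>G\<^esub> w) (f \<one>\<^bsub>G\<^esub> w)) \<le> \<epsilon>"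
proof -
  define d where "d = (\<lambda>s t. k0 s s - 2 * k0 s t + k0 t t)"
  have r0: "r > 0" using r by simp
  \<comment> \<open>The diagonal values are regarded as functions of two variables, so that
    \<open>d\<close> is a sum within the class.\<close>
  have k1: "homogeneous2 r (\<lambda>s t. k0 s s)" "homogeneous2 r (\<lambda>s t. k0 t t)"
  proof -
    have c: "continuous_on UNIV (\<lambda>x. k0 (fst x) (snd x))" using k0 by (simp add: homogeneous2_def)
    have "continuous_on UNIV (\<lambda>x. k0 (fst (fst x, fst x)) (snd (fst x, fst x)))" "continuous_on UNIV (\<lambda>x. k0 (fst (snd x, snd x)) (snd (snd x, snd x)))"
      by (rule continuous_on_compose2[OF c]; (intro continuous_intros)?; simp)+
    then show "homogeneous2 r (\<lambda>s t. k0 s s)" "homogeneous2 r (\<lambda>s t. k0 t t)"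
      using homogeneous2D[OF k0] by (simp_all add: homogeneous2_def)
  qed
  have dh: "homogeneous2 r d" unfolding d_def
    by (intro homogeneous2_add[OF homogeneous2_diff[OF k1(1) homogeneous2_cmult[OF k0]] k1(2)])
  have "\<exists>\<delta>>0. \<forall>k. invariant_kernel G k \<longrightarrow>
     (\<forall>b\<in>carrier G. \<forall>e>0. \<exists>U. openin \<tau> U \<and> b \<in> U \<and> (\<forall>g\<in>U. k g g - 2 * k g b + k b b < e)) \<longrightarrow>
     (\<forall>q\<in>Q. k q q - 2 * k q \<one>\<^bsub>G\<^esub> + k \<one>\<^bsub>G\<^esub> \<one>\<^bsub>G\<^esub> \<le> \<delta>) \<longrightarrow>
     (\<forall>g\<in>carrier G. k g g - 2 * k g \<one>\<^bsub>G\<^esub> + k \<one>\<^bsub>G\<^esub> \<one>\<^bsub>G\<^esub> \<le> \<epsilon>)"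
    by (rule rig[unfolded kernel_rigid_def, THEN spec, THEN mp, OF e])
  then obtain \<theta> where th: "\<theta> > 0" and K0: "\<forall>k. invariant_kernel G k \<longrightarrow>
     (\<forall>b\<in>carrier G. \<forall>e>0. \<exists>U. openin \<tau> U \<and> b \<in> U \<and> (\<forall>g\<in>U. k g g - 2 * k g b + k b b < e)) \<longrightarrow>
     (\<forall>q\<in>Q. k q q - 2 * k q \<one>\<^bsub>G\<^esub> + k \<one>\<^bsub>G\<^esub> \<one>\<^bsub>G\<^esub> \<le> \<theta>) \<longrightarrow>
     (\<forall>g\<in>carrier G. k g g - 2 * k g \<one>\<^bsub>G\<^esub> + k \<one>\<^bsub>G\<^esub> \<one>\<^bsub>G\<^esub> \<le> \<epsilon>)"
    by (elim exE conjE)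
  note K = K0[THEN spec, THEN mp, THEN mp, THEN mp]
  have dz: "d s s \<le> 0" for s by (simp add: d_def)
  obtain \<delta> where \<delta>: "\<delta> > 0" "\<And>(M :: 'w measure) f g. \<lbrakk>f \<in> Lp_set r M; g \<in> Lp_set r M; pint r M f \<le> B; pint r M g \<le> B;
       pint r M (\<lambda>w. f w - g w) \<le> \<delta>\<rbrakk> \<Longrightarrow> (LINT w|M. d (f w) (g w)) \<le> \<theta>"
    by (rule small_of_pint[OF dh r0 dz th, of B], rule that)
  show ?thesis
  proof (rule that[OF \<delta>(1)])
    fix M :: "'w measure" and f g
    assume iso: "isometric_family G \<tau> r M f"
      and inv: "\<forall>h\<in>carrier G. \<forall>g\<in>carrier G. \<forall>g'\<in>carrier G.
        (LINT w|M. k0 (f (h \<otimes>\<^bsub>G\<^esub> g) w) (f (h \<otimes>\<^bsub>G\<^esub> g') w)) = (LINT w|M. k0 (f g w) (f g' w))"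
      and B: "pint r M (f \<one>\<^bsub>G\<^esub>) \<le> B" and q: "\<forall>q\<in>Q. pint r M (\<lambda>w. f q w - f \<one>\<^bsub>G\<^esub> w) \<le> \<delta>" and g: "g \<in> carrier G"
    interpret isometric_family G \<tau> r M f by (rule iso)
    define k where "k = (\<lambda>g g'. LINT w|M. k0 (f g w) (f g' w))"
    have kd: "k a a - 2 * k a b + k b b = (LINT w|M. d (f a w) (f b w))" if "a \<in> carrier G" "b \<in> carrier G" for a b
      unfolding k_def d_def using that by (simp add: homogeneous2_integrable[OF k0 r0] fam)
    have Bg: "pint r M (f g) \<le> B" if "g \<in> carrier G" for g using pint_fam[OF that] B by simp
    have ik: "invariant_kernel G k" unfolding k_def by (rule invariant_kernelI[OF k0 psd sym]) (use inv in blast)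
    have "\<forall>g\<in>carrier G. k g g - 2 * k g \<one>\<^bsub>G\<^esub> + k \<one>\<^bsub>G\<^esub> \<one>\<^bsub>G\<^esub> \<le> \<epsilon>"
    proof (rule K[OF ik])
      show "\<forall>q\<in>Q. k q q - 2 * k q \<one>\<^bsub>G\<^esub> + k \<one>\<^bsub>G\<^esub> \<one>\<^bsub>G\<^esub> \<le> \<theta>"
      proof
        fix x assume x: "x \<in> Q"
        then have xG: "x \<in> carrier G" using Q by blast
        show "k x x - 2 * k x \<one>\<^bsub>G\<^esub> + k \<one>\<^bsub>G\<^esub> \<one>\<^bsub>G\<^esub> \<le> \<theta>"
          unfolding kd[OF xG one_closed]
          by (rule \<delta>(2)[OF fam[OF xG] fam[OF one_closed] Bg[OF xG] Bg[OF one_closed] bspec[OF q x]])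
      qed
      show "\<forall>b\<in>carrier G. \<forall>e>0. \<exists>U. openin \<tau> U \<and> b \<in> U \<and> (\<forall>g\<in>U. k g g - 2 * k g b + k b b < e)"
      proof (intro ballI allI impI)
        fix b and e :: real assume b: "b \<in> carrier G" and e: "e > 0"
        have e2: "e / 2 > 0" using e by simp
        obtain \<eta> where eta: "\<eta> > 0" "\<And>(M :: 'w measure) f g. \<lbrakk>f \<in> Lp_set r M; g \<in> Lp_set r M; pint r M f \<le> B; pint r M g \<le> B;
           pint r M (\<lambda>w. f w - g w) \<le> \<eta>\<rbrakk> \<Longrightarrow> (LINT w|M. d (f w) (g w)) \<le> e / 2"
          by (rule small_of_pint[OF dh r0 dz e2, of B], rule that)
        obtain U where U: "openin \<tau> U" "b \<in> U" "\<And>g. g \<in> U \<Longrightarrow> pint r M (\<lambda>w. f g w - f b w) < \<eta>"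
          using fam_continuous[OF b eta(1)] by blast
        have "k g g - 2 * k g b + k b b < e" if g: "g \<in> U" for g
        proof -
          have gG: "g \<in> carrier G" using g openin_subset[OF U(1)] top by auto
          have "(LINT w|M. d (f g w) (f b w)) \<le> e / 2"
            by (rule eta(2)[OF fam[OF gG] fam[OF b] Bg[OF gG] Bg[OF b] less_imp_le[OF U(3)[OF g]]])
          then show ?thesis unfolding kd[OF gG b] using e by linarith
        qed
        then show "\<exists>U. openin \<tau> U \<and> b \<in> U \<and> (\<forall>g\<in>U. k g g - 2 * k g b + k b b < e)" using U(1,2) by blast
      qed
    qed
    then have "k g g - 2 * k g \<one>\<^bsub>G\<^esub> + k \<one>\<^bsub>G\<^esub> \<one>\<^bsub>G\<^esub> \<le> \<epsilon>" using g by blast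
    then show "(LINT w|M. k0 (f g w) (f g w) - 2 * k0 (f g w) (f \<one>\<^bsub>G\<^esub> w) + k0 (f \<one>\<^bsub>G\<^esub> w) (f \<one>\<^bsub>G\<^esub> w)) \<le> \<epsilon>"
      unfolding kd[OF g one_closed] d_def .
  qed
qed

text \<open>The third argument must be a general a s + b t because the recursion shifts it; the
  kernel is the case a = b = 0.\<close>

lemma homogeneous2_mdiff:
  assumes r: "r > 0"
  shows "homogeneous2 r (\<lambda>s t. mdiff (\<lambda>z. \<bar>z\<bar> powr r) N s t (a * s + b * t))"
proof (induction N arbitrary: a b)
  case 0
  show ?case using homogeneous2_powr[OF homogeneous2_lin r, of r a b] by simp
next
  case (Suc N)
  have e: "a * s + b * t + s + t = (a + 1) * s + (b + 1) * t" "a * s + b * t + s - t = (a + 1) * s + (b - 1) * t"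
    "a * s + b * t - s + t = (a - 1) * s + (b + 1) * t" "a * s + b * t - s - t = (a - 1) * s + (b - 1) * t" for s t :: real
    by (simp_all add: algebra_simps)
  show ?case unfolding mdiff.simps e by (rule homogeneous2_add[OF homogeneous2_diff[OF homogeneous2_diff[OF Suc Suc] Suc] Suc])
qed

text \<open>For N = 0 this is the invariance of the norm of a f(g) + b f(g'), and each step only
  adds integrals of the same kind.\<close>

lemma (in isometric_family) mdiff_invariant:
  assumes h: "h \<in> carrier G" and g: "g \<in> carrier G" and g': "g' \<in> carrier G"
  shows "(LINT w|M. mdiff (\<lambda>z. \<bar>z\<bar> powr r) N (f (h \<otimes>\<^bsub>G\<^esub> g) w) (f (h \<otimes>\<^bsub>G\<^esub> g') w) (a * f (h \<otimes>\<^bsub>G\<^esub> g) w + b * f (h \<otimes>\<^bsub>G\<^esub> g') w))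
     = (LINT w|M. mdiff (\<lambda>z. \<bar>z\<bar> powr r) N (f g w) (f g' w) (a * f g w + b * f g' w))"
proof (induction N arbitrary: a b)
  case 0
  then show ?case using pint_two[OF h g g', of a b] by (simp add: pint_def)
next
  case (Suc N)
  have e: "a * s + b * t + s + t = (a + 1) * s + (b + 1) * t" "a * s + b * t + s - t = (a + 1) * s + (b - 1) * t"
    "a * s + b * t - s + t = (a - 1) * s + (b + 1) * t" "a * s + b * t - s - t = (a - 1) * s + (b - 1) * t" for s t :: real
    by (simp_all add: algebra_simps)
  have i: "integrable M (\<lambda>w. mdiff (\<lambda>z. \<bar>z\<bar> powr r) N (f x w) (f y w) (a * f x w + b * f y w))"
    if "x \<in> carrier G" "y \<in> carrier G" for x y a b
    by (rule homogeneous2_integrable[OF homogeneous2_mdiff[OF r0] r0 fam[OF that(1)] fam[OF that(2)]])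
  have hg: "h \<otimes>\<^bsub>G\<^esub> g \<in> carrier G" "h \<otimes>\<^bsub>G\<^esub> g' \<in> carrier G" using h g g' by auto
  show ?case unfolding mdiff.simps e using i[OF hg] i[OF g g'] Suc.IH by simp
qed

text \<open>The distance \<open>d\<close> of the scalar kernel vanishes on the diagonal only, so a
  small kernel distance turns back into a small L_r-distance.\<close>

proposition orbit_rigidity_not_even:
  assumes rig: "kernel_rigid G \<tau> Q" and Q: "Q \<subseteq> carrier G" and r: "r > 1" and ne: "\<And>n :: nat. r \<noteq> 2 * real n" and e: "\<epsilon> > 0"
  obtains \<delta> where "\<delta> > 0"
    "\<And>(M :: 'w measure) f g. \<lbrakk>isometric_family G \<tau> r M f; pint r M (f \<one>\<^bsub>G\<^esub>) \<le> B;
      \<forall>q\<in>Q. pint r M (\<lambda>w. f q w - f \<one>\<^bsub>G\<^esub> w) \<le> \<delta>; g \<in> carrier G\<rbrakk>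
      \<Longrightarrow> pint r M (\<lambda>w. f g w - f \<one>\<^bsub>G\<^esub> w) \<le> \<epsilon>"
proof -
  have r0: "r > 0" using r by simp
  obtain \<sigma> N where psd: "\<And>c. 0 \<le> (\<Sum>(x, s)\<leftarrow>c. \<Sum>(y, t)\<leftarrow>c. x * y * (\<sigma> * mdiff (\<lambda>z. \<bar>z\<bar> powr r) N s t 0))"
    and sep: "\<And>s t. \<sigma> * mdiff (\<lambda>z. \<bar>z\<bar> powr r) N s s 0 - 2 * (\<sigma> * mdiff (\<lambda>z. \<bar>z\<bar> powr r) N s t 0)
       + \<sigma> * mdiff (\<lambda>z. \<bar>z\<bar> powr r) N t t 0 = 0 \<Longrightarrow> s = t"
    by (rule scalar_kernel[OF r0 ne], rule that)
  define k0 where "k0 = (\<lambda>s t. \<sigma> * mdiff (\<lambda>z. \<bar>z\<bar> powr r) N s t 0)"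
  have k0: "homogeneous2 r k0" unfolding k0_def
    using homogeneous2_cmult[OF homogeneous2_mdiff[OF r0, of N 0 0], of \<sigma>] by simp
  have sym: "k0 s t = k0 t s" for s t unfolding k0_def by (subst mdiff_sym) simp
  have psd': "0 \<le> (\<Sum>(x, s)\<leftarrow>c. \<Sum>(y, t)\<leftarrow>c. x * y * k0 s t)" for c unfolding k0_def by (rule psd)
  define d where "d = (\<lambda>s t. k0 s s - 2 * k0 s t + k0 t t)"
  \<comment> \<open>Positive definiteness on the two points s and t with coefficients 1 and
    -1.\<close>
  have d0: "0 \<le> d s t" for s t
    using psd'[of "[(1, s), (- 1, t)]"] by (simp add: d_def sym[of t s])
  have dz: "s = t" if "d s t = 0" for s t using sep[of s t] that by (simp add: d_def k0_def)
  have kst: "homogeneous2 r (\<lambda>s t. k0 s s)" "homogeneous2 r (\<lambda>s t. k0 t t)"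
  proof -
    have c: "continuous_on UNIV (\<lambda>x. k0 (fst x) (snd x))" using k0 by (simp add: homogeneous2_def)
    have "continuous_on UNIV (\<lambda>x. k0 (fst (fst x, fst x)) (snd (fst x, fst x)))" "continuous_on UNIV (\<lambda>x. k0 (fst (snd x, snd x)) (snd (snd x, snd x)))"
      by (rule continuous_on_compose2[OF c]; (intro continuous_intros)?; simp)+
    then show "homogeneous2 r (\<lambda>s t. k0 s s)" "homogeneous2 r (\<lambda>s t. k0 t t)"
      using homogeneous2D[OF k0] by (simp_all add: homogeneous2_def)
  qed
  have dh: "homogeneous2 r d" unfolding d_def
    by (intro homogeneous2_add[OF homogeneous2_diff[OF kst(1) homogeneous2_cmult[OF k0]] kst(2)])
  obtain \<eta> where eta: "\<eta> > 0" "\<And>(M :: 'w measure) f g. \<lbrakk>f \<in> Lp_set r M; g \<in> Lp_set r M; pint r M f \<le> B; pint r M g \<le> B;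
       (LINT w|M. d (f w) (g w)) \<le> \<eta>\<rbrakk> \<Longrightarrow> pint r M (\<lambda>w. f w - g w) \<le> \<epsilon>"
    by (rule pint_small_of[OF dh r0 d0 dz e, where B = B]) (assumption, rule that)
  obtain \<delta> where \<delta>: "\<delta> > 0"
    "\<And>(M :: 'w measure) f g. \<lbrakk>isometric_family G \<tau> r M f;
      \<forall>h\<in>carrier G. \<forall>g\<in>carrier G. \<forall>g'\<in>carrier G.
        (LINT w|M. k0 (f (h \<otimes>\<^bsub>G\<^esub> g) w) (f (h \<otimes>\<^bsub>G\<^esub> g') w)) = (LINT w|M. k0 (f g w) (f g' w));
      pint r M (f \<one>\<^bsub>G\<^esub>) \<le> B; \<forall>q\<in>Q. pint r M (\<lambda>w. f q w - f \<one>\<^bsub>G\<^esub> w) \<le> \<delta>; g \<in> carrier G\<rbrakk>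
      \<Longrightarrow> (LINT w|M. k0 (f g w) (f g w) - 2 * k0 (f g w) (f \<one>\<^bsub>G\<^esub> w) + k0 (f \<one>\<^bsub>G\<^esub> w) (f \<one>\<^bsub>G\<^esub> w)) \<le> \<eta>"
    by (rule kernel_step[OF rig Q r k0 psd' sym eta(1), of B], rule that)
  show ?thesis
  proof (rule that[OF \<delta>(1)])
    fix M :: "'w measure" and f g
    assume iso: "isometric_family G \<tau> r M f" and B: "pint r M (f \<one>\<^bsub>G\<^esub>) \<le> B"
      and q: "\<forall>q\<in>Q. pint r M (\<lambda>w. f q w - f \<one>\<^bsub>G\<^esub> w) \<le> \<delta>" and g: "g \<in> carrier G"
    interpret isometric_family G \<tau> r M f by (rule iso)
    have inv: "\<forall>h\<in>carrier G. \<forall>g\<in>carrier G. \<forall>g'\<in>carrier G.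
        (LINT w|M. k0 (f (h \<otimes>\<^bsub>G\<^esub> g) w) (f (h \<otimes>\<^bsub>G\<^esub> g') w)) = (LINT w|M. k0 (f g w) (f g' w))"
      using mdiff_invariant[where N = N and a = 0 and b = 0] unfolding k0_def by simp
    have "(LINT w|M. d (f g w) (f \<one>\<^bsub>G\<^esub> w)) \<le> \<eta>" unfolding d_def by (rule \<delta>(2)[OF iso inv B q g])
    then show "pint r M (\<lambda>w. f g w - f \<one>\<^bsub>G\<^esub> w) \<le> \<epsilon>"
      using B pint_fam[OF g] by (intro eta(2) fam g) auto
  qed
qed

section \<open>Even exponents\<close>

text \<open>Every factor is at most the largest one, whose power is among the summands. This
  replaces Hoelder's inequality for products of many functions.\<close>

lemma prod_list_le_sum_power:
  fixes xs :: "real list"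
  assumes "\<And>x. x \<in> set xs \<Longrightarrow> 0 \<le> x" "xs \<noteq> []"
  shows "prod_list xs \<le> (\<Sum>x\<leftarrow>xs. x ^ length xs)"
proof -
  define B where "B = Max (set xs)"
  have B: "B \<in> set xs" "\<And>x. x \<in> set xs \<Longrightarrow> x \<le> B" unfolding B_def using assms(2) by auto
  have "prod_list ys \<le> B ^ length ys" "0 \<le> prod_list ys" if "set ys \<subseteq> set xs" for ys
    using that by (induction ys) (use B assms(1) in \<open>auto intro!: mult_mono\<close>)
  then have "prod_list xs \<le> B ^ length xs" by simp
  also have "B ^ length xs \<le> (\<Sum>x\<leftarrow>xs. x ^ length xs)"
    using B(1) assms(1) by (intro member_le_sum_list) auto
  finally show ?thesis .
qed

lemma abs_powr_nat: "m > 0 \<Longrightarrow> \<bar>x :: real\<bar> powr real m = \<bar>x\<bar> ^ m"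
  by (cases "x = 0") (auto simp: powr_realpow)

lemma abs_prod_list: "\<bar>prod_list xs\<bar> = prod_list (map abs (xs :: real list))"
  by (induction xs) (auto simp: abs_mult)

lemma integrable_prod_list:
  fixes us :: "('w \<Rightarrow> real) list"
  assumes us: "\<And>u. u \<in> set us \<Longrightarrow> u \<in> Lp_set (real (length us)) M" and ne: "us \<noteq> []"
  shows "integrable M (\<lambda>w. prod_list (map (\<lambda>u. u w) us))"
proof -
  let ?m = "length us"
  have m: "?m > 0" using ne by simp
  have "integrable M (\<lambda>w. \<Sum>u\<leftarrow>vs. \<bar>u w\<bar> ^ ?m)" if "set vs \<subseteq> set us" for vs
    using that
  proof (induction vs)
    case (Cons v vs)
    have "v \<in> Lp_set (real ?m) M" by (rule us) (use Cons.prems in simp)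
    from Lp_set_integrable[OF this] have "integrable M (\<lambda>w. \<bar>v w\<bar> ^ ?m)" unfolding abs_powr_nat[OF m] .
    moreover have "integrable M (\<lambda>w. \<Sum>u\<leftarrow>vs. \<bar>u w\<bar> ^ ?m)" by (rule Cons.IH) (use Cons.prems in simp)
    ultimately have "integrable M (\<lambda>w. \<bar>v w\<bar> ^ ?m + (\<Sum>u\<leftarrow>vs. \<bar>u w\<bar> ^ ?m))"
      by (rule Bochner_Integration.integrable_add)
    then show ?case by simp
  qed simp
  from this[OF subset_refl] have i: "integrable M (\<lambda>w. \<Sum>u\<leftarrow>us. \<bar>u w\<bar> ^ ?m)" .
  have meas: "(\<lambda>w. prod_list (map (\<lambda>u. u w) vs)) \<in> borel_measurable M" if "set vs \<subseteq> set us" for vs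
    using that
  proof (induction vs)
    case (Cons v vs)
    have "v \<in> borel_measurable M" by (rule Lp_set_measurable[OF us]) (use Cons.prems in auto)
    moreover have "(\<lambda>w. prod_list (map (\<lambda>u. u w) vs)) \<in> borel_measurable M"
      by (rule Cons.IH) (use Cons.prems in simp)
    ultimately have "(\<lambda>w. v w * prod_list (map (\<lambda>u. u w) vs)) \<in> borel_measurable M"
      by (rule borel_measurable_times)
    then show ?case by (simp only: list.map prod_list.Cons)
  qed simp
  show ?thesis
  proof (rule Bochner_Integration.integrable_bound[OF i meas[OF subset_refl]])
    show "AE w in M. norm (prod_list (map (\<lambda>u. u w) us)) \<le> norm (\<Sum>u\<leftarrow>us. \<bar>u w\<bar> ^ ?m)"
    proof (rule AE_I2)
      fix w
      have "\<bar>prod_list (map (\<lambda>u. u w) us)\<bar> \<le> (\<Sum>u\<leftarrow>us. \<bar>u w\<bar> ^ ?m)"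
      proof -
        have "prod_list (map (\<lambda>u. \<bar>u w\<bar>) us) \<le> (\<Sum>x\<leftarrow>map (\<lambda>u. \<bar>u w\<bar>) us. x ^ length (map (\<lambda>u. \<bar>u w\<bar>) us))"
          by (rule prod_list_le_sum_power) (use ne in auto)
        then show ?thesis unfolding abs_prod_list map_map o_def length_map .
      qed
      then show "norm (prod_list (map (\<lambda>u. u w) us)) \<le> norm (\<Sum>u\<leftarrow>us. \<bar>u w\<bar> ^ ?m)"
        by (metis abs_ge_self order_trans real_norm_def)
    qed
  qed
qed

section \<open>Invariant integrals of degree 2 n\<close>

locale even_family = isometric_family +
  fixes n :: nat
  assumes even_exponent: "r = real (2 * n)" and n0: "n > 0"
begin

lemma pint_even: "pint r M u = (LINT w|M. u w ^ (2 * n))"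
proof -
  have "\<bar>x\<bar> powr r = x ^ (2 * n)" for x :: real
    unfolding even_exponent using n0 by (subst abs_powr_nat) (simp_all add: power_even_abs)
  then show ?thesis by (simp add: pint_def)
qed

text \<open>Polarisation: since \<open>r = 2n\<close>, the integrals of products of \<open>2n\<close> members of the family are determined
  by the \<open>r\<close>-norms of the linear combinations, hence are invariant.\<close>

lemma polarization:
  assumes h: "h \<in> carrier G"
  shows "length gs \<le> 2 * n \<Longrightarrow> set gs \<subseteq> carrier G \<Longrightarrow> (\<And>i. i < (k::nat) \<Longrightarrow> a i \<in> carrier G) \<Longrightarrow>
    (LINT w|M. prod_list (map (\<lambda>g. f (h \<otimes> g) w) gs) * (\<Sum>i<k. c i * f (h \<otimes> a i) w) ^ (2 * n - length gs))
    = (LINT w|M. prod_list (map (\<lambda>g. f g w) gs) * (\<Sum>i<k. c i * f (a i) w) ^ (2 * n - length gs))"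
proof (induction gs arbitrary: k a c)
  case Nil
  show ?case using combination[OF h Nil.prems(3)] unfolding pint_even by simp
next
  case (Cons g gs)
  define m where "m = 2 * n - length (g # gs)"
  have m: "2 * n - length gs = Suc m" unfolding m_def using Cons.prems(1) by simp
  have gG: "g \<in> carrier G" "set gs \<subseteq> carrier G" using Cons.prems by auto
  define P where "P = (\<lambda>h w. prod_list (map (\<lambda>g. f (h \<otimes> g) w) gs))"
  define z where "z = (\<lambda>h w. \<Sum>i<k. c i * f (h \<otimes> a i) w)"
  define J where "J = (\<lambda>h j. (LINT w|M. P h w * (f (h \<otimes> g) w ^ j * z h w ^ (Suc m - j))))"
  have zL: "z h \<in> Lp_set r M" if "h \<in> carrier G" for h
  proof -
    have "(\<lambda>w. \<Sum>i<l. c i * f (h \<otimes> a i) w) \<in> Lp_set r M" if "l \<le> k" for l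
      using that
    proof (induction l)
      case 0 then show ?case using Lp_set_zero[OF r0] by simp
    next
      case (Suc l)
      show ?case unfolding sum.lessThan_Suc
        using Suc \<open>h \<in> carrier G\<close> Cons.prems(3) by (intro Lp_set_add[OF r0] Lp_set_cmult[OF r0] fam) auto
    qed
    then show ?thesis unfolding z_def by simp
  qed
  have int: "integrable M (\<lambda>w. P h w * (f (h \<otimes> g) w ^ j * z h w ^ (Suc m - j)))" if hG: "h \<in> carrier G" and j: "j \<le> Suc m" for h j
  proof -
    define us where "us = map (\<lambda>g. f (h \<otimes> g)) gs @ replicate j (f (h \<otimes> g)) @ replicate (Suc m - j) (z h)"
    have len: "length us = 2 * n" unfolding us_def using j m Cons.prems(1) by simp
    have "us \<noteq> []" using len n0 by auto
    moreover have "u \<in> Lp_set r M" if "u \<in> set us" for u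
      using that gG hG fam zL unfolding us_def by (auto simp: subset_iff)
    then have "u \<in> Lp_set (real (length us)) M" if "u \<in> set us" for u
      using that unfolding len even_exponent[symmetric] by blast
    ultimately have "integrable M (\<lambda>w. prod_list (map (\<lambda>u. u w) us))" by (intro integrable_prod_list)
    moreover have "(\<lambda>w. prod_list (map (\<lambda>u. u w) us)) = (\<lambda>w. P h w * (f (h \<otimes> g) w ^ j * z h w ^ (Suc m - j)))"
      by (auto simp: fun_eq_iff us_def P_def o_def)
    ultimately show ?thesis by simp
  qed
  have expand: "(LINT w|M. P h w * (z h w + t * f (h \<otimes> g) w) ^ Suc m) = (\<Sum>j\<le>Suc m. (real (Suc m choose j) * J h j) * t ^ j)"
    if "h \<in> carrier G" for h t
  proof -
    have "P h w * (z h w + t * f (h \<otimes> g) w) ^ Suc m = (\<Sum>j\<le>Suc m. (real (Suc m choose j) * t ^ j) * (P h w * (f (h \<otimes> g) w ^ j * z h w ^ (Suc m - j))))" for w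
      unfolding add.commute[of "z h w"] binomial_ring sum_distrib_left
      by (intro sum.cong) (auto simp: power_mult_distrib mult_ac)
    then have "(LINT w|M. P h w * (z h w + t * f (h \<otimes> g) w) ^ Suc m) =
        (LINT w|M. (\<Sum>j\<le>Suc m. (real (Suc m choose j) * t ^ j) * (P h w * (f (h \<otimes> g) w ^ j * z h w ^ (Suc m - j)))))" by simp
    also have "\<dots> = (\<Sum>j\<le>Suc m. (real (Suc m choose j) * t ^ j) * J h j)"
      unfolding J_def by (subst Bochner_Integration.integral_sum) (auto intro!: integrable_mult_right int that)
    finally show ?thesis by (simp add: mult_ac)
  qed
  \<comment> \<open>The induction hypothesis is applied to the combination enlarged by t f(g). Both
    sides are polynomials in t, and their coefficients of t are Suc m times the integrals to be
    compared.\<close>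
  have "(LINT w|M. P h w * (z h w + t * f (h \<otimes> g) w) ^ Suc m) = (LINT w|M. P \<one> w * (z \<one> w + t * f (\<one> \<otimes> g) w) ^ Suc m)" for t
  proof -
    let ?a = "\<lambda>i. if i = k then g else a i" and ?c = "\<lambda>i. if i = k then t else c i"
    have aG: "i < Suc k \<Longrightarrow> ?a i \<in> carrier G" for i using gG Cons.prems(3) by auto
    have s: "(\<Sum>i<Suc k. ?c i * f (h' \<otimes> ?a i) w) = (\<Sum>i<k. c i * f (h' \<otimes> a i) w) + t * f (h' \<otimes> g) w" for h' w
      by simp
    have s1: "(\<Sum>i<Suc k. ?c i * f (?a i) w) = (\<Sum>i<k. c i * f (\<one> \<otimes> a i) w) + t * f (\<one> \<otimes> g) w" for w
      using gG Cons.prems(3) by simp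
    have p1: "prod_list (map (\<lambda>g. f g w) gs) = prod_list (map (\<lambda>g. f (\<one> \<otimes> g) w) gs)" for w
      using gG by (intro arg_cong[of _ _ prod_list] map_cong) auto
    show ?thesis using Cons.IH[of "Suc k" ?a ?c, OF _ gG(2) aG] Cons.prems(1)
      unfolding m s s1 p1 P_def z_def by simp
  qed
  then have "\<forall>t. (\<Sum>j\<le>Suc m. (real (Suc m choose j) * J h j) * t ^ j) = (\<Sum>j\<le>Suc m. (real (Suc m choose j) * J \<one> j) * t ^ j)"
    using expand[OF h] expand[OF one_closed] by simp
  then have "real (Suc m choose j) * J h j = real (Suc m choose j) * J \<one> j" if "j \<le> Suc m" for j
    using that polyfun_eq_coeffs[of "\<lambda>j. real (Suc m choose j) * J h j" "Suc m" "\<lambda>j. real (Suc m choose j) * J \<one> j"] by auto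
  from this[of 1] have J: "J h 1 = J \<one> 1" by simp
  have e1: "prod_list (map (\<lambda>g. f (h \<otimes> g) w) (g # gs)) * (\<Sum>i<k. c i * f (h \<otimes> a i) w) ^ m
      = P h w * (f (h \<otimes> g) w ^ 1 * z h w ^ (Suc m - 1))" for w
    unfolding P_def z_def by simp
  have p1: "prod_list (map (\<lambda>g. f g w) gs) = P \<one> w" "(\<Sum>i<k. c i * f (a i) w) = z \<one> w" for w
    unfolding P_def z_def using gG Cons.prems(3) by (auto intro!: arg_cong[of _ _ prod_list] map_cong sum.cong)
  have e2: "prod_list (map (\<lambda>g. f g w) (g # gs)) * (\<Sum>i<k. c i * f (a i) w) ^ m
      = P \<one> w * (f (\<one> \<otimes> g) w ^ 1 * z \<one> w ^ (Suc m - 1))" for w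
    using gG by (simp add: p1)
  show ?case using J unfolding J_def m_def[symmetric] e1 e2 .
qed

text \<open>Homogeneous polynomials of degree d in the members of the family. The variable h is
  kept, so that translating the whole family is substitution in h.\<close>

inductive hom_fam :: "nat \<Rightarrow> ('a \<Rightarrow> 'c \<Rightarrow> real) \<Rightarrow> bool" where
  one: "hom_fam 0 (\<lambda>h w. 1)"
| times: "a \<in> carrier G \<Longrightarrow> hom_fam d F \<Longrightarrow> hom_fam (Suc d) (\<lambda>h w. f (h \<otimes> a) w * F h w)"
| add: "hom_fam d F \<Longrightarrow> hom_fam d F' \<Longrightarrow> hom_fam d (\<lambda>h w. F h w + F' h w)"
| cmult: "hom_fam d F \<Longrightarrow> hom_fam d (\<lambda>h w. c * F h w)"

lemma hom_fam_base: "a \<in> carrier G \<Longrightarrow> hom_fam 1 (\<lambda>h. f (h \<otimes> a))"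
  using hom_fam.times[OF _ hom_fam.one, of a] by simp

lemma hom_fam_mult: "hom_fam d F \<Longrightarrow> hom_fam e F' \<Longrightarrow> hom_fam (d + e) (\<lambda>h w. F h w * F' h w)"
proof (induction rule: hom_fam.induct)
  case (times a d F)
  have "hom_fam (Suc (d + e)) (\<lambda>h w. f (h \<otimes> a) w * (F h w * F' h w))"
    using hom_fam.times[OF times(1) times.IH[OF times.prems]] .
  then show ?case by (simp add: mult.assoc)
next
  case (add d F F1)
  then show ?case using hom_fam.add by (simp add: distrib_right)
next
  case (cmult d F c)
  then show ?case using hom_fam.cmult[of "d + e" "\<lambda>h w. F h w * F' h w" c] by (simp add: mult.assoc)
qed simp

lemma hom_fam_power: "hom_fam d F \<Longrightarrow> hom_fam (d * m) (\<lambda>h w. F h w ^ m)"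
proof (induction m)
  case 0 then show ?case using hom_fam.one by simp
next
  case (Suc m) then show ?case using hom_fam_mult[of d F "d * m"] by simp
qed

text \<open>The list \<open>gs\<close> collects linear factors: a product hands its factor over to
  the list, and when d = 0 is reached the claim is polarisation for a list of length 2 n.\<close>

lemma hom_fam_integral_aux:
  assumes "hom_fam d F"
  shows "set gs \<subseteq> carrier G \<Longrightarrow> length gs + d = 2 * n \<Longrightarrow> h \<in> carrier G \<Longrightarrow>
    integrable M (\<lambda>w. prod_list (map (\<lambda>g. f (h \<otimes> g) w) gs) * F h w) \<and>
    (LINT w|M. prod_list (map (\<lambda>g. f (h \<otimes> g) w) gs) * F h w) = (LINT w|M. prod_list (map (\<lambda>g. f (\<one> \<otimes> g) w) gs) * F \<one> w)"
  using assms
proof (induction arbitrary: gs h rule: hom_fam.induct)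
  case one
  define us where "us = map (\<lambda>g. f (h \<otimes> g)) gs"
  have len: "length us = 2 * n" using one unfolding us_def by simp
  have "integrable M (\<lambda>w. prod_list (map (\<lambda>u. u w) us))"
  proof (rule integrable_prod_list)
    fix u assume "u \<in> set us"
    then have "u \<in> Lp_set r M" using one unfolding us_def by (auto intro!: fam simp: subset_iff)
    then show "u \<in> Lp_set (real (length us)) M" unfolding len even_exponent .
  next
    show "us \<noteq> []" using len n0 by auto
  qed
  then have i: "integrable M (\<lambda>w. prod_list (map (\<lambda>g. f (h \<otimes> g) w) gs))" by (simp add: us_def o_def)
  have p1: "prod_list (map (\<lambda>g. f g w) gs) = prod_list (map (\<lambda>g. f (\<one> \<otimes> g) w) gs)" for w
    using one(1) by (intro arg_cong[of _ _ prod_list] map_cong) auto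
  have len2: "length gs \<le> 2 * n" "2 * n - length gs = 0" using one(2) by auto
  have "(LINT w|M. prod_list (map (\<lambda>g. f (h \<otimes> g) w) gs)) = (LINT w|M. prod_list (map (\<lambda>g. f (\<one> \<otimes> g) w) gs))"
    using polarization[OF one(3) len2(1) one(1), of 0 "\<lambda>_. \<one>" "\<lambda>_. 0"] unfolding len2(2) power_0 mult_1_right p1 by blast
  then show ?case using i unfolding mult_1_right by blast
next
  case (times a d F)
  have e: "prod_list (map (\<lambda>g. f (h \<otimes> g) w) (a # gs)) * F h w = prod_list (map (\<lambda>g. f (h \<otimes> g) w) gs) * (f (h \<otimes> a) w * F h w)" for h w
    by simp
  have "set (a # gs) \<subseteq> carrier G" "length (a # gs) + d = 2 * n" using times(1,4,5) by auto
  from times.IH[OF this times.prems(3), unfolded e] show ?case .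
next
  case (add d F F')
  from add.IH(1)[OF add.prems] add.IH(2)[OF add.prems]
    add.IH(1)[OF add.prems(1,2) one_closed] add.IH(2)[OF add.prems(1,2) one_closed] show ?case by (simp add: distrib_left)
next
  case (cmult d F c)
  from cmult.IH[OF cmult.prems] show ?case by (simp add: mult.left_commute[of _ c])
qed

lemma hom_fam_integral:
  assumes "hom_fam (2 * n) F" "h \<in> carrier G"
  shows "integrable M (F h)" "(LINT w|M. F h w) = (LINT w|M. F \<one> w)"
  using hom_fam_integral_aux[OF assms(1), of "[]" h] assms(2) by simp_all

lemma power_kernel_invariant:
  assumes "h \<in> carrier G" "g \<in> carrier G" "g' \<in> carrier G"
  shows "(LINT w|M. f (h \<otimes> g) w ^ n * f (h \<otimes> g') w ^ n) = (LINT w|M. f g w ^ n * f g' w ^ n)"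
proof -
  have "hom_fam (1 * n + 1 * n) (\<lambda>h w. f (h \<otimes> g) w ^ n * f (h \<otimes> g') w ^ n)"
    using assms by (intro hom_fam_mult hom_fam_power hom_fam_base)
  then have "hom_fam (2 * n) (\<lambda>h w. f (h \<otimes> g) w ^ n * f (h \<otimes> g') w ^ n)" by (simp add: mult_2)
  from hom_fam_integral(2)[OF this assms(1)] show ?thesis using assms by simp
qed

end

text \<open>The kernel s^n t^n has rank one at every point, hence is positive definite, and its
  distance is (s^n - t^n)^2.\<close>

lemma power_kernel_step:
  assumes rig: "kernel_rigid G \<tau> Q" and Q: "Q \<subseteq> carrier G" and n: "n > 0" and e: "\<epsilon> > 0"
  obtains \<delta> where "\<delta> > 0"
    "\<And>(M :: 'w measure) f g. \<lbrakk>isometric_family G \<tau> (real (2 * n)) M f; pint (real (2 * n)) M (f \<one>\<^bsub>G\<^esub>) \<le> B;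
      \<forall>q\<in>Q. pint (real (2 * n)) M (\<lambda>w. f q w - f \<one>\<^bsub>G\<^esub> w) \<le> \<delta>; g \<in> carrier G\<rbrakk>
      \<Longrightarrow> (LINT w|M. (f g w ^ n - f \<one>\<^bsub>G\<^esub> w ^ n)\<^sup>2) \<le> \<epsilon>"
proof -
  define r where "r = real (2 * n)"
  have r: "r > 1" unfolding r_def using n by simp
  have k0: "homogeneous2 r (\<lambda>s t. s ^ n * t ^ n)"
    by (rule homogeneous2_mult[OF homogeneous2_power[OF homogeneous2_fst, of n n] homogeneous2_power[OF homogeneous2_snd, of n n]])
      (auto simp: r_def)
  have psd: "0 \<le> (\<Sum>(x, s)\<leftarrow>c. \<Sum>(y, t)\<leftarrow>c. x * y * (s ^ n * t ^ n))" for c :: "(real \<times> real) list"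
    unfolding double_sum_product by simp
  have sym: "s ^ n * t ^ n = t ^ n * s ^ n" for s t :: real by simp
  obtain \<delta> where \<delta>: "\<delta> > 0"
    "\<And>(M :: 'w measure) f g. \<lbrakk>isometric_family G \<tau> r M f;
      \<forall>h\<in>carrier G. \<forall>g\<in>carrier G. \<forall>g'\<in>carrier G.
        (LINT w|M. f (h \<otimes>\<^bsub>G\<^esub> g) w ^ n * f (h \<otimes>\<^bsub>G\<^esub> g') w ^ n) = (LINT w|M. f g w ^ n * f g' w ^ n);
      pint r M (f \<one>\<^bsub>G\<^esub>) \<le> B; \<forall>q\<in>Q. pint r M (\<lambda>w. f q w - f \<one>\<^bsub>G\<^esub> w) \<le> \<delta>; g \<in> carrier G\<rbrakk>
      \<Longrightarrow> (LINT w|M. f g w ^ n * f g w ^ n - 2 * (f g w ^ n * f \<one>\<^bsub>G\<^esub> w ^ n) + f \<one>\<^bsub>G\<^esub> w ^ n * f \<one>\<^bsub>G\<^esub> w ^ n) \<le> \<epsilon>"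
    by (rule kernel_step[OF rig Q r k0 psd sym e, where B = B], rule that)
  show ?thesis
  proof (rule that[OF \<delta>(1)], fold r_def)
    fix M :: "'w measure" and f g
    assume iso: "isometric_family G \<tau> r M f" and B: "pint r M (f \<one>\<^bsub>G\<^esub>) \<le> B"
      and q: "\<forall>q\<in>Q. pint r M (\<lambda>w. f q w - f \<one>\<^bsub>G\<^esub> w) \<le> \<delta>" and g: "g \<in> carrier G"
    interpret even_family G \<tau> r M f n
      using iso n by (simp add: even_family_def even_family_axioms_def r_def)
    have inv: "\<forall>h\<in>carrier G. \<forall>g\<in>carrier G. \<forall>g'\<in>carrier G.
        (LINT w|M. f (h \<otimes>\<^bsub>G\<^esub> g) w ^ n * f (h \<otimes>\<^bsub>G\<^esub> g') w ^ n) = (LINT w|M. f g w ^ n * f g' w ^ n)"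
      using power_kernel_invariant by blast
    have "(f g w ^ n - f \<one>\<^bsub>G\<^esub> w ^ n)\<^sup>2 = f g w ^ n * f g w ^ n - 2 * (f g w ^ n * f \<one>\<^bsub>G\<^esub> w ^ n) + f \<one>\<^bsub>G\<^esub> w ^ n * f \<one>\<^bsub>G\<^esub> w ^ n" for w
      by (simp add: power2_eq_square algebra_simps)
    then show "(LINT w|M. (f g w ^ n - f \<one>\<^bsub>G\<^esub> w ^ n)\<^sup>2) \<le> \<epsilon>"
      using \<delta>(2)[OF iso inv B q g] by simp
  qed
qed

lemma homogeneous2_power_diff_square: "homogeneous2 (real (2 * n)) (\<lambda>s t. (s ^ n - t ^ n)\<^sup>2)"
  by (rule homogeneous2_power[OF homogeneous2_diff[OF homogeneous2_power[OF homogeneous2_fst, of n n]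
        homogeneous2_power[OF homogeneous2_snd, of n n]]]) auto

text \<open>For odd n the n-th power is injective, so (s^n - t^n)^2 vanishes on the diagonal
  only.\<close>

proposition orbit_rigidity_odd_half:
  assumes rig: "kernel_rigid G \<tau> Q" and Q: "Q \<subseteq> carrier G" and n: "odd n" and e: "\<epsilon> > 0"
  obtains \<delta> where "\<delta> > 0"
    "\<And>(M :: 'w measure) f g. \<lbrakk>isometric_family G \<tau> (real (2 * n)) M f; pint (real (2 * n)) M (f \<one>\<^bsub>G\<^esub>) \<le> B;
      \<forall>q\<in>Q. pint (real (2 * n)) M (\<lambda>w. f q w - f \<one>\<^bsub>G\<^esub> w) \<le> \<delta>; g \<in> carrier G\<rbrakk>
      \<Longrightarrow> pint (real (2 * n)) M (\<lambda>w. f g w - f \<one>\<^bsub>G\<^esub> w) \<le> \<epsilon>"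
proof -
  have n0: "n > 0" using n by (rule odd_pos)
  have r0: "real (2 * n) > 0" using n0 by simp
  have z: "s = t" if "(s ^ n - t ^ n)\<^sup>2 = 0" for s t :: real
  proof -
    have "root n (s ^ n) = root n (t ^ n)" using that by simp
    then show ?thesis using n by (simp add: odd_real_root_power_cancel)
  qed
  obtain \<eta> where eta: "\<eta> > 0" "\<And>(M :: 'w measure) f g. \<lbrakk>f \<in> Lp_set (real (2 * n)) M; g \<in> Lp_set (real (2 * n)) M;
      pint (real (2 * n)) M f \<le> B; pint (real (2 * n)) M g \<le> B; (LINT w|M. (f w ^ n - g w ^ n)\<^sup>2) \<le> \<eta>\<rbrakk>
      \<Longrightarrow> pint (real (2 * n)) M (\<lambda>w. f w - g w) \<le> \<epsilon>"
    by (rule pint_small_of[OF homogeneous2_power_diff_square r0 zero_le_power2 z e, where B = B]) (assumption, rule that)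
  obtain \<delta> where \<delta>: "\<delta> > 0" "\<And>(M :: 'w measure) f g. \<lbrakk>isometric_family G \<tau> (real (2 * n)) M f; pint (real (2 * n)) M (f \<one>\<^bsub>G\<^esub>) \<le> B;
      \<forall>q\<in>Q. pint (real (2 * n)) M (\<lambda>w. f q w - f \<one>\<^bsub>G\<^esub> w) \<le> \<delta>; g \<in> carrier G\<rbrakk>
      \<Longrightarrow> (LINT w|M. (f g w ^ n - f \<one>\<^bsub>G\<^esub> w ^ n)\<^sup>2) \<le> \<eta>"
    by (rule power_kernel_step[OF rig Q n0 eta(1), where B = B], rule that)
  show ?thesis
  proof (rule that[OF \<delta>(1)])
    fix M :: "'w measure" and f g
    assume iso: "isometric_family G \<tau> (real (2 * n)) M f" and B: "pint (real (2 * n)) M (f \<one>\<^bsub>G\<^esub>) \<le> B"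
      and q: "\<forall>q\<in>Q. pint (real (2 * n)) M (\<lambda>w. f q w - f \<one>\<^bsub>G\<^esub> w) \<le> \<delta>" and g: "g \<in> carrier G"
    interpret isometric_family G \<tau> "real (2 * n)" M f by (rule iso)
    show "pint (real (2 * n)) M (\<lambda>w. f g w - f \<one>\<^bsub>G\<^esub> w) \<le> \<epsilon>"
      using B pint_fam[OF g] by (intro eta(2)[OF fam[OF g] fam[OF one_closed] _ B \<delta>(2)[OF iso B q g]]) simp
  qed
qed

lemma homogeneous2_power_mult_abs:
  "homogeneous2 (real m + 1) (\<lambda>s t. \<bar>s\<bar> ^ m * \<bar>t\<bar>)"
  by (rule homogeneous2_mult[OF homogeneous2_power[OF homogeneous2_abs[OF homogeneous2_fst], of m "real m"]
        homogeneous2_abs[OF homogeneous2_snd]]) auto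

lemma homogeneous2_power_mult:
  "homogeneous2 (real m + 1) (\<lambda>s t. s ^ m * t)"
  by (rule homogeneous2_mult[OF homogeneous2_power[OF homogeneous2_fst, of m "real m"] homogeneous2_snd]) auto

lemma homogeneous2_fst_powr: "r > 0 \<Longrightarrow> homogeneous2 r (\<lambda>s t. \<bar>s\<bar> powr r)"
  and homogeneous2_snd_powr: "r > 0 \<Longrightarrow> homogeneous2 r (\<lambda>s t. \<bar>t\<bar> powr r)"
  using homogeneous2_powr[OF homogeneous2_fst, of r r] homogeneous2_powr[OF homogeneous2_snd, of r r] by auto

text \<open>A substitute for Hoelder's inequality with exponents (m + 1) / m and m + 1: the product
  has degree m + 1 and vanishes together with t.\<close>

lemma weighted_small_right:
  assumes m: "m > 0" and e: "\<epsilon> > 0"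
  obtains \<delta> where "\<delta> > 0"
    "\<And>(M :: 'w measure) f g. \<lbrakk>f \<in> Lp_set (real m + 1) M; g \<in> Lp_set (real m + 1) M; pint (real m + 1) M f \<le> B;
       pint (real m + 1) M g \<le> B; pint (real m + 1) M g \<le> \<delta>\<rbrakk> \<Longrightarrow> (LINT w|M. \<bar>f w\<bar> ^ m * \<bar>g w\<bar>) \<le> \<epsilon>"
proof -
  have r: "real m + 1 > 0" by simp
  have z: "\<bar>s\<bar> ^ m * \<bar>t\<bar> \<le> 0" if "\<bar>t\<bar> powr (real m + 1) = 0" for s t :: real using that by simp
  obtain \<delta> where \<delta>: "\<delta> > 0"
    "\<And>(M :: 'w measure) f g. \<lbrakk>f \<in> Lp_set (real m + 1) M; g \<in> Lp_set (real m + 1) M; pint (real m + 1) M f \<le> B;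
       pint (real m + 1) M g \<le> B; (LINT w|M. \<bar>g w\<bar> powr (real m + 1)) \<le> \<delta>\<rbrakk> \<Longrightarrow> (LINT w|M. \<bar>f w\<bar> ^ m * \<bar>g w\<bar>) \<le> \<epsilon>"
    by (rule homogeneous2_integral_small[OF homogeneous2_power_mult_abs homogeneous2_snd_powr[OF r] r powr_ge_zero z e, where B = B],
        assumption, rule that)
  show ?thesis by (rule that[OF \<delta>(1)], rule \<delta>(2)) (simp_all add: pint_def)
qed

text \<open>As before, with the smallness in the factor raised to the power m; m > 0 makes the
  product vanish together with s.\<close>

lemma weighted_small_left:
  assumes m: "m > 0" and e: "\<epsilon> > 0"
  obtains \<delta> where "\<delta> > 0"
    "\<And>(M :: 'w measure) f g. \<lbrakk>f \<in> Lp_set (real m + 1) M; g \<in> Lp_set (real m + 1) M; pint (real m + 1) M f \<le> B;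
       pint (real m + 1) M g \<le> B; pint (real m + 1) M f \<le> \<delta>\<rbrakk> \<Longrightarrow> (LINT w|M. \<bar>f w\<bar> ^ m * \<bar>g w\<bar>) \<le> \<epsilon>"
proof -
  have r: "real m + 1 > 0" by simp
  have z: "\<bar>s\<bar> ^ m * \<bar>t\<bar> \<le> 0" if "\<bar>s\<bar> powr (real m + 1) = 0" for s t :: real
    using that m by (simp add: power_0_left)
  obtain \<delta> where \<delta>: "\<delta> > 0"
    "\<And>(M :: 'w measure) f g. \<lbrakk>f \<in> Lp_set (real m + 1) M; g \<in> Lp_set (real m + 1) M; pint (real m + 1) M f \<le> B;
       pint (real m + 1) M g \<le> B; (LINT w|M. \<bar>f w\<bar> powr (real m + 1)) \<le> \<delta>\<rbrakk> \<Longrightarrow> (LINT w|M. \<bar>f w\<bar> ^ m * \<bar>g w\<bar>) \<le> \<epsilon>"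
    by (rule homogeneous2_integral_small[OF homogeneous2_power_mult_abs homogeneous2_fst_powr[OF r] r powr_ge_zero z e, where B = B],
        assumption, rule that)
  show ?thesis by (rule that[OF \<delta>(1)], rule \<delta>(2)) (simp_all add: pint_def)
qed

text \<open>The exponent gives degree 2 and makes the m-th power equal to (s^m - t^m)^2. So
  \<open>root_diff\<close> leads from L_(2n) to L_n, and for n = m + 1 the estimates for |u|^m |v|
  apply to it.\<close>

definition root_diff :: "nat \<Rightarrow> real \<Rightarrow> real \<Rightarrow> real" where
  "root_diff m s t = \<bar>s ^ m - t ^ m\<bar> powr (2 / real m)"

lemma root_diff_power: "m > 0 \<Longrightarrow> root_diff m s t ^ m = (s ^ m - t ^ m)\<^sup>2"
proof (cases "s ^ m - t ^ m = 0")
  case True then show "m > 0 \<Longrightarrow> ?thesis" by (simp add: root_diff_def power_0_left)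
next
  case False
  assume m: "m > 0"
  define x where "x = \<bar>s ^ m - t ^ m\<bar>"
  have x: "x > 0" unfolding x_def using False by simp
  have "(x powr (2 / real m)) ^ m = (x powr (2 / real m)) powr real m" using x by (simp add: powr_realpow)
  also have "\<dots> = x powr 2" using m by (simp add: powr_powr)
  also have "\<dots> = x\<^sup>2" using x by (simp add: powr_numeral)
  finally show ?thesis unfolding root_diff_def x_def power2_abs .
qed

lemma homogeneous2_root_diff: "m > 0 \<Longrightarrow> homogeneous2 2 (root_diff m)"
  unfolding root_diff_def[abs_def]
  by (rule homogeneous2_powr[OF homogeneous2_diff[OF homogeneous2_power[OF homogeneous2_fst, of m "real m"]
        homogeneous2_power[OF homogeneous2_snd, of m "real m"]]]) auto

section \<open>Squares of the family and the invariant weight\<close>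

context even_family
begin

lemma mult_Lp_set: "u \<in> Lp_set r M \<Longrightarrow> v \<in> Lp_set r M \<Longrightarrow> (\<lambda>w. u w * v w) \<in> Lp_set (real n) M"
  by (rule homogeneous2_Lp_set[OF homogeneous2_mult[OF homogeneous2_fst homogeneous2_snd refl] r0])
    (auto simp: even_exponent)

lemma pint_square: "pint (real n) M (\<lambda>w. (u w)\<^sup>2) = pint r M u"
proof -
  have "\<bar>x\<^sup>2\<bar> powr real n = \<bar>x\<bar> powr r" for x :: real
  proof -
    have "\<bar>x\<bar> powr r = \<bar>x\<bar> ^ (2 * n)" unfolding even_exponent by (rule abs_powr_nat) (use n0 in simp)
    also have "\<dots> = \<bar>x\<^sup>2\<bar> ^ n" by (simp only: power_mult power2_abs abs_power2)
    also have "\<dots> = \<bar>x\<^sup>2\<bar> powr real n" by (rule abs_powr_nat[OF n0, symmetric])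
    finally show ?thesis ..
  qed
  then show ?thesis by (simp add: pint_def)
qed

lemma square_Lp_set: "u \<in> Lp_set r M \<Longrightarrow> (\<lambda>w. (u w)\<^sup>2) \<in> Lp_set (real n) M"
  using mult_Lp_set[of u u] by (simp add: power2_eq_square)

text \<open>Kept as functions of h, so that the elements have degree 2 in the family and translation
  is substitution. Midpoints are all that the minimiser needs.\<close>

inductive sq_hull :: "('a \<Rightarrow> 'c \<Rightarrow> real) \<Rightarrow> bool" where
  base: "a \<in> carrier G \<Longrightarrow> sq_hull (\<lambda>h w. (f (h \<otimes> a) w)\<^sup>2)"
| mid: "sq_hull u \<Longrightarrow> sq_hull v \<Longrightarrow> sq_hull (\<lambda>h w. (u h w + v h w) / 2)"

lemma sq_hull_hom_fam: "sq_hull u \<Longrightarrow> hom_fam 2 u"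
proof (induction rule: sq_hull.induct)
  case (base a)
  show ?case using hom_fam_power[OF hom_fam_base[OF base], of 2] by simp
next
  case (mid u v)
  show ?case using hom_fam.cmult[OF hom_fam.add[OF mid.IH], of "1 / 2"] by (simp add: field_simps)
qed

lemma sq_hull_nonneg: "sq_hull u \<Longrightarrow> u h w \<ge> 0"
  by (induction rule: sq_hull.induct) auto

lemma sq_hull_Lp_set: "sq_hull u \<Longrightarrow> h \<in> carrier G \<Longrightarrow> u h \<in> Lp_set (real n) M"
proof (induction rule: sq_hull.induct)
  case (base a) then show ?case by (intro square_Lp_set fam) auto
next
  case (mid u v) then show ?case using n0 by (intro Lp_set_mid) auto
qed

lemma sq_hull_translate: "sq_hull u \<Longrightarrow> g \<in> carrier G \<Longrightarrow> \<exists>v. sq_hull v \<and> (\<forall>h\<in>carrier G. v h = u (h \<otimes> g))"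
proof (induction rule: sq_hull.induct)
  case (base a)
  then show ?case by (intro exI[of _ "\<lambda>h w. (f (h \<otimes> (g \<otimes> a)) w)\<^sup>2"] conjI sq_hull.base ballI) (auto simp: m_assoc)
next
  case (mid u v)
  then obtain u' v' where "sq_hull u'" "\<forall>h\<in>carrier G. u' h = u (h \<otimes> g)" "sq_hull v'" "\<forall>h\<in>carrier G. v' h = v (h \<otimes> g)" by blast
  then show ?case by (intro exI[of _ "\<lambda>h w. (u' h w + v' h w) / 2"] conjI sq_hull.mid) auto
qed

text \<open>Since u is nonnegative, |u|^n is the polynomial u^n of degree 2 n in the family, whose
  integral is invariant.\<close>

lemma sq_hull_pint:
  assumes u: "sq_hull u" and h: "h \<in> carrier G"
  shows "pint (real n) M (u h) = pint (real n) M (u \<one>)"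
proof -
  have e: "pint (real n) M (u h) = (LINT w|M. u h w ^ n)" for h
  proof -
    have "\<bar>u h w\<bar> powr real n = u h w ^ n" for w
      unfolding abs_powr_nat[OF n0] using sq_hull_nonneg[OF u, of h w] by simp
    then show ?thesis unfolding pint_def by simp
  qed
  have "hom_fam (2 * n) (\<lambda>h w. u h w ^ n)" by (rule hom_fam_power[OF sq_hull_hom_fam[OF u]])
  from hom_fam_integral(2)[OF this h] show ?thesis unfolding e .
qed

text \<open>Balls of L_n are midpoint convex.\<close>

lemma sq_hull_near:
  assumes n2: "n > 1" and u: "sq_hull u" and v: "v \<in> Lp_set (real n) M"
    and b: "\<And>g. g \<in> carrier G \<Longrightarrow> pint (real n) M (\<lambda>w. (f g w)\<^sup>2 - v w) \<le> \<epsilon>" and h: "h \<in> carrier G"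
  shows "pint (real n) M (\<lambda>w. u h w - v w) \<le> \<epsilon>"
  using u
proof (induction rule: sq_hull.induct)
  case (base a) then show ?case using b[of "h \<otimes> a"] h by simp
next
  case (mid u u')
  have nr: "real n > 1" "real n > 0" using n2 by auto
  have d: "(\<lambda>w. u h w - v w) \<in> Lp_set (real n) M" "(\<lambda>w. u' h w - v w) \<in> Lp_set (real n) M"
    using mid sq_hull_Lp_set h v nr by (auto intro!: Lp_set_diff)
  have "pint (real n) M (\<lambda>w. (u h w + u' h w) / 2 - v w) = pint (real n) M (\<lambda>w. ((u h w - v w) + (u' h w - v w)) / 2)"
    by (rule arg_cong[of _ _ "pint (real n) M"]) (auto simp: fun_eq_iff field_simps)
  also have "\<dots> \<le> (LINT w|M. (\<bar>u h w - v w\<bar> powr real n + \<bar>u' h w - v w\<bar> powr real n) / 2)"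
    unfolding pint_def
    by (intro integral_mono Lp_set_integrable[OF Lp_set_mid[OF nr(2) d]] integrable_divide_zero
        Bochner_Integration.integrable_add Lp_set_integrable d abs_powr_midpoint(1)[OF nr(1)])
  also have "\<dots> = (pint (real n) M (\<lambda>w. u h w - v w) + pint (real n) M (\<lambda>w. u' h w - v w)) / 2"
    unfolding pint_def using Lp_set_integrable[OF d(1)] Lp_set_integrable[OF d(2)] by simp
  also have "\<dots> \<le> \<epsilon>" using mid.IH by simp
  finally show ?case .
qed

text \<open>The element of least norm of the midpoint hull of the squares \<open>f(g)\<^sup>2\<close> in \<open>L\<^sub>n\<close> is a nonnegative weight
  that the group leaves invariant in the weak sense needed below.\<close>

lemma sq_hull_center:
  assumes n2: "n > 1"
  obtains c where "c \<in> Lp_set (real n) M" "\<And>w. c w \<ge> 0"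
    "\<And>\<epsilon>. \<epsilon> > 0 \<Longrightarrow> \<exists>u. sq_hull u \<and> (\<forall>h\<in>carrier G. pint (real n) M (\<lambda>w. u h w - c w) \<le> \<epsilon>)"
proof -
  have nr: "real n > 1" "real n > 0" using n2 by auto
  define C where "C = {u \<one> |u. sq_hull u}"
  have C: "C \<subseteq> Lp_set (real n) M" unfolding C_def using sq_hull_Lp_set by auto
  have ne: "C \<noteq> {}" unfolding C_def using sq_hull.base[OF one_closed] by blast
  have mid: "(\<lambda>w. (u w + v w) / 2) \<in> C" if uv: "u \<in> C" "v \<in> C" for u v
  proof -
    obtain u' where u': "u = u' \<one>" "sq_hull u'" using uv(1) unfolding C_def by (elim CollectE exE conjE)
    obtain v' where v': "v = v' \<one>" "sq_hull v'" using uv(2) unfolding C_def by (elim CollectE exE conjE)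
    show ?thesis unfolding C_def
      by (intro CollectI exI[of _ "\<lambda>h w. (u' h w + v' h w) / 2"] conjI sq_hull.mid u'(2) v'(2)) (simp add: u'(1) v'(1))
  qed
  obtain c0 where c0: "c0 \<in> Lp_set (real n) M"
    and m: "\<And>\<epsilon>. \<epsilon> > 0 \<Longrightarrow> \<exists>\<delta>>0. \<forall>u\<in>C. pint (real n) M u \<le> (INF u\<in>C. pint (real n) M u) + \<delta> \<longrightarrow> pint (real n) M (\<lambda>w. u w - c0 w) \<le> \<epsilon>"
    by (rule pint_minimizer[OF nr(1) C ne mid], assumption, assumption, rule that)
  \<comment> \<open>The hull consists of nonnegative functions, so the positive part is at least as
    close to them as \<open>c0\<close>.\<close>
  define c where "c = (\<lambda>w. max (c0 w) 0)"
  have cm: "c \<in> borel_measurable M" unfolding c_def using c0 by (intro borel_measurable_max) (auto simp: Lp_set_iff)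
  have "integrable M (\<lambda>w. \<bar>c w\<bar> powr real n)"
    by (rule Bochner_Integration.integrable_bound[OF Lp_set_integrable[OF c0]])
      (use cm nr in \<open>auto simp: c_def max_def intro!: AE_I2\<close>)
  then have c: "c \<in> Lp_set (real n) M" using cm by (simp add: Lp_set_iff)
  show ?thesis
  proof (rule that[OF c])
    show "c w \<ge> 0" for w by (simp add: c_def)
    fix \<epsilon> :: real assume e: "\<epsilon> > 0"
    define I where "I = (INF u\<in>C. pint (real n) M u)"
    obtain \<delta> where \<delta>: "\<delta> > 0" "\<And>u. u \<in> C \<Longrightarrow> pint (real n) M u \<le> I + \<delta> \<Longrightarrow> pint (real n) M (\<lambda>w. u w - c0 w) \<le> \<epsilon>"
      using m[OF e] unfolding I_def by blast
    have bdd: "bdd_below (pint (real n) M ` C)" by (intro bdd_belowI[of _ 0]) auto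
    have "(INF u\<in>C. pint (real n) M u) < I + \<delta>" using \<delta>(1) by (simp add: I_def)
    then obtain u0 where u0: "u0 \<in> C" "pint (real n) M u0 < I + \<delta>" unfolding cINF_less_iff[OF ne bdd] by blast
    obtain u where u: "u0 = u \<one>" "sq_hull u" using u0(1) unfolding C_def by (elim CollectE exE conjE)
    have "pint (real n) M (\<lambda>w. u h w - c w) \<le> \<epsilon>" if h: "h \<in> carrier G" for h
    proof -
      \<comment> \<open>Translation by h keeps the function in \<open>C\<close> and preserves its
        norm, so it is again a near-minimiser and close to the same centre. This is the weak
        invariance of the weight.\<close>
      obtain v where v: "sq_hull v" "\<forall>x\<in>carrier G. v x = u (x \<otimes> h)" using sq_hull_translate[OF u(2) h] by blast
      then have "v \<one> = u h" using h by simp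
      then have uC: "u h \<in> C" unfolding C_def using v(1) by (intro CollectI exI[of _ v] conjI) simp_all
      have "pint (real n) M (u h) \<le> I + \<delta>" using sq_hull_pint[OF u(2) h] u0(2) u(1) by simp
      from \<delta>(2)[OF uC this] have b: "pint (real n) M (\<lambda>w. u h w - c0 w) \<le> \<epsilon>" .
      have uL: "u h \<in> Lp_set (real n) M" by (rule sq_hull_Lp_set[OF u(2) h])
      have "pint (real n) M (\<lambda>w. u h w - c w) \<le> pint (real n) M (\<lambda>w. u h w - c0 w)"
        unfolding pint_def
      proof (rule integral_mono[OF Lp_set_integrable[OF Lp_set_diff[OF nr(2) uL c]] Lp_set_integrable[OF Lp_set_diff[OF nr(2) uL c0]]])
        fix w
        have "\<bar>u h w - c w\<bar> \<le> \<bar>u h w - c0 w\<bar>" using sq_hull_nonneg[OF u(2), of h w] by (auto simp: c_def max_def)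
        then show "\<bar>u h w - c w\<bar> powr real n \<le> \<bar>u h w - c0 w\<bar> powr real n" using nr by (intro powr_mono2) auto
      qed
      then show ?thesis using b by simp
    qed
    then show "\<exists>u. sq_hull u \<and> (\<forall>h\<in>carrier G. pint (real n) M (\<lambda>w. u h w - c w) \<le> \<epsilon>)" using u(2) by blast
  qed
qed

lemma weighted_integrable:
  assumes m: "n = Suc m" and u: "u \<in> Lp_set (real n) M" and v: "v \<in> Lp_set (real n) M"
  shows "integrable M (\<lambda>w. u w ^ m * v w)" "integrable M (\<lambda>w. \<bar>u w\<bar> ^ m * \<bar>v w\<bar>)"
proof -
  have e: "real n = real m + 1" using m by simp
  show "integrable M (\<lambda>w. u w ^ m * v w)" "integrable M (\<lambda>w. \<bar>u w\<bar> ^ m * \<bar>v w\<bar>)"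
    using u v homogeneous2_integrable[OF homogeneous2_power_mult, of m u M v]
      homogeneous2_integrable[OF homogeneous2_power_mult_abs, of m u M v] unfolding e by auto
qed

text \<open>For u in the hull close to c, (f(a) f(b))^m u has degree 2 m + 2 = 2 n, so its integral
  is exactly invariant. Exchanging c for u costs e / 2 at h and at the identity. Positivity comes
  from c \<ge> 0.\<close>

lemma weighted_kernel:
  assumes m: "n = Suc m" "m > 0" and c: "c \<in> Lp_set (real n) M" and c0: "\<And>w. c w \<ge> 0"
    and ap: "\<And>\<epsilon>. \<epsilon> > 0 \<Longrightarrow> \<exists>u. sq_hull u \<and> (\<forall>h\<in>carrier G. pint (real n) M (\<lambda>w. u h w - c w) \<le> \<epsilon>)"
  shows "invariant_kernel G (\<lambda>g g'. LINT w|M. (f g w * f g' w) ^ m * c w)"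
proof unfold_locales
  have en: "real n = real m + 1" "real n > 0" using m by auto
  have int: "integrable M (\<lambda>w. (f a w * f b w) ^ m * v w)" if "a \<in> carrier G" "b \<in> carrier G" "v \<in> Lp_set (real n) M" for a b v
    using that by (intro weighted_integrable(1)[OF m(1)] mult_Lp_set fam) auto
  show "(\<Sum>(x, a)\<leftarrow>d. \<Sum>(y, b)\<leftarrow>d. x * y * (LINT w|M. (f a w * f b w) ^ m * c w)) \<ge> 0" if d: "snd ` set d \<subseteq> carrier G" for d
  proof -
    have "(\<Sum>(x, a)\<leftarrow>d. \<Sum>(y, b)\<leftarrow>d. x * y * (LINT w|M. (f a w * f b w) ^ m * c w))
        = (LINT w|M. (\<Sum>(x, a)\<leftarrow>d. \<Sum>(y, b)\<leftarrow>d. x * y * ((f a w * f b w) ^ m * c w)))"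
      by (rule double_sum_integral[OF _ d]) (intro int c)
    also have "\<dots> = (LINT w|M. (\<Sum>(x, a)\<leftarrow>d. x * f a w ^ m)\<^sup>2 * c w)"
      unfolding double_sum_cmult power_mult_distrib double_sum_product ..
    also have "\<dots> \<ge> 0" by (simp add: c0)
    finally show ?thesis .
  qed
  show "(LINT w|M. (f (h \<otimes> a) w * f (h \<otimes> b) w) ^ m * c w) = (LINT w|M. (f a w * f b w) ^ m * c w)"
    if h: "h \<in> carrier G" and a: "a \<in> carrier G" and b: "b \<in> carrier G" for h a b
  proof -
    let ?y = "\<lambda>h w. f (h \<otimes> a) w * f (h \<otimes> b) w"
    have y: "?y x \<in> Lp_set (real n) M" if "x \<in> carrier G" for x using that a b by (intro mult_Lp_set fam) auto
    \<comment> \<open>At least 1, because u - c, of size at most 1, must obey the same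
      bound.\<close>
    define B where "B = max 1 (max (pint (real n) M (?y h)) (pint (real n) M (?y \<one>)))"
    have "\<bar>(LINT w|M. ?y h w ^ m * c w) - (LINT w|M. ?y \<one> w ^ m * c w)\<bar> \<le> 0 + e" if e: "e > 0" for e
    proof -
      have e2: "e / 2 > 0" using e by simp
      obtain \<delta> where \<delta>: "\<delta> > 0" and d2: "\<And>(M :: 'c measure) f g. \<lbrakk>f \<in> Lp_set (real m + 1) M; g \<in> Lp_set (real m + 1) M; pint (real m + 1) M f \<le> B;
         pint (real m + 1) M g \<le> B; pint (real m + 1) M g \<le> \<delta>\<rbrakk> \<Longrightarrow> (LINT w|M. \<bar>f w\<bar> ^ m * \<bar>g w\<bar>) \<le> e / 2"
        by (rule weighted_small_right[OF m(2) e2, where B = B], rule that)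
      obtain u where u: "sq_hull u" "\<And>x. x \<in> carrier G \<Longrightarrow> pint (real n) M (\<lambda>w. u x w - c w) \<le> min 1 \<delta>"
        using ap[of "min 1 \<delta>"] \<delta> by auto
      have uL: "u x \<in> Lp_set (real n) M" if "x \<in> carrier G" for x by (rule sq_hull_Lp_set[OF u(1) that])
      have near: "\<bar>(LINT w|M. ?y x w ^ m * u x w) - (LINT w|M. ?y x w ^ m * c w)\<bar> \<le> e / 2"
        if x: "x \<in> carrier G" and xb: "pint (real n) M (?y x) \<le> B" for x
      proof -
        have d: "(\<lambda>w. u x w - c w) \<in> Lp_set (real n) M" by (rule Lp_set_diff[OF en(2) uL[OF x] c])
        have "(LINT w|M. ?y x w ^ m * u x w) - (LINT w|M. ?y x w ^ m * c w) = (LINT w|M. ?y x w ^ m * (u x w - c w))"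
          using weighted_integrable(1)[OF m(1) y[OF x] uL[OF x]] weighted_integrable(1)[OF m(1) y[OF x] c]
          by (simp add: right_diff_distrib)
        also have "\<bar>\<dots>\<bar> \<le> (LINT w|M. \<bar>?y x w ^ m * (u x w - c w)\<bar>)" by (rule integral_abs_bound)
        also have "\<dots> = (LINT w|M. \<bar>?y x w\<bar> ^ m * \<bar>u x w - c w\<bar>)" unfolding abs_mult power_abs ..
        also have "\<dots> \<le> e / 2"
        proof (rule d2[folded en(1), OF y[OF x] d xb])
          have "pint (real n) M (\<lambda>w. u x w - c w) \<le> min 1 \<delta>" by (rule u(2)[OF x])
          then show "pint (real n) M (\<lambda>w. u x w - c w) \<le> B" "pint (real n) M (\<lambda>w. u x w - c w) \<le> \<delta>" unfolding B_def by auto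
        qed
        finally show ?thesis .
      qed
      have "hom_fam (m + m + 2) (\<lambda>x w. f (x \<otimes> a) w ^ m * f (x \<otimes> b) w ^ m * u x w)"
        using hom_fam_mult[OF hom_fam_mult[OF hom_fam_power[OF hom_fam_base[OF a], of m] hom_fam_power[OF hom_fam_base[OF b], of m]] sq_hull_hom_fam[OF u(1)]]
        by simp
      moreover have "m + m + 2 = 2 * n" using m by simp
      ultimately have hf: "hom_fam (2 * n) (\<lambda>x w. f (x \<otimes> a) w ^ m * f (x \<otimes> b) w ^ m * u x w)" by simp
      have eq: "(LINT w|M. ?y h w ^ m * u h w) = (LINT w|M. ?y \<one> w ^ m * u \<one> w)"
        using hom_fam_integral(2)[OF hf h] unfolding power_mult_distrib .
      have "\<bar>(LINT w|M. ?y h w ^ m * u h w) - (LINT w|M. ?y h w ^ m * c w)\<bar> \<le> e / 2" by (rule near[OF h]) (simp add: B_def)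
      moreover have "\<bar>(LINT w|M. ?y \<one> w ^ m * u \<one> w) - (LINT w|M. ?y \<one> w ^ m * c w)\<bar> \<le> e / 2" by (rule near[OF one_closed]) (simp add: B_def)
      moreover have "\<bar>p - q\<bar> \<le> 0 + e" if "\<bar>x - p\<bar> \<le> e / 2" "\<bar>x - q\<bar> \<le> e / 2" for p q x :: real
        using that field_sum_of_halves[of e] by linarith
      ultimately show ?thesis unfolding eq by blast
    qed
    then have "\<bar>(LINT w|M. ?y h w ^ m * c w) - (LINT w|M. ?y \<one> w ^ m * c w)\<bar> \<le> 0" by (rule field_le_epsilon)
    then show ?thesis using a b by simp
  qed
qed (simp add: mult.commute)

end

lemma (in even_family) root_diff_Lp_set:
  assumes "m > 0" "a \<in> carrier G" "b \<in> carrier G"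
  shows "(\<lambda>w. root_diff m (f a w) (f b w)) \<in> Lp_set (real n) M"
  by (rule homogeneous2_Lp_set[OF homogeneous2_root_diff[OF assms(1)] r0 _ fam[OF assms(2)] fam[OF assms(3)]])
    (auto simp: even_exponent)

text \<open>With m = n - 1 odd, the function (s^m - t^m)^2 t^2 + (s^n - t^n)^2 vanishes on the
  diagonal only: the n-th powers settle t = 0, the m-th powers the rest. Its first term is estimated
  by the weighted kernel, where c stands for the square t^2 of f(1).\<close>

proposition orbit_rigidity_even_half:
  assumes rig: "kernel_rigid G \<tau> Q" and Q: "Q \<subseteq> carrier G" and n: "even n" "n > 0" and e: "\<epsilon> > 0"
  obtains \<delta> where "\<delta> > 0"
    "\<And>(M :: 'w measure) f g. \<lbrakk>isometric_family G \<tau> (real (2 * n)) M f; pint (real (2 * n)) M (f \<one>\<^bsub>G\<^esub>) \<le> B;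
      \<forall>q\<in>Q. pint (real (2 * n)) M (\<lambda>w. f q w - f \<one>\<^bsub>G\<^esub> w) \<le> \<delta>; g \<in> carrier G\<rbrakk>
      \<Longrightarrow> pint (real (2 * n)) M (\<lambda>w. f g w - f \<one>\<^bsub>G\<^esub> w) \<le> \<epsilon>"
proof -
  define r where "r = real (2 * n)"
  define m where "m = n - 1"
  have m: "n = Suc m" "m > 0" "odd m" using n unfolding m_def by (auto elim: evenE)
  have n1: "n > 1" using m by simp
  have r0: "r > 0" and en: "real m + 1 = real n" unfolding r_def using n m by auto
  have nr: "real n > 0" using n by simp
  have hsq: "homogeneous2 2 (\<lambda>s t. t\<^sup>2)" "homogeneous2 2 (\<lambda>s t. s\<^sup>2)"
    by (rule homogeneous2_power[OF homogeneous2_snd], simp) (rule homogeneous2_power[OF homogeneous2_fst], simp)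
  define b where "b = (\<lambda>s t. (s ^ m - t ^ m)\<^sup>2 * t\<^sup>2 + (s ^ n - t ^ n)\<^sup>2 :: real)"
  have bh: "homogeneous2 r b" unfolding b_def r_def
    by (rule homogeneous2_add[OF homogeneous2_mult[OF homogeneous2_power_diff_square hsq(1)] homogeneous2_power_diff_square])
      (simp add: m(1))
  have b0: "0 \<le> b s t" for s t unfolding b_def by simp
  have bz: "s = t" if "b s t = 0" for s t
  proof -
    have z: "(s ^ m - t ^ m)\<^sup>2 * t\<^sup>2 = 0" "(s ^ n - t ^ n)\<^sup>2 = 0"
      using that unfolding b_def by (auto simp: add_nonneg_eq_0_iff)
    show ?thesis
    proof (cases "t = 0")
      case True then show ?thesis using z(2) n by (simp add: power_0_left)
    next
      case False
      then have "root m (s ^ m) = root m (t ^ m)" using z(1) by simp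
      then show ?thesis using m(3) by (simp add: odd_real_root_power_cancel)
    qed
  qed
  obtain \<delta>f where df: "\<delta>f > 0" and final: "\<And>(M :: 'w measure) f g. \<lbrakk>f \<in> Lp_set r M; g \<in> Lp_set r M; pint r M f \<le> B; pint r M g \<le> B;
       (LINT w|M. b (f w) (g w)) \<le> \<delta>f\<rbrakk> \<Longrightarrow> pint r M (\<lambda>w. f w - g w) \<le> \<epsilon>"
    by (rule pint_small_of[OF bh r0 b0 bz e, where B = B]) (assumption, rule that)
  have df4: "\<delta>f / 4 > 0" using df by simp
  define A where "A = (\<lambda>s t. \<bar>root_diff m s t\<bar> powr real n)"
  have Ah: "homogeneous2 r A" unfolding A_def
    by (rule homogeneous2_powr[OF homogeneous2_root_diff[OF m(2)] nr]) (simp add: r_def)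
  have Az: "A s s \<le> 0" for s by (simp add: A_def root_diff_def)
  obtain K where K: "K \<ge> 0" "\<And>s t. \<bar>A s t\<bar> \<le> K * (\<bar>s\<bar> powr r + \<bar>t\<bar> powr r)"
    by (rule homogeneous2_bound[OF Ah r0], rule that)
  define D where "D = (2 :: real) powr real n"
  have D: "D \<ge> 1" unfolding D_def using nr by (intro ge_one_powr_ge_zero) auto
  \<comment> \<open>The first entry bounds \<open>root_diff\<close> in L_n, the second bounds v -
    c.\<close>
  define B3 where "B3 = max (K * (B + B)) (D * 2)"
  obtain \<eta>1 where e1: "\<eta>1 > 0" and wr: "\<And>(M :: 'w measure) f g. \<lbrakk>f \<in> Lp_set (real m + 1) M; g \<in> Lp_set (real m + 1) M; pint (real m + 1) M f \<le> B3;
       pint (real m + 1) M g \<le> B3; pint (real m + 1) M g \<le> \<eta>1\<rbrakk> \<Longrightarrow> (LINT w|M. \<bar>f w\<bar> ^ m * \<bar>g w\<bar>) \<le> \<delta>f / 4"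
    by (rule weighted_small_right[OF m(2) df4, where B = B3], rule that)
  define \<epsilon>2 where "\<epsilon>2 = min 1 (\<eta>1 / (D * 2))"
  have eps2: "\<epsilon>2 > 0" "\<epsilon>2 \<le> 1" "D * (2 * \<epsilon>2) \<le> \<eta>1"
    unfolding \<epsilon>2_def using e1 D by (auto simp: min_def field_simps)
  have sqh: "homogeneous2 r (\<lambda>s t. \<bar>s\<^sup>2 - t\<^sup>2\<bar> powr real n)"
    by (rule homogeneous2_powr[OF homogeneous2_diff[OF hsq(2) hsq(1)] nr]) (simp add: r_def)
  have sqz: "\<bar>s\<^sup>2 - t\<^sup>2\<bar> powr real n \<le> 0" if "(s ^ n - t ^ n)\<^sup>2 = 0" for s t :: real
  proof -
    have "\<bar>s\<bar> ^ n = \<bar>t\<bar> ^ n" using that by (simp flip: power_abs)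
    then have "\<bar>s\<bar> = \<bar>t\<bar>" using n(2) power_eq_imp_eq_base[of "\<bar>s\<bar>" n "\<bar>t\<bar>"] by simp
    then have "s\<^sup>2 = t\<^sup>2" by (metis power2_abs)
    then show ?thesis by simp
  qed
  obtain \<delta>s where ds: "\<delta>s > 0" and sq: "\<And>(M :: 'w measure) f g. \<lbrakk>f \<in> Lp_set r M; g \<in> Lp_set r M; pint r M f \<le> B; pint r M g \<le> B;
       (LINT w|M. (f w ^ n - g w ^ n)\<^sup>2) \<le> \<delta>s\<rbrakk> \<Longrightarrow> (LINT w|M. \<bar>(f w)\<^sup>2 - (g w)\<^sup>2\<bar> powr real n) \<le> \<epsilon>2"
    by (rule homogeneous2_integral_small[OF sqh homogeneous2_power_diff_square[of n, folded r_def] r0 zero_le_power2 sqz eps2(1), where B = B],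
        assumption, rule that)
  have dm: "min (\<delta>f / 2) \<delta>s > 0" using df ds by simp
  obtain \<delta>1 where d1: "\<delta>1 > 0" and step1: "\<And>(M :: 'w measure) f g. \<lbrakk>isometric_family G \<tau> (real (2 * n)) M f; pint (real (2 * n)) M (f \<one>\<^bsub>G\<^esub>) \<le> B;
      \<forall>q\<in>Q. pint (real (2 * n)) M (\<lambda>w. f q w - f \<one>\<^bsub>G\<^esub> w) \<le> \<delta>1; g \<in> carrier G\<rbrakk>
      \<Longrightarrow> (LINT w|M. (f g w ^ n - f \<one>\<^bsub>G\<^esub> w ^ n)\<^sup>2) \<le> min (\<delta>f / 2) \<delta>s"
    by (rule power_kernel_step[OF rig Q n(2) dm, where B = B], rule that)
  have "\<exists>\<delta>>0. \<forall>k. invariant_kernel G k \<longrightarrow>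
     (\<forall>b\<in>carrier G. \<forall>e>0. \<exists>U. openin \<tau> U \<and> b \<in> U \<and> (\<forall>g\<in>U. k g g - 2 * k g b + k b b < e)) \<longrightarrow>
     (\<forall>q\<in>Q. k q q - 2 * k q \<one>\<^bsub>G\<^esub> + k \<one>\<^bsub>G\<^esub> \<one>\<^bsub>G\<^esub> \<le> \<delta>) \<longrightarrow>
     (\<forall>g\<in>carrier G. k g g - 2 * k g \<one>\<^bsub>G\<^esub> + k \<one>\<^bsub>G\<^esub> \<one>\<^bsub>G\<^esub> \<le> \<delta>f / 4)"
    by (rule rig[unfolded kernel_rigid_def, THEN spec, THEN mp, OF df4])
  then obtain \<theta> where th: "\<theta> > 0" and K0: "\<forall>k. invariant_kernel G k \<longrightarrow>
     (\<forall>b\<in>carrier G. \<forall>e>0. \<exists>U. openin \<tau> U \<and> b \<in> U \<and> (\<forall>g\<in>U. k g g - 2 * k g b + k b b < e)) \<longrightarrow>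
     (\<forall>q\<in>Q. k q q - 2 * k q \<one>\<^bsub>G\<^esub> + k \<one>\<^bsub>G\<^esub> \<one>\<^bsub>G\<^esub> \<le> \<theta>) \<longrightarrow>
     (\<forall>g\<in>carrier G. k g g - 2 * k g \<one>\<^bsub>G\<^esub> + k \<one>\<^bsub>G\<^esub> \<one>\<^bsub>G\<^esub> \<le> \<delta>f / 4)"
    by (elim exE conjE)
  note step2 = K0[THEN spec, THEN mp, THEN mp, THEN mp]
  \<comment> \<open>The second entry bounds c, written as (c - v) + v.\<close>
  define B4 where "B4 = max (K * (B + B)) (D * (D * 2 + B))"
  \<comment> \<open>Needed twice: with tolerance \<open>\<theta>\<close> for the displacement on Q,
    and with arbitrary tolerance for the continuity of the kernel.\<close>
  have kernel_small: "\<exists>\<delta>>0. \<forall>(M :: 'w measure) f c a b. isometric_family G \<tau> r M f \<longrightarrow> pint r M (f \<one>\<^bsub>G\<^esub>) \<le> B \<longrightarrow> c \<in> Lp_set (real n) M \<longrightarrow>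
      pint (real n) M c \<le> B4 \<longrightarrow> a \<in> carrier G \<longrightarrow> b \<in> carrier G \<longrightarrow> pint r M (\<lambda>w. f a w - f b w) \<le> \<delta> \<longrightarrow>
      (LINT w|M. \<bar>root_diff m (f a w) (f b w)\<bar> ^ m * \<bar>c w\<bar>) \<le> t" if t: "t > 0" for t
  proof -
    obtain \<delta>W where dW: "\<delta>W > 0" and wl: "\<And>(M :: 'w measure) f g. \<lbrakk>f \<in> Lp_set (real m + 1) M; g \<in> Lp_set (real m + 1) M; pint (real m + 1) M f \<le> B4;
       pint (real m + 1) M g \<le> B4; pint (real m + 1) M f \<le> \<delta>W\<rbrakk> \<Longrightarrow> (LINT w|M. \<bar>f w\<bar> ^ m * \<bar>g w\<bar>) \<le> t"
      by (rule weighted_small_left[OF m(2) t, where B = B4], rule that)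
    obtain \<delta>2 where d2: "\<delta>2 > 0" and As: "\<And>(M :: 'w measure) f g. \<lbrakk>f \<in> Lp_set r M; g \<in> Lp_set r M; pint r M f \<le> B; pint r M g \<le> B;
       pint r M (\<lambda>w. f w - g w) \<le> \<delta>2\<rbrakk> \<Longrightarrow> (LINT w|M. A (f w) (g w)) \<le> \<delta>W"
      by (rule small_of_pint[OF Ah r0 Az dW, where B = B], rule that)
    show ?thesis
    proof (intro exI[of _ \<delta>2] conjI d2 allI impI)
      fix M :: "'w measure" and f c a b
      assume iso: "isometric_family G \<tau> r M f" and B: "pint r M (f \<one>\<^bsub>G\<^esub>) \<le> B" and c: "c \<in> Lp_set (real n) M" "pint (real n) M c \<le> B4"
        and ab: "a \<in> carrier G" "b \<in> carrier G" and s: "pint r M (\<lambda>w. f a w - f b w) \<le> \<delta>2"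
      interpret even_family G \<tau> r M f n
        using iso n by (simp add: even_family_def even_family_axioms_def r_def)
      let ?R = "\<lambda>w. root_diff m (f a w) (f b w)"
      have Ba: "pint r M (f a) \<le> B" "pint r M (f b) \<le> B" using B pint_fam[OF ab(1)] pint_fam[OF ab(2)] by simp_all
      have R: "?R \<in> Lp_set (real n) M" by (rule root_diff_Lp_set[OF m(2) ab])
      have pR: "pint (real n) M ?R = (LINT w|M. A (f a w) (f b w))" by (simp add: pint_def A_def)
      have "(LINT w|M. A (f a w) (f b w)) \<le> (LINT w|M. K * (\<bar>f a w\<bar> powr r + \<bar>f b w\<bar> powr r))"
      proof (rule integral_mono)
        show "integrable M (\<lambda>w. A (f a w) (f b w))" by (rule homogeneous2_integrable[OF Ah r0 fam[OF ab(1)] fam[OF ab(2)]])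
        show "integrable M (\<lambda>w. K * (\<bar>f a w\<bar> powr r + \<bar>f b w\<bar> powr r))"
          using Lp_set_integrable[OF fam[OF ab(1)]] Lp_set_integrable[OF fam[OF ab(2)]] by simp
        show "A (f a w) (f b w) \<le> K * (\<bar>f a w\<bar> powr r + \<bar>f b w\<bar> powr r)" for w
          by (rule order_trans[OF abs_ge_self K(2)])
      qed
      also have "\<dots> = K * (pint r M (f a) + pint r M (f b))"
        unfolding pint_def using Lp_set_integrable[OF fam[OF ab(1)]] Lp_set_integrable[OF fam[OF ab(2)]] by simp
      also have "\<dots> \<le> K * (B + B)" using Ba K(1) by (intro mult_left_mono add_mono) auto
      finally have "pint (real n) M ?R \<le> B4" unfolding pR B4_def by simp
      moreover have "pint (real n) M ?R \<le> \<delta>W" unfolding pR by (rule As[OF fam[OF ab(1)] fam[OF ab(2)] Ba s])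
      ultimately show "(LINT w|M. \<bar>?R w\<bar> ^ m * \<bar>c w\<bar>) \<le> t" by (intro wl[unfolded en, OF R c(1) _ c(2)])
    qed
  qed
  obtain \<delta>2 where d2: "\<delta>2 > 0" and small2: "\<forall>(M :: 'w measure) f c a b. isometric_family G \<tau> r M f \<longrightarrow> pint r M (f \<one>\<^bsub>G\<^esub>) \<le> B \<longrightarrow> c \<in> Lp_set (real n) M \<longrightarrow>
      pint (real n) M c \<le> B4 \<longrightarrow> a \<in> carrier G \<longrightarrow> b \<in> carrier G \<longrightarrow> pint r M (\<lambda>w. f a w - f b w) \<le> \<delta>2 \<longrightarrow>
      (LINT w|M. \<bar>root_diff m (f a w) (f b w)\<bar> ^ m * \<bar>c w\<bar>) \<le> \<theta>"
    using kernel_small[OF th] by (elim exE conjE)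
  show ?thesis
  proof (rule that[of "min \<delta>1 \<delta>2"], fold r_def)
    show "min \<delta>1 \<delta>2 > 0" using d1 d2 by simp
    fix M :: "'w measure" and f g
    assume iso: "isometric_family G \<tau> r M f" and B: "pint r M (f \<one>\<^bsub>G\<^esub>) \<le> B"
      and q: "\<forall>q\<in>Q. pint r M (\<lambda>w. f q w - f \<one>\<^bsub>G\<^esub> w) \<le> min \<delta>1 \<delta>2" and g: "g \<in> carrier G"
    interpret even_family G \<tau> r M f n
      using iso n by (simp add: even_family_def even_family_axioms_def r_def)
    have Bg: "pint r M (f x) \<le> B" if "x \<in> carrier G" for x using B pint_fam[OF that] by simp
    have q1: "\<forall>q\<in>Q. pint r M (\<lambda>w. f q w - f \<one>\<^bsub>G\<^esub> w) \<le> \<delta>1" and q2: "\<And>x. x \<in> Q \<Longrightarrow> pint r M (\<lambda>w. f x w - f \<one>\<^bsub>G\<^esub> w) \<le> \<delta>2"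
      using q by auto
    have D1: "(LINT w|M. (f x w ^ n - f \<one>\<^bsub>G\<^esub> w ^ n)\<^sup>2) \<le> min (\<delta>f / 2) \<delta>s" if "x \<in> carrier G" for x
      by (rule step1[folded r_def, OF iso B q1 that])
    define v where "v = (\<lambda>w. (f \<one>\<^bsub>G\<^esub> w)\<^sup>2)"
    have v: "v \<in> Lp_set (real n) M" unfolding v_def by (rule square_Lp_set[OF fam[OF one_closed]])
    have near: "pint (real n) M (\<lambda>w. (f x w)\<^sup>2 - v w) \<le> \<epsilon>2" if x: "x \<in> carrier G" for x
    proof -
      have "(LINT w|M. (f x w ^ n - f \<one>\<^bsub>G\<^esub> w ^ n)\<^sup>2) \<le> \<delta>s" using D1[OF x] by simp
      from sq[OF fam[OF x] fam[OF one_closed] Bg[OF x] B this] show ?thesis by (simp add: pint_def v_def)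
    qed
    obtain c where c: "c \<in> Lp_set (real n) M" and c0: "\<And>w. c w \<ge> 0"
      and ap: "\<And>\<epsilon>. \<epsilon> > 0 \<Longrightarrow> \<exists>u. sq_hull u \<and> (\<forall>h\<in>carrier G. pint (real n) M (\<lambda>w. u h w - c w) \<le> \<epsilon>)"
      by (rule sq_hull_center[OF n1], rule that)
    obtain u where u: "sq_hull u" "\<forall>h\<in>carrier G. pint (real n) M (\<lambda>w. u h w - c w) \<le> \<epsilon>2" using ap[OF eps2(1)] by (elim exE conjE)
    have uL: "u \<one>\<^bsub>G\<^esub> \<in> Lp_set (real n) M" by (rule sq_hull_Lp_set[OF u(1) one_closed])
    \<comment> \<open>The first kernel puts all squares f(x)^2 close to f(1)^2, hence also the hull,
      and c is close to a member of the hull.\<close>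
    have uv: "pint (real n) M (\<lambda>w. u \<one>\<^bsub>G\<^esub> w - v w) \<le> \<epsilon>2" by (rule sq_hull_near[OF n1 u(1) v near one_closed])
    have uc: "pint (real n) M (\<lambda>w. c w - u \<one>\<^bsub>G\<^esub> w) \<le> \<epsilon>2"
      using bspec[OF u(2) one_closed] by (subst pint_diff_commute)
    have "pint (real n) M (\<lambda>w. c w - v w) \<le> D * (pint (real n) M (\<lambda>w. c w - u \<one>\<^bsub>G\<^esub> w) + pint (real n) M (\<lambda>w. u \<one>\<^bsub>G\<^esub> w - v w))"
      unfolding D_def by (rule pint_triangle[OF nr c uL v])
    also have "\<dots> \<le> D * (2 * \<epsilon>2)" using uc uv D by (intro mult_left_mono) auto
    finally have cv: "pint (real n) M (\<lambda>w. c w - v w) \<le> D * (2 * \<epsilon>2)" .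
    have D2: "D * (2 * \<epsilon>2) \<le> D * 2" using eps2 D by (intro mult_left_mono) auto
    have "pint (real n) M (\<lambda>w. (c w - v w) + v w) \<le> D * (pint (real n) M (\<lambda>w. c w - v w) + pint (real n) M v)"
      unfolding D_def by (rule pint_add_le[OF nr Lp_set_diff[OF nr c v] v])
    also have "\<dots> \<le> D * (D * 2 + B)"
    proof (intro mult_left_mono add_mono order_trans[OF cv D2])
      show "pint (real n) M v \<le> B" using B unfolding v_def pint_square .
    qed (use D in simp)
    finally have cB: "pint (real n) M c \<le> B4" unfolding B4_def by simp
    define k where "k = (\<lambda>g g'. LINT w|M. (f g w * f g' w) ^ m * c w)"
    have ik: "invariant_kernel G k" unfolding k_def by (rule weighted_kernel[OF m(1,2) c c0 ap])
    have kd: "k a a - 2 * k a b + k b b = (LINT w|M. \<bar>root_diff m (f a w) (f b w)\<bar> ^ m * \<bar>c w\<bar>)"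
      if ab: "a \<in> carrier G" "b \<in> carrier G" for a b
    proof -
      have i: "integrable M (\<lambda>w. (f x w * f y w) ^ m * c w)" if "x \<in> carrier G" "y \<in> carrier G" for x y
        by (rule weighted_integrable(1)[OF m(1) mult_Lp_set[OF fam[OF that(1)] fam[OF that(2)]] c])
      have "\<bar>root_diff m (f a w) (f b w)\<bar> ^ m * \<bar>c w\<bar> = (f a w * f a w) ^ m * c w - 2 * ((f a w * f b w) ^ m * c w) + (f b w * f b w) ^ m * c w" for w
      proof -
        have h: "\<bar>root_diff m (f a w) (f b w)\<bar> ^ m = (f a w ^ m - f b w ^ m)\<^sup>2"
          using root_diff_power[OF m(2), of "f a w" "f b w"] by (simp add: root_diff_def)
        show ?thesis unfolding h abs_of_nonneg[OF c0] by (simp add: power2_eq_square power_mult_distrib algebra_simps)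
      qed
      then show ?thesis unfolding k_def using i ab by simp
    qed
    have "\<forall>g\<in>carrier G. k g g - 2 * k g \<one>\<^bsub>G\<^esub> + k \<one>\<^bsub>G\<^esub> \<one>\<^bsub>G\<^esub> \<le> \<delta>f / 4"
    proof (rule step2[OF ik])
      show "\<forall>q\<in>Q. k q q - 2 * k q \<one>\<^bsub>G\<^esub> + k \<one>\<^bsub>G\<^esub> \<one>\<^bsub>G\<^esub> \<le> \<theta>"
      proof
        fix x assume x: "x \<in> Q"
        then have xG: "x \<in> carrier G" using Q by blast
        show "k x x - 2 * k x \<one>\<^bsub>G\<^esub> + k \<one>\<^bsub>G\<^esub> \<one>\<^bsub>G\<^esub> \<le> \<theta>"
          unfolding kd[OF xG one_closed] using small2 iso B c cB xG one_closed q2[OF x] by blast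
      qed
      show "\<forall>b\<in>carrier G. \<forall>e>0. \<exists>U. openin \<tau> U \<and> b \<in> U \<and> (\<forall>g\<in>U. k g g - 2 * k g b + k b b < e)"
      proof (intro ballI allI impI)
        fix b and e :: real assume b: "b \<in> carrier G" and e: "e > 0"
        have e2: "e / 2 > 0" using e by simp
        obtain \<delta>3 where d3: "\<delta>3 > 0" and small3: "\<forall>(M :: 'w measure) f c a b. isometric_family G \<tau> r M f \<longrightarrow> pint r M (f \<one>\<^bsub>G\<^esub>) \<le> B \<longrightarrow> c \<in> Lp_set (real n) M \<longrightarrow>
            pint (real n) M c \<le> B4 \<longrightarrow> a \<in> carrier G \<longrightarrow> b \<in> carrier G \<longrightarrow> pint r M (\<lambda>w. f a w - f b w) \<le> \<delta>3 \<longrightarrow>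
            (LINT w|M. \<bar>root_diff m (f a w) (f b w)\<bar> ^ m * \<bar>c w\<bar>) \<le> e / 2"
          using kernel_small[OF e2] by (elim exE conjE)
        obtain U where U: "openin \<tau> U" "b \<in> U" "\<And>g. g \<in> U \<Longrightarrow> pint r M (\<lambda>w. f g w - f b w) < \<delta>3"
          using fam_continuous[OF b d3] by blast
        have "k x x - 2 * k x b + k b b < e" if x: "x \<in> U" for x
        proof -
          have xG: "x \<in> carrier G" using x openin_subset[OF U(1)] top by auto
          have "(LINT w|M. \<bar>root_diff m (f x w) (f b w)\<bar> ^ m * \<bar>c w\<bar>) \<le> e / 2"
            using small3 iso B c cB xG b less_imp_le[OF U(3)[OF x]] by blast
          then show ?thesis unfolding kd[OF xG b] using e by linarith
        qed
        then show "\<exists>U. openin \<tau> U \<and> b \<in> U \<and> (\<forall>g\<in>U. k g g - 2 * k g b + k b b < e)" using U(1,2) by blast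
      qed
    qed
    then have kg: "k g g - 2 * k g \<one>\<^bsub>G\<^esub> + k \<one>\<^bsub>G\<^esub> \<one>\<^bsub>G\<^esub> \<le> \<delta>f / 4" using g by blast
    let ?R = "\<lambda>w. root_diff m (f g w) (f \<one>\<^bsub>G\<^esub> w)"
    have R: "?R \<in> Lp_set (real n) M" by (rule root_diff_Lp_set[OF m(2) g one_closed])
    have Rm: "\<bar>?R w\<bar> ^ m = (f g w ^ m - f \<one>\<^bsub>G\<^esub> w ^ m)\<^sup>2" for w
      using root_diff_power[OF m(2), of "f g w" "f \<one>\<^bsub>G\<^esub> w"] by (simp add: root_diff_def)
    have "pint (real n) M ?R \<le> (LINT w|M. K * (\<bar>f g w\<bar> powr r + \<bar>f \<one>\<^bsub>G\<^esub> w\<bar> powr r))"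
      unfolding pint_def
    proof (rule integral_mono[OF Lp_set_integrable[OF R]])
      show "integrable M (\<lambda>w. K * (\<bar>f g w\<bar> powr r + \<bar>f \<one>\<^bsub>G\<^esub> w\<bar> powr r))"
        using Lp_set_integrable[OF fam[OF g]] Lp_set_integrable[OF fam[OF one_closed]] by simp
      show "\<bar>?R w\<bar> powr real n \<le> K * (\<bar>f g w\<bar> powr r + \<bar>f \<one>\<^bsub>G\<^esub> w\<bar> powr r)" for w
        using K(2)[of "f g w" "f \<one>\<^bsub>G\<^esub> w"] by (simp add: A_def)
    qed
    also have "\<dots> = K * (pint r M (f g) + pint r M (f \<one>\<^bsub>G\<^esub>))"
      unfolding pint_def using Lp_set_integrable[OF fam[OF g]] Lp_set_integrable[OF fam[OF one_closed]] by simp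
    also have "\<dots> \<le> K * (B + B)" using Bg[OF g] B K(1) by (intro mult_left_mono add_mono) auto
    finally have RB: "pint (real n) M ?R \<le> B3" unfolding B3_def by simp
    have vc: "(\<lambda>w. v w - c w) \<in> Lp_set (real n) M" by (rule Lp_set_diff[OF nr v c])
    have vcs: "pint (real n) M (\<lambda>w. v w - c w) \<le> D * (2 * \<epsilon>2)" using cv by (subst pint_diff_commute)
    \<comment> \<open>The cost of exchanging the weight f(1)^2 for c.\<close>
    have part: "(LINT w|M. \<bar>?R w\<bar> ^ m * \<bar>v w - c w\<bar>) \<le> \<delta>f / 4"
      by (rule wr[unfolded en, OF R vc RB]) (use vcs D2 eps2(3) in \<open>auto simp: B3_def\<close>)
    have i1: "integrable M (\<lambda>w. \<bar>?R w\<bar> ^ m * \<bar>v w\<bar>)" "integrable M (\<lambda>w. \<bar>?R w\<bar> ^ m * \<bar>c w\<bar>)" "integrable M (\<lambda>w. \<bar>?R w\<bar> ^ m * \<bar>v w - c w\<bar>)"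
      by (rule weighted_integrable(2)[OF m(1) R v] weighted_integrable(2)[OF m(1) R c] weighted_integrable(2)[OF m(1) R vc])+
    have "(LINT w|M. \<bar>?R w\<bar> ^ m * \<bar>v w\<bar>) \<le> (LINT w|M. \<bar>?R w\<bar> ^ m * \<bar>c w\<bar> + \<bar>?R w\<bar> ^ m * \<bar>v w - c w\<bar>)"
    proof (rule integral_mono[OF i1(1) Bochner_Integration.integrable_add[OF i1(2,3)]])
      fix w
      have "\<bar>?R w\<bar> ^ m * \<bar>v w\<bar> \<le> \<bar>?R w\<bar> ^ m * (\<bar>c w\<bar> + \<bar>v w - c w\<bar>)" by (intro mult_left_mono) auto
      then show "\<bar>?R w\<bar> ^ m * \<bar>v w\<bar> \<le> \<bar>?R w\<bar> ^ m * \<bar>c w\<bar> + \<bar>?R w\<bar> ^ m * \<bar>v w - c w\<bar>" by (simp add: distrib_left)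
    qed
    also have "\<dots> = (LINT w|M. \<bar>?R w\<bar> ^ m * \<bar>c w\<bar>) + (LINT w|M. \<bar>?R w\<bar> ^ m * \<bar>v w - c w\<bar>)"
      by (rule Bochner_Integration.integral_add[OF i1(2,3)])
    also have "\<dots> \<le> \<delta>f / 4 + \<delta>f / 4" using kg part unfolding kd[OF g one_closed] by (rule add_mono)
    finally have w1: "(LINT w|M. \<bar>?R w\<bar> ^ m * \<bar>v w\<bar>) \<le> \<delta>f / 4 + \<delta>f / 4" .
    have i2: "integrable M (\<lambda>w. (f g w ^ n - f \<one>\<^bsub>G\<^esub> w ^ n)\<^sup>2)"
      by (rule homogeneous2_integrable[OF homogeneous2_power_diff_square[of n, folded r_def] r0 fam[OF g] fam[OF one_closed]])
    have "b (f g w) (f \<one>\<^bsub>G\<^esub> w) = \<bar>?R w\<bar> ^ m * \<bar>v w\<bar> + (f g w ^ n - f \<one>\<^bsub>G\<^esub> w ^ n)\<^sup>2" for w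
      unfolding b_def Rm v_def by simp
    then have "(LINT w|M. b (f g w) (f \<one>\<^bsub>G\<^esub> w)) = (LINT w|M. \<bar>?R w\<bar> ^ m * \<bar>v w\<bar>) + (LINT w|M. (f g w ^ n - f \<one>\<^bsub>G\<^esub> w ^ n)\<^sup>2)"
      using Bochner_Integration.integral_add[OF i1(1) i2] by simp
    also have "\<dots> \<le> \<delta>f"
    proof -
      have "(LINT w|M. (f g w ^ n - f \<one>\<^bsub>G\<^esub> w ^ n)\<^sup>2) \<le> \<delta>f / 2" using D1[OF g] by simp
      with w1 show ?thesis by (simp add: field_simps)
    qed
    finally show "pint r M (\<lambda>w. f g w - f \<one>\<^bsub>G\<^esub> w) \<le> \<epsilon>" by (rule final[OF fam[OF g] fam[OF one_closed] Bg[OF g] B])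
  qed
qed

theorem orbit_rigidity:
  assumes rig: "kernel_rigid G \<tau> Q" and Q: "Q \<subseteq> carrier G" and r: "r > 1" and e: "\<epsilon> > 0"
  obtains \<delta> where "\<delta> > 0"
    "\<And>(M :: 'w measure) f g. \<lbrakk>isometric_family G \<tau> r M f; pint r M (f \<one>\<^bsub>G\<^esub>) \<le> B;
      \<forall>q\<in>Q. pint r M (\<lambda>w. f q w - f \<one>\<^bsub>G\<^esub> w) \<le> \<delta>; g \<in> carrier G\<rbrakk>
      \<Longrightarrow> pint r M (\<lambda>w. f g w - f \<one>\<^bsub>G\<^esub> w) \<le> \<epsilon>"
proof (cases "\<exists>n :: nat. r = 2 * real n")
  case False
  then have ne: "\<And>n :: nat. r \<noteq> 2 * real n" by blast
  show ?thesis by (rule orbit_rigidity_not_even[OF rig Q r ne e, where B = B], rule that)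
next
  case True
  then obtain n :: nat where n: "r = real (2 * n)" by auto
  then have n0: "n > 0" using r by (cases n) auto
  show ?thesis
  proof (cases "odd n")
    case True
    show ?thesis by (rule orbit_rigidity_odd_half[OF rig Q True e, where B = B, folded n], rule that)
  next
    case False
    then have ev: "even n" by simp
    show ?thesis by (rule orbit_rigidity_even_half[OF rig Q ev n0 e, where B = B, folded n], rule that)
  qed
qed

section \<open>Spaces mapping uniformly into \<open>L\<^sub>r\<close>\<close>

text \<open>Dyadic convex combinations take the place of the convex hull, as the least-norm argument
  uses midpoints only.\<close>

inductive_set (in real_module) mid_hull :: "'v set \<Rightarrow> 'v set" for S where
  base: "x \<in> S \<Longrightarrow> x \<in> mid_hull S"
| mid: "u \<in> mid_hull S \<Longrightarrow> v \<in> mid_hull S \<Longrightarrow> (1 / 2) \<odot> (u \<oplus> v) \<in> mid_hull S"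

context real_module
begin

lemma mid_hull_carrier:
  assumes "S \<subseteq> carrier V" "u \<in> mid_hull S"
  shows "u \<in> carrier V"
  using assms(2) by (induction rule: mid_hull.induct) (use assms(1) in auto)

lemma half_double: "w \<in> carrier V \<Longrightarrow> (1 / 2) \<odot> w \<oplus> (1 / 2) \<odot> w = w"
  using smult_add[of w "1 / 2" "1 / 2"] by simp

lemma mid_diff:
  assumes "u \<in> carrier V" "v \<in> carrier V" "x \<in> carrier V"
  shows "(1 / 2) \<odot> (u \<oplus> v) \<ominus> x = (1 / 2) \<odot> ((u \<ominus> x) \<oplus> (v \<ominus> x))"
proof -
  have "(1 / 2) \<odot> ((u \<ominus> x) \<oplus> (v \<ominus> x)) = (1 / 2) \<odot> ((u \<oplus> v) \<ominus> (x \<oplus> x))"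
    using assms by (simp add: a_minus_def M.a_ac M.minus_add)
  also have "\<dots> = (1 / 2) \<odot> (u \<oplus> v) \<ominus> (1 / 2) \<odot> (x \<oplus> x)" using assms by (intro smult_diff) auto
  also have "(1 / 2) \<odot> (x \<oplus> x) = x" using assms by (simp add: smult_r_distr half_double)
  finally show ?thesis by simp
qed

lemma additive_minus:
  fixes j :: "'v \<Rightarrow> real"
  assumes j: "\<And>y z. y \<in> carrier V \<Longrightarrow> z \<in> carrier V \<Longrightarrow> j (y \<oplus> z) = j y + j z"
    and y: "y \<in> carrier V" and z: "z \<in> carrier V"
  shows "j (y \<ominus> z) = j y - j z"
  using j[of "y \<ominus> z" z] y z by (simp add: minus_minus_cancel)

end

text \<open>The common interface of subspaces and quotients. \<open>minimizer\<close> is what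
  uniform convexity yields; \<open>support\<close> is a norming functional that inherits the
  symmetries of x, as uniqueness of supporting functionals yields. \<open>Phi_combination\<close>
  replaces linearity of \<open>\<Phi>\<close>.\<close>

locale rigid_space = nspace V for V :: "'v normed_module" (structure) +
  fixes r :: real and M :: "'w measure" and \<Phi> :: "'v \<Rightarrow> 'w \<Rightarrow> real"
  assumes exponent: "r > 1"
    and minimizer: "\<And>C. C \<subseteq> carrier V \<Longrightarrow> C \<noteq> {} \<Longrightarrow> \<forall>u\<in>C. \<forall>v\<in>C. (1 / 2) \<odot> (u \<oplus> v) \<in> C \<Longrightarrow>
      \<exists>c\<in>carrier V. \<forall>\<epsilon>>0. \<exists>\<delta>>0. \<forall>u\<in>C. nrm V u \<le> (INF u\<in>C. nrm V u) + \<delta> \<longrightarrow> nrm V (u \<ominus> c) \<le> \<epsilon>"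
    and support: "\<And>x. x \<in> carrier V \<Longrightarrow> \<exists>j. (\<forall>y\<in>carrier V. \<forall>z\<in>carrier V. j (y \<oplus> z) = j y + j z) \<and>
      (\<forall>y\<in>carrier V. \<bar>j y\<bar> \<le> nrm V y) \<and> j x = nrm V x \<and>
      (\<forall>T\<in>carrier (isometry_group V). T x = x \<longrightarrow> (\<forall>y\<in>carrier V. j (T y) = j y))"
    and Phi_mem: "\<And>x. x \<in> carrier V \<Longrightarrow> \<Phi> x \<in> Lp_set r M"
    and Phi_bound: "\<And>B. \<exists>B'. \<forall>x\<in>carrier V. nrm V x \<le> B \<longrightarrow> pint r M (\<Phi> x) \<le> B'"
    and Phi_combination: "\<And>T (n::nat) c x. T \<in> carrier (isometry_group V) \<Longrightarrow> (\<And>i. i < n \<Longrightarrow> x i \<in> carrier V) \<Longrightarrow>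
      pint r M (\<lambda>w. \<Sum>i<n. c i * \<Phi> (T (x i)) w) = pint r M (\<lambda>w. \<Sum>i<n. c i * \<Phi> (x i) w)"
    and Phi_uniform: "\<And>B \<epsilon>. \<epsilon> > 0 \<Longrightarrow> \<exists>\<delta>>0. \<forall>x\<in>carrier V. \<forall>y\<in>carrier V. nrm V x \<le> B \<longrightarrow> nrm V y \<le> B \<longrightarrow>
      nrm V (x \<ominus> y) \<le> \<delta> \<longrightarrow> pint r M (\<lambda>w. \<Phi> x w - \<Phi> y w) \<le> \<epsilon>"
    and Phi_inverse: "\<And>B \<epsilon>. \<epsilon> > 0 \<Longrightarrow> \<exists>\<delta>>0. \<forall>x\<in>carrier V. \<forall>y\<in>carrier V. nrm V x \<le> B \<longrightarrow> nrm V y \<le> B \<longrightarrow>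
      pint r M (\<lambda>w. \<Phi> x w - \<Phi> y w) \<le> \<delta> \<longrightarrow> nrm V (x \<ominus> y) \<le> \<epsilon>"

locale isometric_rep = nspace V + G: group G
  for V :: "'v normed_module" (structure) and G :: "('g, 'm) monoid_scheme" +
  fixes \<rho> :: "'g \<Rightarrow> 'v \<Rightarrow> 'v"
  assumes rep_hom: "\<rho> \<in> hom G (isometry_group V)"
begin

lemma rep_iso: "g \<in> carrier G \<Longrightarrow> \<rho> g \<in> carrier (isometry_group V)"
  using rep_hom by (auto simp: hom_def)

lemmas rep_closed [simp] = isometryD(1)[OF rep_iso]

lemma rep_mult: "g \<in> carrier G \<Longrightarrow> h \<in> carrier G \<Longrightarrow> x \<in> carrier V \<Longrightarrow> \<rho> (g \<otimes>\<^bsub>G\<^esub> h) x = \<rho> g (\<rho> h x)"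
proof -
  assume g: "g \<in> carrier G" and h: "h \<in> carrier G" and x: "x \<in> carrier V"
  have "\<rho> (g \<otimes>\<^bsub>G\<^esub> h) = \<rho> g \<otimes>\<^bsub>isometry_group V\<^esub> \<rho> h" using rep_hom g h by (simp add: hom_def)
  moreover have "\<rho> g \<in> Bij (carrier V)" "\<rho> h \<in> Bij (carrier V)" using rep_iso g h by (auto simp: isometry_group_def)
  ultimately show ?thesis using x by (simp add: isometry_group_def BijGroup_def compose_eq)
qed

lemma rep_one: "x \<in> carrier V \<Longrightarrow> \<rho> \<one>\<^bsub>G\<^esub> x = x"
proof -
  assume x: "x \<in> carrier V"
  have "\<rho> \<one>\<^bsub>G\<^esub> (\<rho> \<one>\<^bsub>G\<^esub> x) = \<rho> \<one>\<^bsub>G\<^esub> x" using rep_mult[of "\<one>\<^bsub>G\<^esub>" "\<one>\<^bsub>G\<^esub>" x] x by simp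
  moreover have "inj_on (\<rho> \<one>\<^bsub>G\<^esub>) (carrier V)" using isometryD(2)[OF rep_iso[OF G.one_closed]] by (simp add: bij_betw_def)
  ultimately show ?thesis using x by (auto dest: inj_onD)
qed

lemma rep_zero: "g \<in> carrier G \<Longrightarrow> \<rho> g \<zero> = \<zero>"
  using isometry_diff[OF rep_iso, of g \<zero> \<zero>] by (simp add: a_minus_def M.r_neg)

lemma fixed_submodule: "submodule (fixed_vectors G V \<rho>) real_ring V"
proof (rule submoduleI)
  show "\<ominus> a \<in> fixed_vectors G V \<rho>" if "a \<in> fixed_vectors G V \<rho>" for a
  proof -
    have a: "a \<in> carrier V" "\<And>g. g \<in> carrier G \<Longrightarrow> \<rho> g a = a" using that by (auto simp: fixed_vectors_def)
    have "\<rho> g (\<ominus> a) = \<ominus> a" if g: "g \<in> carrier G" for g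
      using isometryD(4)[OF rep_iso[OF g] a(1), of "- 1"] a g by (simp add: smult_minus_one)
    then show ?thesis using a by (simp add: fixed_vectors_def)
  qed
qed (auto simp: fixed_vectors_def rep_zero isometryD(3,4)[OF rep_iso])

lemma induced_rep_coset:
  assumes g: "g \<in> carrier G" and x: "x \<in> carrier V"
  shows "induced_rep G V \<rho> g (fixed_vectors G V \<rho> +> x) = fixed_vectors G V \<rho> +> \<rho> g x"
proof -
  let ?F = "fixed_vectors G V \<rho>"
  have "?F +> \<rho> g z = ?F +> \<rho> g x" if z: "z \<in> ?F +> x" for z
  proof -
    obtain h where h: "h \<in> ?F" "z = h \<oplus> x" using z unfolding a_r_coset_def' by auto
    have hV: "h \<in> carrier V" "\<rho> g h = h" using h g by (auto simp: fixed_vectors_def)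
    have "\<rho> g z \<ominus> \<rho> g x = h" using hV x g isometryD(3)[OF rep_iso[OF g] hV(1) x] h(2) by (simp add: minus_minus_cancel)
    then show ?thesis using h hV x g by (subst coset_eq_iff[OF fixed_submodule]) auto
  qed
  moreover have "x \<in> ?F +> x"
    by (rule abelian_subgroup.a_rcos_self[OF submodule_abelian[OF fixed_submodule] x])
  ultimately show ?thesis unfolding induced_rep_def by blast
qed

end

context rigid_space
begin

theorem rigid_space_TX:
  fixes G :: "('g, 'm) monoid_scheme"
  assumes G: "topological_group G \<tau>" and T: "kazhdan_property_T G \<tau>"
  shows "property_TX G \<tau> V"
  unfolding property_TX_def
proof (intro allI impI notI)
  fix \<rho> :: "'g \<Rightarrow> 'v \<Rightarrow> 'v"
  assume scr: "strongly_continuous_rep G \<tau> V \<rho>"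
    and ahi: "almost_has_invariant_vectors \<tau> (quotient_space V (fixed_vectors G V \<rho>)) (induced_rep G V \<rho>)"
  have grp: "group G" and top: "topspace \<tau> = carrier G" using G by (auto simp: topological_group_def)
  interpret isometric_rep V G \<rho>
    using grp scr nspace_axioms by (simp add: isometric_rep_def isometric_rep_axioms_def strongly_continuous_rep_def)
  define F where "F = fixed_vectors G V \<rho>"
  let ?Q = "quotient_space V F"
  have F: "submodule F real_ring V" unfolding F_def by (rule fixed_submodule)
  have FV: "f \<in> carrier V" and Ffix: "g \<in> carrier G \<Longrightarrow> \<rho> g f = f" if "f \<in> F" for f g
    using that by (auto simp: F_def fixed_vectors_def)
  obtain Q where Q: "compactin \<tau> Q" "\<one>\<^bsub>G\<^esub> \<in> Q" "kernel_rigid G \<tau> Q"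
    by (rule kazhdan_kernel_rigid[OF G T])
  have QG: "Q \<subseteq> carrier G" using compactin_subset_topspace[OF Q(1)] top by simp
  \<comment> \<open>The vector e constructed below has norm at most 4, see
    \<open>e_upper\<close>.\<close>
  obtain B where B: "\<forall>x\<in>carrier V. nrm V x \<le> 4 \<longrightarrow> pint r M (\<Phi> x) \<le> B" using Phi_bound[of 4] by (elim exE)
  \<comment> \<open>The orbit of x will stay within 1 / 2 of x, hence so does its hull, which comes
    within 1 / 4 of c; this contradicts that e = x - c has norm at least 1.\<close>
  have half: "(1 / 2 :: real) > 0" by simp
  obtain \<delta>a where da: "\<delta>a > 0" and inverse: "\<forall>x\<in>carrier V. \<forall>y\<in>carrier V. nrm V x \<le> 4 \<longrightarrow> nrm V y \<le> 4 \<longrightarrow>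
      pint r M (\<lambda>w. \<Phi> x w - \<Phi> y w) \<le> \<delta>a \<longrightarrow> nrm V (x \<ominus> y) \<le> 1 / 2"
    using Phi_inverse[OF half, of 4] by (elim exE conjE)
  obtain \<delta>b where db: "\<delta>b > 0" and orbit: "\<And>(M :: 'w measure) f g. \<lbrakk>isometric_family G \<tau> r M f; pint r M (f \<one>\<^bsub>G\<^esub>) \<le> B;
      \<forall>q\<in>Q. pint r M (\<lambda>w. f q w - f \<one>\<^bsub>G\<^esub> w) \<le> \<delta>b; g \<in> carrier G\<rbrakk>
      \<Longrightarrow> pint r M (\<lambda>w. f g w - f \<one>\<^bsub>G\<^esub> w) \<le> \<delta>a"
    by (rule orbit_rigidity[OF Q(3) QG exponent da, where B = B], rule that)
  obtain \<delta>c where dc: "\<delta>c > 0" and unif: "\<forall>x\<in>carrier V. \<forall>y\<in>carrier V. nrm V x \<le> 4 \<longrightarrow> nrm V y \<le> 4 \<longrightarrow>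
      nrm V (x \<ominus> y) \<le> \<delta>c \<longrightarrow> pint r M (\<lambda>w. \<Phi> x w - \<Phi> y w) \<le> \<delta>b"
    using Phi_uniform[OF db, of 4] by (elim exE conjE)
  \<comment> \<open>Passing from a displacement modulo F to one in V doubles the bound, see
    \<open>dist\<close>.\<close>
  define e0 where "e0 = \<delta>c / 2"
  have e0: "e0 > 0" unfolding e0_def using dc by simp
  have "(INF x\<in>unit_sphere ?Q. ndiam ?Q ((\<lambda>g. induced_rep G V \<rho> g x) ` Q)) < ennreal e0"
    using ahi Q(1) e0 unfolding almost_has_invariant_vectors_def F_def by simp
  then obtain xb where xb: "xb \<in> unit_sphere ?Q" "ndiam ?Q ((\<lambda>g. induced_rep G V \<rho> g xb) ` Q) < ennreal e0"
    unfolding INF_less_iff by blast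
  obtain x where x: "x \<in> carrier V" "xb = F +> x" using xb(1) by (auto simp: unit_sphere_def quotient_carrier[OF F])
  have nx: "(INF f\<in>F. nrm V (f \<oplus> x)) = 1" using xb(1) quotient_nrm[OF F, of x] unfolding unit_sphere_def x(2) by simp
  have Fne: "F \<noteq> {}" using F unfolding F_def fixed_vectors_def by (auto intro!: exI[of _ \<zero>] simp: rep_zero)
  have bdd: "bdd_below ((\<lambda>f. nrm V (f \<oplus> y)) ` F)" if "y \<in> carrier V" for y
    by (rule bdd_belowI2[of _ 0]) (use that FV in \<open>auto intro!: nrm_nonneg\<close>)
  have move: "\<exists>f\<in>F. nrm V (f \<oplus> (\<rho> g x \<ominus> x)) < e0" if g: "g \<in> Q" for g
  proof -
    have gG: "g \<in> carrier G" using g QG by auto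
    have ir: "induced_rep G V \<rho> h xb = F +> \<rho> h x" if "h \<in> carrier G" for h
      unfolding x(2) F_def by (rule induced_rep_coset[OF that x(1)])
    \<comment> \<open>The identity lies in Q, so the diameter bounds the displacement of
      \<open>xb\<close> itself.\<close>
    have "ennreal (nrm ?Q ((F +> \<rho> g x) \<ominus>\<^bsub>?Q\<^esub> (F +> \<rho> \<one>\<^bsub>G\<^esub> x))) \<le> ndiam ?Q ((\<lambda>g. induced_rep G V \<rho> g xb) ` Q)"
      unfolding ndiam_def using g Q(2) ir[OF gG] ir[OF G.one_closed] by (intro SUP_upper2[of "F +> \<rho> g x"] SUP_upper2[of "F +> \<rho> \<one>\<^bsub>G\<^esub> x"]) force+
    then have "ennreal (nrm ?Q ((F +> \<rho> g x) \<ominus>\<^bsub>?Q\<^esub> (F +> \<rho> \<one>\<^bsub>G\<^esub> x))) < ennreal e0" using xb(2) by (rule le_less_trans)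
    then have "nrm ?Q ((F +> \<rho> g x) \<ominus>\<^bsub>?Q\<^esub> (F +> \<rho> \<one>\<^bsub>G\<^esub> x)) < e0" using e0 ennreal_less_iff not_le ennreal_leI by (metis)
    moreover have "(F +> \<rho> g x) \<ominus>\<^bsub>?Q\<^esub> (F +> \<rho> \<one>\<^bsub>G\<^esub> x) = F +> (\<rho> g x \<ominus> x)"
      using quotient_diff[OF F, of "\<rho> g x" "\<rho> \<one>\<^bsub>G\<^esub> x"] gG x(1) by (simp add: rep_one)
    ultimately have "(INF f\<in>F. nrm V (f \<oplus> (\<rho> g x \<ominus> x))) < e0" by (simp add: quotient_nrm[OF F])
    moreover have "\<rho> g x \<ominus> x \<in> carrier V" using gG x(1) by simp
    ultimately show ?thesis by (simp add: cINF_less_iff[OF Fne bdd])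
  qed
  define C where "C = mid_hull ((\<lambda>g. \<rho> g x) ` carrier G)"
  have orbV: "(\<lambda>g. \<rho> g x) ` carrier G \<subseteq> carrier V" using x(1) by auto
  have CV: "C \<subseteq> carrier V" unfolding C_def using mid_hull_carrier[OF orbV] by auto
  have xC: "x \<in> C" unfolding C_def using rep_one[OF x(1)] by (intro mid_hull.base image_eqI[of _ _ "\<one>\<^bsub>G\<^esub>"]) auto
  have midC: "\<forall>u\<in>C. \<forall>v\<in>C. (1 / 2) \<odot> (u \<oplus> v) \<in> C" unfolding C_def using mid_hull.mid by blast
  have Cinv: "\<rho> g u \<in> C" if g: "g \<in> carrier G" and u: "u \<in> C" for g u
    using u unfolding C_def
  proof (induction rule: mid_hull.induct)
    case (base y)
    then obtain h where "h \<in> carrier G" "y = \<rho> h x" by auto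
    then show ?case using rep_mult[OF g _ x(1)] g by (intro mid_hull.base image_eqI[of _ _ "g \<otimes>\<^bsub>G\<^esub> h"]) auto
  next
    case (mid u v)
    have uv: "u \<in> carrier V" "v \<in> carrier V" using mid(1,2) mid_hull_carrier[OF orbV] by auto
    have "\<rho> g ((1 / 2) \<odot> (u \<oplus> v)) = (1 / 2) \<odot> (\<rho> g u \<oplus> \<rho> g v)"
      using isometryD(3)[OF rep_iso[OF g] uv] isometryD(4)[OF rep_iso[OF g], of "u \<oplus> v" "1 / 2"] uv by simp
    then show ?case using mid_hull.mid[OF mid(3,4)] by simp
  qed
  obtain c where c: "c \<in> carrier V" and cm: "\<forall>\<epsilon>>0. \<exists>\<delta>>0. \<forall>u\<in>C. nrm V u \<le> (INF u\<in>C. nrm V u) + \<delta> \<longrightarrow> nrm V (u \<ominus> c) \<le> \<epsilon>"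
    using minimizer[OF CV _ midC] xC by blast
  have Cbdd: "bdd_below (nrm V ` C)" using CV by (intro bdd_belowI2[of _ 0] nrm_nonneg) auto
  \<comment> \<open>C is invariant and norms are preserved, so the orbit of a near-minimiser
    consists of near-minimisers and stays close to c. This is why c is fixed.\<close>
  have capprox: "\<exists>u\<in>C. nrm V (u \<ominus> c) \<le> \<epsilon> \<and> (\<forall>g\<in>carrier G. nrm V (\<rho> g u \<ominus> c) \<le> \<epsilon>)" if e: "\<epsilon> > 0" for \<epsilon>
  proof -
    obtain \<delta> where \<delta>: "\<delta> > 0" "\<forall>u\<in>C. nrm V u \<le> (INF u\<in>C. nrm V u) + \<delta> \<longrightarrow> nrm V (u \<ominus> c) \<le> \<epsilon>" using cm e by blast
    have "(INF u\<in>C. nrm V u) < (INF u\<in>C. nrm V u) + \<delta>" using \<delta>(1) by simp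
    then obtain u where u: "u \<in> C" "nrm V u < (INF u\<in>C. nrm V u) + \<delta>" using xC by (subst (asm) cINF_less_iff[OF _ Cbdd]) auto
    have uV: "u \<in> carrier V" using u CV by auto
    have "nrm V (\<rho> g u \<ominus> c) \<le> \<epsilon>" if g: "g \<in> carrier G" for g
      using \<delta>(2) Cinv[OF g u(1)] u(2) isometryD(5)[OF rep_iso[OF g] uV] by simp
    then show ?thesis using \<delta>(2) u by (intro bexI[of _ u]) auto
  qed
  have cfix: "\<rho> g c = c" if g: "g \<in> carrier G" for g
  proof -
    have gc: "\<rho> g c \<in> carrier V" using g c by simp
    have "nrm V (\<rho> g c \<ominus> c) \<le> 0 + \<epsilon>" if e: "\<epsilon> > 0" for \<epsilon>
    proof -
      have "\<epsilon> / 2 > 0" using e by simp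
      then obtain u where u: "u \<in> C" "nrm V (u \<ominus> c) \<le> \<epsilon> / 2" "\<forall>g\<in>carrier G. nrm V (\<rho> g u \<ominus> c) \<le> \<epsilon> / 2" using capprox[of "\<epsilon> / 2"] by blast
      have uV: "u \<in> carrier V" using u CV by auto
      have gu: "\<rho> g u \<in> carrier V" using g uV by simp
      have "nrm V (\<rho> g c \<ominus> \<rho> g u) = nrm V (c \<ominus> u)"
        using isometry_diff[OF rep_iso[OF g] c uV] isometryD(5)[OF rep_iso[OF g], of "c \<ominus> u"] c uV by simp
      then have "nrm V (\<rho> g c \<ominus> \<rho> g u) \<le> \<epsilon> / 2" using u(2) nrm_minus_commute[OF c uV] by simp
      moreover have "nrm V (\<rho> g u \<ominus> c) \<le> \<epsilon> / 2" using u(3) g by blast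
      ultimately show ?thesis using nrm_triangle_minus[OF gc gu c] field_sum_of_halves[of \<epsilon>] by linarith
    qed
    then have "nrm V (\<rho> g c \<ominus> c) \<le> 0" by (rule field_le_epsilon)
    then have "nrm V (\<rho> g c \<ominus> c) = 0" using nrm_nonneg[of "\<rho> g c \<ominus> c"] gc c by simp
    then have "\<rho> g c \<ominus> c = \<zero>" using nrm_eq_0[of "\<rho> g c \<ominus> c"] gc c by simp
    then have "(\<rho> g c \<ominus> c) \<oplus> c = \<zero> \<oplus> c" by simp
    then show ?thesis using gc c by (simp add: minus_minus_cancel)
  qed
  have cF: "c \<in> F" using c cfix by (simp add: F_def fixed_vectors_def)
  define e where "e = x \<ominus> c"
  have eV: "e \<in> carrier V" unfolding e_def using x(1) c by simp
  have ge: "\<rho> g e \<ominus> e = \<rho> g x \<ominus> x" if g: "g \<in> carrier G" for g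
    unfolding e_def using isometry_diff[OF rep_iso[OF g] x(1) c] cfix[OF g] x(1) c g by (simp add: minus_minus_cancel)
  \<comment> \<open>The functional j that norms f is invariant, so it is constant on C and has the
    same value at c. It kills e and every \<rho>(g) x - x, and adding a vector killed by j cannot
    lower the norm of f: orthogonality in the sense of Birkhoff.\<close>
  have func: "nrm V f \<le> nrm V (f \<oplus> e) \<and> (\<forall>g\<in>carrier G. nrm V f \<le> nrm V (f \<oplus> (\<rho> g x \<ominus> x)))" if f: "f \<in> F" for f
  proof -
    obtain j where j: "\<forall>y\<in>carrier V. \<forall>z\<in>carrier V. j (y \<oplus> z) = j y + j z"
      "\<forall>y\<in>carrier V. \<bar>j y\<bar> \<le> nrm V y" and jf: "j f = nrm V f"
      and j': "\<forall>T\<in>carrier (isometry_group V). T f = f \<longrightarrow> (\<forall>y\<in>carrier V. j (T y) = j y)"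
      using support[OF FV[OF f]] by (elim exE conjE)
    have ja: "j (y \<oplus> z) = j y + j z" if "y \<in> carrier V" "z \<in> carrier V" for y z
      by (rule bspec[OF bspec[OF j(1) that(1)] that(2)])
    have jb: "\<bar>j y\<bar> \<le> nrm V y" if "y \<in> carrier V" for y
      by (rule bspec[OF j(2) that])
    have ji: "j (T y) = j y" if "T \<in> carrier (isometry_group V)" "T f = f" "y \<in> carrier V" for T y
      by (rule bspec[OF mp[OF bspec[OF j' that(1)] that(2)] that(3)])
    have jg: "j (\<rho> g y) = j y" if "g \<in> carrier G" "y \<in> carrier V" for g y
      by (rule ji[OF rep_iso[OF that(1)] Ffix[OF f that(1)] that(2)])
    have jm: "j (y \<ominus> z) = j y - j z" if "y \<in> carrier V" "z \<in> carrier V" for y z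
      by (rule additive_minus[OF ja that])
    have jC: "j u = j x" if "u \<in> C" for u
      using that unfolding C_def
    proof (induction rule: mid_hull.induct)
      case (base y) then show ?case using jg x(1) by auto
    next
      case (mid u v)
      have uv: "u \<in> carrier V" "v \<in> carrier V" using mid(1,2) mid_hull_carrier[OF orbV] by auto
      \<comment> \<open>Only additivity of j is available, so the factor 1 / 2 is treated by
        doubling.\<close>
      have "j ((1 / 2) \<odot> (u \<oplus> v)) + j ((1 / 2) \<odot> (u \<oplus> v)) = j (u \<oplus> v)"
        using ja[of "(1 / 2) \<odot> (u \<oplus> v)" "(1 / 2) \<odot> (u \<oplus> v)"] uv half_double[of "u \<oplus> v"] by simp
      then show ?case using ja[OF uv] mid(3,4) by simp
    qed
    have "\<bar>j x - j c\<bar> \<le> 0 + \<epsilon>" if eps: "\<epsilon> > 0" for \<epsilon>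
    proof -
      obtain u where u: "u \<in> C" "nrm V (u \<ominus> c) \<le> \<epsilon>" using capprox[OF eps] by blast
      have uV: "u \<in> carrier V" using u CV by auto
      show ?thesis using jb[of "u \<ominus> c"] jm[OF uV c] jC[OF u(1)] u(2) uV c by simp
    qed
    then have "\<bar>j x - j c\<bar> \<le> 0" by (rule field_le_epsilon)
    then have je: "j e = 0" unfolding e_def using jm[OF x(1) c] by simp
    have le: "nrm V f \<le> nrm V (f \<oplus> y)" if "y \<in> carrier V" "j y = 0" for y
      using jb[of "f \<oplus> y"] ja[OF FV[OF f] that(1)] that FV[OF f] jf by simp
    have "nrm V f \<le> nrm V (f \<oplus> (\<rho> g x \<ominus> x))" if g: "g \<in> carrier G" for g
      using jm[of "\<rho> g x" x] jg[OF g x(1)] g x(1) by (intro le) auto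
    then show ?thesis using le[OF eV je] by blast
  qed
  have dist: "nrm V (\<rho> g e \<ominus> e) \<le> \<delta>c" if g: "g \<in> Q" for g
  proof -
    have gG: "g \<in> carrier G" using g QG by auto
    obtain f where f: "f \<in> F" "nrm V (f \<oplus> (\<rho> g x \<ominus> x)) < e0" using move[OF g] by blast
    have d: "\<rho> g x \<ominus> x \<in> carrier V" using gG x(1) by simp
    have "nrm V f \<le> nrm V (f \<oplus> (\<rho> g x \<ominus> x))" using func[OF f(1)] gG by blast
    moreover have "nrm V (\<rho> g x \<ominus> x) \<le> nrm V (f \<oplus> (\<rho> g x \<ominus> x)) + nrm V f"
    proof -
      have "(f \<oplus> (\<rho> g x \<ominus> x)) \<ominus> f = \<rho> g x \<ominus> x" using d FV[OF f(1)] by (simp add: M.a_comm[of f] minus_minus_cancel)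
      then show ?thesis using nrm_diff_le[of "f \<oplus> (\<rho> g x \<ominus> x)" f] d FV[OF f(1)] by simp
    qed
    ultimately have "nrm V (\<rho> g x \<ominus> x) \<le> 2 * e0" using f(2) by linarith
    then show ?thesis unfolding ge[OF gG] e0_def by simp
  qed
  \<comment> \<open>As x has norm 1 modulo F, some f + x has norm below 2. It equals (f + c) + e,
    and by \<open>func\<close> the part f + c is not longer than the whole.\<close>
  have e_upper: "nrm V e \<le> 4"
  proof -
    have "(INF f\<in>F. nrm V (f \<oplus> x)) < 2" using nx by simp
    then obtain f where f: "f \<in> F" "nrm V (f \<oplus> x) < 2" unfolding cINF_less_iff[OF Fne bdd[OF x(1)]] by blast
    have fV: "f \<in> carrier V" by (rule FV[OF f(1)])
    have fc: "f \<oplus> c \<in> F" using submoduleE(5)[OF F] f(1) cF by simp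
    have eq: "(f \<oplus> c) \<oplus> e = f \<oplus> x" unfolding e_def using fV c x(1) by (simp add: M.a_assoc minus_minus_cancel)
    have "nrm V (f \<oplus> c) \<le> nrm V (f \<oplus> x)" using func[OF fc] unfolding eq by blast
    moreover have "nrm V e \<le> nrm V (f \<oplus> x) + nrm V (f \<oplus> c)"
    proof -
      have "((f \<oplus> c) \<oplus> e) \<ominus> (f \<oplus> c) = e" using fV c eV by (simp add: M.a_comm[of "f \<oplus> c" e] minus_minus_cancel)
      then show ?thesis using nrm_diff_le[of "(f \<oplus> c) \<oplus> e" "f \<oplus> c"] fV c eV x(1) unfolding eq by simp
    qed
    ultimately show ?thesis using f(2) by linarith
  qed
  have e_lower: "1 \<le> nrm V e"
  proof -
    have mc: "\<ominus> c \<in> F" using submoduleE(3)[OF F] cF by simp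
    have "(INF f\<in>F. nrm V (f \<oplus> x)) \<le> nrm V (\<ominus> c \<oplus> x)" by (rule cINF_lower[OF bdd[OF x(1)] mc])
    moreover have "\<ominus> c \<oplus> x = e" unfolding e_def a_minus_def using c x(1) by (simp add: M.a_comm)
    ultimately show ?thesis using nx by simp
  qed
  have ge4: "nrm V (\<rho> g e) \<le> 4" if "g \<in> carrier G" for g using isometryD(5)[OF rep_iso[OF that] eV] e_upper by simp
  have fam: "isometric_family G \<tau> r M (\<lambda>g. \<Phi> (\<rho> g e))"
  proof (intro isometric_family.intro isometric_family_axioms.intro)
    show "group G" "r > 1" "topspace \<tau> = carrier G" using grp exponent top by auto
    show "\<Phi> (\<rho> g e) \<in> Lp_set r M" if "g \<in> carrier G" for g using that eV by (intro Phi_mem) simp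
    show "pint r M (\<lambda>w. \<Sum>i<n. k i * \<Phi> (\<rho> (h \<otimes>\<^bsub>G\<^esub> a i) e) w) = pint r M (\<lambda>w. \<Sum>i<n. k i * \<Phi> (\<rho> (a i) e) w)"
      if h: "h \<in> carrier G" and a: "\<And>i. i < n \<Longrightarrow> a i \<in> carrier G" for h and n :: nat and a k
    proof -
      have "pint r M (\<lambda>w. \<Sum>i<n. k i * \<Phi> (\<rho> (h \<otimes>\<^bsub>G\<^esub> a i) e) w) = pint r M (\<lambda>w. \<Sum>i<n. k i * \<Phi> (\<rho> h (\<rho> (a i) e)) w)"
        using rep_mult[OF h a eV] by (intro arg_cong[of _ _ "pint r M"] ext sum.cong) auto
      also have "\<dots> = pint r M (\<lambda>w. \<Sum>i<n. k i * \<Phi> (\<rho> (a i) e) w)"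
        by (rule Phi_combination[OF rep_iso[OF h]]) (use a eV in simp)
      finally show ?thesis .
    qed
    show "\<exists>U. openin \<tau> U \<and> b \<in> U \<and> (\<forall>g\<in>U. pint r M (\<lambda>w. \<Phi> (\<rho> g e) w - \<Phi> (\<rho> b e) w) < t)" if b: "b \<in> carrier G" and t: "t > 0" for b and t :: real
    proof -
      have t2: "t / 2 > 0" using t by simp
      obtain \<delta> where \<delta>: "\<delta> > 0" "\<forall>x\<in>carrier V. \<forall>y\<in>carrier V. nrm V x \<le> 4 \<longrightarrow> nrm V y \<le> 4 \<longrightarrow>
          nrm V (x \<ominus> y) \<le> \<delta> \<longrightarrow> pint r M (\<lambda>w. \<Phi> x w - \<Phi> y w) \<le> t / 2"
        using Phi_uniform[OF t2, of 4] by (elim exE conjE)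
      have "continuous_map \<tau> (norm_topology V) (\<lambda>g. \<rho> g e)" using scr eV by (simp add: strongly_continuous_rep_def)
      then obtain U where U: "openin \<tau> U" "b \<in> U" "\<forall>h\<in>U. nrm V (\<rho> h e \<ominus> \<rho> b e) < \<delta>"
        unfolding continuous_map_norm_topology using b top \<delta>(1) by blast
      have "pint r M (\<lambda>w. \<Phi> (\<rho> g e) w - \<Phi> (\<rho> b e) w) < t" if g: "g \<in> U" for g
      proof -
        have gG: "g \<in> carrier G" using g openin_subset[OF U(1)] top by auto
        have "pint r M (\<lambda>w. \<Phi> (\<rho> g e) w - \<Phi> (\<rho> b e) w) \<le> t / 2"
          using \<delta>(2) ge4[OF gG] ge4[OF b] U(3) g gG b eV less_imp_le rep_closed by blast
        then show ?thesis using t by linarith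
      qed
      then show ?thesis using U(1,2) by blast
    qed
  qed
  have start: "pint r M (\<Phi> (\<rho> \<one>\<^bsub>G\<^esub> e)) \<le> B" using B ge4[OF G.one_closed] eV rep_closed[OF G.one_closed eV] by blast
  have "\<forall>q\<in>Q. pint r M (\<lambda>w. \<Phi> (\<rho> q e) w - \<Phi> (\<rho> \<one>\<^bsub>G\<^esub> e) w) \<le> \<delta>b"
  proof
    fix q assume q: "q \<in> Q"
    then have qG: "q \<in> carrier G" using QG by auto
    show "pint r M (\<lambda>w. \<Phi> (\<rho> q e) w - \<Phi> (\<rho> \<one>\<^bsub>G\<^esub> e) w) \<le> \<delta>b"
      unfolding rep_one[OF eV] using unif ge4[OF qG] e_upper dist[OF q] rep_closed[OF qG eV] eV by blast
  qed
  note all = orbit[OF fam start this]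
  have close: "nrm V (\<rho> g x \<ominus> x) \<le> 1 / 2" if g: "g \<in> carrier G" for g
  proof -
    have "pint r M (\<lambda>w. \<Phi> (\<rho> g e) w - \<Phi> e w) \<le> \<delta>a" using all[OF g] unfolding rep_one[OF eV] .
    then have "nrm V (\<rho> g e \<ominus> e) \<le> 1 / 2" using inverse ge4[OF g] e_upper rep_closed[OF g eV] eV by blast
    then show ?thesis unfolding ge[OF g] .
  qed
  have hull: "nrm V (u \<ominus> x) \<le> 1 / 2" if "u \<in> C" for u
    using that unfolding C_def
  proof (induction rule: mid_hull.induct)
    case (base y) then show ?case using close by auto
  next
    case (mid u v)
    have uv: "u \<in> carrier V" "v \<in> carrier V" using mid(1,2) mid_hull_carrier[OF orbV] by auto
    have "nrm V ((1 / 2) \<odot> (u \<oplus> v) \<ominus> x) = 1 / 2 * nrm V ((u \<ominus> x) \<oplus> (v \<ominus> x))"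
      using mid_diff[OF uv x(1)] nrm_smult[of "(u \<ominus> x) \<oplus> (v \<ominus> x)" "1 / 2"] uv x(1) by simp
    also have "\<dots> \<le> 1 / 2 * (nrm V (u \<ominus> x) + nrm V (v \<ominus> x))"
      using nrm_triangle[of "u \<ominus> x" "v \<ominus> x"] uv x(1) by simp
    also have "\<dots> \<le> 1 / 2" using mid(3,4) by simp
    finally show ?case .
  qed
  obtain u where u: "u \<in> C" "nrm V (u \<ominus> c) \<le> 1 / 4" using capprox[of "1 / 4"] by auto
  have uV: "u \<in> carrier V" using u CV by auto
  have "nrm V e \<le> nrm V (x \<ominus> u) + nrm V (u \<ominus> c)" unfolding e_def by (rule nrm_triangle_minus[OF x(1) uV c])
  also have "nrm V (x \<ominus> u) = nrm V (u \<ominus> x)" by (rule nrm_minus_commute[OF x(1) uV])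
  finally show False using hull[OF u(1)] u(2) e_lower by linarith
qed

end

section \<open>Subspaces and quotients of \<open>L\<^sub>p\<close>\<close>

lemma homogeneous2_spow_mult: "p > 1 \<Longrightarrow> homogeneous2 p (\<lambda>s t. spow (p - 1) s * t)"
  by (rule homogeneous2_mult[OF homogeneous2_spow[OF homogeneous2_fst, of "p - 1"] homogeneous2_snd]) auto

lemma spow_mult_integrable:
  assumes p: "p > 1" and F: "F \<in> Lp_set p M" and y: "y \<in> Lp_set p M"
  shows "integrable M (\<lambda>w. spow (p - 1) (F w) * y w)"
  by (rule homogeneous2_integrable[OF homogeneous2_spow_mult[OF p] _ F y]) (use p in simp)

lemma pint_tangent:
  assumes p: "p > 1" and F: "F \<in> Lp_set p M" and y: "y \<in> Lp_set p M"
  shows "pint p M F + p * (LINT w|M. spow (p - 1) (F w) * y w) \<le> pint p M (\<lambda>w. F w + y w)"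
proof -
  have p0: "p > 0" using p by simp
  have "pint p M F + p * (LINT w|M. spow (p - 1) (F w) * y w) = (LINT w|M. \<bar>F w\<bar> powr p + p * (spow (p - 1) (F w) * y w))"
    unfolding pint_def using Lp_set_integrable[OF F] spow_mult_integrable[OF p F y] by simp
  also have "\<dots> \<le> (LINT w|M. \<bar>F w + y w\<bar> powr p)"
  proof (rule integral_mono)
    show "integrable M (\<lambda>w. \<bar>F w\<bar> powr p + p * (spow (p - 1) (F w) * y w))"
      using Lp_set_integrable[OF F] spow_mult_integrable[OF p F y] by simp
    show "integrable M (\<lambda>w. \<bar>F w + y w\<bar> powr p)" by (rule Lp_set_integrable[OF Lp_set_add[OF p0 F y]])
    show "\<bar>F w\<bar> powr p + p * (spow (p - 1) (F w) * y w) \<le> \<bar>F w + y w\<bar> powr p" for w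
      using abs_powr_tangent[OF p, of "F w" "F w + y w"] by (simp add: mult.assoc)
  qed
  finally show ?thesis unfolding pint_def .
qed

lemma spow_self: "p > 1 \<Longrightarrow> (LINT w|M. spow (p - 1) (F w) * F w) = pint p M F"
  unfolding pint_def spow_times by simp

text \<open>The tangent at F evaluated at y is Young's inequality for dual exponents; after
  rescaling it serves as Hoelder's inequality.\<close>

lemma pint_Young:
  assumes p: "p > 1" and F: "F \<in> Lp_set p M" and y: "y \<in> Lp_set p M"
  shows "p * (LINT w|M. spow (p - 1) (F w) * y w) \<le> pint p M y + (p - 1) * pint p M F"
proof -
  have d: "(\<lambda>w. y w - F w) \<in> Lp_set p M" using p y F by (intro Lp_set_diff) auto
  have "(LINT w|M. spow (p - 1) (F w) * (y w - F w)) = (LINT w|M. spow (p - 1) (F w) * y w) - pint p M F"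
    using spow_mult_integrable[OF p F y] spow_mult_integrable[OF p F F] spow_self[OF p, of M F] by (simp add: right_diff_distrib)
  moreover have "(\<lambda>w. F w + (y w - F w)) = y" by auto
  ultimately have "pint p M F + p * ((LINT w|M. spow (p - 1) (F w) * y w) - pint p M F) \<le> pint p M y"
    using pint_tangent[OF p F d] by metis
  then show ?thesis unfolding right_diff_distrib left_diff_distrib by linarith
qed

lemma spow_integral_continuous:
  assumes p: "p > 1" and F: "F \<in> Lp_set p M" and y: "y \<in> Lp_set p M" and e: "e > 0"
  obtains \<delta> where "\<delta> > 0" "\<And>u. u \<in> Lp_set p M \<Longrightarrow> pint p M u \<le> B \<Longrightarrow> pint p M (\<lambda>w. u w - F w) \<le> \<delta> \<Longrightarrow>
    \<bar>(LINT w|M. spow (p - 1) (u w) * y w) - (LINT w|M. spow (p - 1) (F w) * y w)\<bar> \<le> e"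
proof -
  have p0: "p > 0" "p - 1 > 0" using p by auto
  \<comment> \<open>\<open>R\<close> has degree 1, so it leads to L_p, and its power p - 1 is the
    difference of the signed powers; the product with y then has degree p.\<close>
  define R where "R = (\<lambda>s t. \<bar>spow (p - 1) s - spow (p - 1) t\<bar> powr (1 / (p - 1)))"
  have Rh: "homogeneous2 1 R" unfolding R_def
    by (rule homogeneous2_powr[OF homogeneous2_diff[OF homogeneous2_spow[OF homogeneous2_fst p0(2)] homogeneous2_spow[OF homogeneous2_snd p0(2)]]]) (use p0 in auto)
  have Ah: "homogeneous2 p (\<lambda>s t. \<bar>R s t\<bar> powr p)" by (rule homogeneous2_powr[OF Rh p0(1)]) simp
  define B1 where "B1 = max B (pint p M F)"
  obtain K where K: "K \<ge> 0" "\<And>s t. \<bar>\<bar>R s t\<bar> powr p\<bar> \<le> K * (\<bar>s\<bar> powr p + \<bar>t\<bar> powr p)"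
    by (rule homogeneous2_bound[OF Ah p0(1)], rule that)
  define B2 where "B2 = max (K * (B1 + B1)) (pint p M y)"
  have a1: "homogeneous2 p (\<lambda>s t. \<bar>s\<bar> powr (p - 1) * \<bar>t\<bar>)"
    by (rule homogeneous2_mult[OF homogeneous2_powr[OF homogeneous2_fst p0(2)] homogeneous2_abs[OF homogeneous2_snd]]) auto
  have b1: "homogeneous2 p (\<lambda>s t. \<bar>s\<bar> powr p)" by (rule homogeneous2_fst_powr[OF p0(1)])
  have z1: "\<bar>s\<bar> powr (p - 1) * \<bar>t\<bar> \<le> 0" if "\<bar>s\<bar> powr p = 0" for s t :: real using that by simp
  obtain \<eta> where eta: "\<eta> > 0" "\<And>(M :: 'a measure) f g. \<lbrakk>f \<in> Lp_set p M; g \<in> Lp_set p M; pint p M f \<le> B2; pint p M g \<le> B2;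
       (LINT w|M. \<bar>f w\<bar> powr p) \<le> \<eta>\<rbrakk> \<Longrightarrow> (LINT w|M. \<bar>f w\<bar> powr (p - 1) * \<bar>g w\<bar>) \<le> e"
    by (rule homogeneous2_integral_small[OF a1 b1 p0(1) powr_ge_zero z1 e, where B = B2], assumption, rule that)
  have z2: "\<bar>R s s\<bar> powr p \<le> 0" for s by (simp add: R_def)
  obtain \<delta> where \<delta>: "\<delta> > 0" "\<And>(M :: 'a measure) f g. \<lbrakk>f \<in> Lp_set p M; g \<in> Lp_set p M; pint p M f \<le> B1; pint p M g \<le> B1;
       pint p M (\<lambda>w. f w - g w) \<le> \<delta>\<rbrakk> \<Longrightarrow> (LINT w|M. \<bar>R (f w) (g w)\<bar> powr p) \<le> \<eta>"
    by (rule small_of_pint[OF Ah p0(1) z2 eta(1), where B = B1], rule that)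
  show ?thesis
  proof (rule that[OF \<delta>(1)])
    fix u assume u: "u \<in> Lp_set p M" and uB: "pint p M u \<le> B" and d: "pint p M (\<lambda>w. u w - F w) \<le> \<delta>"
    have uB1: "pint p M u \<le> B1" "pint p M F \<le> B1" unfolding B1_def using uB by auto
    let ?R = "\<lambda>w. R (u w) (F w)"
    have RL: "?R \<in> Lp_set p M" by (rule homogeneous2_Lp_set[OF Rh p0(1) _ u F]) auto
    have "pint p M ?R \<le> (LINT w|M. K * (\<bar>u w\<bar> powr p + \<bar>F w\<bar> powr p))"
      unfolding pint_def
    proof (rule integral_mono[OF Lp_set_integrable[OF RL]])
      show "integrable M (\<lambda>w. K * (\<bar>u w\<bar> powr p + \<bar>F w\<bar> powr p))" using Lp_set_integrable[OF u] Lp_set_integrable[OF F] by simp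
      show "\<bar>?R w\<bar> powr p \<le> K * (\<bar>u w\<bar> powr p + \<bar>F w\<bar> powr p)" for w by (rule order_trans[OF abs_ge_self K(2)])
    qed
    also have "\<dots> = K * (pint p M u + pint p M F)" unfolding pint_def using Lp_set_integrable[OF u] Lp_set_integrable[OF F] by simp
    also have "\<dots> \<le> K * (B1 + B1)" by (intro mult_left_mono add_mono uB1 K(1))
    finally have RB: "pint p M ?R \<le> B2" unfolding B2_def by simp
    have "(LINT w|M. \<bar>?R w\<bar> powr p) \<le> \<eta>" by (rule \<delta>(2)[OF u F uB1 d])
    then have s: "(LINT w|M. \<bar>?R w\<bar> powr (p - 1) * \<bar>y w\<bar>) \<le> e" by (intro eta(2)[OF RL y RB]) (auto simp: B2_def)
    have pw: "\<bar>?R w\<bar> powr (p - 1) * \<bar>y w\<bar> = \<bar>(spow (p - 1) (u w) - spow (p - 1) (F w)) * y w\<bar>" for w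
      unfolding R_def abs_mult using p0 by (simp add: powr_powr)
    have "(LINT w|M. spow (p - 1) (u w) * y w) - (LINT w|M. spow (p - 1) (F w) * y w)
        = (LINT w|M. (spow (p - 1) (u w) - spow (p - 1) (F w)) * y w)"
      using spow_mult_integrable[OF p u y] spow_mult_integrable[OF p F y] by (simp add: left_diff_distrib)
    also have "\<bar>\<dots>\<bar> \<le> (LINT w|M. \<bar>(spow (p - 1) (u w) - spow (p - 1) (F w)) * y w\<bar>)" by (rule integral_abs_bound)
    finally show "\<bar>(LINT w|M. spow (p - 1) (u w) * y w) - (LINT w|M. spow (p - 1) (F w) * y w)\<bar> \<le> e"
      using s unfolding pw by linarith
  qed
qed

text \<open>This is the Gateaux differentiability of the norm of \<open>L\<^sub>p\<close>.\<close>

lemma pint_slope_unique: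
  assumes p: "p > 1" and F: "F \<in> Lp_set p M" and y: "y \<in> Lp_set p M"
    and b: "\<And>t. pint p M F + p * (t * b) \<le> pint p M (\<lambda>w. F w + t * y w)"
  shows "b = (LINT w|M. spow (p - 1) (F w) * y w)"
proof -
  have p0: "p > 0" using p by simp
  define a where "a = (LINT w|M. spow (p - 1) (F w) * y w)"
  define u where "u = (\<lambda>t w. F w + t * y w)"
  have u: "u t \<in> Lp_set p M" for t unfolding u_def by (intro Lp_set_add[OF p0] F Lp_set_cmult[OF p0] y)
  \<comment> \<open>The tangent at the displaced function \<open>u t\<close>, followed back to F,
    against the assumed lower bound.\<close>
  have up: "t * b \<le> t * (LINT w|M. spow (p - 1) (u t w) * y w)" for t
  proof -
    have "pint p M (u t) + p * (LINT w|M. spow (p - 1) (u t w) * (- t * y w)) \<le> pint p M (\<lambda>w. u t w + (- t * y w))"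
      by (rule pint_tangent[OF p u Lp_set_cmult[OF p0 y]])
    moreover have "(\<lambda>w. u t w + (- t * y w)) = F" unfolding u_def by auto
    moreover have "(LINT w|M. spow (p - 1) (u t w) * (- t * y w)) = - t * (LINT w|M. spow (p - 1) (u t w) * y w)"
      by (simp add: mult.left_commute[of _ t])
    moreover have "pint p M F + p * (t * b) \<le> pint p M (u t)" using b[of t] unfolding u_def .
    ultimately have "p * (t * b) + p * (- t * (LINT w|M. spow (p - 1) (u t w) * y w)) \<le> 0" by simp
    then have "p * (t * b) \<le> p * (t * (LINT w|M. spow (p - 1) (u t w) * y w))" by simp
    then show ?thesis using p0 by (simp only: mult_le_cancel_left_pos)
  qed
  have "\<bar>b - a\<bar> \<le> 0 + e" if e: "e > 0" for e
  proof -
    define B where "B = 2 powr p * (pint p M F + pint p M y)"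
    obtain \<delta> where \<delta>: "\<delta> > 0" "\<And>u. u \<in> Lp_set p M \<Longrightarrow> pint p M u \<le> B \<Longrightarrow> pint p M (\<lambda>w. u w - F w) \<le> \<delta> \<Longrightarrow>
        \<bar>(LINT w|M. spow (p - 1) (u w) * y w) - (LINT w|M. spow (p - 1) (F w) * y w)\<bar> \<le> e"
      by (rule spow_integral_continuous[OF p F y e, where B = B], rule that)
    note \<delta>2 = \<delta>(2)[folded a_def]
    \<comment> \<open>Small enough that t y is within \<delta>, and at most 1 so that the bound
      \<open>B\<close> holds.\<close>
    define t where "t = min 1 ((\<delta> / (pint p M y + 1)) powr (1 / p))"
    have y1: "pint p M y + 1 > 0" using pint_nonneg[of p M y] by linarith
    have t: "t > 0" "t \<le> 1" unfolding t_def using \<delta>(1) y1 by auto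
    have tp: "t powr p * pint p M y \<le> \<delta>"
    proof -
      have "t powr p \<le> ((\<delta> / (pint p M y + 1)) powr (1 / p)) powr p" using t p0 by (intro powr_mono2) (auto simp: t_def)
      also have "\<dots> = \<delta> / (pint p M y + 1)" using p0 \<delta>(1) y1 by (simp add: powr_powr)
      finally have "t powr p * pint p M y \<le> \<delta> / (pint p M y + 1) * pint p M y" by (intro mult_right_mono) auto
      also have "\<dots> \<le> \<delta>" using \<delta>(1) y1 by (simp add: field_simps)
      finally show ?thesis .
    qed
    have main: "\<bar>(LINT w|M. spow (p - 1) (u s w) * y w) - a\<bar> \<le> e" if s: "\<bar>s\<bar> = t" for s
    proof (rule \<delta>2[OF u])
      have ts: "pint p M (\<lambda>w. s * y w) = t powr p * pint p M y" unfolding pint_cmult s ..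
      have "t powr p \<le> 1 powr p" using t p0 by (intro powr_mono2) auto
      then have "pint p M (\<lambda>w. s * y w) \<le> pint p M y" unfolding ts using mult_right_mono[of "t powr p" 1 "pint p M y"] by simp
      then show "pint p M (u s) \<le> B"
        unfolding B_def u_def by (intro order_trans[OF pint_add_le[OF p0 F Lp_set_cmult[OF p0 y]]] mult_left_mono) auto
      have "(\<lambda>w. u s w - F w) = (\<lambda>w. s * y w)" unfolding u_def by auto
      then show "pint p M (\<lambda>w. u s w - F w) \<le> \<delta>" using ts tp by simp
    qed
    \<comment> \<open>Positive displacements bound b from above, negative ones from below.\<close>
    have "b \<le> (LINT w|M. spow (p - 1) (u t w) * y w)" using up[of t] t(1) by simp
    moreover have "(LINT w|M. spow (p - 1) (u (- t) w) * y w) \<le> b" using up[of "- t"] t(1) by simp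
    ultimately show ?thesis using main[of t] main[of "- t"] t(1) by (simp add: abs_le_iff)
  qed
  then have "\<bar>b - a\<bar> \<le> 0" by (rule field_le_epsilon)
  then show ?thesis unfolding a_def by simp
qed

lemma powr_add_le:
  fixes m d p :: real
  assumes "p > 1" "m \<ge> 0" "d \<ge> 0"
  shows "(m + d) powr p \<le> m powr p + p * (m + d) powr (p - 1) * d"
  using abs_powr_tangent[OF assms(1), of "m + d" m] assms(2,3) by (simp add: spow_if split: if_splits)

lemma powr_close:
  fixes B p \<epsilon> :: real
  assumes p: "p > 1" and B: "B \<ge> 0" and e: "\<epsilon> > 0"
  obtains \<delta> where "\<delta> > 0" "\<delta> \<le> 1" "\<And>m d. 0 \<le> m \<Longrightarrow> m \<le> B \<Longrightarrow> 0 \<le> d \<Longrightarrow> d \<le> \<delta> \<Longrightarrow> (m + d) powr p \<le> m powr p + \<epsilon>"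
proof -
  define K where "K = p * (B + 1) powr (p - 1)"
  have K: "K > 0" unfolding K_def using p B by simp
  show ?thesis
  proof (rule that[of "min 1 (\<epsilon> / K)"])
    fix m d :: real assume m: "0 \<le> m" "m \<le> B" and d: "0 \<le> d" "d \<le> min 1 (\<epsilon> / K)"
    have "(m + d) powr (p - 1) \<le> (B + 1) powr (p - 1)" using m d p by (intro powr_mono2) auto
    then have "p * (m + d) powr (p - 1) * d \<le> K * d" unfolding K_def using p d by (intro mult_right_mono mult_left_mono) auto
    also have "\<dots> \<le> K * (\<epsilon> / K)" using d K by (intro mult_left_mono) auto
    also have "\<dots> = \<epsilon>" using K by simp
    finally show "(m + d) powr p \<le> m powr p + \<epsilon>" using powr_add_le[OF p m(1) d(1)] by linarith
  qed (use e K in auto)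
qed

text \<open>V presented as L / N on the level of functions. A subspace of L_p has the null functions
  as N, a quotient has all of \<open>Lp_set p M\<close> as L, so both share the constructions
  below.\<close>

locale subquotient = nspace V for V :: "'v normed_module" (structure) +
  fixes p :: real and M :: "'w measure" and L N :: "('w \<Rightarrow> real) set" and P :: "('w \<Rightarrow> real) \<Rightarrow> 'v"
  assumes p: "p > 1" and L_sub: "L \<subseteq> Lp_set p M" and N_sub: "N \<subseteq> L"
    and L_add: "f \<in> L \<Longrightarrow> g \<in> L \<Longrightarrow> (\<lambda>w. f w + g w) \<in> L" and L_cmult: "f \<in> L \<Longrightarrow> (\<lambda>w. c * f w) \<in> L"
    and L_closed: "f \<in> Lp_set p M \<Longrightarrow> (\<And>\<epsilon>. \<epsilon> > 0 \<Longrightarrow> \<exists>h\<in>L. pint p M (\<lambda>w. h w - f w) \<le> \<epsilon>) \<Longrightarrow> f \<in> L"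
    and N_closed: "f \<in> Lp_set p M \<Longrightarrow> (\<And>\<epsilon>. \<epsilon> > 0 \<Longrightarrow> \<exists>h\<in>N. pint p M (\<lambda>w. h w - f w) \<le> \<epsilon>) \<Longrightarrow> f \<in> N"
    and P_image: "P ` L = carrier V"
    and P_add: "f \<in> L \<Longrightarrow> g \<in> L \<Longrightarrow> P (\<lambda>w. f w + g w) = P f \<oplus> P g"
    and P_cmult: "f \<in> L \<Longrightarrow> P (\<lambda>w. c * f w) = c \<odot> P f"
    and P_eq: "f \<in> L \<Longrightarrow> g \<in> L \<Longrightarrow> P f = P g \<longleftrightarrow> (\<lambda>w. f w - g w) \<in> N"
    and P_nrm: "f \<in> L \<Longrightarrow> nrm V (P f) = (INF h\<in>N. pint p M (\<lambda>w. f w + h w) powr (1 / p))"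
begin

lemma p0: "p > 0" using p by simp

lemma L_Lp [simp]: "f \<in> L \<Longrightarrow> f \<in> Lp_set p M" using L_sub by blast

lemma P_closed [simp]: "f \<in> L \<Longrightarrow> P f \<in> carrier V" using P_image by blast

lemma L_diff: "f \<in> L \<Longrightarrow> g \<in> L \<Longrightarrow> (\<lambda>w. f w - g w) \<in> L"
  using L_add[OF _ L_cmult[of g "- 1"], of f] by simp

lemma L_mid: "f \<in> L \<Longrightarrow> g \<in> L \<Longrightarrow> (\<lambda>w. (f w + g w) / 2) \<in> L"
  using L_cmult[OF L_add, of f g "1 / 2"] by simp

lemma P_diff: "f \<in> L \<Longrightarrow> g \<in> L \<Longrightarrow> P (\<lambda>w. f w - g w) = P f \<ominus> P g"
  using P_add[OF _ L_cmult[of g "- 1"], of f] P_cmult[of g "- 1"] by (simp add: smult_minus_one a_minus_def)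

lemma P_mid: "f \<in> L \<Longrightarrow> g \<in> L \<Longrightarrow> P (\<lambda>w. (f w + g w) / 2) = (1 / 2) \<odot> (P f \<oplus> P g)"
  using P_cmult[OF L_add, of f g "1 / 2"] P_add[of f g] by simp

lemma mid_self: "x \<in> carrier V \<Longrightarrow> (1 / 2) \<odot> (x \<oplus> x) = x"
  by (simp add: smult_r_distr half_double)

lemma N_zero: "(\<lambda>w. 0) \<in> N"
proof -
  obtain f where "f \<in> L" using P_image zero_closed by blast
  then show ?thesis using P_eq[of f f] by simp
qed

lemma nrm_P_le: "f \<in> L \<Longrightarrow> nrm V (P f) \<le> pint p M f powr (1 / p)"
proof -
  assume f: "f \<in> L"
  have "(INF h\<in>N. pint p M (\<lambda>w. f w + h w) powr (1 / p)) \<le> pint p M (\<lambda>w. f w + 0) powr (1 / p)"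
    by (rule cINF_lower[OF _ N_zero]) (auto intro: bdd_belowI2[of _ 0])
  then show ?thesis using P_nrm[OF f] by simp
qed

lemma nrm_P_powr_le: "f \<in> L \<Longrightarrow> nrm V (P f) powr p \<le> pint p M f"
proof -
  assume f: "f \<in> L"
  have "nrm V (P f) powr p \<le> (pint p M f powr (1 / p)) powr p"
    using nrm_P_le[OF f] nrm_nonneg[OF P_closed[OF f]] p0 by (intro powr_mono2) auto
  then show ?thesis using p0 by (simp add: powr_powr)
qed

text \<open>The representatives of x form a midpoint convex set, closed because N is; so the limit
  supplied by \<open>pint_minimizer\<close> is itself a representative.\<close>

lemma lift_ex: assumes x: "x \<in> carrier V" shows "\<exists>F\<in>L. P F = x \<and> pint p M F = nrm V x powr p"
proof -
  define C where "C = {f \<in> L. P f = x}"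
  have CL: "C \<subseteq> Lp_set p M" unfolding C_def using L_sub by auto
  have "x \<in> P ` L" using x by (simp only: P_image)
  then obtain f0 where f0: "f0 \<in> C" unfolding C_def by (elim imageE) auto
  then have ne: "C \<noteq> {}" by blast
  have mid: "(\<lambda>w. (u w + v w) / 2) \<in> C" if "u \<in> C" "v \<in> C" for u v
    using that x unfolding C_def by (auto simp: L_mid P_mid mid_self)
  obtain c where c: "c \<in> Lp_set p M" and m: "\<And>\<epsilon>. \<epsilon> > 0 \<Longrightarrow> \<exists>\<delta>>0. \<forall>u\<in>C. pint p M u \<le> (INF u\<in>C. pint p M u) + \<delta> \<longrightarrow> pint p M (\<lambda>w. u w - c w) \<le> \<epsilon>"
    by (rule pint_minimizer[OF p CL ne mid], assumption, assumption, rule that)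
  define I where "I = (INF u\<in>C. pint p M u)"
  have bdd: "bdd_below (pint p M ` C)" by (intro bdd_belowI[of _ 0]) auto
  have near: "\<exists>u\<in>C. pint p M u \<le> I + \<epsilon> \<and> pint p M (\<lambda>w. u w - c w) \<le> \<epsilon>" if e: "\<epsilon> > 0" for \<epsilon>
  proof -
    obtain \<delta> where \<delta>: "\<delta> > 0" "\<forall>u\<in>C. pint p M u \<le> I + \<delta> \<longrightarrow> pint p M (\<lambda>w. u w - c w) \<le> \<epsilon>" using m[OF e] unfolding I_def by blast
    have "(INF u\<in>C. pint p M u) < I + min \<delta> \<epsilon>" using \<delta>(1) e by (simp add: I_def)
    then obtain u where "u \<in> C" "pint p M u < I + min \<delta> \<epsilon>" unfolding cINF_less_iff[OF ne bdd] by blast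
    then show ?thesis using \<delta>(2) by (intro bexI[of _ u]) auto
  qed
  have f0L: "f0 \<in> L" "P f0 = x" using f0 unfolding C_def by auto
  have cf: "(\<lambda>w. c w - f0 w) \<in> N"
  proof (rule N_closed)
    show "(\<lambda>w. c w - f0 w) \<in> Lp_set p M" by (rule Lp_set_diff[OF p0 c]) (use f0L in simp)
    fix \<epsilon> :: real assume "\<epsilon> > 0"
    then obtain u where u: "u \<in> C" "pint p M (\<lambda>w. u w - c w) \<le> \<epsilon>" using near by blast
    have "(\<lambda>w. u w - f0 w) \<in> N" using u(1) f0L P_eq[of u f0] unfolding C_def by simp
    then show "\<exists>h\<in>N. pint p M (\<lambda>w. h w - (c w - f0 w)) \<le> \<epsilon>" using u(2) by (intro bexI[of _ "\<lambda>w. u w - f0 w"]) auto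
  qed
  have cL: "c \<in> L" using L_add[OF f0L(1), of "\<lambda>w. c w - f0 w"] cf N_sub by auto
  have Pc: "P c = x" using P_eq[OF cL f0L(1)] cf f0L(2) by simp
  have cC: "c \<in> C" using cL Pc by (simp add: C_def)
  \<comment> \<open>c is a limit of near-minimisers, and the p-th power of the norm is continuous on
    bounded sets.\<close>
  have low: "pint p M c \<le> pint p M u" if u: "u \<in> C" for u
  proof -
    have "pint p M c \<le> I + e" if e: "e > 0" for e
    proof -
      have e2: "e / 2 > 0" using e by simp
      define B where "B = max (I + 1) (pint p M c)"
      have ah: "homogeneous2 p (\<lambda>s t. \<bar>t\<bar> powr p - \<bar>s\<bar> powr p)"
        by (rule homogeneous2_diff[OF homogeneous2_snd_powr[OF p0] homogeneous2_fst_powr[OF p0]])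
      have az: "\<bar>s\<bar> powr p - \<bar>s\<bar> powr p \<le> 0" for s :: real by simp
      obtain \<delta> where \<delta>: "\<delta> > 0" "\<And>(M :: 'w measure) f g. \<lbrakk>f \<in> Lp_set p M; g \<in> Lp_set p M; pint p M f \<le> B; pint p M g \<le> B;
         pint p M (\<lambda>w. f w - g w) \<le> \<delta>\<rbrakk> \<Longrightarrow> (LINT w|M. \<bar>g w\<bar> powr p - \<bar>f w\<bar> powr p) \<le> e / 2"
        by (rule small_of_pint[OF ah p0 az e2, where B = B], rule that)
      obtain v where v: "v \<in> C" "pint p M v \<le> I + min 1 (min \<delta> (e / 2))" "pint p M (\<lambda>w. v w - c w) \<le> min 1 (min \<delta> (e / 2))"
        using near[of "min 1 (min \<delta> (e / 2))"] \<delta>(1) e by auto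
      have vL: "v \<in> Lp_set p M" using v(1) CL by auto
      have "(LINT w|M. \<bar>c w\<bar> powr p - \<bar>v w\<bar> powr p) \<le> e / 2" by (rule \<delta>(2)[OF vL c]) (use v in \<open>auto simp: B_def\<close>)
      then have "pint p M c - pint p M v \<le> e / 2" unfolding pint_def using Lp_set_integrable[OF c] Lp_set_integrable[OF vL] by simp
      moreover have "pint p M v \<le> I + e / 2" using v(2) by simp
      ultimately show ?thesis using field_sum_of_halves[of e] by linarith
    qed
    then have "pint p M c \<le> I" by (rule field_le_epsilon)
    also have "I \<le> pint p M u" unfolding I_def by (rule cINF_lower[OF bdd u])
    finally show ?thesis .
  qed
  have "nrm V x = pint p M c powr (1 / p)"
  proof (rule antisym)
    show "nrm V x \<le> pint p M c powr (1 / p)" using nrm_P_le[OF cL] Pc by simp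
    show "pint p M c powr (1 / p) \<le> nrm V x"
      unfolding Pc[symmetric] P_nrm[OF cL]
    proof (rule cINF_greatest)
      fix h assume h: "h \<in> N"
      then have hL: "h \<in> L" using N_sub by auto
      have "(\<lambda>w. c w + h w) \<in> C" using P_eq[OF L_add[OF cL hL] cL] h L_add[OF cL hL] Pc by (simp add: C_def)
      then show "pint p M c powr (1 / p) \<le> pint p M (\<lambda>w. c w + h w) powr (1 / p)" using p0 by (intro powr_mono2 low) auto
    qed (use N_zero in blast)
  qed
  then have "pint p M c = nrm V x powr p" using p0 by (simp add: powr_powr)
  then show ?thesis using cL Pc by blast
qed

text \<open>\<open>SOME\<close> picks one representative of least norm. Equivariance is stated for
  \<open>dual\<close> instead, which \<open>dual_unique\<close> describes by the norm of V.\<close>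

definition lift :: "'v \<Rightarrow> 'w \<Rightarrow> real" where
  "lift x = (SOME F. F \<in> L \<and> P F = x \<and> pint p M F = nrm V x powr p)"

lemma lift: assumes "x \<in> carrier V" shows "lift x \<in> L" "P (lift x) = x" "pint p M (lift x) = nrm V x powr p"
proof -
  have "\<exists>F. F \<in> L \<and> P F = x \<and> pint p M F = nrm V x powr p" using lift_ex[OF assms] by blast
  from someI_ex[OF this] show "lift x \<in> L" "P (lift x) = x" "pint p M (lift x) = nrm V x powr p"
    unfolding lift_def by auto
qed

text \<open>Minimise over the preimage of C in L. Lifts of near-minimisers are near-minimisers
  there, and P does not increase distances.\<close>

lemma subquotient_minimizer:
  assumes C: "C \<subseteq> carrier V" "C \<noteq> {}" and mid: "\<forall>u\<in>C. \<forall>v\<in>C. (1 / 2) \<odot> (u \<oplus> v) \<in> C"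
  shows "\<exists>c\<in>carrier V. \<forall>\<epsilon>>0. \<exists>\<delta>>0. \<forall>u\<in>C. nrm V u \<le> (INF u\<in>C. nrm V u) + \<delta> \<longrightarrow> nrm V (u \<ominus> c) \<le> \<epsilon>"
proof -
  define D where "D = {f \<in> L. P f \<in> C}"
  have DL: "D \<subseteq> Lp_set p M" unfolding D_def by auto
  have lD: "lift x \<in> D" if "x \<in> C" for x using that C(1) lift[of x] unfolding D_def by auto
  have ne: "D \<noteq> {}" using lD C(2) by blast
  have midD: "(\<lambda>w. (u w + v w) / 2) \<in> D" if "u \<in> D" "v \<in> D" for u v
    using that mid unfolding D_def by (auto simp: L_mid P_mid)
  obtain c where c: "c \<in> Lp_set p M" and m: "\<And>\<epsilon>. \<epsilon> > 0 \<Longrightarrow> \<exists>\<delta>>0. \<forall>u\<in>D. pint p M u \<le> (INF u\<in>D. pint p M u) + \<delta> \<longrightarrow> pint p M (\<lambda>w. u w - c w) \<le> \<epsilon>"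
    by (rule pint_minimizer[OF p DL ne midD], assumption, assumption, rule that)
  define I where "I = (INF u\<in>D. pint p M u)"
  have bdd: "bdd_below (pint p M ` D)" by (intro bdd_belowI[of _ 0]) auto
  have cL: "c \<in> L"
  proof (rule L_closed[OF c])
    fix \<epsilon> :: real assume e: "\<epsilon> > 0"
    obtain \<delta> where \<delta>: "\<delta> > 0" "\<forall>u\<in>D. pint p M u \<le> I + \<delta> \<longrightarrow> pint p M (\<lambda>w. u w - c w) \<le> \<epsilon>" using m[OF e] unfolding I_def by blast
    have "(INF u\<in>D. pint p M u) < I + \<delta>" using \<delta>(1) by (simp add: I_def)
    then obtain u where "u \<in> D" "pint p M u < I + \<delta>" unfolding cINF_less_iff[OF ne bdd] by blast
    then show "\<exists>h\<in>L. pint p M (\<lambda>w. h w - c w) \<le> \<epsilon>" using \<delta>(2) by (intro bexI[of _ u]) (auto simp: D_def)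
  qed
  define k where "k = (INF u\<in>C. nrm V u)"
  have bddC: "bdd_below (nrm V ` C)" using C(1) by (intro bdd_belowI2[of _ 0] nrm_nonneg) auto
  have k0: "k \<ge> 0" unfolding k_def by (rule cINF_greatest[OF C(2)]) (use C(1) nrm_nonneg in auto)
  have kI: "k powr p \<le> I" unfolding I_def
  proof (rule cINF_greatest[OF ne])
    fix f assume f: "f \<in> D"
    have "k \<le> nrm V (P f)" unfolding k_def by (rule cINF_lower[OF bddC]) (use f in \<open>simp add: D_def\<close>)
    then have "k powr p \<le> nrm V (P f) powr p" using k0 p0 by (intro powr_mono2) auto
    also have "\<dots> \<le> pint p M f" by (rule nrm_P_powr_le) (use f in \<open>simp add: D_def\<close>)
    finally show "k powr p \<le> pint p M f" .
  qed
  show ?thesis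
  proof (intro bexI[of _ "P c"] P_closed cL allI impI)
    fix \<epsilon> :: real assume e: "\<epsilon> > 0"
    have ep: "\<epsilon> powr p > 0" using e by simp
    obtain \<delta> where \<delta>: "\<delta> > 0" "\<forall>u\<in>D. pint p M u \<le> I + \<delta> \<longrightarrow> pint p M (\<lambda>w. u w - c w) \<le> \<epsilon> powr p" using m[OF ep] unfolding I_def by blast
    \<comment> \<open>Converts a slack in the norm into a slack in its p-th power.\<close>
    obtain \<eta> where eta: "\<eta> > 0" "\<eta> \<le> 1" "\<And>m d. 0 \<le> m \<Longrightarrow> m \<le> k \<Longrightarrow> 0 \<le> d \<Longrightarrow> d \<le> \<eta> \<Longrightarrow> (m + d) powr p \<le> m powr p + \<delta>"
      by (rule powr_close[OF p k0 \<delta>(1)], rule that)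
    show "\<exists>\<delta>>0. \<forall>u\<in>C. nrm V u \<le> (INF u\<in>C. nrm V u) + \<delta> \<longrightarrow> nrm V (u \<ominus> P c) \<le> \<epsilon>"
    proof (intro exI[of _ \<eta>] conjI eta(1) ballI impI)
      fix u assume u: "u \<in> C" and le: "nrm V u \<le> (INF u\<in>C. nrm V u) + \<eta>"
      have uV: "u \<in> carrier V" using u C(1) by auto
      have "nrm V u powr p \<le> (k + \<eta>) powr p" using le nrm_nonneg[OF uV] p0 unfolding k_def by (intro powr_mono2) auto
      also have "\<dots> \<le> k powr p + \<delta>" using eta(3)[of k \<eta>] k0 eta(1) by simp
      finally have "pint p M (lift u) \<le> I + \<delta>" using lift(3)[OF uV] kI by simp
      then have "pint p M (\<lambda>w. lift u w - c w) \<le> \<epsilon> powr p" using \<delta>(2) lD[OF u] by blast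
      then have "pint p M (\<lambda>w. lift u w - c w) powr (1 / p) \<le> (\<epsilon> powr p) powr (1 / p)" using p0 by (intro powr_mono2) auto
      also have "\<dots> = \<epsilon>" using p0 e by (simp add: powr_powr)
      finally show "nrm V (u \<ominus> P c) \<le> \<epsilon>"
        using nrm_P_le[OF L_diff[OF lift(1)[OF uV] cL]] P_diff[OF lift(1)[OF uV] cL] lift(2)[OF uV] by simp
    qed
  qed
qed

text \<open>Divided by nothing but p, this is the slope of the p-th power of the norm of V at x in
  the direction \<open>P f\<close>, see \<open>dual_slope\<close>.\<close>

definition dual :: "'v \<Rightarrow> ('w \<Rightarrow> real) \<Rightarrow> real" where
  "dual x f = (LINT w|M. spow (p - 1) (lift x w) * f w)"

lemma dual_integrable: "x \<in> carrier V \<Longrightarrow> f \<in> Lp_set p M \<Longrightarrow> integrable M (\<lambda>w. spow (p - 1) (lift x w) * f w)"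
  using lift(1) by (intro spow_mult_integrable[OF p]) auto

lemma dual_add: "x \<in> carrier V \<Longrightarrow> f \<in> Lp_set p M \<Longrightarrow> g \<in> Lp_set p M \<Longrightarrow> dual x (\<lambda>w. f w + g w) = dual x f + dual x g"
  unfolding dual_def using dual_integrable by (simp add: distrib_left)

lemma dual_cmult: "dual x (\<lambda>w. c * f w) = c * dual x f"
  unfolding dual_def by (simp add: mult.left_commute[of _ c])

text \<open>The lift has least norm in its coset, so 0 is an admissible slope along h, and slopes
  are unique.\<close>

lemma dual_null: assumes x: "x \<in> carrier V" and h: "h \<in> N" shows "dual x h = 0"
proof -
  have hL: "h \<in> L" using h N_sub by auto
  have "pint p M (lift x) + p * (t * 0) \<le> pint p M (\<lambda>w. lift x w + t * h w)" for t
  proof -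
    have tL: "(\<lambda>w. lift x w + t * h w) \<in> L" by (intro L_add L_cmult hL lift(1)[OF x])
    have n0: "(\<lambda>w. 0 * h w) \<in> L" using L_cmult[OF hL, of 0] .
    have zero: "P h = \<zero>" using P_eq[OF hL n0] P_cmult[OF hL, of 0] h smult_l_null[OF P_closed[OF hL]] by simp
    have "P (\<lambda>w. lift x w + t * h w) = x"
      using P_add[OF lift(1)[OF x] L_cmult[OF hL]] P_cmult[OF hL] lift(2)[OF x] x zero by simp
    then show ?thesis using nrm_P_powr_le[OF tL] lift(3)[OF x] by simp
  qed
  from pint_slope_unique[OF p _ _ this] show ?thesis unfolding dual_def using lift(1)[OF x] hL by simp
qed

lemma dual_lift: assumes x: "x \<in> carrier V" and f: "f \<in> L" shows "dual x f = dual x (lift (P f))"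
proof -
  have l: "lift (P f) \<in> L" "P (lift (P f)) = P f" using lift[OF P_closed[OF f]] by auto
  have n: "(\<lambda>w. f w - lift (P f) w) \<in> N" using P_eq[OF f l(1)] l(2) by simp
  have "dual x (\<lambda>w. lift (P f) w + (f w - lift (P f) w)) = dual x (lift (P f)) + dual x (\<lambda>w. f w - lift (P f) w)"
    by (rule dual_add[OF x]) (use l(1) f L_diff in auto)
  then show ?thesis using dual_null[OF x n] by simp
qed

text \<open>The lift of x + t P f differs from \<open>lift x\<close> by t f and an element of N,
  which \<open>dual x\<close> ignores; so the tangent inequality of L_p descends to V.\<close>

lemma dual_slope:
  assumes x: "x \<in> carrier V" and f: "f \<in> L"
  shows "nrm V x powr p + p * (t * dual x f) \<le> nrm V (x \<oplus> t \<odot> P f) powr p"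
proof -
  define z where "z = x \<oplus> t \<odot> P f"
  have z: "z \<in> carrier V" unfolding z_def using x f by simp
  have tf: "(\<lambda>w. t * f w) \<in> L" "(\<lambda>w. lift x w + t * f w) \<in> L" by (intro L_add L_cmult f lift(1)[OF x])+
  have Pz: "P (\<lambda>w. lift x w + t * f w) = z"
    unfolding z_def using P_add[OF lift(1)[OF x] tf(1)] P_cmult[OF f] lift(2)[OF x] by simp
  define h where "h = (\<lambda>w. lift z w - (lift x w + t * f w))"
  have h: "h \<in> N" unfolding h_def using P_eq[OF lift(1)[OF z] tf(2)] lift(2)[OF z] Pz by simp
  have hL: "h \<in> L" using h N_sub by auto
  have s: "(\<lambda>w. t * f w + h w) \<in> Lp_set p M" using L_add[OF tf(1) hL] by simp
  have "pint p M (lift x) + p * dual x (\<lambda>w. t * f w + h w) \<le> pint p M (\<lambda>w. lift x w + (t * f w + h w))"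
    unfolding dual_def by (rule pint_tangent[OF p _ s]) (use lift(1)[OF x] in simp)
  moreover have "(\<lambda>w. lift x w + (t * f w + h w)) = lift z" unfolding h_def by auto
  moreover have "dual x (\<lambda>w. t * f w + h w) = t * dual x f"
    using dual_add[OF x L_Lp[OF tf(1)] L_Lp[OF hL]] dual_null[OF x h] dual_cmult by simp
  ultimately show ?thesis using lift(3)[OF x] lift(3)[OF z] unfolding z_def by simp
qed

text \<open>P does not increase norms and preserves the norm of the lift, so a slope for V is one
  for L_p, where slopes are unique.\<close>

lemma dual_unique:
  assumes x: "x \<in> carrier V" and f: "f \<in> L"
    and b: "\<And>t. nrm V x powr p + p * (t * b) \<le> nrm V (x \<oplus> t \<odot> P f) powr p"
  shows "b = dual x f"
  unfolding dual_def
proof (rule pint_slope_unique[OF p])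
  fix t
  have tf: "(\<lambda>w. t * f w) \<in> L" "(\<lambda>w. lift x w + t * f w) \<in> L" by (intro L_add L_cmult f lift(1)[OF x])+
  have "P (\<lambda>w. lift x w + t * f w) = x \<oplus> t \<odot> P f"
    using P_add[OF lift(1)[OF x] tf(1)] P_cmult[OF f] lift(2)[OF x] by simp
  then show "pint p M (lift x) + p * (t * b) \<le> pint p M (\<lambda>w. lift x w + t * f w)"
    using nrm_P_powr_le[OF tf(2)] b[of t] lift(3)[OF x] by simp
qed (use f lift(1)[OF x] in auto)

text \<open>An isometry carries slopes at T x back to slopes at x, and uniqueness identifies
  them.\<close>

lemma dual_isometry:
  assumes T: "T \<in> carrier (isometry_group V)" and x: "x \<in> carrier V" and y: "y \<in> carrier V"
  shows "dual (T x) (lift (T y)) = dual x (lift y)"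
proof (rule dual_unique[OF x lift(1)[OF y]])
  fix t
  note Tx = isometryD(1)[OF T x] and Ty = isometryD(1)[OF T y]
  have ty: "t \<odot> y \<in> carrier V" using y by simp
  have "nrm V (T x) powr p + p * (t * dual (T x) (lift (T y))) \<le> nrm V (T x \<oplus> t \<odot> T y) powr p"
    using dual_slope[OF Tx lift(1)[OF Ty], of t] lift(2)[OF Ty] by simp
  also have "T x \<oplus> t \<odot> T y = T (x \<oplus> t \<odot> y)" using isometryD(3)[OF T x ty] isometryD(4)[OF T y] by simp
  also have "nrm V (T (x \<oplus> t \<odot> y)) = nrm V (x \<oplus> t \<odot> y)" using x ty by (intro isometryD(5)[OF T]) simp
  finally show "nrm V x powr p + p * (t * dual (T x) (lift (T y))) \<le> nrm V (x \<oplus> t \<odot> P (lift y)) powr p"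
    using isometryD(5)[OF T x] lift(2)[OF y] by simp
qed

text \<open>Young's inequality, with y rescaled to the norm of x, becomes Hoelder's
  inequality.\<close>

lemma dual_le:
  assumes x: "x \<in> carrier V" and y: "y \<in> carrier V"
  shows "dual x (lift y) \<le> nrm V x powr (p - 1) * nrm V y"
proof (cases "nrm V y = 0")
  case True
  then have "y = \<zero>" using nrm_eq_0[OF y] by simp
  have "pint p M (lift y) = 0" using lift(3)[OF y] True by simp
  then have "AE w in M. \<bar>lift y w\<bar> powr p = 0"
    unfolding pint_def using integral_nonneg_eq_0_iff_AE[OF Lp_set_integrable[OF L_Lp[OF lift(1)[OF y]]]] by simp
  then have "AE w in M. spow (p - 1) (lift x w) * lift y w = 0" by eventually_elim simp
  then have "dual x (lift y) = 0" unfolding dual_def by (rule integral_eq_zero_AE)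
  then show ?thesis using True by simp
next
  case False
  define A B where "A = nrm V x" and "B = nrm V y"
  have B: "B > 0" unfolding B_def using False nrm_nonneg[OF y] by simp
  have A: "A \<ge> 0" unfolding A_def by (rule nrm_nonneg[OF x])
  show ?thesis
  proof (cases "A = 0")
    case True
    have "pint p M (lift x) = 0" using lift(3)[OF x] True unfolding A_def by simp
    then have "AE w in M. \<bar>lift x w\<bar> powr p = 0"
      unfolding pint_def using integral_nonneg_eq_0_iff_AE[OF Lp_set_integrable[OF L_Lp[OF lift(1)[OF x]]]] by simp
    then have "AE w in M. spow (p - 1) (lift x w) * lift y w = 0" by eventually_elim (simp add: spow_def)
    then have "dual x (lift y) = 0" unfolding dual_def by (rule integral_eq_zero_AE)
    then show ?thesis using True unfolding A_def by simp
  next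
    case False
    then have A: "A > 0" using A by simp
    have "p * dual x (\<lambda>w. (A / B) * lift y w) \<le> pint p M (\<lambda>w. (A / B) * lift y w) + (p - 1) * pint p M (lift x)"
      unfolding dual_def by (rule pint_Young[OF p L_Lp[OF lift(1)[OF x]] L_Lp[OF L_cmult[OF lift(1)[OF y]]]])
    also have "pint p M (\<lambda>w. (A / B) * lift y w) = A powr p"
      unfolding pint_cmult lift(3)[OF y] B_def[symmetric] using A B by (simp add: powr_divide)
    also have "pint p M (lift x) = A powr p" unfolding lift(3)[OF x] A_def ..
    also have "A powr p + (p - 1) * A powr p = p * A powr p" by (simp add: algebra_simps)
    finally have "(A / B) * dual x (lift y) \<le> A powr p" unfolding dual_cmult mult_le_cancel_left_pos[OF p0] .
    also have "A powr p = A * A powr (p - 1)" using powr_mult_base[of A "p - 1"] A by simp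
    finally have "A * (dual x (lift y) / B) \<le> A * A powr (p - 1)" by simp
    then have "dual x (lift y) / B \<le> A powr (p - 1)" unfolding mult_le_cancel_left_pos[OF A] .
    then show ?thesis using B unfolding A_def[symmetric] B_def[symmetric] by (simp add: field_simps)
  qed
qed

lemma dual_lift_add:
  assumes x: "x \<in> carrier V" and y: "y \<in> carrier V" and z: "z \<in> carrier V"
  shows "dual x (lift (y \<oplus> z)) = dual x (lift y) + dual x (lift z)"
proof -
  note l = lift[OF y] lift[OF z]
  have "dual x (lift (y \<oplus> z)) = dual x (\<lambda>w. lift y w + lift z w)"
    using dual_lift[OF x L_add[OF l(1) l(4)]] P_add[OF l(1) l(4)] l(2,5) by simp
  then show ?thesis using dual_add[OF x] l(1,4) by simp
qed

lemma subquotient_support: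
  assumes x: "x \<in> carrier V"
  shows "\<exists>j. (\<forall>y\<in>carrier V. \<forall>z\<in>carrier V. j (y \<oplus> z) = j y + j z) \<and>
      (\<forall>y\<in>carrier V. \<bar>j y\<bar> \<le> nrm V y) \<and> j x = nrm V x \<and>
      (\<forall>T\<in>carrier (isometry_group V). T x = x \<longrightarrow> (\<forall>y\<in>carrier V. j (T y) = j y))"
proof (cases "nrm V x = 0")
  case True
  then show ?thesis by (intro exI[of _ "\<lambda>_. 0"]) (simp add: nrm_nonneg)
next
  case False
  define A where "A = nrm V x"
  have A: "A > 0" unfolding A_def using False nrm_nonneg[OF x] by simp
  show ?thesis
  proof (intro exI[of _ "\<lambda>y. dual x (lift y) / A powr (p - 1)"] conjI ballI impI)
    fix y z assume "y \<in> carrier V" "z \<in> carrier V"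
    then show "dual x (lift (y \<oplus> z)) / A powr (p - 1) = dual x (lift y) / A powr (p - 1) + dual x (lift z) / A powr (p - 1)"
      by (simp add: dual_lift_add[OF x] add_divide_distrib)
  next
    fix y assume y: "y \<in> carrier V"
    have "dual x (lift (y \<oplus> \<ominus> y)) = dual x (lift y) + dual x (lift (\<ominus> y))" using y by (intro dual_lift_add[OF x]) auto
    moreover have "dual x (lift (y \<oplus> \<ominus> y)) = 0"
    proof -
      have "dual x (lift \<zero>) = dual x (lift \<zero>) + dual x (lift \<zero>)" using dual_lift_add[OF x, of \<zero> \<zero>] by simp
      then show ?thesis using y by (simp add: M.r_neg)
    qed
    ultimately have "- dual x (lift y) \<le> A powr (p - 1) * nrm V y"
      using dual_le[OF x, of "\<ominus> y"] y by (simp add: nrm_neg A_def)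
    moreover have "dual x (lift y) \<le> A powr (p - 1) * nrm V y" using dual_le[OF x y] by (simp add: A_def)
    ultimately have "\<bar>dual x (lift y)\<bar> \<le> A powr (p - 1) * nrm V y" by linarith
    then show "\<bar>dual x (lift y) / A powr (p - 1)\<bar> \<le> nrm V y" using A by (simp add: field_simps)
  next
    have "dual x (lift x) = A powr p" unfolding dual_def spow_self[OF p] lift(3)[OF x] A_def ..
    also have "A powr p = A * A powr (p - 1)" using powr_mult_base[of A "p - 1"] A by simp
    finally show "dual x (lift x) / A powr (p - 1) = nrm V x" using A unfolding A_def[symmetric] by simp
  next
    fix T y assume T: "T \<in> carrier (isometry_group V)" "T x = x" and y: "y \<in> carrier V"
    show "dual x (lift (T y)) / A powr (p - 1) = dual x (lift y) / A powr (p - 1)"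
      using dual_isometry[OF T(1) x y] T(2) by simp
  qed
qed

end

section \<open>Uniform continuity of the lift, and the case of subspaces\<close>

context subquotient
begin

text \<open>With u = y - x, g = lift x + lift u is a second representative of y. Its norm is at most
  ||y|| + 2 ||u||, nearly the least, so uniform convexity puts it close to \<open>lift y\<close>,
  while g - lift x = lift u is small.\<close>

lemma lift_uniform:
  assumes e: "\<epsilon> > 0"
  shows "\<exists>\<delta>>0. \<forall>x\<in>carrier V. \<forall>y\<in>carrier V. nrm V x \<le> B \<longrightarrow> nrm V y \<le> B \<longrightarrow>
    nrm V (x \<ominus> y) \<le> \<delta> \<longrightarrow> pint p M (\<lambda>w. lift x w - lift y w) \<le> \<epsilon>"
proof -
  define B0 where "B0 = max B 0"
  have B0: "B0 \<ge> 0" unfolding B0_def by simp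
  define e1 where "e1 = \<epsilon> / (2 * 2 powr p)"
  have e1: "e1 > 0" unfolding e1_def using e by simp
  define B1 where "B1 = B0 powr p + 1"
  obtain d1 where d1: "d1 > 0" "\<And>(M :: 'w measure) f g. \<lbrakk>f \<in> Lp_set p M; g \<in> Lp_set p M; pint p M f \<le> B1; pint p M g \<le> B1;
       (pint p M f + pint p M g) / 2 - pint p M (\<lambda>w. (f w + g w) / 2) \<le> d1\<rbrakk>
       \<Longrightarrow> pint p M (\<lambda>w. f w - g w) \<le> e1"
    by (rule uniform_convexity_pint[OF p e1, where B = B1], rule that)
  have m1: "min d1 1 > 0" using d1(1) by simp
  obtain d2 where d2: "d2 > 0" "d2 \<le> 1" "\<And>m d. 0 \<le> m \<Longrightarrow> m \<le> B0 \<Longrightarrow> 0 \<le> d \<Longrightarrow> d \<le> d2 \<Longrightarrow> (m + d) powr p \<le> m powr p + min d1 1"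
    by (rule powr_close[OF p B0 m1], rule that)
  show ?thesis
  \<comment> \<open>The first entry gives 2 ||u|| \<le> \<open>d2\<close>, the second ||u||^p \<le>
    \<open>e1\<close>.\<close>
  proof (intro exI[of _ "min (d2 / 2) (e1 powr (1 / p))"] conjI ballI impI)
    show "min (d2 / 2) (e1 powr (1 / p)) > 0" using d2(1) e1 by simp
    fix x y assume x: "x \<in> carrier V" and y: "y \<in> carrier V" and yB: "nrm V y \<le> B"
      and d: "nrm V (x \<ominus> y) \<le> min (d2 / 2) (e1 powr (1 / p))"
    define u where "u = y \<ominus> x"
    have u: "u \<in> carrier V" unfolding u_def using x y by simp
    have nu: "nrm V u = nrm V (x \<ominus> y)" unfolding u_def by (rule nrm_minus_commute[OF y x])
    have nu0: "nrm V u \<ge> 0" by (rule nrm_nonneg[OF u])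
    have nup: "nrm V u powr p \<le> e1"
    proof -
      have "nrm V u powr p \<le> (e1 powr (1 / p)) powr p" using d nu nu0 p0 by (intro powr_mono2) auto
      then show ?thesis using p0 e1 by (simp add: powr_powr)
    qed
    define g where "g = (\<lambda>w. lift x w + lift u w)"
    note lx = lift[OF x] and ly = lift[OF y] and lu = lift[OF u]
    have g: "g \<in> L" unfolding g_def by (rule L_add[OF lx(1) lu(1)])
    have Pg: "P g = y" unfolding g_def P_add[OF lx(1) lu(1)] lx(2) lu(2)
      unfolding u_def using x y by (simp add: M.a_comm[of x] minus_minus_cancel)
    have nx: "nrm V x \<le> nrm V y + nrm V u" using nrm_le_diff[OF x y] nu by linarith
    have root: "pint p M (lift z) powr (1 / p) = nrm V z" if z: "z \<in> carrier V" for z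
      unfolding lift(3)[OF z] using p0 nrm_nonneg[OF z] by (simp add: powr_powr)
    have "pint p M g powr (1 / p) \<le> nrm V x + nrm V u"
      unfolding g_def using Minkowski_pint[OF p L_Lp[OF lx(1)] L_Lp[OF lu(1)]] unfolding root[OF x] root[OF u] .
    also have "\<dots> \<le> nrm V y + 2 * nrm V u" using nx by simp
    finally have "(pint p M g powr (1 / p)) powr p \<le> (nrm V y + 2 * nrm V u) powr p" using p0 by (intro powr_mono2) auto
    moreover have "(pint p M g powr (1 / p)) powr p = pint p M g" using p0 by (simp add: powr_powr)
    moreover have "(nrm V y + 2 * nrm V u) powr p \<le> nrm V y powr p + min d1 1"
      by (rule d2(3)) (use nrm_nonneg[OF y] yB nu nu0 d in \<open>auto simp: B0_def\<close>)
    ultimately have gb: "pint p M g \<le> nrm V y powr p + min d1 1" by simp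
    have yb: "nrm V y powr p \<le> B0 powr p" using nrm_nonneg[OF y] yB p0 by (intro powr_mono2) (auto simp: B0_def)
    have "P (\<lambda>w. (g w + lift y w) / 2) = y" unfolding P_mid[OF g ly(1)] Pg ly(2) by (rule mid_self[OF y])
    then have mid: "nrm V y powr p \<le> pint p M (\<lambda>w. (g w + lift y w) / 2)"
      using nrm_P_powr_le[OF L_mid[OF g ly(1)]] by simp
    have "pint p M (\<lambda>w. g w - lift y w) \<le> e1"
    proof (rule d1(2)[OF L_Lp[OF g] L_Lp[OF ly(1)]])
      show "pint p M g \<le> B1" unfolding B1_def using gb yb by linarith
      show "pint p M (lift y) \<le> B1" unfolding ly(3) B1_def using yb by linarith
      have "pint p M g + pint p M (lift y) \<le> 2 * nrm V y powr p + d1" unfolding ly(3) using gb by linarith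
      then have "(pint p M g + pint p M (lift y)) / 2 \<le> nrm V y powr p + d1" using d1(1) by simp
      then show "(pint p M g + pint p M (lift y)) / 2 - pint p M (\<lambda>w. (g w + lift y w) / 2) \<le> d1" using mid by linarith
    qed
    moreover have "pint p M (\<lambda>w. lift x w - g w) \<le> e1"
    proof -
      have "pint p M (\<lambda>w. g w - lift x w) = nrm V u powr p" unfolding g_def by (simp add: lu(3))
      then show ?thesis using nup pint_diff_commute[of p M "lift x" g] by simp
    qed
    ultimately have "2 powr p * (pint p M (\<lambda>w. lift x w - g w) + pint p M (\<lambda>w. g w - lift y w)) \<le> 2 powr p * (e1 + e1)"
      by (intro mult_left_mono add_mono) auto
    also have "\<dots> = \<epsilon>" unfolding e1_def by (simp add: field_simps)
    finally show "pint p M (\<lambda>w. lift x w - lift y w) \<le> \<epsilon>"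
      using pint_triangle[OF p0 L_Lp[OF lx(1)] L_Lp[OF g] L_Lp[OF ly(1)]] by linarith
  qed
qed

lemma nrm_diff_le_pint:
  assumes x: "x \<in> carrier V" and y: "y \<in> carrier V"
  shows "nrm V (x \<ominus> y) powr p \<le> pint p M (\<lambda>w. lift x w - lift y w)"
  using nrm_P_powr_le[OF L_diff[OF lift(1)[OF x] lift(1)[OF y]]]
  unfolding P_diff[OF lift(1)[OF x] lift(1)[OF y]] lift(2)[OF x] lift(2)[OF y] .

lemma nrm_diff_le_root:
  assumes x: "x \<in> carrier V" and y: "y \<in> carrier V" and e: "e > 0"
    and s: "pint p M (\<lambda>w. lift x w - lift y w) \<le> e powr p"
  shows "nrm V (x \<ominus> y) \<le> e"
proof (rule ccontr)
  assume "\<not> nrm V (x \<ominus> y) \<le> e"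
  then have "e powr p < nrm V (x \<ominus> y) powr p" using e p0 by (intro powr_less_mono2) auto
  then show False using s nrm_diff_le_pint[OF x y] by linarith
qed

lemma pint_lift_bound: "x \<in> carrier V \<Longrightarrow> nrm V x \<le> B \<Longrightarrow> pint p M (lift x) \<le> B powr p"
  unfolding lift(3) using nrm_nonneg p0 by (simp add: powr_mono2)

text \<open>P is isometric on L and sends a combination of lifts to the combination of the vectors,
  so the required invariance is that of the norm of V under T.\<close>

theorem isometric_rigid_space:
  assumes iso: "\<And>f. f \<in> L \<Longrightarrow> pint p M f = nrm V (P f) powr p"
  shows "rigid_space V p M lift"
proof (unfold_locales, rule p)
  fix C assume "C \<subseteq> carrier V" "C \<noteq> {}" "\<forall>u\<in>C. \<forall>v\<in>C. (1 / 2) \<odot> (u \<oplus> v) \<in> C"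
  then show "\<exists>c\<in>carrier V. \<forall>\<epsilon>>0. \<exists>\<delta>>0. \<forall>u\<in>C. nrm V u \<le> (INF u\<in>C. nrm V u) + \<delta> \<longrightarrow> nrm V (u \<ominus> c) \<le> \<epsilon>"
    by (rule subquotient_minimizer)
next
  fix x assume "x \<in> carrier V"
  then show "\<exists>j. (\<forall>y\<in>carrier V. \<forall>z\<in>carrier V. j (y \<oplus> z) = j y + j z) \<and>
      (\<forall>y\<in>carrier V. \<bar>j y\<bar> \<le> nrm V y) \<and> j x = nrm V x \<and>
      (\<forall>T\<in>carrier (isometry_group V). T x = x \<longrightarrow> (\<forall>y\<in>carrier V. j (T y) = j y))"
    by (rule subquotient_support)
next
  fix x assume "x \<in> carrier V"
  then show "lift x \<in> Lp_set p M" using lift(1) by simp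
next
  fix B
  show "\<exists>B'. \<forall>x\<in>carrier V. nrm V x \<le> B \<longrightarrow> pint p M (lift x) \<le> B'"
    by (intro exI[of _ "B powr p"] ballI impI pint_lift_bound)
next
  fix T :: "'v \<Rightarrow> 'v" and n :: nat and c x
  assume T: "T \<in> carrier (isometry_group V)" and x: "\<And>i. i < n \<Longrightarrow> x i \<in> carrier V"
  have N0: "(\<lambda>w. 0) \<in> L" using N_zero N_sub by blast
  have P0: "P (\<lambda>w. 0) = \<zero>" using P_cmult[OF N0, of 0] smult_l_null[OF P_closed[OF N0]] by simp
  have "(\<lambda>w. \<Sum>i<n. c i * lift (x i) w) \<in> L \<and> (\<lambda>w. \<Sum>i<n. c i * lift (T (x i)) w) \<in> L \<and>
      P (\<lambda>w. \<Sum>i<n. c i * lift (T (x i)) w) = T (P (\<lambda>w. \<Sum>i<n. c i * lift (x i) w))"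
    using x
  proof (induction n)
    case 0
    have "T \<zero> = \<zero>" using isometry_diff[OF T, of \<zero> \<zero>] by (simp add: a_minus_def M.r_neg isometryD(1)[OF T])
    then show ?case using N0 P0 by simp
  next
    case (Suc n)
    have xn: "x n \<in> carrier V" "T (x n) \<in> carrier V" using Suc.prems[of n] isometryD(1)[OF T] by auto
    define S S' where "S = (\<lambda>w. \<Sum>i<n. c i * lift (x i) w)" and "S' = (\<lambda>w. \<Sum>i<n. c i * lift (T (x i)) w)"
    have IH: "S \<in> L" "S' \<in> L" "P S' = T (P S)" unfolding S_def S'_def using Suc.IH Suc.prems by auto
    note a = L_cmult[OF lift(1)[OF xn(1)], of "c n"] and b = L_cmult[OF lift(1)[OF xn(2)], of "c n"]
    have "P (\<lambda>w. S' w + c n * lift (T (x n)) w) = T (P S) \<oplus> c n \<odot> T (x n)"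
      unfolding P_add[OF IH(2) b] P_cmult[OF lift(1)[OF xn(2)]] lift(2)[OF xn(2)] IH(3) ..
    also have "\<dots> = T (P S \<oplus> c n \<odot> x n)"
      using isometryD(3)[OF T P_closed[OF IH(1)], of "c n \<odot> x n"] isometryD(4)[OF T xn(1)] xn(1) by simp
    also have "\<dots> = T (P (\<lambda>w. S w + c n * lift (x n) w))"
      unfolding P_add[OF IH(1) a] P_cmult[OF lift(1)[OF xn(1)]] lift(2)[OF xn(1)] ..
    finally show ?case using L_add[OF IH(1) a] L_add[OF IH(2) b] unfolding S_def S'_def by simp
  qed
  then show "pint p M (\<lambda>w. \<Sum>i<n. c i * lift (T (x i)) w) = pint p M (\<lambda>w. \<Sum>i<n. c i * lift (x i) w)"
    using iso isometryD(5)[OF T] P_closed by simp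
next
  fix B \<epsilon> :: real assume "\<epsilon> > 0"
  then show "\<exists>\<delta>>0. \<forall>x\<in>carrier V. \<forall>y\<in>carrier V. nrm V x \<le> B \<longrightarrow> nrm V y \<le> B \<longrightarrow>
      nrm V (x \<ominus> y) \<le> \<delta> \<longrightarrow> pint p M (\<lambda>w. lift x w - lift y w) \<le> \<epsilon>"
    by (rule lift_uniform)
next
  fix B \<epsilon> :: real assume e: "\<epsilon> > 0"
  show "\<exists>\<delta>>0. \<forall>x\<in>carrier V. \<forall>y\<in>carrier V. nrm V x \<le> B \<longrightarrow> nrm V y \<le> B \<longrightarrow>
      pint p M (\<lambda>w. lift x w - lift y w) \<le> \<delta> \<longrightarrow> nrm V (x \<ominus> y) \<le> \<epsilon>"
    by (intro exI[of _ "\<epsilon> powr p"] conjI ballI impI nrm_diff_le_root) (use e in auto)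
qed

end

section \<open>Quotients and the duality map\<close>

locale Lp_quotient = subquotient +
  assumes full: "L = Lp_set p M"
begin

definition r :: real where "r = p / (p - 1)"

text \<open>The element of L_r that represents the functional \<open>dual x\<close>.\<close>

definition \<Phi> :: "'a \<Rightarrow> 'b \<Rightarrow> real" where "\<Phi> x w = spow (p - 1) (lift x w)"

lemma r: "r > 1" "r > 0" "(p - 1) * r = p" "r - 1 = 1 / (p - 1)" "p - 1 > 0"
  using p unfolding r_def by (auto simp: field_simps)

lemma spow_powr: "\<bar>spow (p - 1) s\<bar> powr r = \<bar>s\<bar> powr p"
  by (simp add: powr_powr r(3))

lemma pint_spow: "pint r M (\<lambda>w. spow (p - 1) (h w)) = pint p M h"
  unfolding pint_def spow_powr ..

lemma spow_Lp_set: "h \<in> Lp_set p M \<Longrightarrow> (\<lambda>w. spow (p - 1) (h w)) \<in> Lp_set r M"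
  unfolding Lp_set_iff spow_powr by auto

text \<open>The signed powers p - 1 and 1 / (p - 1) are inverse to each other. The function h
  obtained here norms z: the integral of z h is the p-th power of the norm of h.\<close>

lemma spow_root: assumes z: "z \<in> Lp_set r M"
  shows "\<exists>h\<in>Lp_set p M. z = (\<lambda>w. spow (p - 1) (h w))"
proof (intro bexI)
  have *: "spow (p - 1) (spow (1 / (p - 1)) s) = s" for s by (rule spow_spow[OF r(5)])
  then show "z = (\<lambda>w. spow (p - 1) (spow (1 / (p - 1)) (z w)))" by simp
  have "\<bar>spow (1 / (p - 1)) s\<bar> powr p = \<bar>s\<bar> powr r" for s unfolding spow_powr[symmetric] * ..
  then show "(\<lambda>w. spow (1 / (p - 1)) (z w)) \<in> Lp_set p M" using z unfolding Lp_set_iff by auto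
qed

lemma Phi_Lp_set: "x \<in> carrier V \<Longrightarrow> \<Phi> x \<in> Lp_set r M"
  using spow_Lp_set[OF L_Lp[OF lift(1)]] unfolding \<Phi>_def .

lemma sum_Lp_set: "(\<And>i. i < n \<Longrightarrow> x i \<in> carrier V) \<Longrightarrow> (\<lambda>w. \<Sum>i<n. c i * \<Phi> (x i) w) \<in> Lp_set r M" for n :: nat
  by (induction n) (auto intro!: Lp_set_zero Lp_set_add Lp_set_cmult Phi_Lp_set r(2))

text \<open>\<open>p\<close> and \<open>r\<close> are conjugate, and \<open>\<Phi> x\<close> is the functional \<open>dual x\<close>; the norm of a combination is
  therefore determined by its values on \<open>V\<close>.\<close>

lemma combination_le:
  fixes n :: nat
  assumes x: "\<And>i. i < n \<Longrightarrow> x i \<in> carrier V" and y: "\<And>i. i < n \<Longrightarrow> y i \<in> carrier V"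
    and uv: "\<And>u. u \<in> carrier V \<Longrightarrow> \<exists>v\<in>carrier V. nrm V v = nrm V u \<and> (\<forall>i<n. dual (x i) (lift u) = dual (y i) (lift v))"
  shows "pint r M (\<lambda>w. \<Sum>i<n. c i * \<Phi> (x i) w) \<le> pint r M (\<lambda>w. \<Sum>i<n. c i * \<Phi> (y i) w)"
proof -
  have expand: "(LINT w|M. (\<Sum>i<n. c i * \<Phi> (x i) w) * f w) = (\<Sum>i<n. c i * dual (x i) f)"
    if x: "\<And>i. i < n \<Longrightarrow> x i \<in> carrier V" and f: "f \<in> Lp_set p M" for x f
  proof -
    have "(LINT w|M. (\<Sum>i<n. c i * \<Phi> (x i) w) * f w) = (LINT w|M. (\<Sum>i<n. c i * (spow (p - 1) (lift (x i) w) * f w)))"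
      unfolding \<Phi>_def by (simp add: sum_distrib_right mult.assoc)
    also have "\<dots> = (\<Sum>i<n. (LINT w|M. c i * (spow (p - 1) (lift (x i) w) * f w)))"
      by (rule Bochner_Integration.integral_sum) (use dual_integrable[OF x f] in auto)
    finally show ?thesis unfolding dual_def by simp
  qed
  \<comment> \<open>\<open>h\<close> is the test function that norms the left side; \<open>k\<close>
    plays this part for the right side.\<close>
  obtain h where h: "h \<in> Lp_set p M" "(\<lambda>w. \<Sum>i<n. c i * \<Phi> (x i) w) = (\<lambda>w. spow (p - 1) (h w))"
    using spow_root[OF sum_Lp_set[of n x c, OF x]] by auto
  obtain k where k: "k \<in> Lp_set p M" "(\<lambda>w. \<Sum>i<n. c i * \<Phi> (y i) w) = (\<lambda>w. spow (p - 1) (k w))"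
    using spow_root[OF sum_Lp_set[of n y c, OF y]] by auto
  have hL: "h \<in> L" using h(1) full by simp
  obtain v where v: "v \<in> carrier V" "nrm V v = nrm V (P h)" "\<forall>i<n. dual (x i) (lift (P h)) = dual (y i) (lift v)"
    using uv[OF P_closed[OF hL]] by auto
  have vL: "lift v \<in> Lp_set p M" using lift(1)[OF v(1)] by simp
  have "pint p M h = (LINT w|M. (\<Sum>i<n. c i * \<Phi> (x i) w) * h w)" unfolding fun_cong[OF h(2)] spow_self[OF p] ..
  also have "\<dots> = (\<Sum>i<n. c i * dual (x i) h)" by (rule expand[OF x h(1)])
  also have "\<dots> = (\<Sum>i<n. c i * dual (y i) (lift v))" using dual_lift[OF x hL] v(3) by simp
  also have "\<dots> = (LINT w|M. (\<Sum>i<n. c i * \<Phi> (y i) w) * lift v w)" by (rule expand[OF y vL, symmetric])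
  also have "\<dots> = (LINT w|M. spow (p - 1) (k w) * lift v w)" unfolding fun_cong[OF k(2)] ..
  \<comment> \<open>Young's inequality, with the norm of \<open>lift v\<close> bounded by that of
    \<open>h\<close>, reads p a \<le> a + (p - 1) b, whence a \<le> b; here a and b are the r-th
    powers of the norms of the two combinations.\<close>
  finally have "p * pint p M h \<le> pint p M (lift v) + (p - 1) * pint p M k" using pint_Young[OF p k(1) vL] by simp
  moreover have "pint p M (lift v) \<le> pint p M h" unfolding lift(3)[OF v(1)] v(2) by (rule nrm_P_powr_le[OF hL])
  ultimately have "(p - 1) * pint p M h \<le> (p - 1) * pint p M k" by (simp add: left_diff_distrib)
  then have "pint p M h \<le> pint p M k" unfolding mult_le_cancel_left_pos[OF r(5)] .
  then show ?thesis unfolding h(2) k(2) pint_spow .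
qed

text \<open>The test vectors u and T u give one inequality of \<open>Phi_combination\<close>,
  surjectivity of T gives the other. The uniform estimates combine the lift with the Mazur
  map.\<close>

theorem quotient_rigid_space: "rigid_space V r M \<Phi>"
proof (unfold_locales, rule r(1))
  fix C assume "C \<subseteq> carrier V" "C \<noteq> {}" "\<forall>u\<in>C. \<forall>v\<in>C. (1 / 2) \<odot> (u \<oplus> v) \<in> C"
  then show "\<exists>c\<in>carrier V. \<forall>\<epsilon>>0. \<exists>\<delta>>0. \<forall>u\<in>C. nrm V u \<le> (INF u\<in>C. nrm V u) + \<delta> \<longrightarrow> nrm V (u \<ominus> c) \<le> \<epsilon>"
    by (rule subquotient_minimizer)
next
  fix x assume "x \<in> carrier V"
  then show "\<exists>j. (\<forall>y\<in>carrier V. \<forall>z\<in>carrier V. j (y \<oplus> z) = j y + j z) \<and>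
      (\<forall>y\<in>carrier V. \<bar>j y\<bar> \<le> nrm V y) \<and> j x = nrm V x \<and>
      (\<forall>T\<in>carrier (isometry_group V). T x = x \<longrightarrow> (\<forall>y\<in>carrier V. j (T y) = j y))"
    by (rule subquotient_support)
next
  fix x assume "x \<in> carrier V"
  then show "\<Phi> x \<in> Lp_set r M" by (rule Phi_Lp_set)
next
  fix B
  show "\<exists>B'. \<forall>x\<in>carrier V. nrm V x \<le> B \<longrightarrow> pint r M (\<Phi> x) \<le> B'"
    unfolding \<Phi>_def pint_spow by (intro exI[of _ "B powr p"] ballI impI pint_lift_bound)
next
  fix T :: "'a \<Rightarrow> 'a" and n :: nat and c x
  assume T: "T \<in> carrier (isometry_group V)" and x: "\<And>i. i < n \<Longrightarrow> x i \<in> carrier V"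
  have Tx: "T (x i) \<in> carrier V" if "i < n" for i using isometryD(1)[OF T x[OF that]] .
  show "pint r M (\<lambda>w. \<Sum>i<n. c i * \<Phi> (T (x i)) w) = pint r M (\<lambda>w. \<Sum>i<n. c i * \<Phi> (x i) w)"
  proof (rule antisym)
    show "pint r M (\<lambda>w. \<Sum>i<n. c i * \<Phi> (x i) w) \<le> pint r M (\<lambda>w. \<Sum>i<n. c i * \<Phi> (T (x i)) w)"
    proof (rule combination_le[OF x Tx])
      fix u assume u: "u \<in> carrier V"
      then show "\<exists>v\<in>carrier V. nrm V v = nrm V u \<and> (\<forall>i<n. dual (x i) (lift u) = dual (T (x i)) (lift v))"
        by (intro bexI[of _ "T u"]) (auto simp: dual_isometry[OF T x u] isometryD(1,5)[OF T])
    qed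
    show "pint r M (\<lambda>w. \<Sum>i<n. c i * \<Phi> (T (x i)) w) \<le> pint r M (\<lambda>w. \<Sum>i<n. c i * \<Phi> (x i) w)"
    proof (rule combination_le[OF Tx x])
      fix u assume "u \<in> carrier V"
      then have "u \<in> T ` carrier V" using isometryD(2)[OF T] by (simp only: bij_betw_imp_surj_on)
      then obtain v where v: "v \<in> carrier V" "u = T v" by (elim imageE)
      then show "\<exists>v\<in>carrier V. nrm V v = nrm V u \<and> (\<forall>i<n. dual (T (x i)) (lift u) = dual (x i) (lift v))"
        by (intro bexI[of _ v]) (auto simp: dual_isometry[OF T x v(1)] isometryD(5)[OF T])
    qed
  qed
next
  fix B \<epsilon> :: real assume e: "\<epsilon> > 0"
  note hs = homogeneous2_spow[OF homogeneous2_fst r(5)] homogeneous2_spow[OF homogeneous2_snd r(5)]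
  have a: "homogeneous2 p (\<lambda>s t. \<bar>spow (p - 1) s - spow (p - 1) t\<bar> powr r)"
    by (rule homogeneous2_powr[OF homogeneous2_diff[OF hs] r(2,3)]) auto
  have z: "\<bar>spow (p - 1) s - spow (p - 1) s\<bar> powr r \<le> 0" for s by simp
  obtain \<eta> where eta: "\<eta> > 0" "\<And>(M :: 'b measure) f g. \<lbrakk>f \<in> Lp_set p M; g \<in> Lp_set p M; pint p M f \<le> B powr p; pint p M g \<le> B powr p;
      pint p M (\<lambda>w. f w - g w) \<le> \<eta>\<rbrakk> \<Longrightarrow> (LINT w|M. \<bar>spow (p - 1) (f w) - spow (p - 1) (g w)\<bar> powr r) \<le> \<epsilon>"
    by (rule small_of_pint[OF a p0 z e, where B = "B powr p"], rule that)
  obtain \<delta> where \<delta>: "\<delta> > 0" "\<forall>x\<in>carrier V. \<forall>y\<in>carrier V. nrm V x \<le> B \<longrightarrow> nrm V y \<le> B \<longrightarrow>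
      nrm V (x \<ominus> y) \<le> \<delta> \<longrightarrow> pint p M (\<lambda>w. lift x w - lift y w) \<le> \<eta>"
    using lift_uniform[OF eta(1), of B] by (elim exE conjE)
  show "\<exists>\<delta>>0. \<forall>x\<in>carrier V. \<forall>y\<in>carrier V. nrm V x \<le> B \<longrightarrow> nrm V y \<le> B \<longrightarrow>
      nrm V (x \<ominus> y) \<le> \<delta> \<longrightarrow> pint r M (\<lambda>w. \<Phi> x w - \<Phi> y w) \<le> \<epsilon>"
  proof (intro exI[of _ \<delta>] conjI \<delta>(1) ballI impI)
    fix x y assume x: "x \<in> carrier V" and y: "y \<in> carrier V" and B: "nrm V x \<le> B" "nrm V y \<le> B" "nrm V (x \<ominus> y) \<le> \<delta>"
    have "pint p M (\<lambda>w. lift x w - lift y w) \<le> \<eta>" using \<delta>(2) x y B by blast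
    then show "pint r M (\<lambda>w. \<Phi> x w - \<Phi> y w) \<le> \<epsilon>"
      unfolding pint_def[of r] \<Phi>_def
      by (intro eta(2) L_Lp lift(1) x y pint_lift_bound B)
  qed
next
  fix B \<epsilon> :: real assume e: "\<epsilon> > 0"
  then have ep: "\<epsilon> powr p > 0" by simp
  note hs = homogeneous2_spow[OF homogeneous2_fst r(5)] homogeneous2_spow[OF homogeneous2_snd r(5)]
  have b: "homogeneous2 p (\<lambda>s t. \<bar>spow (p - 1) s - spow (p - 1) t\<bar> powr r)"
    by (rule homogeneous2_powr[OF homogeneous2_diff[OF hs] r(2,3)]) auto
  have z: "s = t" if "\<bar>spow (p - 1) s - spow (p - 1) t\<bar> powr r = 0" for s t
    using that spow_eq_iff[OF r(5)] by simp
  obtain \<delta> where \<delta>: "\<delta> > 0" "\<And>(M :: 'b measure) f g. \<lbrakk>f \<in> Lp_set p M; g \<in> Lp_set p M; pint p M f \<le> B powr p; pint p M g \<le> B powr p;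
      (LINT w|M. \<bar>spow (p - 1) (f w) - spow (p - 1) (g w)\<bar> powr r) \<le> \<delta>\<rbrakk> \<Longrightarrow> pint p M (\<lambda>w. f w - g w) \<le> \<epsilon> powr p"
    by (rule pint_small_of[OF b p0 powr_ge_zero z ep, where B = "B powr p"], assumption, rule that)
  show "\<exists>\<delta>>0. \<forall>x\<in>carrier V. \<forall>y\<in>carrier V. nrm V x \<le> B \<longrightarrow> nrm V y \<le> B \<longrightarrow>
      pint r M (\<lambda>w. \<Phi> x w - \<Phi> y w) \<le> \<delta> \<longrightarrow> nrm V (x \<ominus> y) \<le> \<epsilon>"
  proof (intro exI[of _ \<delta>] conjI \<delta>(1) ballI impI)
    fix x y assume x: "x \<in> carrier V" and y: "y \<in> carrier V" and B: "nrm V x \<le> B" "nrm V y \<le> B"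
      and d: "pint r M (\<lambda>w. \<Phi> x w - \<Phi> y w) \<le> \<delta>"
    have "pint p M (\<lambda>w. lift x w - lift y w) \<le> \<epsilon> powr p"
      using d unfolding pint_def[of r] \<Phi>_def by (intro \<delta>(2) L_Lp lift(1) x y pint_lift_bound B)
    then show "nrm V (x \<ominus> y) \<le> \<epsilon>" by (rule nrm_diff_le_root[OF x y e])
  qed
qed

end

text \<open>Near-minimisers in the cosets give homogeneity and the triangle inequality; closedness
  of Y makes the seminorm definite.\<close>

lemma (in nspace) quotient_nspace:
  assumes Y: "closed_subspace V Y"
  shows "nspace (quotient_space V Y)"
proof -
  let ?Q = "quotient_space V Y"
  have sub: "submodule Y real_ring V" and cl: "closedin (norm_topology V) Y" using Y by (auto simp: closed_subspace_def)
  interpret Y: abelian_subgroup Y V by (rule submodule_abelian[OF sub])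
  interpret Q: real_module ?Q by (rule quotient_module[OF sub])
  have YV: "y \<in> carrier V" if "y \<in> Y" for y using that Y.a_subset by blast
  have Yne: "Y \<noteq> {}" using Y.zero_closed by blast
  have bdd: "bdd_below ((\<lambda>y. nrm V (y \<oplus> x)) ` Y)" if "x \<in> carrier V" for x
    by (rule bdd_belowI2[of _ 0]) (use that YV in \<open>auto intro!: nrm_nonneg\<close>)
  define q where "q x = (INF y\<in>Y. nrm V (y \<oplus> x))" for x
  have low: "q x \<le> nrm V (y \<oplus> x)" if "x \<in> carrier V" "y \<in> Y" for x y
    unfolding q_def by (rule cINF_lower[OF bdd[OF that(1)] that(2)])
  have near: "\<exists>y\<in>Y. nrm V (y \<oplus> x) < q x + e" if x: "x \<in> carrier V" and e: "e > 0" for x e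
    using cINF_less_iff[OF Yne bdd[OF x], of "q x + e"] e unfolding q_def by simp
  have q0: "q x \<ge> 0" if "x \<in> carrier V" for x
    unfolding q_def by (rule cINF_greatest[OF Yne]) (use that YV nrm_nonneg in auto)
  have zero: "q x = 0 \<longleftrightarrow> Y +> x = \<zero>\<^bsub>?Q\<^esub>" if x: "x \<in> carrier V" for x
  proof -
    have "q x = 0 \<longleftrightarrow> x \<in> Y"
    proof
      assume "x \<in> Y"
      then have "q x \<le> nrm V (\<ominus> x \<oplus> x)" by (intro low x) simp
      then show "q x = 0" using q0[OF x] x by (simp add: M.l_neg)
    next
      assume z: "q x = 0"
      show "x \<in> Y"
      proof (rule closedin_norm_topologyD[OF cl x])
        fix \<epsilon> :: real assume "\<epsilon> > 0"
        then obtain y where y: "y \<in> Y" "nrm V (y \<oplus> x) < \<epsilon>" using near[OF x, of \<epsilon>] z by auto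
        have "x \<ominus> \<ominus> y = y \<oplus> x" using x YV[OF y(1)] by (simp add: a_minus_def M.a_comm)
        then show "\<exists>y\<in>Y. nrm V (x \<ominus> y) < \<epsilon>" using y by (intro bexI[of _ "\<ominus> y"]) auto
      qed
    qed
    also have "\<dots> \<longleftrightarrow> Y +> x = Y +> \<zero>" using coset_eq_iff[OF sub x M.zero_closed] minus_minus_cancel(7)[OF x M.zero_closed M.zero_closed] x by simp
    finally show ?thesis by (simp add: quotient_zero[OF sub])
  qed
  have scale_le: "q (c \<odot> x) \<le> \<bar>c\<bar> * q x" if x: "x \<in> carrier V" for c x
  proof (rule field_le_epsilon)
    fix e :: real assume e: "e > 0"
    obtain y where y: "y \<in> Y" "nrm V (y \<oplus> x) < q x + e / (\<bar>c\<bar> + 1)" using near[OF x, of "e / (\<bar>c\<bar> + 1)"] e by auto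
    have "q (c \<odot> x) \<le> nrm V (c \<odot> y \<oplus> c \<odot> x)" using x submodule.smult_closed[OF sub _ y(1), of c] by (intro low) auto
    also have "\<dots> = nrm V (c \<odot> (y \<oplus> x))" using x YV[OF y(1)] by (simp add: smult_r_distr)
    also have "\<dots> = \<bar>c\<bar> * nrm V (y \<oplus> x)" using x YV[OF y(1)] by (intro nrm_smult) simp
    also have "\<dots> \<le> \<bar>c\<bar> * (q x + e / (\<bar>c\<bar> + 1))" using y(2) by (intro mult_left_mono) auto
    also have "\<dots> \<le> \<bar>c\<bar> * q x + e"
    proof -
      have "\<bar>c\<bar> * (e / (\<bar>c\<bar> + 1)) \<le> e" using e by (simp add: field_simps)
      then show ?thesis by (simp add: distrib_left)
    qed
    finally show "q (c \<odot> x) \<le> \<bar>c\<bar> * q x + e" .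
  qed
  have scale: "q (c \<odot> x) = \<bar>c\<bar> * q x" if x: "x \<in> carrier V" for c x
  proof (cases "c = 0")
    case True
    then show ?thesis using scale_le[OF x, of c] q0[of "c \<odot> x"] x by simp
  next
    case False
    have "q x = q ((1 / c) \<odot> (c \<odot> x))" using smult_mult[OF x, of "1 / c" c] x False by simp
    also have "\<dots> \<le> \<bar>1 / c\<bar> * q (c \<odot> x)" using x by (intro scale_le) simp
    finally have "\<bar>c\<bar> * q x \<le> q (c \<odot> x)" using False by (simp add: field_simps)
    then show ?thesis using scale_le[OF x, of c] by simp
  qed
  have triangle: "q (x \<oplus> z) \<le> q x + q z" if x: "x \<in> carrier V" and z: "z \<in> carrier V" for x z
  proof (rule field_le_epsilon)
    fix e :: real assume e: "e > 0"
    obtain y1 where y1: "y1 \<in> Y" "nrm V (y1 \<oplus> x) < q x + e / 2" using near[OF x, of "e / 2"] e by auto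
    obtain y2 where y2: "y2 \<in> Y" "nrm V (y2 \<oplus> z) < q z + e / 2" using near[OF z, of "e / 2"] e by auto
    have "q (x \<oplus> z) \<le> nrm V ((y1 \<oplus> y2) \<oplus> (x \<oplus> z))" using x z y1 y2 by (intro low) auto
    also have "(y1 \<oplus> y2) \<oplus> (x \<oplus> z) = (y1 \<oplus> x) \<oplus> (y2 \<oplus> z)" using x z YV[OF y1(1)] YV[OF y2(1)] by (simp add: M.a_ac)
    also have "nrm V \<dots> \<le> nrm V (y1 \<oplus> x) + nrm V (y2 \<oplus> z)" using x z YV[OF y1(1)] YV[OF y2(1)] by (intro nrm_triangle) auto
    finally show "q (x \<oplus> z) \<le> q x + q z + e" using y1(2) y2(2) field_sum_of_halves[of e] by linarith
  qed
  have "normed_space ?Q"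
    unfolding normed_space_def quotient_carrier[OF sub] ball_simps
    using Q.module_axioms zero scale triangle
    by (auto simp: quotient_nrm[OF sub] quotient_smult[OF sub] quotient_add[OF sub] q_def[symmetric])
  then show ?thesis by (rule nspace.intro)
qed

lemma (in nspace) restrict_nspace:
  assumes sub: "submodule Y real_ring V"
  shows "nspace (restrict_space_to V Y)"
proof -
  interpret Y: abelian_subgroup Y V by (rule submodule_abelian[OF sub])
  have YV: "y \<in> carrier V" if "y \<in> Y" for y using that Y.a_subset by blast
  have "Module.module real_ring (restrict_space_to V Y)" using restrict_module[OF sub] by (simp add: real_module_def)
  then have "normed_space (restrict_space_to V Y)"
    unfolding normed_space_def using YV nrm_eq_0 nrm_smult nrm_triangle by (simp add: restrict_space_to_def)
  then show ?thesis by (rule nspace.intro)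
qed

section \<open>The spaces of classes, their subspaces and quotients\<close>

locale Lp_setting =
  fixes p :: real and M :: "'w measure"
  assumes p: "p > 1"
begin

abbreviation E where "E \<equiv> Lp_functions p M"

definition Z where "Z = {f \<in> Lp_set p M. AE w in M. f w = 0}"

definition cls where "cls f = Z +>\<^bsub>E\<^esub> f"

lemma p0: "p > 0" using p by simp

lemma E_simps: "f \<oplus>\<^bsub>E\<^esub> g = (\<lambda>w. f w + g w)" "c \<odot>\<^bsub>E\<^esub> f = (\<lambda>w. c * f w)" "\<zero>\<^bsub>E\<^esub> = (\<lambda>w. 0)"
  "nrm E f = pint p M f powr (1 / p)"
  by (simp_all add: Lp_functions_def pint_def)

text \<open>Before passing to classes there is only a seminorm, so \<open>E\<close> is treated as a
  module and not as an \<open>nspace\<close>.\<close>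

sublocale E: real_module E
  unfolding real_module_def
proof (rule moduleI)
  show "abelian_group E"
  proof (rule abelian_groupI)
    fix x assume x: "x \<in> carrier E"
    show "\<exists>y\<in>carrier E. y \<oplus>\<^bsub>E\<^esub> x = \<zero>\<^bsub>E\<^esub>"
      using Lp_set_cmult[OF p0 x, of "- 1"] by (intro bexI[of _ "\<lambda>w. - 1 * x w"]) (auto simp: E_simps)
  qed (auto simp: E_simps Lp_set_add Lp_set_zero p0)
qed (auto simp: E_simps Lp_set_cmult p0 real_ring_cring algebra_simps)

lemma E_minus: "f \<in> Lp_set p M \<Longrightarrow> g \<in> Lp_set p M \<Longrightarrow> f \<ominus>\<^bsub>E\<^esub> g = (\<lambda>w. f w - g w)"
  using E.smult_minus_one[of g, symmetric] by (simp add: a_minus_def E_simps)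

lemma Z_submodule: "submodule Z real_ring E"
proof (rule E.submoduleI)
  fix a b assume "a \<in> Z" "b \<in> Z"
  then show "a \<oplus>\<^bsub>E\<^esub> b \<in> Z" unfolding Z_def E_simps by (auto intro: Lp_set_add p0)
next
  fix c a assume "a \<in> Z"
  then show "c \<odot>\<^bsub>E\<^esub> a \<in> Z" unfolding Z_def E_simps by (auto intro: Lp_set_cmult p0)
next
  fix a assume a: "a \<in> Z"
  then have "\<ominus>\<^bsub>E\<^esub> a = (\<lambda>w. - 1 * a w)" using E.smult_minus_one[of a] by (simp add: Z_def E_simps)
  then show "\<ominus>\<^bsub>E\<^esub> a \<in> Z" using a Lp_set_cmult[OF p0, of a M "- 1"] unfolding Z_def by auto
qed (auto simp: Z_def E_simps Lp_set_zero p0)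

lemma Lp_eq: "Lp p M = quotient_space E Z"
  unfolding Lp_def Z_def ..

lemma pint_add_Z: "f \<in> Lp_set p M \<Longrightarrow> h \<in> Z \<Longrightarrow> pint p M (\<lambda>w. h w + f w) = pint p M f"
  unfolding pint_def Z_def by (intro integral_cong_AE) auto

lemma Z_iff: assumes f: "f \<in> Lp_set p M" shows "f \<in> Z \<longleftrightarrow> pint p M f = 0"
  unfolding pint_def using integral_nonneg_eq_0_iff_AE[OF Lp_set_integrable[OF f]] f by (simp add: Z_def)

lemma cls_carrier: "carrier (Lp p M) = cls ` Lp_set p M"
  unfolding Lp_eq cls_def E.quotient_carrier[OF Z_submodule] ..

lemma cls_add: "f \<in> Lp_set p M \<Longrightarrow> g \<in> Lp_set p M \<Longrightarrow> cls (\<lambda>w. f w + g w) = cls f \<oplus>\<^bsub>Lp p M\<^esub> cls g"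
  and cls_cmult: "f \<in> Lp_set p M \<Longrightarrow> cls (\<lambda>w. c * f w) = c \<odot>\<^bsub>Lp p M\<^esub> cls f"
  and cls_diff: "f \<in> Lp_set p M \<Longrightarrow> g \<in> Lp_set p M \<Longrightarrow> cls (\<lambda>w. f w - g w) = cls f \<ominus>\<^bsub>Lp p M\<^esub> cls g"
  and cls_eq_iff: "f \<in> Lp_set p M \<Longrightarrow> g \<in> Lp_set p M \<Longrightarrow> cls f = cls g \<longleftrightarrow> (\<lambda>w. f w - g w) \<in> Z"
  and cls_zero: "\<zero>\<^bsub>Lp p M\<^esub> = cls (\<lambda>w. 0)"
  unfolding Lp_eq cls_def
  by (simp_all add: E.quotient_add[OF Z_submodule] E.quotient_smult[OF Z_submodule] E.quotient_diff[OF Z_submodule]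
      E.coset_eq_iff[OF Z_submodule] E.quotient_zero[OF Z_submodule] E_simps E_minus)

lemma nrm_cls: assumes f: "f \<in> Lp_set p M" shows "nrm (Lp p M) (cls f) = pint p M f powr (1 / p)"
proof -
  have "(\<lambda>w. 0) \<in> Z" unfolding Z_def by (simp add: Lp_set_zero p0)
  then have "Z \<noteq> {}" by blast
  moreover have "nrm (Lp p M) (cls f) = (INF h\<in>Z. pint p M f powr (1 / p))"
    unfolding Lp_eq cls_def E.quotient_nrm[OF Z_submodule] E_simps by (rule INF_cong) (auto simp: pint_add_Z f)
  ultimately show ?thesis by simp
qed

sublocale nspace "Lp p M"
proof
  have "Module.module real_ring (Lp p M)"
    unfolding Lp_eq using E.quotient_module[OF Z_submodule] by (simp add: real_module_def)
  moreover have "nrm (Lp p M) (cls f) = 0 \<longleftrightarrow> cls f = \<zero>\<^bsub>Lp p M\<^esub>" if "f \<in> Lp_set p M" for f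
    using that Z_iff[OF that] by (simp add: nrm_cls cls_zero cls_eq_iff Lp_set_zero p0)
  moreover have "nrm (Lp p M) (c \<odot>\<^bsub>Lp p M\<^esub> cls f) = \<bar>c\<bar> * nrm (Lp p M) (cls f)" if "f \<in> Lp_set p M" for f c
    using that p0 by (simp add: cls_cmult[symmetric] nrm_cls Lp_set_cmult pint_cmult powr_mult powr_powr)
  moreover have "nrm (Lp p M) (cls f \<oplus>\<^bsub>Lp p M\<^esub> cls g) \<le> nrm (Lp p M) (cls f) + nrm (Lp p M) (cls g)"
    if "f \<in> Lp_set p M" "g \<in> Lp_set p M" for f g
    using that Minkowski_pint[OF p that] by (simp add: cls_add[symmetric] nrm_cls Lp_set_add p0)
  ultimately show "normed_space (Lp p M)"
    unfolding normed_space_def cls_carrier by auto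
qed

lemma nrm_cls_le: "f \<in> Lp_set p M \<Longrightarrow> pint p M f \<le> e powr p \<Longrightarrow> e > 0 \<Longrightarrow> nrm (Lp p M) (cls f) \<le> e"
  using powr_mono2[of "1 / p" "pint p M f" "e powr p"] p0 by (simp add: nrm_cls powr_powr)

context
  fixes Y assumes Y: "closed_subspace (Lp p M) Y"
begin

lemma Y_sub: "submodule Y real_ring (Lp p M)" and Y_closedin: "closedin (norm_topology (Lp p M)) Y"
  using Y by (auto simp: closed_subspace_def)

definition pre where "pre = {f \<in> Lp_set p M. cls f \<in> Y}"

lemma Y_carrier: "Y \<subseteq> carrier (Lp p M)"
  using Y_sub by (auto simp: submodule_def subgroup_def)

lemma Y_pre: "cls ` pre = Y"
  using Y_carrier unfolding pre_def cls_carrier by auto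

lemma pre_add: "f \<in> pre \<Longrightarrow> g \<in> pre \<Longrightarrow> (\<lambda>w. f w + g w) \<in> pre"
  using additive_subgroup.a_closed[of Y "Lp p M"] submodule_abelian[OF Y_sub]
  by (simp add: pre_def cls_add Lp_set_add p0 abelian_subgroup_def)

lemma pre_cmult: "f \<in> pre \<Longrightarrow> (\<lambda>w. c * f w) \<in> pre"
  using submodule.smult_closed[OF Y_sub] by (auto simp: pre_def cls_cmult Lp_set_cmult p0)

lemma pre_closed:
  assumes f: "f \<in> Lp_set p M" and ap: "\<And>\<epsilon>. \<epsilon> > 0 \<Longrightarrow> \<exists>h\<in>pre. pint p M (\<lambda>w. h w - f w) \<le> \<epsilon>"
  shows "f \<in> pre"
proof -
  have "cls f \<in> Y"
  proof (rule closedin_norm_topologyD[OF Y_closedin])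
    show "cls f \<in> carrier (Lp p M)" using f cls_carrier by blast
    fix \<epsilon> :: real assume e: "\<epsilon> > 0"
    then have "(\<epsilon> / 2) powr p > 0" by simp
    then obtain h where h: "h \<in> pre" "pint p M (\<lambda>w. h w - f w) \<le> (\<epsilon> / 2) powr p" using ap by blast
    have hL: "h \<in> Lp_set p M" using h(1) by (simp add: pre_def)
    have "nrm (Lp p M) (cls (\<lambda>w. f w - h w)) \<le> \<epsilon> / 2"
      by (rule nrm_cls_le) (use e h(2) pint_diff_commute[of p M h f] in \<open>auto intro: Lp_set_diff p0 f hL\<close>)
    then show "\<exists>y\<in>Y. nrm (Lp p M) (cls f \<ominus>\<^bsub>Lp p M\<^esub> y) < \<epsilon>"
      using h(1) e by (intro bexI[of _ "cls h"]) (auto simp: cls_diff[OF f hL] pre_def)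
  qed
  then show ?thesis using f by (simp add: pre_def)
qed

lemma Z_closed:
  assumes f: "f \<in> Lp_set p M" and ap: "\<And>\<epsilon>. \<epsilon> > 0 \<Longrightarrow> \<exists>h\<in>Z. pint p M (\<lambda>w. h w - f w) \<le> \<epsilon>"
  shows "f \<in> Z"
proof -
  have "pint p M f \<le> 0 + \<epsilon>" if e: "\<epsilon> > 0" for \<epsilon>
  proof -
    obtain h where h: "h \<in> Z" "pint p M (\<lambda>w. h w - f w) \<le> \<epsilon>" using ap[OF e] by blast
    have "pint p M (\<lambda>w. h w + - 1 * f w) = pint p M (\<lambda>w. - 1 * f w)" by (rule pint_add_Z[OF Lp_set_cmult[OF p0 f] h(1)])
    then show ?thesis using h(2) by (simp add: pint_def)
  qed
  then have "pint p M f \<le> 0" by (rule field_le_epsilon)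
  then have "pint p M f = 0" using pint_nonneg[of p M f] by linarith
  then show ?thesis using Z_iff[OF f] by simp
qed

text \<open>The null functions serve as N; adding one does not change the norm, so the infimum is
  over equal numbers.\<close>

lemma subspace_subquotient: "subquotient (restrict_space_to (Lp p M) Y) p M pre Z cls"
proof -
  let ?R = "restrict_space_to (Lp p M) Y"
  interpret R: nspace ?R by (rule restrict_nspace[OF Y_sub])
  have R: "carrier ?R = Y" "x \<oplus>\<^bsub>?R\<^esub> y = x \<oplus>\<^bsub>Lp p M\<^esub> y" "c \<odot>\<^bsub>?R\<^esub> x = c \<odot>\<^bsub>Lp p M\<^esub> x" "nrm ?R x = nrm (Lp p M) x" for x y c
    by (simp_all add: restrict_space_to_def)
  have zZ: "(\<lambda>w. 0) \<in> Z" unfolding Z_def by (simp add: Lp_set_zero p0)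
  have Zpre: "Z \<subseteq> pre"
  proof
    fix h assume h: "h \<in> Z"
    then have hL: "h \<in> Lp_set p M" by (simp add: Z_def)
    then have "cls h = \<zero>\<^bsub>Lp p M\<^esub>" using h by (simp add: cls_zero cls_eq_iff Lp_set_zero p0)
    moreover have "\<zero>\<^bsub>Lp p M\<^esub> \<in> Y" using R.zero_closed by (simp add: restrict_space_to_def)
    ultimately show "h \<in> pre" using hL by (simp add: pre_def)
  qed
  have preL: "f \<in> pre \<Longrightarrow> f \<in> Lp_set p M" for f by (simp add: pre_def)
  show ?thesis
  proof (unfold_locales, unfold R)
    fix f assume f: "f \<in> pre"
    have "(INF h\<in>Z. pint p M (\<lambda>w. f w + h w) powr (1 / p)) = (INF h\<in>Z. pint p M f powr (1 / p))"
      by (rule INF_cong) (use pint_add_Z[OF preL[OF f]] in \<open>auto simp: add.commute\<close>)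
    also have "\<dots> = pint p M f powr (1 / p)" using zZ by (intro cINF_const) blast
    finally show "nrm (Lp p M) (cls f) = (INF h\<in>Z. pint p M (\<lambda>w. f w + h w) powr (1 / p))" by (simp add: nrm_cls preL[OF f])
  next
    fix f assume "f \<in> Lp_set p M" "\<And>\<epsilon>. \<epsilon> > 0 \<Longrightarrow> \<exists>h\<in>pre. pint p M (\<lambda>w. h w - f w) \<le> \<epsilon>"
    then show "f \<in> pre" by (rule pre_closed)
  next
    fix f assume "f \<in> Lp_set p M" "\<And>\<epsilon>. \<epsilon> > 0 \<Longrightarrow> \<exists>h\<in>Z. pint p M (\<lambda>w. h w - f w) \<le> \<epsilon>"
    then show "f \<in> Z" by (rule Z_closed)
  qed (use Zpre in \<open>auto simp: p pre_add pre_cmult Y_pre cls_add cls_cmult cls_eq_iff preL\<close>)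
qed

text \<open>Here \<open>cls\<close> preserves norms, so the lift itself serves as
  \<open>\<Phi>\<close> and the exponent stays p.\<close>

lemma subspace_rigid: "rigid_space (restrict_space_to (Lp p M) Y) p M (subquotient.lift (restrict_space_to (Lp p M) Y) p M pre cls)"
proof -
  interpret S: subquotient "restrict_space_to (Lp p M) Y" p M pre Z cls by (rule subspace_subquotient)
  show ?thesis
  proof (rule S.isometric_rigid_space)
    fix f assume f: "f \<in> pre"
    have "nrm (restrict_space_to (Lp p M) Y) (cls f) = pint p M f powr (1 / p)"
      by (simp add: restrict_space_to_def nrm_cls[OF S.L_Lp[OF f]])
    then show "pint p M f = nrm (restrict_space_to (Lp p M) Y) (cls f) powr p" using p0 by (simp add: powr_powr)
  qed
qed

text \<open>A quotient of a quotient: the infimum over the classes in Y is an infimum over the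
  functions in \<open>pre\<close>, which become N.\<close>

lemma quotient_subquotient: "subquotient (quotient_space (Lp p M) Y) p M (Lp_set p M) pre (\<lambda>f. Y +>\<^bsub>Lp p M\<^esub> cls f)"
proof -
  let ?Q = "quotient_space (Lp p M) Y"
  interpret Q: nspace ?Q by (rule quotient_nspace[OF Y])
  have cl: "cls f \<in> carrier (Lp p M)" if "f \<in> Lp_set p M" for f using that cls_carrier by blast
  note qs = quotient_carrier[OF Y_sub] quotient_add[OF Y_sub] quotient_smult[OF Y_sub] coset_eq_iff[OF Y_sub]
  have preL: "f \<in> pre \<Longrightarrow> f \<in> Lp_set p M" for f by (simp add: pre_def)
  show ?thesis
  proof (unfold_locales)
    show "(\<lambda>f. Y +>\<^bsub>Lp p M\<^esub> cls f) ` Lp_set p M = carrier ?Q" unfolding qs cls_carrier image_image ..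
    fix f assume f: "f \<in> Lp_set p M"
    have "nrm ?Q (Y +>\<^bsub>Lp p M\<^esub> cls f) = (INF h\<in>pre. nrm (Lp p M) (cls h \<oplus>\<^bsub>Lp p M\<^esub> cls f))"
      unfolding quotient_nrm[OF Y_sub] by (subst Y_pre[symmetric]) (simp add: image_image)
    also have "\<dots> = (INF h\<in>pre. pint p M (\<lambda>w. f w + h w) powr (1 / p))"
    proof (rule INF_cong)
      fix h assume h: "h \<in> pre"
      show "nrm (Lp p M) (cls h \<oplus>\<^bsub>Lp p M\<^esub> cls f) = pint p M (\<lambda>w. f w + h w) powr (1 / p)"
        unfolding cls_add[OF preL[OF h] f, symmetric] nrm_cls[OF Lp_set_add[OF p0 preL[OF h] f]] by (simp add: add.commute)
    qed simp
    finally show "nrm ?Q (Y +>\<^bsub>Lp p M\<^esub> cls f) = (INF h\<in>pre. pint p M (\<lambda>w. f w + h w) powr (1 / p))" .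
  next
    fix f g assume fg: "f \<in> Lp_set p M" "g \<in> Lp_set p M"
    show "Y +>\<^bsub>Lp p M\<^esub> cls f = Y +>\<^bsub>Lp p M\<^esub> cls g \<longleftrightarrow> (\<lambda>w. f w - g w) \<in> pre"
      using fg cl by (simp add: qs cls_diff[symmetric] pre_def Lp_set_diff p0)
  next
    fix f assume "f \<in> Lp_set p M" "\<And>\<epsilon>. \<epsilon> > 0 \<Longrightarrow> \<exists>h\<in>pre. pint p M (\<lambda>w. h w - f w) \<le> \<epsilon>"
    then show "f \<in> pre" by (rule pre_closed)
  qed (auto simp: p Lp_set_add Lp_set_cmult p0 qs cls_add cls_cmult cl preL)
qed

lemma quotient_rigid:
  "rigid_space (quotient_space (Lp p M) Y) (Lp_quotient.r p) M
     (Lp_quotient.\<Phi> (quotient_space (Lp p M) Y) p M (Lp_set p M) (\<lambda>f. Y +>\<^bsub>Lp p M\<^esub> cls f))"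
proof -
  interpret S: subquotient "quotient_space (Lp p M) Y" p M "Lp_set p M" pre "\<lambda>f. Y +>\<^bsub>Lp p M\<^esub> cls f"
    by (rule quotient_subquotient)
  interpret Lp_quotient "quotient_space (Lp p M) Y" p M "Lp_set p M" pre "\<lambda>f. Y +>\<^bsub>Lp p M\<^esub> cls f"
    by unfold_locales simp
  show ?thesis by (rule quotient_rigid_space)
qed

end

end

theorem closed_subspace_TX:
  assumes "topological_group G \<tau>" "kazhdan_property_T G \<tau>" "p > 1" "closed_subspace (Lp p M) Y"
  shows "property_TX G \<tau> (restrict_space_to (Lp p M) Y)" "property_TX G \<tau> (quotient_space (Lp p M) Y)"
proof -
  interpret Lp_setting p M by unfold_locales fact
  show "property_TX G \<tau> (restrict_space_to (Lp p M) Y)"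
    by (rule rigid_space.rigid_space_TX[OF subspace_rigid[OF assms(4)] assms(1,2)])
  show "property_TX G \<tau> (quotient_space (Lp p M) Y)"
    by (rule rigid_space.rigid_space_TX[OF quotient_rigid[OF assms(4)] assms(1,2)])
qed

theorem corollary1p2:
  fixes G :: "('g, 'm) monoid_scheme" and \<tau> :: "'g topology"
    and M :: "'w measure" and p :: real
  assumes "topological_group G \<tau>"
    and "Hausdorff_space \<tau>" and "locally_compact_space \<tau>" and "second_countable \<tau>"
    and "kazhdan_property_T G \<tau>"
    and "1 < p"
    and "standard_borel M" and "sigma_finite_measure M"
  shows "\<forall>Y. closed_subspace (Lp p M) Y \<longrightarrow>
           property_TX G \<tau> (restrict_space_to (Lp p M) Y) \<and>
           property_TX G \<tau> (quotient_space (Lp p M) Y)"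
  using closed_subspace_TX[OF assms(1,5,6)] by blast

end
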